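(* For any set $\Gamma$ of $\mathbf D$-formulas with countably many free variables and any first-order formula $\alpha$, $\Gamma\models\alpha$ implies $\Gamma\vdash_{\mathbf D}\alpha$, where $\vdash_{\mathbf D}$ is the consequence relation induced by the natural deduction system of dependence logic $\mathbf D$ given by Kontinen and Väänänen.
   Context: Semantics. Vocabularies are first-order with equality; every model $M$ has at least two elements. A team $X$ of $M$ over $V=\mathrm{dom}(X)$ is a set of assignments $s:V\to M$. $s(a/x)$ is $s$ modified or extended to send $x$ to $a$; $X(M/x)=\{s(a/x)\mid s\in X,a\in M\}$; $X(F/x)=\{s(a/x)\mid s\in X,a\in F(s)\}$ for $F:X\to\wp(M)\setminus\{\emptyset\}$. Barred letters denote finite sequences; $\mathsf{Fv}$ denotes the set of free variables. First-order formulas: $\alpha::=\lambda\mid\neg\alpha\mid\alpha\wedge\alpha\mid\alpha\vee\alpha\mid\exists x\alpha\mid\forall x\alpha$; $\alpha\to\beta:=\neg\alpha\vee\beta$, $\bot:=\exists x(x\ne x)$. $\mathbf D$: $\phi::=\lambda\mid{=\!(\bar t,\bar t')}\mid\neg\alpha\mid\phi\wedge\phi\mid\phi\vee\phi\mid\exists x\phi\mid\forall x\phi$ ($\lambda$ a first-order atom, $\alpha$ first-order, $\bar t,\bar t'$ sequences of terms). In the Kontinen–Väänänen system dependence atoms have a single dependent term; an atom $=\!(\bar t,\bar t')$ is there read as shorthand for $\exists\bar x\bar y(\bigwedge_i{=\!(\bar x,y_i)}\wedge\bar x=\bar t\wedge\bar y=\bar t')$. $M\models_X\lambda$ iff $M\models_s\lambda$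 for all $s\in X$; $M\models_X{=\!(\bar t,\bar t')}$ iff any $s,s'\in X$ agreeing on the value of $\bar t$ agree on $\bar t'$; $M\models_X\neg\alpha$ iff $M\not\models_{\{s\}}\alpha$ for all $s\in X$; $\wedge$ is conjunction; $M\models_X\phi\vee\psi$ iff $X=Y\cup Z$ with $M\models_Y\phi$, $M\models_Z\psi$; $M\models_X\exists x\phi$ iff $M\models_{X(F/x)}\phi$ for some $F$; $M\models_X\forall x\phi$ iff $M\models_{X(M/x)}\phi$. $\Gamma\models\phi$: every $M,X$ (domain containing the free variables) satisfying all of $\Gamma$ satisfies $\phi$. The system for $\mathbf D$ is that of J. Kontinen and J. Väänänen, "Axiomatizing first-order consequences in dependence logic" (sequents $\Gamma\vdash\phi$; $\alpha,\beta$ first-order; substituted terms are free for the variables; $\phi(\bar x)$ indicates that the free variables of $\phi$ are among $\bar x$). Its rules include, in slightly adapted form: - From $\Gamma,\alpha\vdash\bot$ infer $\Gamma\vdash\neg\alpha$; from $\Gamma\vdash\alpha$, $\Gamma\vdash\neg\alpha$ infer $\Gamma\vdash\phi$; from $\Gamma,\neg\alpha\vdash\bot$ infer $\Gamma\vdash\alpha$. - From $\Gamma\vdash\phi$ infer $\Gamma\vdash\phi\vee\psi$ and $\Gamma\vdash\psi\vee\phi$; from $\Gamma\vdash\phi\vee\psi$, $\Gamma,\phi\vdash\chi$ infer $\Gamma\vdash\chi\vee\psi$. - From $\Gamma\vdash\phi$ infer $\Gamma\vdash\forall x\phi$ if $x\notin\mathsf{Fv}(\Gamma)$; from $\Gamma\vdash\forall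 x\phi$ infer $\Gamma\vdash\phi(t/x)$; from $\Gamma\vdash\phi(t/x)$ infer $\Gamma\vdash\exists x\phi$; from $\Gamma\vdash\exists x\phi$, $\Gamma,\phi(v/x)\vdash\psi$ infer $\Gamma\vdash\psi$ if $v\notin\mathsf{Fv}(\Gamma\cup\{\phi,\psi\})$. - Dependence introduction: from $\Gamma\vdash\exists\bar x\forall y\,\phi(\bar x,y,\bar z)$ infer $\Gamma\vdash\forall y\exists\bar x({=\!(\bar z,\bar x)}\wedge\phi)$. - Dependence elimination: from $\Gamma\vdash\forall\bar x\exists\bar y(\bigwedge_{i\in I}{=\!(\sigma^i_{\bar x\bar y\bar v},y_i)}\wedge\phi(\bar x,\bar y,\bar v))$ infer $\Gamma\vdash\forall\bar x\exists\bar y\big(\phi(\bar x,\bar y,\bar v)\wedge\forall\bar x'\exists\bar y'(\phi(\bar x',\bar y',\bar v)\wedge\bigwedge_{i\in I}(\sigma^i_{\bar x\bar y\bar v}=\sigma^i_{\bar x'\bar y'\bar v}\to y_i=y'_i))\big)$, each $\sigma^i_{\bar x\bar y\bar v}$ a subsequence of $\bar x\bar y\bar v$ (and $y_i$ from $\bar y$). The other rules of the system (whose exact form is that of the cited system) are: $\Gamma\vdash\phi$ if $\phi\in\Gamma$; $\Gamma\vdash t=t$; from $\Gamma\vdash t=t'$, $\Gamma\vdash\phi(t/x)$ infer $\Gamma\vdash\phi(t'/x)$; $\wedge$-introduction and eliminations; from $\Gamma\vdash\phi\vee\psi$, $\Gamma,\phi\vdash\alpha$, $\Gamma,\psi\vdash\alpha$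 infer $\Gamma\vdash\alpha$; commutativity and associativity of $\vee$; scope extension ($x\notin\mathsf{Fv}(\psi)$; $y,z$ fresh): from $\Gamma\vdash\exists x\phi\vee\psi$ infer $\Gamma\vdash\exists x(\phi\vee\psi)$, and from $\Gamma\vdash\forall x\phi\vee\psi$ infer $\Gamma\vdash\exists y\exists z\forall x((\phi\wedge y=z)\vee(\psi\wedge y\neq z))$; unnesting: from $\Gamma\vdash{=\!(t_1,\dots,t_n)}$ infer $\Gamma\vdash\exists z({=\!(t_1,\dots,t_{i-1},z,t_{i+1},\dots,t_n)}\wedge z=t_i)$, $z$ fresh (the last listed term is the dependent one); dependence distribution: from $\Gamma\vdash\exists y_1\dots\exists y_n(\bigwedge_{j\le n}{=\!(\bar z^j,y_j)}\wedge\alpha)\vee\exists y_{n+1}\dots\exists y_{n+m}(\bigwedge_{n<j\le n+m}{=\!(\bar z^j,y_j)}\wedge\beta)$ infer $\Gamma\vdash\exists y_1\dots\exists y_{n+m}(\bigwedge_{j\le n+m}{=\!(\bar z^j,y_j)}\wedge(\alpha\vee\beta))$, with $\alpha,\beta$ quantifier-free and the $y$'s of each disjunct not occurring in the other disjunct. *)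

theory Defs
  imports "HOL-Library.Sublist" "HOL-Library.Countable_Set"
begin

section \<open>Syntax\<close>

datatype ('f, 'v) tm = Var 'v | Fn 'f "('f, 'v) tm list"

datatype ('f, 'p, 'v) fm =
    Eq "('f, 'v) tm" "('f, 'v) tm"
  | Rel 'p "('f, 'v) tm list"
  | Dep "('f, 'v) tm list" "('f, 'v) tm list"
  | Neg "('f, 'p, 'v) fm"
  | And "('f, 'p, 'v) fm" "('f, 'p, 'v) fm"
  | Or "('f, 'p, 'v) fm" "('f, 'p, 'v) fm"
  | Ex 'v "('f, 'p, 'v) fm"
  | All 'v "('f, 'p, 'v) fm"

text \<open>The symbols of a vocabulary are those in the domains of its two arity maps, so that it may
  lack function symbols or relation symbols altogether; constants are 0-ary function symbols.\<close>

record ('f, 'p) vocab =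
  fun_ar :: "'f \<rightharpoonup> nat"
  rel_ar :: "'p \<rightharpoonup> nat"

fun wf_tm :: "('f, 'p) vocab \<Rightarrow> ('f, 'v) tm \<Rightarrow> bool" where
  "wf_tm L (Var x) \<longleftrightarrow> True"
| "wf_tm L (Fn f ts) \<longleftrightarrow> fun_ar L f = Some (length ts) \<and> (\<forall>t \<in> set ts. wf_tm L t)"

primrec first_order :: "('f, 'p, 'v) fm \<Rightarrow> bool" where
  "first_order (Eq t u) \<longleftrightarrow> True"
| "first_order (Rel p ts) \<longleftrightarrow> True"
| "first_order (Dep ts us) \<longleftrightarrow> False"
| "first_order (Neg \<phi>) \<longleftrightarrow> first_order \<phi>"
| "first_order (And \<phi> \<psi>) \<longleftrightarrow> first_order \<phi> \<and> first_order \<psi>"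
| "first_order (Or \<phi> \<psi>) \<longleftrightarrow> first_order \<phi> \<and> first_order \<psi>"
| "first_order (Ex x \<phi>) \<longleftrightarrow> first_order \<phi>"
| "first_order (All x \<phi>) \<longleftrightarrow> first_order \<phi>"

primrec D_formula :: "('f, 'p) vocab \<Rightarrow> ('f, 'p, 'v) fm \<Rightarrow> bool" where
  "D_formula L (Eq t u) \<longleftrightarrow> wf_tm L t \<and> wf_tm L u"
| "D_formula L (Rel p ts) \<longleftrightarrow> rel_ar L p = Some (length ts) \<and> (\<forall>t \<in> set ts. wf_tm L t)"
| "D_formula L (Dep ts us) \<longleftrightarrow> (\<forall>t \<in> set ts \<union> set us. wf_tm L t)"
| "D_formula L (Neg \<phi>) \<longleftrightarrow> first_order \<phi> \<and> D_formula L \<phi>"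
| "D_formula L (And \<phi> \<psi>) \<longleftrightarrow> D_formula L \<phi> \<and> D_formula L \<psi>"
| "D_formula L (Or \<phi> \<psi>) \<longleftrightarrow> D_formula L \<phi> \<and> D_formula L \<psi>"
| "D_formula L (Ex x \<phi>) \<longleftrightarrow> D_formula L \<phi>"
| "D_formula L (All x \<phi>) \<longleftrightarrow> D_formula L \<phi>"

primrec Fvt :: "('f, 'v) tm \<Rightarrow> 'v set" where
  "Fvt (Var x) = {x}"
| "Fvt (Fn f ts) = \<Union> (set (map Fvt ts))"

primrec Fv :: "('f, 'p, 'v) fm \<Rightarrow> 'v set" where
  "Fv (Eq t u) = Fvt t \<union> Fvt u"
| "Fv (Rel p ts) = (\<Union>t \<in> set ts. Fvt t)"
| "Fv (Dep ts us) = (\<Union>t \<in> set ts \<union> set us. Fvt t)"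
| "Fv (Neg \<phi>) = Fv \<phi>"
| "Fv (And \<phi> \<psi>) = Fv \<phi> \<union> Fv \<psi>"
| "Fv (Or \<phi> \<psi>) = Fv \<phi> \<union> Fv \<psi>"
| "Fv (Ex x \<phi>) = Fv \<phi> - {x}"
| "Fv (All x \<phi>) = Fv \<phi> - {x}"

abbreviation Fvs :: "('f, 'p, 'v) fm set \<Rightarrow> 'v set" where
  "Fvs \<Gamma> \<equiv> (\<Union>\<phi> \<in> \<Gamma>. Fv \<phi>)"


section \<open>Team semantics\<close>

record ('f, 'p, 'u) model =
  univ :: "'u set"
  fint :: "'f \<Rightarrow> 'u list \<Rightarrow> 'u"
  rint :: "'p \<Rightarrow> 'u list set"

definition is_model :: "('f, 'p) vocab \<Rightarrow> ('f, 'p, 'u) model \<Rightarrow> bool" where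
  "is_model L M \<longleftrightarrow>
     (\<exists>a \<in> univ M. \<exists>b \<in> univ M. a \<noteq> b) \<and>
     (\<forall>f n as. fun_ar L f = Some n \<and> length as = n \<and> set as \<subseteq> univ M \<longrightarrow> fint M f as \<in> univ M)"

definition is_team :: "('f, 'p, 'u) model \<Rightarrow> 'v set \<Rightarrow> ('v \<rightharpoonup> 'u) set \<Rightarrow> bool" where
  "is_team M V X \<longleftrightarrow> (\<forall>s \<in> X. dom s = V \<and> ran s \<subseteq> univ M)"

text \<open>The values of \<^term>\<open>val\<close> and \<^term>\<open>sat\<close> are only meaningful when the free variables belong to
  the domain of the assignments.\<close>

primrec val :: "('f, 'p, 'u) model \<Rightarrow> ('v \<rightharpoonup> 'u) \<Rightarrow> ('f, 'v) tm \<Rightarrow> 'u" where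
  "val M s (Var x) = the (s x)"
| "val M s (Fn f ts) = fint M f (map (val M s) ts)"

definition supp :: "('v \<rightharpoonup> 'u) set \<Rightarrow> (('v \<rightharpoonup> 'u) \<Rightarrow> 'u set) \<Rightarrow> 'v \<Rightarrow> ('v \<rightharpoonup> 'u) set" where
  "supp X F x = {s(x \<mapsto> a) | s a. s \<in> X \<and> a \<in> F s}"

primrec sat :: "('f, 'p, 'u) model \<Rightarrow> ('v \<rightharpoonup> 'u) set \<Rightarrow> ('f, 'p, 'v) fm \<Rightarrow> bool" where
  "sat M X (Eq t u) \<longleftrightarrow> (\<forall>s \<in> X. val M s t = val M s u)"
| "sat M X (Rel p ts) \<longleftrightarrow> (\<forall>s \<in> X. map (val M s) ts \<in> rint M p)"
| "sat M X (Dep ts us) \<longleftrightarrow>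
     (\<forall>s \<in> X. \<forall>s' \<in> X. map (val M s) ts = map (val M s') ts \<longrightarrow>
        map (val M s) us = map (val M s') us)"
| "sat M X (Neg \<phi>) \<longleftrightarrow> (\<forall>s \<in> X. \<not> sat M {s} \<phi>)"
| "sat M X (And \<phi> \<psi>) \<longleftrightarrow> sat M X \<phi> \<and> sat M X \<psi>"
| "sat M X (Or \<phi> \<psi>) \<longleftrightarrow> (\<exists>Y Z. X = Y \<union> Z \<and> sat M Y \<phi> \<and> sat M Z \<psi>)"
| "sat M X (Ex x \<phi>) \<longleftrightarrow>
     (\<exists>F. (\<forall>s \<in> X. F s \<noteq> {} \<and> F s \<subseteq> univ M) \<and> sat M (supp X F x) \<phi>)"
| "sat M X (All x \<phi>) \<longleftrightarrow> sat M (supp X (\<lambda>_. univ M) x) \<phi>"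

text \<open>HOL cannot quantify over types inside a formula, so consequence is relative to a type
  \<open>'u\<close> in which the universes of the models are (arbitrary) subsets.\<close>

definition entails ::
  "'u itself \<Rightarrow> ('f, 'p) vocab \<Rightarrow> ('f, 'p, 'v) fm set \<Rightarrow> ('f, 'p, 'v) fm \<Rightarrow> bool" where
  "entails U L \<Gamma> \<phi> \<longleftrightarrow>
     (\<forall>(M :: ('f, 'p, 'u) model) V X.
        is_model L M \<and> is_team M V X \<and> Fvs \<Gamma> \<union> Fv \<phi> \<subseteq> V \<and> (\<forall>\<gamma> \<in> \<Gamma>. sat M X \<gamma>)
        \<longrightarrow> sat M X \<phi>)"


section \<open>Syntactic operations\<close>

primrec subst_tm :: "('v \<Rightarrow> ('f, 'v) tm) \<Rightarrow> ('f, 'v) tm \<Rightarrow> ('f, 'v) tm" where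
  "subst_tm \<theta> (Var x) = \<theta> x"
| "subst_tm \<theta> (Fn f ts) = Fn f (map (subst_tm \<theta>) ts)"

text \<open>Simultaneous substitution for the free occurrences of variables. It does not rename bound
  variables: \<open>free_for \<theta> \<phi>\<close> says that no variable is captured.\<close>

primrec subst_fm :: "('v \<Rightarrow> ('f, 'v) tm) \<Rightarrow> ('f, 'p, 'v) fm \<Rightarrow> ('f, 'p, 'v) fm" where
  "subst_fm \<theta> (Eq t u) = Eq (subst_tm \<theta> t) (subst_tm \<theta> u)"
| "subst_fm \<theta> (Rel p ts) = Rel p (map (subst_tm \<theta>) ts)"
| "subst_fm \<theta> (Dep ts us) = Dep (map (subst_tm \<theta>) ts) (map (subst_tm \<theta>) us)"
| "subst_fm \<theta> (Neg \<phi>) = Neg (subst_fm \<theta> \<phi>)"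
| "subst_fm \<theta> (And \<phi> \<psi>) = And (subst_fm \<theta> \<phi>) (subst_fm \<theta> \<psi>)"
| "subst_fm \<theta> (Or \<phi> \<psi>) = Or (subst_fm \<theta> \<phi>) (subst_fm \<theta> \<psi>)"
| "subst_fm \<theta> (Ex x \<phi>) = Ex x (subst_fm (\<theta>(x := Var x)) \<phi>)"
| "subst_fm \<theta> (All x \<phi>) = All x (subst_fm (\<theta>(x := Var x)) \<phi>)"

primrec free_for :: "('v \<Rightarrow> ('f, 'v) tm) \<Rightarrow> ('f, 'p, 'v) fm \<Rightarrow> bool" where
  "free_for \<theta> (Eq t u) \<longleftrightarrow> True"
| "free_for \<theta> (Rel p ts) \<longleftrightarrow> True"
| "free_for \<theta> (Dep ts us) \<longleftrightarrow> True"
| "free_for \<theta> (Neg \<phi>) \<longleftrightarrow> free_for \<theta> \<phi>"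
| "free_for \<theta> (And \<phi> \<psi>) \<longleftrightarrow> free_for \<theta> \<phi> \<and> free_for \<theta> \<psi>"
| "free_for \<theta> (Or \<phi> \<psi>) \<longleftrightarrow> free_for \<theta> \<phi> \<and> free_for \<theta> \<psi>"
| "free_for \<theta> (Ex x \<phi>) \<longleftrightarrow>
     (\<forall>z \<in> Fv \<phi> - {x}. x \<notin> Fvt (\<theta> z)) \<and> free_for (\<theta>(x := Var x)) \<phi>"
| "free_for \<theta> (All x \<phi>) \<longleftrightarrow>
     (\<forall>z \<in> Fv \<phi> - {x}. x \<notin> Fvt (\<theta> z)) \<and> free_for (\<theta>(x := Var x)) \<phi>"

abbreviation single :: "'v \<Rightarrow> ('f, 'v) tm \<Rightarrow> 'v \<Rightarrow> ('f, 'v) tm" where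
  "single x t \<equiv> Var(x := t)"

text \<open>All variables that occur in a formula, free, bound, or next to a quantifier.\<close>

primrec vars :: "('f, 'p, 'v) fm \<Rightarrow> 'v set" where
  "vars (Eq t u) = Fvt t \<union> Fvt u"
| "vars (Rel p ts) = (\<Union>t \<in> set ts. Fvt t)"
| "vars (Dep ts us) = (\<Union>t \<in> set ts \<union> set us. Fvt t)"
| "vars (Neg \<phi>) = vars \<phi>"
| "vars (And \<phi> \<psi>) = vars \<phi> \<union> vars \<psi>"
| "vars (Or \<phi> \<psi>) = vars \<phi> \<union> vars \<psi>"
| "vars (Ex x \<phi>) = insert x (vars \<phi>)"
| "vars (All x \<phi>) = insert x (vars \<phi>)"

primrec quantifier_free :: "('f, 'p, 'v) fm \<Rightarrow> bool" where
  "quantifier_free (Eq t u) \<longleftrightarrow> True"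
| "quantifier_free (Rel p ts) \<longleftrightarrow> True"
| "quantifier_free (Dep ts us) \<longleftrightarrow> True"
| "quantifier_free (Neg \<phi>) \<longleftrightarrow> quantifier_free \<phi>"
| "quantifier_free (And \<phi> \<psi>) \<longleftrightarrow> quantifier_free \<phi> \<and> quantifier_free \<psi>"
| "quantifier_free (Or \<phi> \<psi>) \<longleftrightarrow> quantifier_free \<phi> \<and> quantifier_free \<psi>"
| "quantifier_free (Ex x \<phi>) \<longleftrightarrow> False"
| "quantifier_free (All x \<phi>) \<longleftrightarrow> False"

text \<open>The bound variable of \<open>falsum\<close> is fixed but arbitrary.\<close>

definition falsum :: "('f, 'p, 'v) fm" where
  "falsum = Ex undefined (Neg (Eq (Var undefined) (Var undefined)))"

definition imp :: "('f, 'p, 'v) fm \<Rightarrow> ('f, 'p, 'v) fm \<Rightarrow> ('f, 'p, 'v) fm" where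
  "imp \<phi> \<psi> = Or (Neg \<phi>) \<psi>"

fun Conj :: "('f, 'p, 'v) fm list \<Rightarrow> ('f, 'p, 'v) fm" where
  "Conj [] = Neg falsum"
| "Conj [\<phi>] = \<phi>"
| "Conj (\<phi> # \<psi> # \<phi>s) = And \<phi> (Conj (\<psi> # \<phi>s))"

definition Exs :: "'v list \<Rightarrow> ('f, 'p, 'v) fm \<Rightarrow> ('f, 'p, 'v) fm" where
  "Exs xs \<phi> = foldr Ex xs \<phi>"

definition Alls :: "'v list \<Rightarrow> ('f, 'p, 'v) fm \<Rightarrow> ('f, 'p, 'v) fm" where
  "Alls xs \<phi> = foldr All xs \<phi>"

definition Eqs :: "('f, 'v) tm list \<Rightarrow> ('f, 'v) tm list \<Rightarrow> ('f, 'p, 'v) fm" where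
  "Eqs ts us = Conj (map2 Eq ts us)"

definition dep_atom :: "'v list \<times> 'v \<Rightarrow> ('f, 'p, 'v) fm" where
  "dep_atom d = Dep (map Var (fst d)) [Var (snd d)]"


section \<open>The natural deduction system\<close>

text \<open>The formulas of the system have only dependence atoms with a single dependent term. Any other
  atom is read as shorthand, for which \<open>dep_shorthand\<close> picks some variables \<open>xs\<close>, \<open>ys\<close> that do not
  occur in the atom.\<close>

primrec single_dep :: "('f, 'p, 'v) fm \<Rightarrow> bool" where
  "single_dep (Eq t u) \<longleftrightarrow> True"
| "single_dep (Rel p ts) \<longleftrightarrow> True"
| "single_dep (Dep ts us) \<longleftrightarrow> length us = 1"
| "single_dep (Neg \<phi>) \<longleftrightarrow> single_dep \<phi>"
| "single_dep (And \<phi> \<psi>) \<longleftrightarrow> single_dep \<phi> \<and> single_dep \<psi>"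
| "single_dep (Or \<phi> \<psi>) \<longleftrightarrow> single_dep \<phi> \<and> single_dep \<psi>"
| "single_dep (Ex x \<phi>) \<longleftrightarrow> single_dep \<phi>"
| "single_dep (All x \<phi>) \<longleftrightarrow> single_dep \<phi>"

definition KV_formula :: "('f, 'p) vocab \<Rightarrow> ('f, 'p, 'v) fm \<Rightarrow> bool" where
  "KV_formula L \<phi> \<longleftrightarrow> D_formula L \<phi> \<and> single_dep \<phi>"

definition dep_shorthand :: "('f, 'v) tm list \<Rightarrow> ('f, 'v) tm list \<Rightarrow> ('f, 'p, 'v) fm" where
  "dep_shorthand ts us =
     (if length us = 1 then Dep ts us
      else let (xs, ys) = (SOME (xs, ys). length xs = length ts \<and> length ys = length us \<and>
                             distinct (xs @ ys) \<and>
                             set (xs @ ys) \<inter> (\<Union>t \<in> set ts \<union> set us. Fvt t) = {})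
           in Exs (xs @ ys)
                (And (Conj (map (\<lambda>y. dep_atom (xs, y)) ys))
                  (And (Eqs (map Var xs) ts) (Eqs (map Var ys) us))))"

primrec expand :: "('f, 'p, 'v) fm \<Rightarrow> ('f, 'p, 'v) fm" where
  "expand (Eq t u) = Eq t u"
| "expand (Rel p ts) = Rel p ts"
| "expand (Dep ts us) = dep_shorthand ts us"
| "expand (Neg \<phi>) = Neg (expand \<phi>)"
| "expand (And \<phi> \<psi>) = And (expand \<phi>) (expand \<psi>)"
| "expand (Or \<phi> \<psi>) = Or (expand \<phi>) (expand \<psi>)"
| "expand (Ex x \<phi>) = Ex x (expand \<phi>)"
| "expand (All x \<phi>) = All x (expand \<phi>)"

definition rename :: "'v list \<Rightarrow> 'v list \<Rightarrow> 'v \<Rightarrow> 'v" where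
  "rename xs xs' v = (case map_of (zip xs xs') v of Some w \<Rightarrow> w | None \<Rightarrow> v)"

text \<open>The formula \<open>\<exists>y\<^sub>1 \<dots> \<exists>y\<^sub>n (\<And>\<^sub>j =(z\<^sup>j, y\<^sub>j) \<and> \<alpha>)\<close>, where \<open>ds\<close> lists the pairs \<open>(z\<^sup>j, y\<^sub>j)\<close>.\<close>

definition dep_block :: "('v list \<times> 'v) list \<Rightarrow> ('f, 'p, 'v) fm \<Rightarrow> ('f, 'p, 'v) fm" where
  "dep_block ds \<alpha> = Exs (map snd ds) (And (Conj (map dep_atom ds)) \<alpha>)"

text \<open>\<open>derives L \<Gamma> \<phi>\<close>: there is a derivation of \<open>\<phi>\<close> whose undischarged assumptions are in \<open>\<Gamma>\<close>. The
  conditions of the quantifier rules concern the assumptions that are actually used, not all of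
  \<open>\<Gamma>\<close> (whose free variables may exhaust the variables); this is the purpose of rule \<open>weaken\<close>.
  The premises \<open>KV_formula\<close> and \<open>wf_tm\<close> keep every formula of a derivation within the vocabulary
  \<open>L\<close>.

  In \<open>dep_dist\<close> the variables \<open>z\<^sup>j\<close> are distinct from the \<open>y\<^sub>i\<close>; if the \<open>z\<^sup>j\<close> of one disjunct could
  contain its \<open>y\<^sub>i\<close>, then atoms such as \<open>=(u, y\<^sub>2, y\<^sub>1)\<close> and \<open>=(u', y\<^sub>1, y\<^sub>2)\<close> would make the rule
  unsound.\<close>

inductive derives :: "('f, 'p) vocab \<Rightarrow> ('f, 'p, 'v) fm set \<Rightarrow> ('f, 'p, 'v) fm \<Rightarrow> bool"
  for L :: "('f, 'p) vocab" where
  assm: "\<phi> \<in> \<Gamma> \<Longrightarrow> \<forall>\<gamma> \<in> \<Gamma>. KV_formula L \<gamma> \<Longrightarrow> derives L \<Gamma> \<phi>"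
| weaken: "derives L \<Gamma> \<phi> \<Longrightarrow> \<Gamma> \<subseteq> \<Gamma>' \<Longrightarrow> \<forall>\<gamma> \<in> \<Gamma>'. KV_formula L \<gamma> \<Longrightarrow> derives L \<Gamma>' \<phi>"
| negI: "derives L (insert \<alpha> \<Gamma>) falsum \<Longrightarrow> first_order \<alpha> \<Longrightarrow> derives L \<Gamma> (Neg \<alpha>)"
| negE: "derives L \<Gamma> \<alpha> \<Longrightarrow> derives L \<Gamma> (Neg \<alpha>) \<Longrightarrow> first_order \<alpha> \<Longrightarrow> KV_formula L \<phi> \<Longrightarrow>
    derives L \<Gamma> \<phi>"
| raa: "derives L (insert (Neg \<alpha>) \<Gamma>) falsum \<Longrightarrow> first_order \<alpha> \<Longrightarrow> derives L \<Gamma> \<alpha>"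
| andI: "derives L \<Gamma> \<phi> \<Longrightarrow> derives L \<Gamma> \<psi> \<Longrightarrow> derives L \<Gamma> (And \<phi> \<psi>)"
| andE1: "derives L \<Gamma> (And \<phi> \<psi>) \<Longrightarrow> derives L \<Gamma> \<phi>"
| andE2: "derives L \<Gamma> (And \<phi> \<psi>) \<Longrightarrow> derives L \<Gamma> \<psi>"
| orI1: "derives L \<Gamma> \<phi> \<Longrightarrow> KV_formula L \<psi> \<Longrightarrow> derives L \<Gamma> (Or \<phi> \<psi>)"
| orI2: "derives L \<Gamma> \<phi> \<Longrightarrow> KV_formula L \<psi> \<Longrightarrow> derives L \<Gamma> (Or \<psi> \<phi>)"
| orE: "derives L \<Gamma> (Or \<phi> \<psi>) \<Longrightarrow> derives L (insert \<phi> \<Gamma>) \<alpha> \<Longrightarrow> derives L (insert \<psi> \<Gamma>) \<alpha> \<Longrightarrow>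
    first_order \<alpha> \<Longrightarrow> derives L \<Gamma> \<alpha>"
| or_subst: "derives L \<Gamma> (Or \<phi> \<psi>) \<Longrightarrow> derives L (insert \<phi> \<Gamma>) \<chi> \<Longrightarrow> derives L \<Gamma> (Or \<chi> \<psi>)"
| or_comm: "derives L \<Gamma> (Or \<phi> \<psi>) \<Longrightarrow> derives L \<Gamma> (Or \<psi> \<phi>)"
| or_assoc: "derives L \<Gamma> (Or (Or \<phi> \<psi>) \<chi>) \<Longrightarrow> derives L \<Gamma> (Or \<phi> (Or \<psi> \<chi>))"
| allI: "derives L \<Gamma> \<phi> \<Longrightarrow> x \<notin> Fvs \<Gamma> \<Longrightarrow> derives L \<Gamma> (All x \<phi>)"
| allE: "derives L \<Gamma> (All x \<phi>) \<Longrightarrow> wf_tm L t \<Longrightarrow> free_for (single x t) \<phi> \<Longrightarrow>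
    derives L \<Gamma> (subst_fm (single x t) \<phi>)"
| exI: "derives L \<Gamma> (subst_fm (single x t) \<phi>) \<Longrightarrow> wf_tm L t \<Longrightarrow> KV_formula L \<phi> \<Longrightarrow>
    free_for (single x t) \<phi> \<Longrightarrow> derives L \<Gamma> (Ex x \<phi>)"
| exE: "derives L \<Gamma> (Ex x \<phi>) \<Longrightarrow> derives L (insert (subst_fm (single x (Var v)) \<phi>) \<Gamma>) \<psi> \<Longrightarrow>
    free_for (single x (Var v)) \<phi> \<Longrightarrow> v \<notin> Fvs \<Gamma> \<union> Fv \<phi> \<union> Fv \<psi> \<Longrightarrow> derives L \<Gamma> \<psi>"
| eq_refl: "wf_tm L t \<Longrightarrow> \<forall>\<gamma> \<in> \<Gamma>. KV_formula L \<gamma> \<Longrightarrow> derives L \<Gamma> (Eq t t)"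
| eq_subst: "derives L \<Gamma> (Eq t t') \<Longrightarrow> derives L \<Gamma> (subst_fm (single x t) \<phi>) \<Longrightarrow>
    free_for (single x t) \<phi> \<Longrightarrow> free_for (single x t') \<phi> \<Longrightarrow>
    derives L \<Gamma> (subst_fm (single x t') \<phi>)"
| ex_scope: "derives L \<Gamma> (Or (Ex x \<phi>) \<psi>) \<Longrightarrow> x \<notin> Fv \<psi> \<Longrightarrow> derives L \<Gamma> (Ex x (Or \<phi> \<psi>))"
| all_scope: "derives L \<Gamma> (Or (All x \<phi>) \<psi>) \<Longrightarrow> x \<notin> Fv \<psi> \<Longrightarrow>
    distinct [x, y, z] \<Longrightarrow> {y, z} \<inter> (vars \<phi> \<union> vars \<psi>) = {} \<Longrightarrow>
    derives L \<Gamma> (Ex y (Ex z (All x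
      (Or (And \<phi> (Eq (Var y) (Var z))) (And \<psi> (Neg (Eq (Var y) (Var z))))))))"
| unnest1: "derives L \<Gamma> (Dep ts [t]) \<Longrightarrow> i < length ts \<Longrightarrow> z \<notin> vars (Dep ts [t] :: ('f, 'p, 'v) fm) \<Longrightarrow>
    derives L \<Gamma> (Ex z (And (Dep (ts[i := Var z]) [t]) (Eq (Var z) (ts ! i))))"
| unnest2: "derives L \<Gamma> (Dep ts [t]) \<Longrightarrow> z \<notin> vars (Dep ts [t] :: ('f, 'p, 'v) fm) \<Longrightarrow>
    derives L \<Gamma> (Ex z (And (Dep ts [Var z]) (Eq (Var z) t)))"
| dep_dist: "derives L \<Gamma> (Or (dep_block ds \<alpha>) (dep_block es \<beta>)) \<Longrightarrow>
    first_order \<alpha> \<Longrightarrow> first_order \<beta> \<Longrightarrow> quantifier_free \<alpha> \<Longrightarrow> quantifier_free \<beta> \<Longrightarrow>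
    distinct (map snd ds) \<Longrightarrow> distinct (map snd es) \<Longrightarrow>
    set (map snd ds) \<inter> vars (dep_block es \<beta>) = {} \<Longrightarrow>
    set (map snd es) \<inter> vars (dep_block ds \<alpha>) = {} \<Longrightarrow>
    \<forall>d \<in> set ds. set (fst d) \<inter> set (map snd ds) = {} \<Longrightarrow>
    \<forall>e \<in> set es. set (fst e) \<inter> set (map snd es) = {} \<Longrightarrow>
    derives L \<Gamma> (dep_block (ds @ es) (Or \<alpha> \<beta>))"
| dep_intro: "derives L \<Gamma> (Exs xs (All y \<phi>)) \<Longrightarrow>
    distinct (xs @ [y] @ zs) \<Longrightarrow> Fv \<phi> \<subseteq> set (xs @ [y] @ zs) \<Longrightarrow>
    derives L \<Gamma> (All y (Exs xs (And (dep_shorthand (map Var zs) (map Var xs)) \<phi>)))"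
| dep_elim: "derives L \<Gamma> (Alls xs (Exs ys (And (Conj (map dep_atom ds)) \<phi>))) \<Longrightarrow>
    distinct (xs @ ys @ vs @ xs' @ ys') \<Longrightarrow> length xs' = length xs \<Longrightarrow> length ys' = length ys \<Longrightarrow>
    Fv \<phi> \<subseteq> set (xs @ ys @ vs) \<Longrightarrow>
    \<forall>(zs, y) \<in> set ds. subseq zs (xs @ ys @ vs) \<and> y \<in> set ys \<Longrightarrow>
    r = rename (xs @ ys) (xs' @ ys') \<Longrightarrow> free_for (Var \<circ> r) \<phi> \<Longrightarrow>
    derives L \<Gamma> (Alls xs (Exs ys (And \<phi> (Alls xs' (Exs ys' (And (subst_fm (Var \<circ> r) \<phi>)
      (Conj (map (\<lambda>(zs, y). imp (Eqs (map Var zs) (map (Var \<circ> r) zs)) (Eq (Var y) (Var (r y))))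
        ds))))))))"

definition D_derives :: "('f, 'p) vocab \<Rightarrow> ('f, 'p, 'v) fm set \<Rightarrow> ('f, 'p, 'v) fm \<Rightarrow> bool" where
  "D_derives L \<Gamma> \<phi> \<longleftrightarrow> derives L (expand ` \<Gamma>) (expand \<phi>)"

end

theory Submission imports Defs begin

text \<open>Suppose that \<open>\<alpha>\<close> is not derivable from \<open>\<Gamma>\<close>. A first-order formula is flat: it holds in a
  team iff it holds at each assignment of the team (lemma \<open>flat\<close>). So it is enough to find a
  model and one assignment \<open>e\<close> such that the team \<open>{e}\<close> satisfies \<open>\<Gamma>\<close> and \<open>e\<close> falsifies \<open>\<alpha>\<close>.

  From each formula of \<open>\<Gamma>\<close> the calculus derives a formula
  \<open>\<forall>xs \<exists>ys (\<And> =(zs, y) \<and> \<theta>)\<close> with \<open>\<theta>\<close> first-order and quantifier-free, which semantically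
  implies the original formula (\<open>normal_form\<close>). Read as a game, it says that the second player can
  answer values for \<open>xs\<close> by values for \<open>ys\<close> so that \<open>\<theta>\<close> holds, and so that any two rounds are
  compatible: where they agree on \<open>zs\<close>, they agree on \<open>y\<close>. Iterated dependence elimination
  derives, for each \<open>n\<close>, a first-order formula which says that the second player can survive \<open>n\<close>
  rounds (\<open>approximation\<close>). If finitely many of these approximations derived \<open>\<alpha>\<close>, so would
  \<open>\<Gamma>\<close>. By completeness for first-order formulas (\<open>model_existence\<close> and
  \<open>consistent_has_model\<close>, a Henkin construction), any finitely many of them hold in a countable
  model in which \<open>\<alpha>\<close> fails.

  Winning each finite game in its own countable model has to be turned into winning all games
  forever in one model. For this purpose elements are given names that are closed under the
  function symbols, under witnesses for first-order existential formulas, and under answers of the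
  second player to moves that consist of names. Finitely many named moves can be answered in one
  of the countable models (\<open>play\<close>), hence some ultrafilter on triples of a model, an
  assignment and an answer function contains the set of good triples for every pair of moves.
  Names modulo equality on a set of the ultrafilter form a model in which first-order truth is
  truth on a set of the ultrafilter, as in the theorem of Los. There the answers to all moves are
  pairwise compatible, so that the team of all pairs of a move and its answer satisfies the
  quantifier-free part of the normal form (\<open>strategy_model\<close>). As there are at most as many names
  as formulas, this model fits into the type \<open>'u\<close>.\<close>

section \<open>Team semantics and first-order semantics\<close>

primrec tval :: "('f, 'p, 'u) model \<Rightarrow> ('v \<Rightarrow> 'u) \<Rightarrow> ('f, 'v) tm \<Rightarrow> 'u" where
  "tval M e (Var x) = e x"
| "tval M e (Fn f ts) = fint M f (map (tval M e) ts)"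

text \<open>A dependence atom counts as true, as it is in every team of one assignment.\<close>

primrec fsat :: "('f, 'p, 'u) model \<Rightarrow> ('v \<Rightarrow> 'u) \<Rightarrow> ('f, 'p, 'v) fm \<Rightarrow> bool" where
  "fsat M e (Eq t u) \<longleftrightarrow> tval M e t = tval M e u"
| "fsat M e (Rel p ts) \<longleftrightarrow> map (tval M e) ts \<in> rint M p"
| "fsat M e (Dep ts us) \<longleftrightarrow> True"
| "fsat M e (Neg \<phi>) \<longleftrightarrow> \<not> fsat M e \<phi>"
| "fsat M e (And \<phi> \<psi>) \<longleftrightarrow> fsat M e \<phi> \<and> fsat M e \<psi>"
| "fsat M e (Or \<phi> \<psi>) \<longleftrightarrow> fsat M e \<phi> \<or> fsat M e \<psi>"
| "fsat M e (Ex x \<phi>) \<longleftrightarrow> (\<exists>a \<in> univ M. fsat M (e(x := a)) \<phi>)"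
| "fsat M e (All x \<phi>) \<longleftrightarrow> (\<forall>a \<in> univ M. fsat M (e(x := a)) \<phi>)"

lemma val_tval: "val M s t = tval M (\<lambda>x. the (s x)) t"
  by (induction t) (auto cong: map_cong)

lemma tval_cong: "(\<And>x. x \<in> Fvt t \<Longrightarrow> e x = e' x) \<Longrightarrow> tval M e t = tval M e' t"
proof (induction t)
  case (Fn f ts)
  then have "map (tval M e) ts = map (tval M e') ts" by (intro map_cong) auto
  then show ?case by (simp only: tval.simps)
qed simp

lemma val_cong: "(\<And>x. x \<in> Fvt t \<Longrightarrow> the (s x) = the (s' x)) \<Longrightarrow> val M s t = val M s' t"
  unfolding val_tval by (rule tval_cong)

lemma fsat_cong: "(\<And>x. x \<in> Fv \<phi> \<Longrightarrow> e x = e' x) \<Longrightarrow> fsat M e \<phi> = fsat M e' \<phi>"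
proof (induction \<phi> arbitrary: e e')
  case (Rel p ts)
  then have "map (tval M e) ts = map (tval M e') ts" by (intro map_cong refl tval_cong) auto
  then show ?case by (simp only: fsat.simps)
next
  case (Eq t u)
  then show ?case using tval_cong[of t e e' M] tval_cong[of u e e' M] by auto
next
  case (Neg \<phi>)
  from Neg.IH[of e e'] Neg.prems show ?case by simp
next
  case (And \<phi> \<psi>)
  from And.IH(1)[of e e'] And.IH(2)[of e e'] And.prems show ?case by simp
next
  case (Or \<phi> \<psi>)
  from Or.IH(1)[of e e'] Or.IH(2)[of e e'] Or.prems show ?case by simp
next
  case (Ex x \<phi>)
  have "fsat M (e(x := a)) \<phi> = fsat M (e'(x := a)) \<phi>" for a
    by (rule Ex.IH) (use Ex.prems in auto)
  then show ?case by simp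
next
  case (All x \<phi>)
  have "fsat M (e(x := a)) \<phi> = fsat M (e'(x := a)) \<phi>" for a
    by (rule All.IH) (use All.prems in auto)
  then show ?case by simp
qed simp

lemma tval_subst: "tval M e (subst_tm \<theta> t) = tval M (\<lambda>x. tval M e (\<theta> x)) t"
  by (induction t) (auto simp: o_def cong: map_cong)

lemma fsat_subst:
  "free_for \<theta> \<phi> \<Longrightarrow> fsat M e (subst_fm \<theta> \<phi>) = fsat M (\<lambda>x. tval M e (\<theta> x)) \<phi>"
proof (induction \<phi> arbitrary: e \<theta>)
  case (Ex x \<phi>)
  have "fsat M (e(x := a)) (subst_fm (\<theta>(x := Var x)) \<phi>) =
        fsat M ((\<lambda>y. tval M e (\<theta> y))(x := a)) \<phi>" for a
  proof -
    have "fsat M (e(x := a)) (subst_fm (\<theta>(x := Var x)) \<phi>) =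
      fsat M (\<lambda>y. tval M (e(x := a)) ((\<theta>(x := Var x)) y)) \<phi>"
      by (rule Ex.IH) (use Ex.prems in \<open>simp only: free_for.simps\<close>)
    also have "\<dots> = fsat M ((\<lambda>y. tval M e (\<theta> y))(x := a)) \<phi>"
      by (rule fsat_cong) (use Ex.prems in \<open>auto intro!: tval_cong\<close>)
    finally show ?thesis .
  qed
  then show ?case by simp
next
  case (All x \<phi>)
  have "fsat M (e(x := a)) (subst_fm (\<theta>(x := Var x)) \<phi>) =
        fsat M ((\<lambda>y. tval M e (\<theta> y))(x := a)) \<phi>" for a
  proof -
    have "fsat M (e(x := a)) (subst_fm (\<theta>(x := Var x)) \<phi>) =
      fsat M (\<lambda>y. tval M (e(x := a)) ((\<theta>(x := Var x)) y)) \<phi>"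
      by (rule All.IH) (use All.prems in \<open>simp only: free_for.simps\<close>)
    also have "\<dots> = fsat M ((\<lambda>y. tval M e (\<theta> y))(x := a)) \<phi>"
      by (rule fsat_cong) (use All.prems in \<open>auto intro!: tval_cong\<close>)
    finally show ?thesis .
  qed
  then show ?case by simp
qed (auto simp: tval_subst o_def)

lemma first_order_subst [simp]: "first_order (subst_fm \<theta> \<phi>) = first_order \<phi>"
  by (induction \<phi> arbitrary: \<theta>) auto

lemma sat_ExI:
  "(\<And>s. s \<in> X \<Longrightarrow> F s \<noteq> {} \<and> F s \<subseteq> univ M) \<Longrightarrow> sat M (supp X F x) \<phi> \<Longrightarrow> sat M X (Ex x \<phi>)"
  by auto

lemma sat_OrI: "X = Y \<union> Z \<Longrightarrow> sat M Y \<phi> \<Longrightarrow> sat M Z \<psi> \<Longrightarrow> sat M X (Or \<phi> \<psi>)"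
  by auto

lemma the_upd: "(\<lambda>x. the ((s(y \<mapsto> a)) x)) = (\<lambda>x. the (s x))(y := a)"
  by auto

text \<open>A first-order disjunction or existential quantifier can be decided assignment by assignment,
  because the pieces of the team found for the single assignments can be put together.\<close>

lemma flat:
  "first_order \<phi> \<Longrightarrow> sat M X \<phi> \<longleftrightarrow> (\<forall>s \<in> X. fsat M (\<lambda>x. the (s x)) \<phi>)"
proof (induction \<phi> arbitrary: X)
  case (Or \<phi> \<psi>)
  show ?case (is "?l = ?r")
  proof
    assume ?l
    then show ?r using Or by auto
  next
    assume r: ?r
    let ?Y = "{s \<in> X. fsat M (\<lambda>x. the (s x)) \<phi>}" and ?Z = "{s \<in> X. fsat M (\<lambda>x. the (s x)) \<psi>}"
    have "X = ?Y \<union> ?Z" using r by auto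
    moreover have "sat M ?Y \<phi>" "sat M ?Z \<psi>" using Or by auto
    ultimately show ?l by (rule sat_OrI)
  qed
next
  case (Ex x \<phi>)
  show ?case (is "?l = ?r")
  proof
    assume ?l
    then obtain F where F: "\<forall>s \<in> X. F s \<noteq> {} \<and> F s \<subseteq> univ M" "sat M (supp X F x) \<phi>" by auto
    show ?r
    proof
      fix s assume s: "s \<in> X"
      then obtain a where a: "a \<in> F s" using F(1) by blast
      then have "s(x \<mapsto> a) \<in> supp X F x" using s by (auto simp: supp_def)
      moreover have "\<forall>s \<in> supp X F x. fsat M (\<lambda>x. the (s x)) \<phi>" using F(2) Ex by simp
      ultimately have "fsat M (\<lambda>z. the ((s(x \<mapsto> a)) z)) \<phi>" by blast
      then show "fsat M (\<lambda>x. the (s x)) (Ex x \<phi>)" using a s F(1) unfolding the_upd by auto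
    qed
  next
    assume r: ?r
    let ?F = "\<lambda>s. {a \<in> univ M. fsat M ((\<lambda>x. the (s x))(x := a)) \<phi>}"
    have "\<forall>t \<in> supp X ?F x. fsat M (\<lambda>z. the (t z)) \<phi>"
    proof
      fix t assume "t \<in> supp X ?F x"
      then obtain s a where t: "t = s(x \<mapsto> a)" "a \<in> ?F s" unfolding supp_def by blast
      show "fsat M (\<lambda>z. the (t z)) \<phi>" unfolding t(1) the_upd using t(2) by simp
    qed
    then have "sat M (supp X ?F x) \<phi>" using Ex by simp
    moreover have "?F s \<noteq> {} \<and> ?F s \<subseteq> univ M" if "s \<in> X" for s using r that by auto
    ultimately show ?l by (rule sat_ExI[rotated])
  qed
next
  case (All x \<phi>)
  then have "sat M X (All x \<phi>) \<longleftrightarrow>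
    (\<forall>s \<in> supp X (\<lambda>_. univ M) x. fsat M (\<lambda>x. the (s x)) \<phi>)" by simp
  also have "\<dots> \<longleftrightarrow> (\<forall>s \<in> X. \<forall>a \<in> univ M. fsat M (\<lambda>z. the ((s(x \<mapsto> a)) z)) \<phi>)"
    unfolding supp_def by blast
  also have "\<dots> \<longleftrightarrow> (\<forall>s \<in> X. fsat M (\<lambda>x. the (s x)) (All x \<phi>))" unfolding the_upd by simp
  finally show ?case .
qed (auto simp: val_tval[abs_def])

text \<open>Locality, downward closure and the substitution lemma go through the same induction on
  formulas, and so they are proved as one. The first two are the case of the identity
  substitution.\<close>

lemma sat_subst:
  "D_formula L \<phi> \<Longrightarrow> free_for \<theta> \<phi> \<Longrightarrow>
    (\<And>s'. s' \<in> X' \<Longrightarrow> \<exists>s \<in> X. \<forall>z \<in> Fv \<phi>. the (s' z) = val M s (\<theta> z)) \<Longrightarrow>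
    sat M X (subst_fm \<theta> \<phi>) \<Longrightarrow> sat M X' \<phi>"
proof (induction \<phi> arbitrary: \<theta> X X')
  case (Eq t u)
  show ?case unfolding sat.simps
  proof
    fix s' assume "s' \<in> X'"
    then obtain s where s: "s \<in> X" "\<forall>z \<in> Fvt t \<union> Fvt u. the (s' z) = val M s (\<theta> z)"
      using Eq.prems(3)[of s'] by auto
    have *: "val M s' r = val M s (subst_tm \<theta> r)" if "Fvt r \<subseteq> Fvt t \<union> Fvt u" for r
      unfolding val_tval tval_subst by (rule tval_cong) (use that s in \<open>auto simp: val_tval\<close>)
    show "val M s' t = val M s' u" using * Eq.prems(4) s by auto
  qed
next
  case (Rel p ts)
  show ?case unfolding sat.simps
  proof
    fix s' assume "s' \<in> X'"
    then obtain s where s: "s \<in> X" "\<forall>z \<in> Fv (Rel p ts). the (s' z) = val M s (\<theta> z)"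
      using Rel.prems(3)[of s'] by blast
    have "map (val M s') ts = map (val M s) (map (subst_tm \<theta>) ts)"
      using s unfolding list.map_comp
      by (intro map_cong refl) (auto simp: val_tval tval_subst intro!: tval_cong)
    then show "map (val M s') ts \<in> rint M p" using Rel.prems(4) s by (simp del: map_map)
  qed
next
  case (Dep ts us)
  show ?case unfolding sat.simps
  proof (intro ballI impI)
    fix s1' s2' assume "s1' \<in> X'" "s2' \<in> X'" and eq: "map (val M s1') ts = map (val M s2') ts"
    from Dep.prems(3)[OF \<open>s1' \<in> X'\<close>] obtain s1 where
      s1: "s1 \<in> X" "\<forall>z \<in> (\<Union>t \<in> set ts \<union> set us. Fvt t). the (s1' z) = val M s1 (\<theta> z)" by auto
    from Dep.prems(3)[OF \<open>s2' \<in> X'\<close>] obtain s2 where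
      s2: "s2 \<in> X" "\<forall>z \<in> (\<Union>t \<in> set ts \<union> set us. Fvt t). the (s2' z) = val M s2 (\<theta> z)" by auto
    have *: "map (val M s') rs = map (val M s) (map (subst_tm \<theta>) rs)"
      if "set rs \<subseteq> set ts \<union> set us" "\<forall>z \<in> (\<Union>t \<in> set ts \<union> set us. Fvt t). the (s' z) = val M s (\<theta> z)"
      for rs s s'
      using that unfolding list.map_comp
      by (intro map_cong refl) (auto simp: val_tval tval_subst intro!: tval_cong)
    have "map (val M s1) (map (subst_tm \<theta>) ts) = map (val M s2) (map (subst_tm \<theta>) ts)"
      using *[OF _ s1(2), of ts] *[OF _ s2(2), of ts] eq by (simp del: map_map)
    then have "map (val M s1) (map (subst_tm \<theta>) us) = map (val M s2) (map (subst_tm \<theta>) us)"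
      using Dep.prems(4) s1(1) s2(1) unfolding sat.simps subst_fm.simps by blast
    then show "map (val M s1') us = map (val M s2') us"
      using *[OF _ s1(2), of us] *[OF _ s2(2), of us] by (simp del: map_map)
  qed
next
  case (Neg \<phi>)
  have fo: "first_order \<phi>" using Neg.prems by simp
  have fo': "first_order (subst_fm \<theta> \<phi>)" for \<theta> using fo by simp
  show ?case unfolding sat.simps
  proof
    fix s' assume "s' \<in> X'"
    then obtain s where s: "s \<in> X" "\<forall>z \<in> Fv \<phi>. the (s' z) = val M s (\<theta> z)"
      using Neg.prems(3)[of s'] by auto
    have "\<not> fsat M (\<lambda>x. the (s x)) (subst_fm \<theta> \<phi>)" using Neg.prems(4) s fo' by (simp add: flat)
    moreover have "fsat M (\<lambda>x. the (s x)) (subst_fm \<theta> \<phi>) = fsat M (\<lambda>x. the (s' x)) \<phi>"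
    proof -
      have "fsat M (\<lambda>x. the (s x)) (subst_fm \<theta> \<phi>) =
        fsat M (\<lambda>x. tval M (\<lambda>x. the (s x)) (\<theta> x)) \<phi>"
        using Neg.prems(2) by (intro fsat_subst) simp
      also have "\<dots> = fsat M (\<lambda>x. the (s' x)) \<phi>"
        by (rule fsat_cong) (use s in \<open>simp add: val_tval\<close>)
      finally show ?thesis .
    qed
    ultimately show "\<not> sat M {s'} \<phi>" using fo by (simp add: flat)
  qed
next
  case (And \<phi> \<psi>)
  have "\<exists>s\<in>X. \<forall>z\<in>Fv \<phi>. the (s' z) = val M s (\<theta> z)" "\<exists>s\<in>X. \<forall>z\<in>Fv \<psi>. the (s' z) = val M s (\<theta> z)"
    if "s' \<in> X'" for s' using And.prems(3)[OF that] by auto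
  then show ?case using And.IH[of \<theta> X' X] And.prems by simp
next
  case (Or \<phi> \<psi>)
  then obtain Y Z where YZ: "X = Y \<union> Z" "sat M Y (subst_fm \<theta> \<phi>)" "sat M Z (subst_fm \<theta> \<psi>)" by auto
  let ?Y = "{s' \<in> X'. \<exists>s \<in> Y. \<forall>z \<in> Fv \<phi>. the (s' z) = val M s (\<theta> z)}"
  let ?Z = "{s' \<in> X'. \<exists>s \<in> Z. \<forall>z \<in> Fv \<psi>. the (s' z) = val M s (\<theta> z)}"
  have "s' \<in> ?Y \<union> ?Z" if "s' \<in> X'" for s' using Or.prems(3)[OF that] that YZ(1) by auto
  then have "X' = ?Y \<union> ?Z" by blast
  moreover have "sat M ?Y \<phi>" by (rule Or.IH(1)[OF _ _ _ YZ(2)]) (use Or.prems(1,2) in auto)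
  moreover have "sat M ?Z \<psi>" by (rule Or.IH(2)[OF _ _ _ YZ(3)]) (use Or.prems(1,2) in auto)
  ultimately show ?case by (rule sat_OrI)
next
  case (Ex x \<phi>)
  then obtain F where F: "\<forall>s \<in> X. F s \<noteq> {} \<and> F s \<subseteq> univ M"
    "sat M (supp X F x) (subst_fm (\<theta>(x := Var x)) \<phi>)" by auto
  let ?F = "\<lambda>s'. \<Union> {F s | s. s \<in> X \<and> (\<forall>z \<in> Fv \<phi> - {x}. the (s' z) = val M s (\<theta> z))}"
  have "sat M (supp X' ?F x) \<phi>"
  proof (rule Ex.IH[OF _ _ _ F(2)])
    fix t assume "t \<in> supp X' ?F x"
    then obtain s s' a where t: "t = s'(x \<mapsto> a)" "a \<in> F s" "s \<in> X"
      "\<forall>z \<in> Fv \<phi> - {x}. the (s' z) = val M s (\<theta> z)" unfolding supp_def by blast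
    have "s(x \<mapsto> a) \<in> supp X F x" using t by (auto simp: supp_def)
    moreover have "the (t z) = val M (s(x \<mapsto> a)) ((\<theta>(x := Var x)) z)" if "z \<in> Fv \<phi>" for z
    proof (cases "z = x")
      case False
      have "val M s (\<theta> z) = val M (s(x \<mapsto> a)) (\<theta> z)"
        by (rule val_cong) (use Ex.prems(2) that False in auto)
      then show ?thesis using t that False by simp
    qed (use t in simp)
    ultimately show "\<exists>s \<in> supp X F x. \<forall>z\<in>Fv \<phi>. the (t z) = val M s ((\<theta>(x := Var x)) z)"
      by blast
  qed (use Ex.prems(1,2) in \<open>simp_all only: free_for.simps D_formula.simps\<close>)
  moreover have "?F s' \<noteq> {} \<and> ?F s' \<subseteq> univ M" if "s' \<in> X'" for s'
  proof -
    from Ex.prems(3)[OF that] obtain s where s: "s \<in> X" "\<forall>z \<in> Fv \<phi> - {x}. the (s' z) = val M s (\<theta> z)"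
      by auto
    then have "F s \<subseteq> ?F s'" by blast
    then have "?F s' \<noteq> {}" using F(1) s(1) by (metis subset_empty)
    moreover have "?F s' \<subseteq> univ M" using F(1) by (intro Union_least) auto
    ultimately show "?F s' \<noteq> {} \<and> ?F s' \<subseteq> univ M" ..
  qed
  ultimately show ?case by (rule sat_ExI[rotated])
next
  case (All x \<phi>)
  have "sat M (supp X' (\<lambda>_. univ M) x) \<phi>"
  proof (rule All.IH[where \<theta> = "\<theta>(x := Var x)" and X = "supp X (\<lambda>_. univ M) x"])
    fix t assume "t \<in> supp X' (\<lambda>_. univ M) x"
    then obtain s' a where t: "t = s'(x \<mapsto> a)" "s' \<in> X'" "a \<in> univ M" by (auto simp: supp_def)
    then obtain s where s: "s \<in> X" "\<forall>z \<in> Fv \<phi> - {x}. the (s' z) = val M s (\<theta> z)"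
      using All.prems(3)[of s'] by auto
    have "s(x \<mapsto> a) \<in> supp X (\<lambda>_. univ M) x" using t s by (auto simp: supp_def)
    moreover have "the (t z) = val M (s(x \<mapsto> a)) ((\<theta>(x := Var x)) z)" if "z \<in> Fv \<phi>" for z
    proof (cases "z = x")
      case False
      have "val M s (\<theta> z) = val M (s(x \<mapsto> a)) (\<theta> z)"
        by (rule val_cong) (use All.prems(2) that False in auto)
      then show ?thesis using t s that False by simp
    qed (use t in simp)
    ultimately show "\<exists>s \<in> supp X (\<lambda>_. univ M) x. \<forall>z\<in>Fv \<phi>. the (t z) = val M s ((\<theta>(x := Var x)) z)"
      by blast
  qed (use All.prems(1,2,4) in \<open>simp_all only: free_for.simps D_formula.simps sat.simps subst_fm.simps\<close>)
  then show ?case by simp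
qed

lemma subst_tm_cong: "(\<And>x. x \<in> Fvt t \<Longrightarrow> \<theta> x = \<theta>' x) \<Longrightarrow> subst_tm \<theta> t = subst_tm \<theta>' t"
  by (induction t) auto

lemma subst_tm_Var [simp]: "subst_tm Var t = t"
  by (induction t) (auto intro: map_idI)

lemma subst_fm_cong: "(\<And>x. x \<in> Fv \<phi> \<Longrightarrow> \<theta> x = \<theta>' x) \<Longrightarrow> subst_fm \<theta> \<phi> = subst_fm \<theta>' \<phi>"
proof (induction \<phi> arbitrary: \<theta> \<theta>')
  case (Ex x \<phi>)
  have "subst_fm (\<theta>(x := Var x)) \<phi> = subst_fm (\<theta>'(x := Var x)) \<phi>"
    by (rule Ex.IH) (use Ex.prems in auto)
  then show ?case by simp
next
  case (All x \<phi>)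
  have "subst_fm (\<theta>(x := Var x)) \<phi> = subst_fm (\<theta>'(x := Var x)) \<phi>"
    by (rule All.IH) (use All.prems in auto)
  then show ?case by simp
next
  case (Eq t u)
  then show ?case using subst_tm_cong[of t \<theta> \<theta>'] subst_tm_cong[of u \<theta> \<theta>'] by auto
next
  case (Rel p ts)
  then show ?case by (auto intro!: subst_tm_cong)
next
  case (Dep ts us)
  then show ?case by (auto intro!: subst_tm_cong)
next
  case (Neg \<phi>)
  from Neg.IH[of \<theta> \<theta>'] Neg.prems show ?case by simp
next
  case (And \<phi> \<psi>)
  from And.IH(1)[of \<theta> \<theta>'] And.IH(2)[of \<theta> \<theta>'] And.prems show ?case by simp
next
  case (Or \<phi> \<psi>)
  from Or.IH(1)[of \<theta> \<theta>'] Or.IH(2)[of \<theta> \<theta>'] Or.prems show ?case by simp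
qed

lemma subst_fm_Var [simp]: "subst_fm Var \<phi> = \<phi>"
  by (induction \<phi>) (auto intro: map_idI)

lemma free_for_Var [simp]: "free_for Var \<phi>"
  by (induction \<phi>) auto

lemma subst_fm_single_idle: "x \<notin> Fv \<phi> \<Longrightarrow> subst_fm (single x t) \<phi> = \<phi>"
  by (rule trans[OF subst_fm_cong[where \<theta>' = Var] subst_fm_Var]) auto

lemma subst_tm_single_idle: "x \<notin> Fvt s \<Longrightarrow> subst_tm (single x t) s = s"
  by (rule trans[OF subst_tm_cong[where \<theta>' = Var] subst_tm_Var]) auto

lemmas sat_local = sat_subst[where \<theta> = Var, simplified]

lemma subst_tm_comp: "subst_tm \<theta>1 (subst_tm \<theta>2 t) = subst_tm (\<lambda>x. subst_tm \<theta>1 (\<theta>2 x)) t"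
  by (induction t) auto

lemma subst_fm_comp:
  "free_for \<theta>2 \<phi> \<Longrightarrow> subst_fm \<theta>1 (subst_fm \<theta>2 \<phi>) = subst_fm (\<lambda>x. subst_tm \<theta>1 (\<theta>2 x)) \<phi>"
proof (induction \<phi> arbitrary: \<theta>1 \<theta>2)
  case (Ex x \<phi>)
  have "subst_fm (\<theta>1(x := Var x)) (subst_fm (\<theta>2(x := Var x)) \<phi>) =
    subst_fm (\<lambda>y. subst_tm (\<theta>1(x := Var x)) ((\<theta>2(x := Var x)) y)) \<phi>"
    by (rule Ex.IH) (use Ex.prems in \<open>simp only: free_for.simps\<close>)
  also have "\<dots> = subst_fm ((\<lambda>y. subst_tm \<theta>1 (\<theta>2 y))(x := Var x)) \<phi>"
    by (rule subst_fm_cong) (use Ex.prems in \<open>auto intro!: subst_tm_cong\<close>)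
  finally show ?case by simp
next
  case (All x \<phi>)
  have "subst_fm (\<theta>1(x := Var x)) (subst_fm (\<theta>2(x := Var x)) \<phi>) =
    subst_fm (\<lambda>y. subst_tm (\<theta>1(x := Var x)) ((\<theta>2(x := Var x)) y)) \<phi>"
    by (rule All.IH) (use All.prems in \<open>simp only: free_for.simps\<close>)
  also have "\<dots> = subst_fm ((\<lambda>y. subst_tm \<theta>1 (\<theta>2 y))(x := Var x)) \<phi>"
    by (rule subst_fm_cong) (use All.prems in \<open>auto intro!: subst_tm_cong\<close>)
  finally show ?case by simp
qed (auto simp: subst_tm_comp)

lemma Fvt_subst: "Fvt (subst_tm \<theta> t) = (\<Union>x \<in> Fvt t. Fvt (\<theta> x))"
  by (induction t) auto

lemma Fv_subst:
  "free_for \<theta> \<phi> \<Longrightarrow> Fv (subst_fm \<theta> \<phi>) = (\<Union>x \<in> Fv \<phi>. Fvt (\<theta> x))"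
proof (induction \<phi> arbitrary: \<theta>)
  case (Ex x \<phi>)
  have "Fv (subst_fm (\<theta>(x := Var x)) \<phi>) = (\<Union>y \<in> Fv \<phi>. Fvt ((\<theta>(x := Var x)) y))"
    by (rule Ex.IH) (use Ex.prems in \<open>simp only: free_for.simps\<close>)
  then show ?case using Ex.prems by (auto split: if_splits)
next
  case (All x \<phi>)
  have "Fv (subst_fm (\<theta>(x := Var x)) \<phi>) = (\<Union>y \<in> Fv \<phi>. Fvt ((\<theta>(x := Var x)) y))"
    by (rule All.IH) (use All.prems in \<open>simp only: free_for.simps\<close>)
  then show ?case using All.prems by (auto split: if_splits)
qed (auto simp: Fvt_subst)

lemma Fv_vars: "Fv \<phi> \<subseteq> vars \<phi>"
  by (induction \<phi>) auto

lemma finite_Fvt [simp]: "finite (Fvt t)"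
  by (induction t) auto

lemma finite_vars [simp]: "finite (vars \<phi>)"
  by (induction \<phi>) auto

lemma finite_Fv [simp]: "finite (Fv \<phi>)"
  using Fv_vars finite_vars finite_subset by metis

primrec bvs :: "('f, 'p, 'v) fm \<Rightarrow> 'v set" where
  "bvs (Eq t u) = {}"
| "bvs (Rel p ts) = {}"
| "bvs (Dep ts us) = {}"
| "bvs (Neg \<phi>) = bvs \<phi>"
| "bvs (And \<phi> \<psi>) = bvs \<phi> \<union> bvs \<psi>"
| "bvs (Or \<phi> \<psi>) = bvs \<phi> \<union> bvs \<psi>"
| "bvs (Ex x \<phi>) = insert x (bvs \<phi>)"
| "bvs (All x \<phi>) = insert x (bvs \<phi>)"

lemma vars_eq: "vars \<phi> = Fv \<phi> \<union> bvs \<phi>"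
  by (induction \<phi>) auto

lemma bvs_subst [simp]: "bvs (subst_fm \<theta> \<phi>) = bvs \<phi>"
  by (induction \<phi> arbitrary: \<theta>) auto

lemma free_for_bvs:
  "(\<And>z x. z \<in> Fv \<phi> \<Longrightarrow> x \<in> Fvt (\<theta> z) \<Longrightarrow> x = z \<or> x \<notin> bvs \<phi>) \<Longrightarrow> free_for \<theta> \<phi>"
proof (induction \<phi> arbitrary: \<theta>)
  case (Ex x \<phi>)
  have "free_for (\<theta>(x := Var x)) \<phi>"
    by (rule Ex.IH) (use Ex.prems in \<open>auto split: if_splits\<close>)
  then show ?case using Ex.prems by auto
next
  case (All x \<phi>)
  have "free_for (\<theta>(x := Var x)) \<phi>"
    by (rule All.IH) (use All.prems in \<open>auto split: if_splits\<close>)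
  then show ?case using All.prems by auto
next
  case (And \<phi> \<psi>)
  from And.prems show ?case by (auto intro!: And.IH)
next
  case (Or \<phi> \<psi>)
  from Or.prems show ?case by (auto intro!: Or.IH)
next
  case (Neg \<phi>)
  from Neg.prems show ?case by (auto intro!: Neg.IH)
qed auto

lemma free_for_single_fresh: "v \<notin> vars \<phi> \<Longrightarrow> free_for (single x (Var v)) \<phi>"
  by (rule free_for_bvs) (auto simp: vars_eq split: if_splits)

lemma single_dep_subst [simp]: "single_dep (subst_fm \<theta> \<phi>) = single_dep \<phi>"
  by (induction \<phi> arbitrary: \<theta>) auto

lemma quantifier_free_subst [simp]: "quantifier_free (subst_fm \<theta> \<phi>) = quantifier_free \<phi>"
  by (induction \<phi> arbitrary: \<theta>) auto

lemma wf_tm_subst: "wf_tm L t \<Longrightarrow> (\<And>x. x \<in> Fvt t \<Longrightarrow> wf_tm L (\<theta> x)) \<Longrightarrow> wf_tm L (subst_tm \<theta> t)"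
  by (induction t) auto

lemma D_formula_subst:
  "D_formula L \<phi> \<Longrightarrow> (\<And>x. x \<in> Fv \<phi> \<Longrightarrow> wf_tm L (\<theta> x)) \<Longrightarrow> D_formula L (subst_fm \<theta> \<phi>)"
proof (induction \<phi> arbitrary: \<theta>)
  case (Ex x \<phi>)
  have "D_formula L (subst_fm (\<theta>(x := Var x)) \<phi>)"
    by (rule Ex.IH) (use Ex.prems in auto)
  then show ?case by simp
next
  case (All x \<phi>)
  have "D_formula L (subst_fm (\<theta>(x := Var x)) \<phi>)"
    by (rule All.IH) (use All.prems in auto)
  then show ?case by simp
qed (auto intro!: wf_tm_subst)

lemma first_order_single_dep: "first_order \<phi> \<Longrightarrow> single_dep \<phi>"
  by (induction \<phi>) auto

lemma KV_first_order: "first_order \<phi> \<Longrightarrow> KV_formula L \<phi> \<longleftrightarrow> D_formula L \<phi>"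
  by (simp add: KV_formula_def first_order_single_dep)

lemma KV_simps [simp]:
  "KV_formula L (Eq t u) \<longleftrightarrow> wf_tm L t \<and> wf_tm L u"
  "KV_formula L (Neg \<phi>) \<longleftrightarrow> first_order \<phi> \<and> KV_formula L \<phi>"
  "KV_formula L (And \<phi> \<psi>) \<longleftrightarrow> KV_formula L \<phi> \<and> KV_formula L \<psi>"
  "KV_formula L (Or \<phi> \<psi>) \<longleftrightarrow> KV_formula L \<phi> \<and> KV_formula L \<psi>"
  "KV_formula L (Ex x \<phi>) \<longleftrightarrow> KV_formula L \<phi>"
  "KV_formula L (All x \<phi>) \<longleftrightarrow> KV_formula L \<phi>"
  by (auto simp: KV_formula_def)

lemma KV_subst:
  "KV_formula L \<phi> \<Longrightarrow> (\<And>x. x \<in> Fv \<phi> \<Longrightarrow> wf_tm L (\<theta> x)) \<Longrightarrow> KV_formula L (subst_fm \<theta> \<phi>)"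
  by (simp add: KV_formula_def D_formula_subst)

lemma falsum_simps [simp]:
  "first_order falsum" "KV_formula L falsum" "Fv falsum = {}" "fsat M e falsum \<longleftrightarrow> False"
  by (auto simp: falsum_def)

section \<open>Derived rules of the calculus\<close>

text \<open>The type arguments are parameters because the locale fixes no term from which the type of the
  variables could be inferred.\<close>

locale dep_logic =
  fixes L :: "('f, 'p) vocab" and V :: "'v itself"
  assumes inf: "infinite (UNIV :: 'v set)"
begin

abbreviation der :: "('f, 'p, 'v) fm set \<Rightarrow> ('f, 'p, 'v) fm \<Rightarrow> bool" (infix "\<turnstile>" 50) where
  "\<Gamma> \<turnstile> \<phi> \<equiv> derives L \<Gamma> \<phi>"

abbreviation KV :: "('f, 'p, 'v) fm \<Rightarrow> bool" where
  "KV \<equiv> KV_formula L"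

lemma fresh: "finite (A :: 'v set) \<Longrightarrow> \<exists>v. v \<notin> A"
  using ex_new_if_finite inf by blast

lemma fresh_list: "finite (A :: 'v set) \<Longrightarrow> \<exists>vs. length vs = n \<and> distinct vs \<and> set vs \<inter> A = {}"
proof (induction n)
  case (Suc n)
  then obtain vs where vs: "length vs = n" "distinct vs" "set vs \<inter> A = {}" by auto
  obtain v where "v \<notin> A \<union> set vs" using fresh[of "A \<union> set vs"] Suc.prems by auto
  then show ?case using vs by (intro HOL.exI[of _ "v # vs"]) auto
qed simp

text \<open>Cut for arbitrary formulas: the implication \<open>\<phi> \<rightarrow> \<psi>\<close> is not a formula if \<open>\<phi>\<close> is not
  first-order, but \<open>\<phi>\<close> may be replaced by \<open>\<exists>x \<phi>\<close> with a vacuous quantifier, and the elimination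
  rule for it discharges the assumption \<open>\<phi>\<close>. Finiteness of \<open>\<Gamma>\<close> provides the parameter of this
  rule.\<close>

lemma cut:
  assumes "\<Gamma> \<turnstile> \<phi>" "insert \<phi> \<Gamma> \<turnstile> \<psi>" "finite \<Gamma>" "KV \<phi>"
  shows "\<Gamma> \<turnstile> \<psi>"
proof -
  obtain x where x: "x \<notin> vars \<phi>" using fresh[of "vars \<phi>"] by auto
  then have xF: "x \<notin> Fv \<phi>" using Fv_vars[of \<phi>] by blast
  obtain v where v: "v \<notin> Fvs \<Gamma> \<union> vars \<phi> \<union> Fv \<psi>"
    using fresh[of "Fvs \<Gamma> \<union> vars \<phi> \<union> Fv \<psi>"] assms(3) by auto
  have "\<Gamma> \<turnstile> Ex x \<phi>"
    by (rule derives.exI[where t = "Var x"]) (use assms in auto)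
  then show ?thesis
  proof (rule derives.exE)
    show "insert (subst_fm (single x (Var v)) \<phi>) \<Gamma> \<turnstile> \<psi>"
      using assms(2) xF by (simp add: subst_fm_single_idle)
    show "free_for (single x (Var v)) \<phi>" using v by (intro free_for_single_fresh) auto
    show "v \<notin> Fvs \<Gamma> \<union> Fv \<phi> \<union> Fv \<psi>" using v Fv_vars[of \<phi>] by auto
  qed
qed

lemma cuts:
  assumes "finite \<Delta>" "\<And>\<delta>. \<delta> \<in> \<Delta> \<Longrightarrow> \<Gamma> \<turnstile> \<delta>" "\<Delta> \<turnstile> \<psi>" "finite \<Gamma>"
    "\<And>\<delta>. \<delta> \<in> \<Delta> \<union> \<Gamma> \<Longrightarrow> KV \<delta>"
  shows "\<Gamma> \<turnstile> \<psi>"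
proof -
  have "\<Delta> \<union> \<Gamma> \<turnstile> \<psi>" by (rule derives.weaken[OF assms(3)]) (use assms in auto)
  with assms(1,2,5) show ?thesis
  proof (induction \<Delta> rule: finite_induct)
    case (insert \<delta> \<Delta>)
    have "\<Delta> \<union> \<Gamma> \<turnstile> \<delta>" by (rule derives.weaken[where \<Gamma> = \<Gamma>]) (use insert in auto)
    then have "\<Delta> \<union> \<Gamma> \<turnstile> \<psi>" by (rule cut) (use insert assms(4) in auto)
    then show ?case using insert by auto
  qed simp
qed

lemma ax: "\<phi> \<in> \<Gamma> \<Longrightarrow> (\<And>\<gamma>. \<gamma> \<in> \<Gamma> \<Longrightarrow> KV \<gamma>) \<Longrightarrow> \<Gamma> \<turnstile> \<phi>"
  by (rule derives.assm) auto

lemma ax1: "KV \<phi> \<Longrightarrow> {\<phi>} \<turnstile> \<phi>"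
  by (rule ax) auto

lemma eq_sym:
  assumes "\<Gamma> \<turnstile> Eq t u" "wf_tm L t" "\<And>\<gamma>. \<gamma> \<in> \<Gamma> \<Longrightarrow> KV \<gamma>"
  shows "\<Gamma> \<turnstile> Eq u t"
proof -
  obtain x where x: "x \<notin> Fvt t" using fresh[of "Fvt t"] by auto
  have "\<Gamma> \<turnstile> subst_fm (single x t) (Eq (Var x) t)"
    using x assms by (auto simp: subst_tm_single_idle intro!: derives.eq_refl)
  then have "\<Gamma> \<turnstile> subst_fm (single x u) (Eq (Var x) t)"
    by (rule derives.eq_subst[OF assms(1)]) auto
  then show ?thesis using x by (simp add: subst_tm_single_idle)
qed

lemma eq_trans:
  assumes "\<Gamma> \<turnstile> Eq t u" "\<Gamma> \<turnstile> Eq u r"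
  shows "\<Gamma> \<turnstile> Eq t r"
proof -
  obtain x where x: "x \<notin> Fvt t" using fresh[of "Fvt t"] by auto
  have "\<Gamma> \<turnstile> subst_fm (single x u) (Eq t (Var x))"
    using x assms by (auto simp: subst_tm_single_idle)
  then have "\<Gamma> \<turnstile> subst_fm (single x r) (Eq t (Var x))"
    by (rule derives.eq_subst[OF assms(2)]) auto
  then show ?thesis using x by (simp add: subst_tm_single_idle)
qed

text \<open>The elimination rule does not allow the bound variable \<open>x\<close> as its parameter when \<open>x\<close> is free in
  \<open>\<phi>\<close>. So \<open>\<phi>(v/x)\<close> is assumed for a fresh \<open>v\<close>. Now \<open>x\<close> is free in none of the assumptions and can
  be the parameter for \<open>\<exists>w (w = v)\<close>, which gives \<open>x = v\<close> and thereby \<open>\<phi>\<close>.\<close>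

lemma ex_elim:
  assumes "insert \<phi> \<Gamma> \<turnstile> \<psi>" "x \<notin> Fvs \<Gamma>" "x \<notin> Fv \<psi>" "finite \<Gamma>"
    and KV: "\<And>\<gamma>. \<gamma> \<in> insert \<phi> \<Gamma> \<Longrightarrow> KV \<gamma>"
  shows "insert (Ex x \<phi>) \<Gamma> \<turnstile> \<psi>"
proof -
  let ?\<Gamma> = "insert (Ex x \<phi>) \<Gamma>"
  have "finite (Fvs ?\<Gamma> \<union> vars \<phi> \<union> Fv \<psi> \<union> {x})" using assms(4) by simp
  from fresh[OF this] obtain v where v: "v \<notin> Fvs ?\<Gamma> \<union> vars \<phi> \<union> Fv \<psi> \<union> {x}" by blast
  obtain w where w: "w \<noteq> v" "w \<noteq> x" using fresh[of "{v, x}"] by auto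
  let ?\<phi> = "subst_fm (single x (Var v)) \<phi>"
  let ?\<Delta> = "insert ?\<phi> ?\<Gamma>"
  have ff: "free_for (single x (Var v)) \<phi>" using v by (intro free_for_single_fresh) auto
  have KV1: "\<And>\<gamma>. \<gamma> \<in> ?\<Delta> \<Longrightarrow> KV \<gamma>" using KV by (auto intro!: KV_subst)
  have xF: "x \<notin> Fvs ?\<Delta>" using assms(2) v by (simp add: Fv_subst[OF ff]) metis
  have "?\<Delta> \<turnstile> Ex w (Eq (Var w) (Var v))"
    by (rule derives.exI[where t = "Var v"]) (use w KV1 in \<open>auto intro!: eq_refl\<close>)
  then have d: "?\<Delta> \<turnstile> \<psi>"
  proof (rule derives.exE[where v = x])
    let ?\<Theta> = "insert (subst_fm (single w (Var x)) (Eq (Var w) (Var v))) ?\<Delta>"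
    have e: "subst_fm (single w (Var x)) (Eq (Var w) (Var v)) = Eq (Var x) (Var v)"
      using w by simp
    have KV2: "KV \<gamma>" if "\<gamma> \<in> ?\<Theta>" for \<gamma>
      using that KV1[of \<gamma>] unfolding e by (elim insertE) simp_all
    have m: "Eq (Var x) (Var v) \<in> ?\<Theta>" "?\<phi> \<in> ?\<Theta>" unfolding e by (rule insertI1, simp)
    have "?\<Theta> \<turnstile> Eq (Var x) (Var v)" by (rule ax[OF m(1) KV2])
    then have "?\<Theta> \<turnstile> Eq (Var v) (Var x)" by (rule eq_sym[OF _ _ KV2]) simp
    moreover have "?\<Theta> \<turnstile> ?\<phi>" by (rule ax[OF m(2) KV2])
    ultimately have "?\<Theta> \<turnstile> subst_fm (single x (Var x)) \<phi>"
      by (rule derives.eq_subst[OF _ _ ff]) simp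
    then have *: "?\<Theta> \<turnstile> \<phi>" by simp
    have "KV \<gamma>" if "\<gamma> \<in> insert \<phi> ?\<Theta>" for \<gamma> using that KV[of \<phi>] KV2[of \<gamma>] by blast
    then have "insert \<phi> ?\<Theta> \<turnstile> \<psi>" by (intro derives.weaken[OF assms(1)]) blast+
    then show "?\<Theta> \<turnstile> \<psi>" by (rule cut[OF *]) (use assms(4) KV[of \<phi>] in simp_all)
    show "x \<notin> Fvs ?\<Delta> \<union> Fv (Eq (Var w) (Var v)) \<union> Fv \<psi>" using xF w v assms(3) by auto
  qed auto
  have e: "?\<Gamma> \<turnstile> Ex x \<phi>" using KV by (intro ax) auto
  have f: "v \<notin> Fvs ?\<Gamma> \<union> Fv \<phi> \<union> Fv \<psi>" using v Fv_vars[of \<phi>] by blast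
  show ?thesis by (rule derives.exE[OF e d ff f])
qed

lemma all_elim_self: "\<Gamma> \<turnstile> All x \<phi> \<Longrightarrow> \<Gamma> \<turnstile> \<phi>"
  using derives.allE[of L \<Gamma> x \<phi> "Var x"] by simp

lemma ex_intro_self: "\<Gamma> \<turnstile> \<phi> \<Longrightarrow> KV \<phi> \<Longrightarrow> \<Gamma> \<turnstile> Ex x \<phi>"
  using derives.exI[of L \<Gamma> x "Var x" \<phi>] by simp

text \<open>With one premise and one conclusion, derivability is a preorder for which conjunction,
  disjunction and the quantifiers are monotone. Including \<open>KV\<close> of both sides keeps side conditions out of the
  chains of steps below.\<close>

definition pv :: "('f, 'p, 'v) fm \<Rightarrow> ('f, 'p, 'v) fm \<Rightarrow> bool" where
  "pv \<phi> \<psi> \<longleftrightarrow> {\<phi>} \<turnstile> \<psi> \<and> KV \<phi> \<and> KV \<psi>"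

lemma pv_KV: "pv \<phi> \<psi> \<Longrightarrow> KV \<phi>" "pv \<phi> \<psi> \<Longrightarrow> KV \<psi>"
  by (auto simp: pv_def)

lemma pv_refl: "KV \<phi> \<Longrightarrow> pv \<phi> \<phi>"
  by (simp add: pv_def ax1)

lemma pv_der: "pv \<phi> \<psi> \<Longrightarrow> \<Gamma> \<turnstile> \<phi> \<Longrightarrow> finite \<Gamma> \<Longrightarrow> (\<And>\<gamma>. \<gamma> \<in> \<Gamma> \<Longrightarrow> KV \<gamma>) \<Longrightarrow> \<Gamma> \<turnstile> \<psi>"
  by (rule cuts[of "{\<phi>}"]) (auto simp: pv_def)

lemma pv_trans: "pv \<phi> \<psi> \<Longrightarrow> pv \<psi> \<chi> \<Longrightarrow> pv \<phi> \<chi>"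
  unfolding pv_def using pv_der[of \<psi> \<chi> "{\<phi>}"] by (simp add: pv_def)

lemma pv_andI: "pv \<phi> \<psi> \<Longrightarrow> pv \<phi> \<chi> \<Longrightarrow> pv \<phi> (And \<psi> \<chi>)"
  unfolding pv_def using derives.andI[of L "{\<phi>}" \<psi> \<chi>] by simp

lemma pv_and1: "KV \<phi> \<Longrightarrow> KV \<psi> \<Longrightarrow> pv (And \<phi> \<psi>) \<phi>"
  unfolding pv_def using derives.andE1[OF ax1[of "And \<phi> \<psi>"]] by simp

lemma pv_and2: "KV \<phi> \<Longrightarrow> KV \<psi> \<Longrightarrow> pv (And \<phi> \<psi>) \<psi>"
  unfolding pv_def using derives.andE2[OF ax1[of "And \<phi> \<psi>"]] by simp

lemma pv_and_mono: "pv \<phi> \<phi>' \<Longrightarrow> pv \<psi> \<psi>' \<Longrightarrow> pv (And \<phi> \<psi>) (And \<phi>' \<psi>')"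
  by (meson pv_KV pv_and1 pv_and2 pv_andI pv_trans)

lemma pv_or_comm: "KV \<phi> \<Longrightarrow> KV \<psi> \<Longrightarrow> pv (Or \<phi> \<psi>) (Or \<psi> \<phi>)"
  unfolding pv_def using derives.or_comm[OF ax1[of "Or \<phi> \<psi>"]] by simp

lemma pv_or_mono1: "pv \<phi> \<phi>' \<Longrightarrow> KV \<psi> \<Longrightarrow> pv (Or \<phi> \<psi>) (Or \<phi>' \<psi>)"
proof -
  assume a: "pv \<phi> \<phi>'" and b: "KV \<psi>"
  have "insert \<phi> {Or \<phi> \<psi>} \<turnstile> \<phi>'"
    by (rule derives.weaken[of L "{\<phi>}"]) (use a b in \<open>auto simp: pv_def\<close>)
  moreover have "{Or \<phi> \<psi>} \<turnstile> Or \<phi> \<psi>" by (rule ax1) (use a b in \<open>auto simp: pv_def\<close>)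
  ultimately have "{Or \<phi> \<psi>} \<turnstile> Or \<phi>' \<psi>" by (rule derives.or_subst[rotated])
  then show ?thesis using a b by (simp add: pv_def)
qed

lemma pv_or_mono: "pv \<phi> \<phi>' \<Longrightarrow> pv \<psi> \<psi>' \<Longrightarrow> pv (Or \<phi> \<psi>) (Or \<phi>' \<psi>')"
  by (meson pv_KV pv_or_comm pv_or_mono1 pv_trans)

lemma pv_ex_mono: "pv \<phi> \<phi>' \<Longrightarrow> pv (Ex x \<phi>) (Ex x \<phi>')"
proof -
  assume a: "pv \<phi> \<phi>'"
  then have "{\<phi>} \<turnstile> Ex x \<phi>'" by (intro ex_intro_self) (simp_all add: pv_def)
  then have "{Ex x \<phi>} \<turnstile> Ex x \<phi>'" by (rule ex_elim) (use a in \<open>simp_all add: pv_def\<close>)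
  then show ?thesis using a by (simp add: pv_def)
qed

lemma pv_all_mono: "pv \<phi> \<phi>' \<Longrightarrow> pv (All x \<phi>) (All x \<phi>')"
proof -
  assume a: "pv \<phi> \<phi>'"
  have "{All x \<phi>} \<turnstile> \<phi>" using a all_elim_self[OF ax1[of "All x \<phi>"]] by (simp add: pv_def)
  then have "{All x \<phi>} \<turnstile> \<phi>'" by (rule pv_der[OF a]) (use a in \<open>auto simp: pv_def\<close>)
  then show ?thesis using a derives.allI[of L "{All x \<phi>}" \<phi>' x] by (simp add: pv_def)
qed

lemma pv_ex_intro: "KV \<phi> \<Longrightarrow> pv \<phi> (Ex x \<phi>)"
  unfolding pv_def using ex_intro_self[OF ax1] by simp

lemma pv_all_elim: "KV \<phi> \<Longrightarrow> pv (All x \<phi>) \<phi>"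
  unfolding pv_def using all_elim_self[OF ax1[of "All x \<phi>"]] by simp

lemma pv_all_intro: "pv \<phi> \<psi> \<Longrightarrow> x \<notin> Fv \<phi> \<Longrightarrow> pv \<phi> (All x \<psi>)"
  unfolding pv_def using derives.allI[of L "{\<phi>}" \<psi> x] by simp

lemma pv_cut2:
  assumes "{\<phi>, \<psi>} \<turnstile> \<chi>" "pv \<theta> \<phi>" "pv \<theta> \<psi>" "KV \<chi>"
  shows "pv \<theta> \<chi>"
proof -
  have "{\<theta>} \<turnstile> \<chi>"
  proof (rule cuts[OF _ _ assms(1)])
    show "{\<theta>} \<turnstile> \<delta>" if "\<delta> \<in> {\<phi>, \<psi>}" for \<delta> using that assms(2,3) unfolding pv_def by blast
    show "KV \<delta>" if "\<delta> \<in> {\<phi>, \<psi>} \<union> {\<theta>}" for \<delta> using that assms(2,3) unfolding pv_def by blast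
  qed simp_all
  then show ?thesis using assms by (simp add: pv_def)
qed

lemma pv_Ex_and: "KV \<phi> \<Longrightarrow> KV \<psi> \<Longrightarrow> x \<notin> Fv \<psi> \<Longrightarrow> pv (And (Ex x \<phi>) \<psi>) (Ex x (And \<phi> \<psi>))"
proof -
  assume a: "KV \<phi>" "KV \<psi>" "x \<notin> Fv \<psi>"
  have "{\<phi>, \<psi>} \<turnstile> And \<phi> \<psi>" using a by (intro derives.andI ax) auto
  then have "{\<phi>, \<psi>} \<turnstile> Ex x (And \<phi> \<psi>)" using a by (intro ex_intro_self) auto
  then have "{Ex x \<phi>, \<psi>} \<turnstile> Ex x (And \<phi> \<psi>)" using a by (intro ex_elim) auto
  then show ?thesis
    by (rule pv_cut2) (use a in \<open>simp_all add: pv_and1 pv_and2\<close>)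
qed

lemma pv_All_and: "KV \<phi> \<Longrightarrow> KV \<psi> \<Longrightarrow> x \<notin> Fv \<psi> \<Longrightarrow> pv (And (All x \<phi>) \<psi>) (All x (And \<phi> \<psi>))"
  by (intro pv_all_intro pv_and_mono pv_all_elim pv_refl) auto

end

section \<open>Completeness for first-order formulas\<close>

subsection \<open>Conjunctions and blocks of quantifiers\<close>

lemma Conj_simps:
  "KV_formula L (Conj \<phi>s) \<longleftrightarrow> (\<forall>\<phi> \<in> set \<phi>s. KV_formula L \<phi>)"
  "first_order (Conj \<phi>s) \<longleftrightarrow> (\<forall>\<phi> \<in> set \<phi>s. first_order \<phi>)"
  "quantifier_free (Conj (\<phi> # \<phi>s)) \<longleftrightarrow> (\<forall>\<psi> \<in> set (\<phi> # \<phi>s). quantifier_free \<psi>)"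
  "fsat M e (Conj \<phi>s) \<longleftrightarrow> (\<forall>\<phi> \<in> set \<phi>s. fsat M e \<phi>)"
  "sat M X (Conj \<phi>s) \<longleftrightarrow> (\<forall>\<phi> \<in> set \<phi>s. sat M X \<phi>)"
  "Fv (Conj \<phi>s) = (\<Union>\<phi> \<in> set \<phi>s. Fv \<phi>)"
proof -
  have [simp]: "sat M X (Neg falsum)" by (subst flat) auto
  show "KV_formula L (Conj \<phi>s) \<longleftrightarrow> (\<forall>\<phi> \<in> set \<phi>s. KV_formula L \<phi>)"
    "first_order (Conj \<phi>s) \<longleftrightarrow> (\<forall>\<phi> \<in> set \<phi>s. first_order \<phi>)"
    "fsat M e (Conj \<phi>s) \<longleftrightarrow> (\<forall>\<phi> \<in> set \<phi>s. fsat M e \<phi>)"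
    "Fv (Conj \<phi>s) = (\<Union>\<phi> \<in> set \<phi>s. Fv \<phi>)"
    by (induction \<phi>s rule: Conj.induct) simp_all
  show "sat M X (Conj \<phi>s) \<longleftrightarrow> (\<forall>\<phi> \<in> set \<phi>s. sat M X \<phi>)"
    by (induction \<phi>s rule: Conj.induct) (simp_all del: sat.simps(4))
  show "quantifier_free (Conj (\<phi> # \<phi>s)) \<longleftrightarrow> (\<forall>\<psi> \<in> set (\<phi> # \<phi>s). quantifier_free \<psi>)"
    by (induction \<phi>s arbitrary: \<phi>) simp_all
qed

lemma Exs_simps [simp]: "Exs [] \<phi> = \<phi>" "Exs (x # xs) \<phi> = Ex x (Exs xs \<phi>)"
  by (simp_all add: Exs_def)

lemma Alls_simps [simp]: "Alls [] \<phi> = \<phi>" "Alls (x # xs) \<phi> = All x (Alls xs \<phi>)"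
  by (simp_all add: Alls_def)

lemma Exs_props [simp]:
  "KV_formula L (Exs xs \<phi>) = KV_formula L \<phi>" "first_order (Exs xs \<phi>) = first_order \<phi>"
  "Fv (Exs xs \<phi>) = Fv \<phi> - set xs"
  by (induction xs) auto

lemma Alls_props [simp]:
  "KV_formula L (Alls xs \<phi>) = KV_formula L \<phi>" "first_order (Alls xs \<phi>) = first_order \<phi>"
  "Fv (Alls xs \<phi>) = Fv \<phi> - set xs"
  by (induction xs) auto

subsection \<open>Subformulas and subterms\<close>

primrec sub :: "('f, 'p, 'v) fm \<Rightarrow> ('f, 'p, 'v) fm set" where
  "sub (Eq t u) = {Eq t u}"
| "sub (Rel p ts) = {Rel p ts}"
| "sub (Dep ts us) = {Dep ts us}"
| "sub (Neg \<phi>) = insert (Neg \<phi>) (sub \<phi>)"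
| "sub (And \<phi> \<psi>) = insert (And \<phi> \<psi>) (sub \<phi> \<union> sub \<psi>)"
| "sub (Or \<phi> \<psi>) = insert (Or \<phi> \<psi>) (sub \<phi> \<union> sub \<psi>)"
| "sub (Ex x \<phi>) = insert (Ex x \<phi>) (sub \<phi>)"
| "sub (All x \<phi>) = insert (All x \<phi>) (sub \<phi>)"

primrec subt :: "('f, 'v) tm \<Rightarrow> ('f, 'v) tm set" where
  "subt (Var x) = {Var x}"
| "subt (Fn f ts) = insert (Fn f ts) (\<Union> (set (map subt ts)))"

primrec tms :: "('f, 'p, 'v) fm \<Rightarrow> ('f, 'v) tm set" where
  "tms (Eq t u) = subt t \<union> subt u"
| "tms (Rel p ts) = (\<Union>t \<in> set ts. subt t)"
| "tms (Dep ts us) = {}"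
| "tms (Neg \<phi>) = tms \<phi>"
| "tms (And \<phi> \<psi>) = tms \<phi> \<union> tms \<psi>"
| "tms (Or \<phi> \<psi>) = tms \<phi> \<union> tms \<psi>"
| "tms (Ex x \<phi>) = tms \<phi>"
| "tms (All x \<phi>) = tms \<phi>"

lemma finite_sub: "finite (sub \<phi>)" by (induction \<phi>) auto

lemma finite_subt: "finite (subt t)" by (induction t) auto

lemma finite_tms: "finite (tms \<phi>)" by (induction \<phi>) (auto simp: finite_subt)

lemma sub_self: "\<phi> \<in> sub \<phi>" by (cases \<phi>) auto

lemma subt_self: "t \<in> subt t" by (cases t) auto

lemma sub_props:
  "\<psi> \<in> sub \<phi> \<Longrightarrow> (first_order \<phi> \<longrightarrow> first_order \<psi>) \<and> (KV_formula L \<phi> \<longrightarrow> KV_formula L \<psi>) \<and> vars \<psi> \<subseteq> vars \<phi>"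
  by (induction \<phi>) auto

lemma subt_props: "s \<in> subt t \<Longrightarrow> (wf_tm L t \<longrightarrow> wf_tm L s) \<and> Fvt s \<subseteq> Fvt t"
  by (induction t) fastforce+

lemma KV_Rel: "KV_formula L (Rel p ts) \<longleftrightarrow> rel_ar L p = Some (length ts) \<and> (\<forall>t \<in> set ts. wf_tm L t)"
  by (simp add: KV_formula_def)

lemma tms_props: "s \<in> tms \<phi> \<Longrightarrow> (KV_formula L \<phi> \<longrightarrow> wf_tm L s) \<and> Fvt s \<subseteq> vars \<phi>"
proof (induction \<phi>)
  case (Eq t u)
  then show ?case using subt_props[of s t L] subt_props[of s u L] by auto
next
  case (Rel p ts)
  then obtain t where "t \<in> set ts" "s \<in> subt t" by auto
  then show ?case using subt_props[of s t L] by (auto simp: KV_Rel)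
qed auto

subsection \<open>Quotients of interpreted names\<close>

text \<open>The kernel of \<open>i\<close> is going to be provable equality of parameters in one case, and equality of
  names on a set of an ultrafilter in the other.\<close>

lemma quotient_model:
  fixes i :: "'d \<Rightarrow> 'u" and F :: "'f \<Rightarrow> 'd list \<Rightarrow> 'd" and R :: "'p \<Rightarrow> 'd list \<Rightarrow> bool"
  assumes F: "\<And>f ds ds'. map i ds = map i ds' \<Longrightarrow> i (F f ds) = i (F f ds')"
    and R: "\<And>p ds ds'. map i ds = map i ds' \<Longrightarrow> R p ds \<Longrightarrow> R p ds'"
  obtains M :: "('f, 'p, 'u) model" where "univ M = range i"
    "\<And>f ds. fint M f (map i ds) = i (F f ds)" "\<And>p ds. map i ds \<in> rint M p \<longleftrightarrow> R p ds"
proof -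
  define M where "M = \<lparr>univ = range i, fint = \<lambda>f as. i (F f (map (inv i) as)),
    rint = \<lambda>p. {map i ds | ds. R p ds}\<rparr>"
  show ?thesis
  proof (rule that)
    show "univ M = range i" by (simp add: M_def)
    show "fint M f (map i ds) = i (F f ds)" for f ds
    proof -
      have "map i (map (inv i) (map i ds)) = map i ds"
        unfolding list.map_comp by (rule map_cong) (auto simp: f_inv_into_f)
      then have "i (F f (map (inv i) (map i ds))) = i (F f ds)" by (rule F)
      then show ?thesis by (simp add: M_def)
    qed
    show "map i ds \<in> rint M p \<longleftrightarrow> R p ds" for p ds
    proof
      assume "map i ds \<in> rint M p"
      then obtain ds' where "map i ds = map i ds'" "R p ds'" unfolding M_def by auto
      then show "R p ds" using R[of ds' ds p] by simp
    qed (auto simp: M_def)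
  qed
qed

text \<open>Models that may have a single element. The calculus has no rule that obviously expresses the
  existence of two elements, so completeness is first shown for these models.\<close>

definition closed_model :: "('f, 'p) vocab \<Rightarrow> ('f, 'p, 'u) model \<Rightarrow> bool" where
  "closed_model L M \<longleftrightarrow> univ M \<noteq> {} \<and>
     (\<forall>f n as. fun_ar L f = Some n \<and> length as = n \<and> set as \<subseteq> univ M \<longrightarrow> fint M f as \<in> univ M)"

lemma quotient_closed:
  assumes "univ M = range i" "\<And>f ds. fint M f (map i ds) = i (F f ds)"
  shows "closed_model L M"
  unfolding closed_model_def
proof (intro conjI HOL.allI impI)
  fix f n as assume "fun_ar L f = Some n \<and> length as = n \<and> set as \<subseteq> univ M"
  then obtain ds where "as = map i ds" using assms(1) ex_map_conv[of as i] by blast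
  then show "fint M f as \<in> univ M" using assms by simp
qed (use assms in simp)

context dep_logic
begin

subsection \<open>Theories\<close>

text \<open>Derivations from infinite sets, by finite subsets. With an infinite set of assumptions there
  may be no fresh variable, so that cut would not be available.\<close>

definition derivable :: "('f, 'p, 'v) fm set \<Rightarrow> ('f, 'p, 'v) fm \<Rightarrow> bool" where
  "derivable T \<psi> \<longleftrightarrow> (\<exists>\<Delta>. finite \<Delta> \<and> \<Delta> \<subseteq> T \<and> \<Delta> \<turnstile> \<psi>)"

lemma derivable_common:
  assumes "finite \<Theta>" "\<And>\<theta>. \<theta> \<in> \<Theta> \<Longrightarrow> derivable T \<theta>" "\<And>\<gamma>. \<gamma> \<in> T \<Longrightarrow> KV \<gamma>"
  shows "\<exists>\<Delta>. finite \<Delta> \<and> \<Delta> \<subseteq> T \<and> (\<forall>\<theta> \<in> \<Theta>. \<Delta> \<turnstile> \<theta>)"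
  using assms(1,2)
proof (induction \<Theta> rule: finite_induct)
  case (insert \<theta> \<Theta>)
  from insert obtain \<Delta> where D: "finite \<Delta>" "\<Delta> \<subseteq> T" "\<forall>\<theta> \<in> \<Theta>. \<Delta> \<turnstile> \<theta>" by auto
  from insert.prems[of \<theta>] obtain \<Delta>' where D': "finite \<Delta>'" "\<Delta>' \<subseteq> T" "\<Delta>' \<turnstile> \<theta>"
    by (auto simp: derivable_def)
  have KV: "\<forall>\<gamma> \<in> \<Delta> \<union> \<Delta>'. KV \<gamma>" using D D' assms(3) by blast
  have "\<Delta> \<union> \<Delta>' \<turnstile> \<theta>" by (rule derives.weaken[OF D'(3) _ KV]) simp
  moreover have "\<Delta> \<union> \<Delta>' \<turnstile> \<chi>" if "\<chi> \<in> \<Theta>" for \<chi>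
    by (rule derives.weaken[OF _ _ KV, of \<Delta>]) (use D that in auto)
  ultimately have "\<forall>\<chi> \<in> insert \<theta> \<Theta>. \<Delta> \<union> \<Delta>' \<turnstile> \<chi>" by simp
  then show ?case using D D' by (intro HOL.exI[of _ "\<Delta> \<union> \<Delta>'"]) simp
qed auto

lemma derivable_rule:
  assumes "finite \<Theta>" "\<And>\<theta>. \<theta> \<in> \<Theta> \<Longrightarrow> derivable T \<theta>" "\<And>\<gamma>. \<gamma> \<in> T \<Longrightarrow> KV \<gamma>"
    and "\<And>\<Delta>. finite \<Delta> \<Longrightarrow> (\<And>\<delta>. \<delta> \<in> \<Delta> \<Longrightarrow> KV \<delta>) \<Longrightarrow> (\<And>\<theta>. \<theta> \<in> \<Theta> \<Longrightarrow> \<Delta> \<turnstile> \<theta>) \<Longrightarrow> \<Delta> \<turnstile> \<psi>"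
  shows "derivable T \<psi>"
proof -
  obtain \<Delta> where D: "finite \<Delta>" "\<Delta> \<subseteq> T" "\<forall>\<theta> \<in> \<Theta>. \<Delta> \<turnstile> \<theta>" using derivable_common[OF assms(1-3)] by blast
  have "\<Delta> \<turnstile> \<psi>" by (rule assms(4)[OF D(1)]) (use D assms(3) in blast)+
  then show ?thesis unfolding derivable_def using D by blast
qed

text \<open>The arguments are replaced one after the other; \<open>as\<close> collects those that are done.\<close>

lemma fn_cong:
  assumes "list_all2 (\<lambda>t u. \<Gamma> \<turnstile> Eq t u) ts us" "\<Gamma> \<turnstile> Eq s (Fn f (as @ ts))"
  shows "\<Gamma> \<turnstile> Eq s (Fn f (as @ us))"
  using assms
proof (induction ts us arbitrary: as rule: list_all2_induct)
  case (Cons t ts u us)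
  have "finite (Fvt s \<union> (\<Union>r \<in> set (as @ ts). Fvt r))" by simp
  from fresh[OF this] obtain x where x: "x \<notin> Fvt s" "\<forall>r \<in> set (as @ ts). x \<notin> Fvt r" by auto
  have *: "subst_fm (single x r) (Eq s (Fn f (as @ Var x # ts))) = Eq s (Fn f (as @ r # ts))" for r
    using x by (simp add: subst_tm_single_idle map_idI)
  have "\<Gamma> \<turnstile> subst_fm (single x u) (Eq s (Fn f (as @ Var x # ts)))"
    by (rule derives.eq_subst[OF Cons.hyps(1)]) (use Cons.prems in \<open>simp_all only: * free_for.simps\<close>)
  then have "\<Gamma> \<turnstile> Eq s (Fn f ((as @ [u]) @ ts))" by (simp only: * append.simps append_assoc)
  from Cons.IH[OF this] show ?case by simp
qed simp

lemma rel_cong: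
  assumes "list_all2 (\<lambda>t u. \<Gamma> \<turnstile> Eq t u) ts us" "\<Gamma> \<turnstile> Rel p (as @ ts)"
  shows "\<Gamma> \<turnstile> Rel p (as @ us)"
  using assms
proof (induction ts us arbitrary: as rule: list_all2_induct)
  case (Cons t ts u us)
  have "finite (\<Union>r \<in> set (as @ ts). Fvt r)" by simp
  from fresh[OF this] obtain x where x: "\<forall>r \<in> set (as @ ts). x \<notin> Fvt r" by auto
  have *: "subst_fm (single x r) (Rel p (as @ Var x # ts)) = Rel p (as @ r # ts)" for r
    using x by (simp add: subst_tm_single_idle map_idI)
  have "\<Gamma> \<turnstile> subst_fm (single x u) (Rel p (as @ Var x # ts))"
    by (rule derives.eq_subst[OF Cons.hyps(1)]) (use Cons.prems in \<open>simp_all only: * free_for.simps\<close>)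
  then have "\<Gamma> \<turnstile> Rel p ((as @ [u]) @ ts)" by (simp only: * append.simps append_assoc)
  from Cons.IH[OF this] show ?case by simp
qed simp

lemma neg_falsum: "(\<And>\<gamma>. \<gamma> \<in> \<Gamma> \<Longrightarrow> KV \<gamma>) \<Longrightarrow> \<Gamma> \<turnstile> Neg falsum"
  by (rule derives.negI[OF ax]) auto

lemma der_Conj:
  "(\<And>\<phi>. \<phi> \<in> set \<phi>s \<Longrightarrow> \<Gamma> \<turnstile> \<phi>) \<Longrightarrow> (\<And>\<gamma>. \<gamma> \<in> \<Gamma> \<Longrightarrow> KV \<gamma>) \<Longrightarrow> \<Gamma> \<turnstile> Conj \<phi>s"
proof (induction \<phi>s rule: Conj.induct)
  case 1 then show ?case using neg_falsum by simp
next
  case (3 \<phi> \<psi> \<phi>s)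
  have "\<Gamma> \<turnstile> Conj (\<psi> # \<phi>s)" by (rule 3(1)) (use 3(2,3) in auto)
  moreover have "\<Gamma> \<turnstile> \<phi>" by (rule 3(2)) simp
  ultimately show ?case using derives.andI[of L \<Gamma> \<phi>] by simp
qed simp

lemma Conj_der: "\<Gamma> \<turnstile> Conj \<phi>s \<Longrightarrow> \<phi> \<in> set \<phi>s \<Longrightarrow> \<Gamma> \<turnstile> \<phi>"
proof (induction \<phi>s rule: Conj.induct)
  case (3 \<psi> \<chi> \<phi>s)
  have "\<Gamma> \<turnstile> \<psi>" "\<Gamma> \<turnstile> Conj (\<chi> # \<phi>s)"
    using derives.andE1[of L \<Gamma> \<psi>] derives.andE2[of L \<Gamma> \<psi>] 3(2) by simp_all
  then show ?case using 3 by (cases "\<phi> = \<psi>") auto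
qed auto

end

subsection \<open>Henkin extensions\<close>

text \<open>The occurrences of \<open>v\<close> after renaming are exactly the former free occurrences of \<open>x\<close>, none of
  which lies in the scope of a quantifier on \<open>x\<close>.\<close>

lemma free_for_rename_back:
  fixes \<chi> :: "('f, 'p, 'v) fm"
  shows "v \<notin> vars \<chi> \<Longrightarrow> free_for (single v (Var x)) (subst_fm (single x (Var v)) \<chi>)"
proof (induction \<chi>)
  case (Ex y \<chi>)
  have *: "(single v (Var x))(y := Var y) = (single v (Var x) :: 'v \<Rightarrow> ('f, 'v) tm)" using Ex.prems by auto
  show ?case
  proof (cases "y = x")
    case True
    have "free_for (single v (Var x)) \<chi>"
      by (rule free_for_bvs) (use Ex.prems in \<open>auto simp: vars_eq split: if_splits\<close>)
    moreover have "(single x (Var v))(x := Var x) = (Var :: 'v \<Rightarrow> ('f, 'v) tm)" by auto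
    then have "subst_fm (single x (Var v)) (Ex y \<chi>) = Ex x \<chi>" using True by (simp only: subst_fm.simps subst_fm_Var)
    moreover have "\<forall>z \<in> Fv \<chi> - {x}. x \<notin> Fvt ((single v (Var x) :: 'v \<Rightarrow> ('f, 'v) tm) z)"
      using Ex.prems by (auto simp: vars_eq split: if_splits)
    ultimately show ?thesis using * True by (simp only: free_for.simps)
  next
    case False
    then have "(single x (Var v))(y := Var y) = (single x (Var v) :: 'v \<Rightarrow> ('f, 'v) tm)" by auto
    then have "subst_fm (single x (Var v)) (Ex y \<chi>) = Ex y (subst_fm (single x (Var v)) \<chi>)"
      by (simp only: subst_fm.simps)
    moreover have "free_for (single v (Var x)) (subst_fm (single x (Var v)) \<chi>)"
      by (rule Ex.IH) (use Ex.prems in simp)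
    moreover have "\<forall>z \<in> A - {y}. y \<notin> Fvt ((single v (Var x) :: 'v \<Rightarrow> ('f, 'v) tm) z)" for A
      using False by auto
    ultimately show ?thesis using * by (simp only: free_for.simps) blast
  qed
next
  case (All y \<chi>)
  have *: "(single v (Var x))(y := Var y) = (single v (Var x) :: 'v \<Rightarrow> ('f, 'v) tm)" using All.prems by auto
  show ?case
  proof (cases "y = x")
    case True
    have "free_for (single v (Var x)) \<chi>"
      by (rule free_for_bvs) (use All.prems in \<open>auto simp: vars_eq split: if_splits\<close>)
    moreover have "(single x (Var v))(x := Var x) = (Var :: 'v \<Rightarrow> ('f, 'v) tm)" by auto
    then have "subst_fm (single x (Var v)) (All y \<chi>) = All x \<chi>" using True by (simp only: subst_fm.simps subst_fm_Var)
    moreover have "\<forall>z \<in> Fv \<chi> - {x}. x \<notin> Fvt ((single v (Var x) :: 'v \<Rightarrow> ('f, 'v) tm) z)"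
      using All.prems by (auto simp: vars_eq split: if_splits)
    ultimately show ?thesis using * True by (simp only: free_for.simps)
  next
    case False
    then have "(single x (Var v))(y := Var y) = (single x (Var v) :: 'v \<Rightarrow> ('f, 'v) tm)" by auto
    then have "subst_fm (single x (Var v)) (All y \<chi>) = All y (subst_fm (single x (Var v)) \<chi>)"
      by (simp only: subst_fm.simps)
    moreover have "free_for (single v (Var x)) (subst_fm (single x (Var v)) \<chi>)"
      by (rule All.IH) (use All.prems in simp)
    moreover have "\<forall>z \<in> A - {y}. y \<notin> Fvt ((single v (Var x) :: 'v \<Rightarrow> ('f, 'v) tm) z)" for A
      using False by auto
    ultimately show ?thesis using * by (simp only: free_for.simps) blast
  qed
qed auto

context dep_logic
begin

text \<open>The sets in the construction of a Henkin theory. The parameters are the variables \<open>g k\<close>; a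
  finite set leaves infinitely many of them fresh.\<close>

definition stage :: "(nat \<Rightarrow> 'v) \<Rightarrow> ('f, 'p, 'v) fm set \<Rightarrow> bool" where
  "stage g S \<longleftrightarrow> finite S \<and> (\<forall>\<gamma> \<in> S. KV \<gamma>) \<and> Fvs S \<subseteq> range g \<and> \<not> S \<turnstile> falsum"

definition decided :: "(nat \<Rightarrow> 'v) \<Rightarrow> ('f, 'p, 'v) fm set \<Rightarrow> ('f, 'p, 'v) fm \<Rightarrow> bool" where
  "decided g S \<psi> \<longleftrightarrow> (\<psi> \<in> S \<or> Neg \<psi> \<in> S) \<and>
     (\<forall>x \<chi>. \<psi> = Ex x \<chi> \<and> \<psi> \<in> S \<longrightarrow> (\<exists>k. subst_fm (single x (Var (g k))) \<chi> \<in> S)) \<and>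
     (\<forall>x \<chi>. \<psi> = All x \<chi> \<and> Neg \<psi> \<in> S \<longrightarrow> (\<exists>k. Neg (subst_fm (single x (Var (g k))) \<chi>) \<in> S))"

text \<open>The bound variables must not be parameters, so that substituting parameters captures
  nothing, and so that a bound variable is never free in a stage.\<close>

definition question :: "(nat \<Rightarrow> 'v) \<Rightarrow> ('f, 'p, 'v) fm \<Rightarrow> bool" where
  "question g \<psi> \<longleftrightarrow> first_order \<psi> \<and> KV \<psi> \<and> Fv \<psi> \<subseteq> range g \<and> bvs \<psi> \<inter> range g = {}"

lemma fresh_parameter:
  assumes "inj (g :: nat \<Rightarrow> 'v)" "finite A" shows "\<exists>k. g k \<notin> (A :: 'v set)"
proof -
  have "infinite (range g)" using assms(1) by (rule range_inj_infinite)
  then have "\<not> range g \<subseteq> A" using assms(2) finite_subset by blast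
  then show ?thesis by blast
qed

lemma stage_witness:
  assumes g: "inj g" and S: "stage g S" and E: "Ex x \<chi> \<in> S"
  shows "\<exists>k. stage g (insert (subst_fm (single x (Var (g k))) \<chi>) S)"
proof -
  have fin: "finite S" "\<And>\<gamma>. \<gamma> \<in> S \<Longrightarrow> KV \<gamma>" "Fvs S \<subseteq> range g" "\<not> S \<turnstile> falsum"
    using S by (auto simp: stage_def)
  have "finite (Fvs S \<union> vars \<chi>)" using fin by simp
  from fresh_parameter[OF g this] obtain k where k: "g k \<notin> Fvs S \<union> vars \<chi>" by blast
  let ?\<chi> = "subst_fm (single x (Var (g k))) \<chi>"
  have ff: "free_for (single x (Var (g k))) \<chi>" by (rule free_for_single_fresh) (use k in simp)
  have KVx: "KV \<chi>" using fin(2)[OF E] by simp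
  have "\<not> insert ?\<chi> S \<turnstile> falsum"
  proof
    assume a: "insert ?\<chi> S \<turnstile> falsum"
    have "S \<turnstile> Ex x \<chi>" by (rule ax[OF E fin(2)])
    from derives.exE[OF this a ff] have "S \<turnstile> falsum" using k by (simp add: vars_eq)
    then show False using fin by simp
  qed
  moreover have "KV ?\<chi>" using KVx by (rule KV_subst) simp
  moreover have "Fv ?\<chi> \<subseteq> range g"
  proof -
    have "Fv (Ex x \<chi>) \<subseteq> range g" using fin(3) E by blast
    then show ?thesis by (auto simp: Fv_subst[OF ff] split: if_splits)
  qed
  ultimately have "stage g (insert ?\<chi> S)" using fin by (simp add: stage_def)
  then show ?thesis by blast
qed

text \<open>Introduction of \<open>\<forall>\<close> at the fresh parameter, followed by instantiation with \<open>x\<close>, returns to the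
  original bound variable.\<close>

lemma stage_counterexample:
  assumes g: "inj g" and S: "stage g S" and E: "Neg (All x \<chi>) \<in> S" and q: "question g (All x \<chi>)"
  shows "\<exists>k. stage g (insert (Neg (subst_fm (single x (Var (g k))) \<chi>)) S)"
proof -
  have fin: "finite S" "\<And>\<gamma>. \<gamma> \<in> S \<Longrightarrow> KV \<gamma>" "Fvs S \<subseteq> range g" "\<not> S \<turnstile> falsum"
    using S by (auto simp: stage_def)
  have "finite (Fvs S \<union> vars \<chi>)" using fin by simp
  from fresh_parameter[OF g this] obtain k where k: "g k \<notin> Fvs S \<union> vars \<chi>" by blast
  let ?\<chi> = "subst_fm (single x (Var (g k))) \<chi>"
  have ff: "free_for (single x (Var (g k))) \<chi>" by (rule free_for_single_fresh) (use k in simp)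
  have KVx: "KV \<chi>" "first_order \<chi>" using fin(2)[OF E] by simp_all
  have "\<not> insert (Neg ?\<chi>) S \<turnstile> falsum"
  proof
    assume "insert (Neg ?\<chi>) S \<turnstile> falsum"
    then have "S \<turnstile> ?\<chi>" by (rule derives.raa) (use KVx in simp)
    then have "S \<turnstile> All (g k) ?\<chi>" by (rule derives.allI) (use k in simp)
    then have "S \<turnstile> subst_fm (single (g k) (Var x)) ?\<chi>"
    by (rule derives.allE) (use free_for_rename_back[of "g k" \<chi> x] k in simp_all)
    moreover have "subst_fm (single (g k) (Var x)) ?\<chi> = \<chi>"
    proof -
      have "subst_fm (single (g k) (Var x)) ?\<chi> =
        subst_fm (\<lambda>y. subst_tm (single (g k) (Var x)) (single x (Var (g k)) y)) \<chi>"
        by (rule subst_fm_comp[OF ff])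
      also have "\<dots> = subst_fm Var \<chi>"
        by (rule subst_fm_cong) (use k in \<open>auto simp: vars_eq\<close>)
      finally show ?thesis by simp
    qed
    ultimately have "S \<turnstile> \<chi>" by simp
    moreover have "x \<notin> Fvs S" using fin(3) q by (auto simp: question_def)
    ultimately have "S \<turnstile> All x \<chi>" by (rule derives.allI)
    from derives.negE[OF this ax[OF E fin(2)]] have "S \<turnstile> falsum" using KVx by simp
    then show False using fin by simp
  qed
  moreover have "KV (Neg ?\<chi>)" using KVx by (simp add: KV_subst)
  moreover have "Fv (Neg ?\<chi>) \<subseteq> range g"
  proof -
    have "Fv (Neg (All x \<chi>)) \<subseteq> range g" using fin(3) E by blast
    then show ?thesis by (auto simp: Fv_subst[OF ff] split: if_splits)
  qed
  ultimately have "stage g (insert (Neg ?\<chi>) S)" using fin by (simp add: stage_def)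
  then show ?thesis by blast
qed

lemma stage_clash: "stage g S \<Longrightarrow> \<psi> \<in> S \<Longrightarrow> Neg \<psi> \<in> S \<Longrightarrow> False"
proof -
  assume S: "stage g S" and m: "\<psi> \<in> S" "Neg \<psi> \<in> S"
  have KV: "KV \<gamma>" if "\<gamma> \<in> S" for \<gamma> using S that by (simp add: stage_def)
  have "S \<turnstile> falsum"
    by (rule derives.negE[OF ax[OF m(1) KV] ax[OF m(2) KV]]) (use KV[OF m(2)] in simp_all)
  then show False using S by (simp add: stage_def)
qed

lemma decided_ExI:
  "Ex x \<chi> \<in> S \<Longrightarrow> subst_fm (single x (Var (g k))) \<chi> \<in> S \<Longrightarrow> decided g S (Ex x \<chi>)"
  unfolding decided_def by simp blast

lemma decided_AllI:
  "Neg (All x \<chi>) \<in> S \<Longrightarrow> Neg (subst_fm (single x (Var (g k))) \<chi>) \<in> S \<Longrightarrow> decided g S (All x \<chi>)"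
  unfolding decided_def by simp blast

lemma decide:
  assumes g: "inj g" and S: "stage g S" and q: "question g \<psi>"
  shows "\<exists>S'. S \<subseteq> S' \<and> stage g S' \<and> decided g S' \<psi>"
proof (cases "insert \<psi> S \<turnstile> falsum")
  case False
  then have c: "stage g (insert \<psi> S)" using S q by (simp add: stage_def question_def)
  show ?thesis
  proof (cases "\<exists>x \<chi>. \<psi> = Ex x \<chi>")
    case True
    then obtain x \<chi> where e: "\<psi> = Ex x \<chi>" by blast
    obtain k where k: "stage g (insert (subst_fm (single x (Var (g k))) \<chi>) (insert \<psi> S))"
      using stage_witness[OF g c, of x \<chi>] e by auto
    let ?S' = "insert (subst_fm (single x (Var (g k))) \<chi>) (insert \<psi> S)"
    have "decided g ?S' \<psi>" unfolding e by (rule decided_ExI[where k = k]) simp_all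
    moreover have "S \<subseteq> ?S'" by (simp add: subset_insertI2)
    ultimately show ?thesis using k by (intro HOL.exI[of _ ?S'] conjI)
  next
    case f: False
    have "Neg \<psi> \<notin> insert \<psi> S" using stage_clash[OF c, of \<psi>] by (metis insertI1)
    then have "decided g (insert \<psi> S) \<psi>" using f unfolding decided_def by simp
    moreover have "S \<subseteq> insert \<psi> S" by (rule subset_insertI)
    ultimately show ?thesis using c by metis
  qed
next
  case True
  have fin: "finite S" "\<And>\<gamma>. \<gamma> \<in> S \<Longrightarrow> KV \<gamma>" "\<not> S \<turnstile> falsum" using S by (auto simp: stage_def)
  have q': "first_order \<psi>" "KV \<psi>" "Fv \<psi> \<subseteq> range g" using q by (auto simp: question_def)
  have n: "S \<turnstile> Neg \<psi>" by (rule derives.negI[OF True q'(1)])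
  have "\<not> insert (Neg \<psi>) S \<turnstile> falsum" using cut[OF n _ fin(1), of falsum] fin(3) q' by auto
  then have c: "stage g (insert (Neg \<psi>) S)" using S q' by (simp add: stage_def)
  have nin: "\<psi> \<notin> insert (Neg \<psi>) S" using stage_clash[OF c, of \<psi>] by (metis insertI1)
  show ?thesis
  proof (cases "\<exists>x \<chi>. \<psi> = All x \<chi>")
    case True
    then obtain x \<chi> where e: "\<psi> = All x \<chi>" by blast
    obtain k where k: "stage g (insert (Neg (subst_fm (single x (Var (g k))) \<chi>)) (insert (Neg \<psi>) S))"
      using stage_counterexample[OF g c, of x \<chi>] e q by auto
    let ?S' = "insert (Neg (subst_fm (single x (Var (g k))) \<chi>)) (insert (Neg \<psi>) S)"
    have "decided g ?S' \<psi>" unfolding e by (rule decided_AllI[where k = k]) simp_all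
    moreover have "S \<subseteq> ?S'" by (simp add: subset_insertI2)
    ultimately show ?thesis using k by (intro HOL.exI[of _ ?S'] conjI)
  next
    case False
    then have "decided g (insert (Neg \<psi>) S) \<psi>" using nin unfolding decided_def by simp
    moreover have "S \<subseteq> insert (Neg \<psi>) S" by (rule subset_insertI)
    ultimately show ?thesis using c by metis
  qed
qed

lemma decided_mono_cases:
  "decided g S \<psi> \<Longrightarrow> S \<subseteq> T \<Longrightarrow> \<not> (\<psi> \<in> T \<and> Neg \<psi> \<in> T) \<Longrightarrow> decided g T \<psi>"
  unfolding decided_def by blast

lemma henkin_theory:
  assumes g: "inj g" and S: "stage g S" and Q: "countable Q" "\<And>\<psi>. \<psi> \<in> Q \<Longrightarrow> question g \<psi>"
  obtains T where "S \<subseteq> T" "\<And>\<gamma>. \<gamma> \<in> T \<Longrightarrow> KV \<gamma>" "\<not> derivable T falsum" "\<And>\<psi>. \<psi> \<in> Q \<Longrightarrow> decided g T \<psi>"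
proof (cases "Q = {}")
  case True
  show ?thesis
  proof (rule that[of S])
    show "\<not> derivable S falsum"
    proof
      assume "derivable S falsum"
      then obtain \<Delta> where "\<Delta> \<subseteq> S" "\<Delta> \<turnstile> falsum" by (auto simp: derivable_def)
      have KVS: "\<forall>\<gamma> \<in> S. KV \<gamma>" using S by (simp add: stage_def)
      have "S \<turnstile> falsum" by (rule derives.weaken[OF \<open>\<Delta> \<turnstile> falsum\<close> \<open>\<Delta> \<subseteq> S\<close> KVS])
      then show False using S by (simp add: stage_def)
    qed
  qed (use S True in \<open>auto simp: stage_def\<close>)
next
  case False
  let ?q = "from_nat_into Q"
  have q: "question g (?q n)" for n using Q(2) from_nat_into[OF False] by blast
  have "\<exists>f. \<forall>n. (S \<subseteq> f n \<and> stage g (f n)) \<and> (f n \<subseteq> f (Suc n) \<and> decided g (f (Suc n)) (?q n))"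
  proof (rule dependent_nat_choice)
    show "\<exists>x. S \<subseteq> x \<and> stage g x" using S by blast
  next
    fix x n assume "S \<subseteq> x \<and> stage g x"
    then show "\<exists>y. (S \<subseteq> y \<and> stage g y) \<and> x \<subseteq> y \<and> decided g y (?q n)"
      using decide[OF g, of x, OF _ q] by (meson order_trans)
  qed
  then obtain f where f: "\<And>n. S \<subseteq> f n" "\<And>n. stage g (f n)" "\<And>n. f n \<subseteq> f (Suc n)"
    "\<And>n. decided g (f (Suc n)) (?q n)" by blast
  have mono: "m \<le> n \<Longrightarrow> f m \<subseteq> f n" for m n using f(3) by (rule lift_Suc_mono_le)
  have fin: "\<exists>n. \<Delta> \<subseteq> f n" if "finite \<Delta>" "\<Delta> \<subseteq> (\<Union>n. f n)" for \<Delta>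
    using that
  proof (induction \<Delta> rule: finite_induct)
    case (insert \<delta> \<Delta>)
    then obtain m n where "\<Delta> \<subseteq> f m" "\<delta> \<in> f n" by auto
    then have "insert \<delta> \<Delta> \<subseteq> f (max m n)" using mono[of m "max m n"] mono[of n "max m n"] by auto
    then show ?case by blast
  qed simp
  let ?T = "\<Union>n. f n"
  show ?thesis
  proof (rule that[of ?T])
    show "S \<subseteq> ?T" using f(1) by blast
    show "KV \<gamma>" if "\<gamma> \<in> ?T" for \<gamma> using f(2) that by (auto simp: stage_def)
    show "\<not> derivable ?T falsum"
    proof
      assume "derivable ?T falsum"
      then obtain \<Delta> where D: "finite \<Delta>" "\<Delta> \<subseteq> ?T" "\<Delta> \<turnstile> falsum" by (auto simp: derivable_def)
      from fin[OF D(1,2)] obtain n where "\<Delta> \<subseteq> f n" by blast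
      have KVf: "\<forall>\<gamma> \<in> f n. KV \<gamma>" using f(2)[of n] by (simp add: stage_def)
      have "f n \<turnstile> falsum" by (rule derives.weaken[OF D(3) \<open>\<Delta> \<subseteq> f n\<close> KVf])
      then show False using f(2)[of n] by (simp add: stage_def)
    qed
    show "decided g ?T \<psi>" if "\<psi> \<in> Q" for \<psi>
    proof -
      from from_nat_into_surj[OF Q(1) that] obtain n where n: "?q n = \<psi>" by blast
      have nc: "\<not> (\<psi> \<in> ?T \<and> Neg \<psi> \<in> ?T)"
      proof
        assume "\<psi> \<in> ?T \<and> Neg \<psi> \<in> ?T"
        then have "{\<psi>, Neg \<psi>} \<subseteq> ?T" by blast
        from fin[OF _ this] obtain m where "{\<psi>, Neg \<psi>} \<subseteq> f m" by blast
        then show False using stage_clash[OF f(2)[of m], of \<psi>] by simp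
      qed
      have "f (Suc n) \<subseteq> ?T" by blast
      from decided_mono_cases[OF f(4)[of n, unfolded n] this nc] show ?thesis .
    qed
  qed
qed

subsection \<open>The model of a consistent sentence\<close>

definition par :: "(nat \<Rightarrow> 'v) \<Rightarrow> ('v \<Rightarrow> nat) \<Rightarrow> 'v \<Rightarrow> ('f, 'v) tm" where
  "par g e z = Var (g (e z))"

text \<open>Assigning the parameter number \<open>k\<close> to \<open>x\<close> amounts to leaving \<open>x\<close> open and then substituting
  \<open>g k\<close> for it.\<close>

lemma par_step:
  assumes "bvs \<psi> \<inter> range g = {}"
  shows "free_for ((par g e)(x := Var x)) \<psi>"
    "free_for (single x (Var (g k))) (subst_fm ((par g e)(x := Var x)) \<psi>)"
    "x \<notin> range g \<Longrightarrow> subst_fm (single x (Var (g k))) (subst_fm ((par g e)(x := Var x)) \<psi>) =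
      subst_fm (par g (e(x := k))) \<psi>"
proof -
  show ff: "free_for ((par g e)(x := Var x)) \<psi>"
    by (rule free_for_bvs) (use assms in \<open>auto simp: par_def split: if_splits\<close>)
  show "free_for (single x (Var (g k))) (subst_fm ((par g e)(x := Var x)) \<psi>)"
    by (rule free_for_bvs) (use assms in \<open>auto split: if_splits\<close>)
  assume x: "x \<notin> range g"
  show "subst_fm (single x (Var (g k))) (subst_fm ((par g e)(x := Var x)) \<psi>) =
      subst_fm (par g (e(x := k))) \<psi>"
    unfolding subst_fm_comp[OF ff] by (rule subst_fm_cong) (use x in \<open>auto simp: par_def\<close>)
qed

text \<open>A Henkin model whose elements are the parameters modulo provable equality. Only instances of
  finitely many formulas have to be decided: the subformulas of \<open>\<phi>\<close>, and \<open>\<exists>z (z = t)\<close> for the terms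
  \<open>t\<close> of \<open>\<phi>\<close>, which provides each term with a parameter as its value. So there are countably many
  questions, and a model on the natural numbers, for a vocabulary of any size.\<close>

lemma model_existence:
  assumes \<phi>: "first_order \<phi>" "KV \<phi>" "Fv \<phi> = {}" and con: "\<not> {\<phi>} \<turnstile> falsum"
  shows "\<exists>(M :: ('f, 'p, nat) model) e. closed_model L M \<and> range e \<subseteq> univ M \<and> fsat M e \<phi>"
proof -
  obtain z0 where z0: "z0 \<notin> vars \<phi>" using fresh[OF finite_vars[of \<phi>]] by blast
  define B where "B = insert z0 (vars \<phi>)"
  have finB: "finite B" by (simp add: B_def)
  then have "infinite (- B)" using inf finite_compl by blast
  then obtain g :: "nat \<Rightarrow> 'v" where g: "inj g" "range g \<subseteq> - B"
    using infinite_countable_subset by blast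
  \<comment> \<open>The variable \<open>z0\<close> is bound in the formulas that give names to terms.\<close>
  define \<F> where "\<F> = sub \<phi> \<union> (\<lambda>t. Ex z0 (Eq (Var z0) t)) ` tms \<phi>"
  define Q where "Q = (\<Union>\<psi> \<in> \<F>. range (\<lambda>e. subst_fm (par g e) \<psi>))"
  have \<F>: "first_order \<psi>" "KV \<psi>" "vars \<psi> \<subseteq> B" if "\<psi> \<in> \<F>" for \<psi>
  proof -
    have t: "wf_tm L t" "Fvt t \<subseteq> vars \<phi>" if "t \<in> tms \<phi>" for t
      using tms_props[OF that, of L] \<phi>(2) by simp_all
    from that consider "\<psi> \<in> sub \<phi>" | t where "t \<in> tms \<phi>" "\<psi> = Ex z0 (Eq (Var z0) t)"
      by (auto simp: \<F>_def)
    then have "first_order \<psi> \<and> KV \<psi> \<and> vars \<psi> \<subseteq> B"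
    proof cases
      case 1
      then show ?thesis using sub_props[of \<psi> \<phi> L] \<phi>(1,2) by (auto simp: B_def)
    next
      case 2
      then show ?thesis using t[OF 2(1)] by (auto simp: B_def)
    qed
    then show "first_order \<psi>" "KV \<psi>" "vars \<psi> \<subseteq> B" by simp_all
  qed
  have bvs\<F>: "bvs \<psi> \<inter> range g = {}" if "\<psi> \<in> \<F>" for \<psi>
    using \<F>(3)[OF that] g(2) by (auto simp: vars_eq)
  have par_free: "free_for (par g e) \<psi>" if "\<psi> \<in> \<F>" for \<psi> e
    by (rule free_for_bvs) (use bvs\<F>[OF that] in \<open>auto simp: par_def\<close>)
  have quest: "question g \<psi>" if "\<psi> \<in> Q" for \<psi>
  proof -
    from that obtain \<chi> e where c: "\<chi> \<in> \<F>" "\<psi> = subst_fm (par g e) \<chi>" by (auto simp: Q_def)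
    have "KV \<psi>" unfolding c(2) using \<F>(2)[OF c(1)] by (rule KV_subst) (simp add: par_def)
    then show ?thesis
      using c \<F>(1)[OF c(1)] bvs\<F>[OF c(1)] Fv_subst[OF par_free[OF c(1)]]
      by (auto simp: question_def par_def)
  qed
  \<comment> \<open>Only the values on the finite set \<open>B\<close> matter, so lists of numbers are enough.\<close>
  have "countable (range (\<lambda>e. subst_fm (par g e) \<psi>))" if "\<psi> \<in> \<F>" for \<psi>
  proof -
    obtain bl where bl: "set bl = B" using finite_list[OF finB] by blast
    define E where "E ns z = (case map_of (zip bl ns) z of Some n \<Rightarrow> n | None \<Rightarrow> 0)" for ns :: "nat list" and z
    have "range (\<lambda>e. subst_fm (par g e) \<psi>) \<subseteq> range (\<lambda>ns. subst_fm (par g (E ns)) \<psi>)"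
    proof
      fix \<chi> assume "\<chi> \<in> range (\<lambda>e. subst_fm (par g e) \<psi>)"
      then obtain e where e: "\<chi> = subst_fm (par g e) \<psi>" by blast
      have "E (map e bl) z = e z" if "z \<in> B" for z using that bl by (simp add: E_def map_of_zip_map)
      then have "\<chi> = subst_fm (par g (E (map e bl))) \<psi>"
        unfolding e using \<F>(3)[OF that] by (intro subst_fm_cong) (auto simp: par_def vars_eq)
      then show "\<chi> \<in> range (\<lambda>ns. subst_fm (par g (E ns)) \<psi>)" by blast
    qed
    then show ?thesis using countable_subset by blast
  qed
  moreover have "finite \<F>" by (simp add: \<F>_def finite_sub finite_tms)
  ultimately have cQ: "countable Q" unfolding Q_def using countable_finite by (intro countable_UN) auto
  have stage0: "stage g {\<phi>}" using \<phi> con by (simp add: stage_def)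
  obtain T where T: "{\<phi>} \<subseteq> T" "\<And>\<gamma>. \<gamma> \<in> T \<Longrightarrow> KV \<gamma>" "\<not> derivable T falsum"
    "\<And>\<psi>. \<psi> \<in> Q \<Longrightarrow> decided g T \<psi>" using henkin_theory[OF g(1) stage0 cQ quest] by blast
  have mem: "derivable T \<psi>" if "\<psi> \<in> T" for \<psi>
    unfolding derivable_def using that T(2) by (intro HOL.exI[of _ "{\<psi>}"]) (simp add: ax1)
  have clash: False if "derivable T \<psi>" "derivable T (Neg \<psi>)" "first_order \<psi>" for \<psi>
  proof -
    have "derivable T falsum"
    proof (rule derivable_rule[of "{\<psi>, Neg \<psi>}"])
      fix \<Delta> assume "\<And>\<theta>. \<theta> \<in> {\<psi>, Neg \<psi>} \<Longrightarrow> \<Delta> \<turnstile> \<theta>"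
      then have "\<Delta> \<turnstile> \<psi>" "\<Delta> \<turnstile> Neg \<psi>" by simp_all
      then show "\<Delta> \<turnstile> falsum" by (rule derives.negE) (use that in simp_all)
    qed (use that T(2) in auto)
    then show False using T(3) by blast
  qed
  define inst where "inst e \<psi> = subst_fm (par g e) \<psi>" for e and \<psi> :: "('f, 'p, 'v) fm"
  have inst_Q: "inst e \<psi> \<in> Q" if "\<psi> \<in> \<F>" for e \<psi> using that by (auto simp: Q_def inst_def)
  have neg: "derivable T (Neg (inst e \<psi>)) \<longleftrightarrow> \<not> derivable T (inst e \<psi>)" if "\<psi> \<in> \<F>" for e \<psi>
  proof
    show "derivable T (Neg (inst e \<psi>)) \<Longrightarrow> \<not> derivable T (inst e \<psi>)"
      using clash[of "inst e \<psi>"] \<F>(1)[OF that] by (auto simp: inst_def)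
    show "\<not> derivable T (inst e \<psi>) \<Longrightarrow> derivable T (Neg (inst e \<psi>))"
      using T(4)[OF inst_Q[OF that, of e]] mem by (auto simp: decided_def)
  qed
  have inT: "inst e \<psi> \<in> T" if "\<psi> \<in> \<F>" "derivable T (inst e \<psi>)" for e \<psi>
    using T(4)[OF inst_Q[OF that(1), of e]] mem neg[OF that(1), of e] that(2) by (auto simp: decided_def)
  define eqv where "eqv k l = derivable T (Eq (Var (g k)) (Var (g l)))" for k l
  have derivable_sym: "derivable T (Eq u t)" if "derivable T (Eq t u)" "wf_tm L t" for t u
    by (rule derivable_rule[of "{Eq t u}"]) (use that T(2) eq_sym in auto)
  have derivable_trans: "derivable T (Eq t r)" if "derivable T (Eq t u)" "derivable T (Eq u r)" for t u r
    by (rule derivable_rule[of "{Eq t u, Eq u r}"]) (use that T(2) in \<open>auto intro: eq_trans\<close>)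
  have derivable_refl: "derivable T (Eq t t)" if "wf_tm L t" for t
    by (rule derivable_rule[of "{}"]) (use that T(2) in \<open>auto intro: derives.eq_refl\<close>)
  \<comment> \<open>Each class of parameters is represented by its least index.\<close>
  define i where "i k = (LEAST l. eqv k l)" for k
  have eqv_i: "eqv k (i k)" for k
    unfolding i_def by (rule LeastI[of _ k]) (simp add: eqv_def derivable_refl)
  have i_iff: "i k = i l \<longleftrightarrow> eqv k l" for k l
  proof
    assume "i k = i l"
    then have "eqv k (i l)" using eqv_i[of k] by simp
    then show "eqv k l" using eqv_i[of l] derivable_sym derivable_trans unfolding eqv_def by (meson wf_tm.simps(1))
  next
    assume e: "eqv k l"
    have "eqv k m \<longleftrightarrow> eqv l m" for m
      using e derivable_sym derivable_trans unfolding eqv_def by (meson wf_tm.simps(1))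
    then show "i k = i l" by (simp add: i_def)
  qed
  have all2: "list_all2 (\<lambda>t u. derivable T (Eq t u)) (map (Var \<circ> g) ks) (map (Var \<circ> g) ls)"
    if "map i ks = map i ls" for ks ls
    using that i_iff by (auto simp: list_all2_conv_all_nth eqv_def list_eq_iff_nth_eq)
  have common: "\<exists>\<Delta>. finite \<Delta> \<and> \<Delta> \<subseteq> T \<and> list_all2 (\<lambda>t u. \<Delta> \<turnstile> Eq t u) ts us \<and> \<Delta> \<turnstile> \<psi>"
    if "list_all2 (\<lambda>t u. derivable T (Eq t u)) ts us" "derivable T \<psi>" for ts us \<psi>
  proof -
    have "\<exists>\<Delta>. finite \<Delta> \<and> \<Delta> \<subseteq> T \<and> (\<forall>\<theta> \<in> insert \<psi> (set (map2 Eq ts us)). \<Delta> \<turnstile> \<theta>)"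
      by (rule derivable_common) (use that T(2) in \<open>auto simp: list_all2_iff\<close>)
    then show ?thesis using that(1) by (auto simp: list_all2_iff)
  qed
  have fcong: "derivable T (Eq s (Fn f us))"
    if "list_all2 (\<lambda>t u. derivable T (Eq t u)) ts us" "derivable T (Eq s (Fn f ts))" for s f ts us
    using common[OF that] fn_cong[of _ ts us s f "[]"] unfolding derivable_def by auto
  have rcong: "derivable T (Rel p us)"
    if "list_all2 (\<lambda>t u. derivable T (Eq t u)) ts us" "derivable T (Rel p ts)" for p ts us
    using common[OF that] rel_cong[of _ ts us p "[]"] unfolding derivable_def by auto
  define F where "F f ks = (SOME k. derivable T (Eq (Var (g k)) (Fn f (map (Var \<circ> g) ks))))" for f ks
  define R where "R p ks = derivable T (Rel p (map (Var \<circ> g) ks))" for p ks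
  obtain M :: "('f, 'p, nat) model" where M: "univ M = range i"
    "\<And>f ds. fint M f (map i ds) = i (F f ds)" "\<And>p ds. map i ds \<in> rint M p \<longleftrightarrow> R p ds"
  proof (rule quotient_model[of i F R])
    fix f ds ds' assume e: "map i ds = map i ds'"
    have "F f ds = F f ds'"
      unfolding F_def using fcong[OF all2[OF e]] fcong[OF all2[OF e[symmetric]]] by metis
    then show "i (F f ds) = i (F f ds')" by simp
  next
    fix p ds ds' assume e: "map i ds = map i ds'" "R p ds"
    then show "R p ds'" unfolding R_def using rcong[OF all2[OF e(1)]] by blast
  qed blast
  have name: "\<exists>k. derivable T (Eq (Var (g k)) (subst_tm (par g e) t))" if t: "t \<in> tms \<phi>" for t e
  proof -
    let ?\<psi> = "Ex z0 (Eq (Var z0) t)"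
    have z0t: "z0 \<notin> Fvt t" using tms_props[OF t] z0 by blast
    have wf: "wf_tm L t" using tms_props[OF t, of L] \<phi>(2) by blast
    have m: "?\<psi> \<in> \<F>" using t by (auto simp: \<F>_def)
    have st: "subst_tm ((par g e)(z0 := Var z0)) t = subst_tm (par g e) t"
      by (rule subst_tm_cong) (use z0t in auto)
    have z0s: "z0 \<notin> Fvt (subst_tm (par g e) t)"
      using g(2) by (auto simp: Fvt_subst par_def B_def)
    have i: "inst e ?\<psi> = Ex z0 (Eq (Var z0) (subst_tm (par g e) t))"
      using st by (simp add: inst_def)
    have wfs: "wf_tm L (subst_tm (par g e) t)" using wf by (rule wf_tm_subst) (simp add: par_def)
    have "derivable T (inst e ?\<psi>)" unfolding i
    proof (rule derivable_rule[of "{}"])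
      fix \<Delta> assume KV: "\<And>\<delta>. \<delta> \<in> \<Delta> \<Longrightarrow> KV \<delta>"
      then have "\<Delta> \<turnstile> subst_fm (single z0 (subst_tm (par g e) t)) (Eq (Var z0) (subst_tm (par g e) t))"
        using z0s wfs derives.eq_refl[of L "subst_tm (par g e) t" \<Delta>] by (simp add: subst_tm_single_idle)
      then show "\<Delta> \<turnstile> Ex z0 (Eq (Var z0) (subst_tm (par g e) t))"
        by (rule derives.exI) (use wfs in simp_all)
    qed (use T(2) in auto)
    from inT[OF m this] have "inst e ?\<psi> \<in> T" .
    with T(4)[OF inst_Q[OF m, of e]] i obtain k where
      "subst_fm (single z0 (Var (g k))) (Eq (Var z0) (subst_tm (par g e) t)) \<in> T"
      unfolding decided_def by auto
    then show ?thesis using mem z0s by (auto simp: subst_tm_single_idle)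
  qed
  have val_name: "tval M (\<lambda>x. i (e x)) t = i k"
    if "subt t \<subseteq> tms \<phi>" "derivable T (Eq (Var (g k)) (subst_tm (par g e) t))" for t e k
    using that
  proof (induction t arbitrary: k)
    case (Var x)
    then have "eqv k (e x)" by (simp add: eqv_def par_def)
    then show ?case using i_iff[of k "e x"] by simp
  next
    case (Fn f ts)
    have sub: "subt t \<subseteq> tms \<phi>" if "t \<in> set ts" for t using Fn.prems(1) that by auto
    have "\<exists>k. derivable T (Eq (Var (g k)) (subst_tm (par g e) t))" if "t \<in> set ts" for t
      using name sub[OF that] subt_self by blast
    then obtain K where K: "\<And>t. t \<in> set ts \<Longrightarrow> derivable T (Eq (Var (g (K t))) (subst_tm (par g e) t))"
      by metis
    have wf: "wf_tm L t" if "t \<in> set ts" for t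
      using tms_props[of t \<phi> L] \<phi>(2) sub[OF that] subt_self by blast
    have "map (tval M (\<lambda>x. i (e x))) ts = map i (map K ts)"
      using Fn.IH[OF _ sub K] by simp
    then have v: "tval M (\<lambda>x. i (e x)) (Fn f ts) = i (F f (map K ts))" by (simp only: tval.simps M)
    have "derivable T (Eq (subst_tm (par g e) t) (Var (g (K t))))" if "t \<in> set ts" for t
      by (rule derivable_sym[OF K[OF that]]) simp
    then have "list_all2 (\<lambda>t u. derivable T (Eq t u)) (map (subst_tm (par g e)) ts) (map (Var \<circ> g) (map K ts))"
      by (simp add: list_all2_conv_all_nth)
    from fcong[OF this] Fn.prems(2) have k: "derivable T (Eq (Var (g k)) (Fn f (map (Var \<circ> g) (map K ts))))"
      by simp
    then have "derivable T (Eq (Var (g (F f (map K ts)))) (Fn f (map (Var \<circ> g) (map K ts))))"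
      unfolding F_def by (rule someI)
    moreover have "wf_tm L (Var (g (F f (map K ts))))" by simp
    ultimately have "eqv k (F f (map K ts))" using k derivable_sym derivable_trans unfolding eqv_def by blast
    then have "i k = i (F f (map K ts))" using i_iff by blast
    then show ?case using v by (simp only:)
  qed
  have upd: "(\<lambda>z. i ((e(x := k)) z)) = (\<lambda>z. i (e z))(x := i k)" for e and x :: 'v and k by auto
  have truth: "fsat M (\<lambda>x. i (e x)) \<psi> \<longleftrightarrow> derivable T (inst e \<psi>)"
    if "sub \<psi> \<subseteq> sub \<phi>" "tms \<psi> \<subseteq> tms \<phi>" for \<psi> e
    using that
  proof (induction \<psi> arbitrary: e)
    case (Eq t u)
    have tu: "subt t \<subseteq> tms \<phi>" "subt u \<subseteq> tms \<phi>" using Eq.prems(2) by simp_all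
    have tu: "t \<in> tms \<phi>" "u \<in> tms \<phi>" "subt t \<subseteq> tms \<phi>" "subt u \<subseteq> tms \<phi>"
      using subsetD[OF tu(1) subt_self] subsetD[OF tu(2) subt_self] tu by simp_all
    from name[OF tu(1)] name[OF tu(2)] obtain k l where
      kl: "derivable T (Eq (Var (g k)) (subst_tm (par g e) t))"
      "derivable T (Eq (Var (g l)) (subst_tm (par g e) u))" by metis
    have wf: "wf_tm L (subst_tm (par g e) t)" "wf_tm L (subst_tm (par g e) u)"
      using tms_props[OF tu(1), of L] tms_props[OF tu(2), of L] \<phi>(2)
      by (auto intro!: wf_tm_subst simp: par_def)
    have "fsat M (\<lambda>x. i (e x)) (Eq t u) \<longleftrightarrow> eqv k l"
      using val_name[OF tu(3) kl(1)] val_name[OF tu(4) kl(2)] i_iff by simp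
    also have "\<dots> \<longleftrightarrow> derivable T (Eq (subst_tm (par g e) t) (subst_tm (par g e) u))"
    proof
      assume "eqv k l"
      then have "derivable T (Eq (Var (g k)) (subst_tm (par g e) u))" unfolding eqv_def by (rule derivable_trans[OF _ kl(2)])
      then show "derivable T (Eq (subst_tm (par g e) t) (subst_tm (par g e) u))"
        by (rule derivable_trans[OF derivable_sym[OF kl(1)], rotated]) simp
    next
      assume "derivable T (Eq (subst_tm (par g e) t) (subst_tm (par g e) u))"
      then have "derivable T (Eq (Var (g k)) (subst_tm (par g e) u))" by (rule derivable_trans[OF kl(1)])
      then show "eqv k l" unfolding eqv_def by (rule derivable_trans[OF _ derivable_sym[OF kl(2)]]) simp
    qed
    finally show ?case by (simp add: inst_def)
  next
    case (Rel p ts)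
    have sub: "subt t \<subseteq> tms \<phi>" if "t \<in> set ts" for t using Rel.prems that by auto
    have "\<exists>k. derivable T (Eq (Var (g k)) (subst_tm (par g e) t))" if "t \<in> set ts" for t
      using name sub[OF that] subt_self by blast
    then obtain K where K: "\<And>t. t \<in> set ts \<Longrightarrow> derivable T (Eq (Var (g (K t))) (subst_tm (par g e) t))"
      by metis
    have "map (tval M (\<lambda>x. i (e x))) ts = map i (map K ts)" using val_name[OF sub K] by simp
    then have v: "fsat M (\<lambda>x. i (e x)) (Rel p ts) \<longleftrightarrow> derivable T (Rel p (map (Var \<circ> g) (map K ts)))"
      by (simp only: fsat.simps M R_def)
    have "derivable T (Eq (subst_tm (par g e) t) (Var (g (K t))))" if "t \<in> set ts" for t
      by (rule derivable_sym[OF K[OF that]]) simp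
    then have "list_all2 (\<lambda>t u. derivable T (Eq t u)) (map (subst_tm (par g e)) ts) (map (Var \<circ> g) (map K ts))"
      "list_all2 (\<lambda>t u. derivable T (Eq t u)) (map (Var \<circ> g) (map K ts)) (map (subst_tm (par g e)) ts)"
      using K by (simp_all add: list_all2_conv_all_nth)
    then have "derivable T (Rel p (map (Var \<circ> g) (map K ts))) \<longleftrightarrow> derivable T (Rel p (map (subst_tm (par g e)) ts))"
      using rcong by blast
    then show ?case using v by (simp add: inst_def)
  next
    case (Dep ts us)
    then show ?case using sub_props[of "Dep ts us" \<phi> L] \<phi>(1) by simp
  next
    case (Neg \<psi>)
    have m: "\<psi> \<in> \<F>" using Neg.prems sub_self by (auto simp: \<F>_def)
    have "fsat M (\<lambda>x. i (e x)) (Neg \<psi>) \<longleftrightarrow> \<not> derivable T (inst e \<psi>)" using Neg.IH[of e] Neg.prems by simp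
    also have "\<dots> \<longleftrightarrow> derivable T (Neg (inst e \<psi>))" using neg[OF m] by simp
    finally show ?case by (simp add: inst_def)
  next
    case (And \<psi> \<chi>)
    have "derivable T (And (inst e \<psi>) (inst e \<chi>)) \<longleftrightarrow> derivable T (inst e \<psi>) \<and> derivable T (inst e \<chi>)" (is "?a \<longleftrightarrow> ?b \<and> ?c")
    proof (intro iffI conjI)
      assume a: ?a
      show ?b by (rule derivable_rule[of "{And (inst e \<psi>) (inst e \<chi>)}"]) (use a T(2) derives.andE1 in auto)
      show ?c by (rule derivable_rule[of "{And (inst e \<psi>) (inst e \<chi>)}"]) (use a T(2) derives.andE2 in auto)
    next
      assume a: "?b \<and> ?c"
      show ?a by (rule derivable_rule[of "{inst e \<psi>, inst e \<chi>}"]) (use a T(2) in \<open>auto intro: derives.andI\<close>)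
    qed
    then show ?case using And.IH[of e] And.prems by (simp add: inst_def)
  next
    case (Or \<psi> \<chi>)
    have m: "\<psi> \<in> \<F>" "\<chi> \<in> \<F>" "Or \<psi> \<chi> \<in> \<F>"
      using Or.prems sub_self[of \<psi>] sub_self[of \<chi>] by (auto simp: \<F>_def)
    have fo: "first_order (inst e \<psi>)" "first_order (inst e \<chi>)" "KV (inst e \<psi>)" "KV (inst e \<chi>)"
      using quest[OF inst_Q[OF m(1)]] quest[OF inst_Q[OF m(2)]] by (auto simp: question_def)
    have "derivable T (Or (inst e \<psi>) (inst e \<chi>)) \<longleftrightarrow> derivable T (inst e \<psi>) \<or> derivable T (inst e \<chi>)" (is "?a \<longleftrightarrow> ?b \<or> ?c")
    proof
      assume a: ?a
      show "?b \<or> ?c"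
      proof (rule ccontr)
        assume "\<not> (?b \<or> ?c)"
        then have n: "derivable T (Neg (inst e \<psi>))" "derivable T (Neg (inst e \<chi>))" using neg m by auto
        have "derivable T falsum"
        proof (rule derivable_rule[of "{Or (inst e \<psi>) (inst e \<chi>), Neg (inst e \<psi>), Neg (inst e \<chi>)}"])
          fix \<Delta> assume KV: "\<And>\<delta>. \<delta> \<in> \<Delta> \<Longrightarrow> KV \<delta>"
            and d: "\<And>\<theta>. \<theta> \<in> {Or (inst e \<psi>) (inst e \<chi>), Neg (inst e \<psi>), Neg (inst e \<chi>)} \<Longrightarrow> \<Delta> \<turnstile> \<theta>"
          have o: "\<Delta> \<turnstile> Or (inst e \<psi>) (inst e \<chi>)" by (rule d) simp
          have f: "insert \<theta> \<Delta> \<turnstile> falsum" if t: "\<Delta> \<turnstile> Neg \<theta>" "KV \<theta>" "first_order \<theta>" for \<theta>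
          proof (rule derives.negE[of L _ \<theta>])
            show "insert \<theta> \<Delta> \<turnstile> \<theta>" by (rule ax) (use KV t in auto)
            show "insert \<theta> \<Delta> \<turnstile> Neg \<theta>" by (rule derives.weaken[OF t(1)]) (use KV t in auto)
          qed (use t in simp_all)
          show "\<Delta> \<turnstile> falsum"
            by (rule derives.orE[OF o f f]) (use fo in \<open>simp_all add: d\<close>)
        qed (use a n T(2) in auto)
        then show False using T(3) by blast
      qed
    next
      assume "?b \<or> ?c"
      then show ?a
      proof
        assume b: ?b
        show ?a by (rule derivable_rule[of "{inst e \<psi>}"]) (use b fo T(2) derives.orI1 in auto)
      next
        assume c: ?c
        show ?a by (rule derivable_rule[of "{inst e \<chi>}"]) (use c fo T(2) derives.orI2 in auto)
      qed
    qed
    then show ?case using Or.IH[of e] Or.prems by (simp add: inst_def)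
  next
    case (Ex x \<psi>)
    have m: "\<psi> \<in> \<F>" "Ex x \<psi> \<in> \<F>" using Ex.prems sub_self by (auto simp: \<F>_def)
    have x: "x \<notin> range g" using bvs\<F>[OF m(2)] by simp
    let ?\<psi> = "subst_fm ((par g e)(x := Var x)) \<psi>"
    have st: "subst_fm (single x (Var (g k))) ?\<psi> = inst (e(x := k)) \<psi>" for k
      using par_step(3)[OF bvs\<F>[OF m(1)] x] by (simp add: inst_def)
    have i: "inst e (Ex x \<psi>) = Ex x ?\<psi>" by (simp add: inst_def)
    have KVx: "KV ?\<psi>" using quest[OF inst_Q[OF m(2), of e]] i by (simp add: question_def)
    have "fsat M (\<lambda>x. i (e x)) (Ex x \<psi>) \<longleftrightarrow> (\<exists>k. fsat M (\<lambda>z. i ((e(x := k)) z)) \<psi>)"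
      unfolding upd by (simp add: M(1) del: fun_upd_apply)
    also have "\<dots> \<longleftrightarrow> (\<exists>k. derivable T (inst (e(x := k)) \<psi>))"
      using Ex.IH Ex.prems by (simp only: sub.simps tms.simps insert_subset)
    also have "\<dots> \<longleftrightarrow> derivable T (inst e (Ex x \<psi>))"
    proof
      assume "\<exists>k. derivable T (inst (e(x := k)) \<psi>)"
      then obtain k where k: "derivable T (subst_fm (single x (Var (g k))) ?\<psi>)" using st by auto
      show "derivable T (inst e (Ex x \<psi>))" unfolding i
      proof (rule derivable_rule[of "{subst_fm (single x (Var (g k))) ?\<psi>}"])
        fix \<Delta> assume "\<And>\<theta>. \<theta> \<in> {subst_fm (single x (Var (g k))) ?\<psi>} \<Longrightarrow> \<Delta> \<turnstile> \<theta>"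
        then have "\<Delta> \<turnstile> subst_fm (single x (Var (g k))) ?\<psi>" by simp
        then show "\<Delta> \<turnstile> Ex x ?\<psi>"
          by (rule derives.exI) (use KVx par_step(2)[OF bvs\<F>[OF m(1)]] in simp_all)
      qed (use k T(2) in auto)
    next
      assume "derivable T (inst e (Ex x \<psi>))"
      from inT[OF m(2) this] T(4)[OF inst_Q[OF m(2), of e]] i obtain k where
        "subst_fm (single x (Var (g k))) ?\<psi> \<in> T" unfolding decided_def by auto
      then show "\<exists>k. derivable T (inst (e(x := k)) \<psi>)" using mem st by auto
    qed
    finally show ?case .
  next
    case (All x \<psi>)
    have m: "\<psi> \<in> \<F>" "All x \<psi> \<in> \<F>" using All.prems sub_self by (auto simp: \<F>_def)
    have x: "x \<notin> range g" using bvs\<F>[OF m(2)] by simp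
    let ?\<psi> = "subst_fm ((par g e)(x := Var x)) \<psi>"
    have st: "subst_fm (single x (Var (g k))) ?\<psi> = inst (e(x := k)) \<psi>" for k
      using par_step(3)[OF bvs\<F>[OF m(1)] x] by (simp add: inst_def)
    have i: "inst e (All x \<psi>) = All x ?\<psi>" by (simp add: inst_def)
    have "fsat M (\<lambda>x. i (e x)) (All x \<psi>) \<longleftrightarrow> (\<forall>k. fsat M (\<lambda>z. i ((e(x := k)) z)) \<psi>)"
      unfolding upd by (simp add: M(1) del: fun_upd_apply)
    also have "\<dots> \<longleftrightarrow> (\<forall>k. derivable T (inst (e(x := k)) \<psi>))"
      using All.IH All.prems by (simp only: sub.simps tms.simps insert_subset)
    also have "\<dots> \<longleftrightarrow> derivable T (inst e (All x \<psi>))"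
    proof
      assume a: "derivable T (inst e (All x \<psi>))"
      show "\<forall>k. derivable T (inst (e(x := k)) \<psi>)"
      proof
        fix k
        show "derivable T (inst (e(x := k)) \<psi>)" unfolding st[symmetric]
        proof (rule derivable_rule[of "{All x ?\<psi>}"])
          fix \<Delta> assume "\<And>\<theta>. \<theta> \<in> {All x ?\<psi>} \<Longrightarrow> \<Delta> \<turnstile> \<theta>"
          then have "\<Delta> \<turnstile> All x ?\<psi>" by simp
          then show "\<Delta> \<turnstile> subst_fm (single x (Var (g k))) ?\<psi>"
            by (rule derives.allE) (use par_step(2)[OF bvs\<F>[OF m(1)]] in simp_all)
        qed (use a i T(2) in auto)
      qed
    next
      assume a: "\<forall>k. derivable T (inst (e(x := k)) \<psi>)"
      show "derivable T (inst e (All x \<psi>))"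
      proof (rule ccontr)
        assume n: "\<not> derivable T (inst e (All x \<psi>))"
        then have "inst e (All x \<psi>) \<notin> T" using mem by blast
        with T(4)[OF inst_Q[OF m(2), of e]] i obtain k where
          "Neg (subst_fm (single x (Var (g k))) ?\<psi>) \<in> T" unfolding decided_def by auto
        then have "derivable T (Neg (inst (e(x := k)) \<psi>))" using mem st by auto
        then show False using a neg[OF m(1)] by blast
      qed
    qed
    finally show ?case .
  qed
  have "fsat M (\<lambda>x. i 0) \<phi>"
  proof -
    have "inst (\<lambda>_. 0) \<phi> = subst_fm Var \<phi>"
      unfolding inst_def by (rule subst_fm_cong) (use \<phi>(3) in simp)
    then have "derivable T (inst (\<lambda>_. 0) \<phi>)" using mem T(1) by simp
    then show ?thesis using truth[of \<phi> "\<lambda>_. 0"] by simp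
  qed
  moreover have "closed_model L M" using M(1,2) by (rule quotient_closed)
  moreover have "range (\<lambda>x. i 0) \<subseteq> univ M" using M(1) by auto
  ultimately show ?thesis by blast
qed

end

subsection \<open>Completeness\<close>

lemma KV_D: "KV_formula L \<phi> \<Longrightarrow> D_formula L \<phi>"
  by (simp add: KV_formula_def)

lemma fsat_Exs:
  "fsat M e (Exs xs \<phi>) \<Longrightarrow> range e \<subseteq> univ M \<Longrightarrow> \<exists>e'. range e' \<subseteq> univ M \<and> fsat M e' \<phi>"
proof (induction xs arbitrary: e)
  case (Cons x xs)
  then obtain a where a: "a \<in> univ M" "fsat M (e(x := a)) (Exs xs \<phi>)" by auto
  show ?case by (rule Cons.IH[OF a(2)]) (use a Cons.prems in auto)
qed auto

context dep_logic
begin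

lemma pv_Exs_intro: "KV \<phi> \<Longrightarrow> pv \<phi> (Exs xs \<phi>)"
proof (induction xs)
  case (Cons x xs)
  have "pv (Exs xs \<phi>) (Ex x (Exs xs \<phi>))" using Cons.prems by (intro pv_ex_intro) simp
  with Cons show ?case using pv_trans by (metis Exs_simps(2))
qed (simp add: pv_refl)

text \<open>The existential closure of the conjunction is a consistent sentence; an assignment that
  satisfies the conjunction is then read off from its model.\<close>

lemma finite_model_existence:
  assumes S: "finite S" "\<And>\<phi>. \<phi> \<in> S \<Longrightarrow> first_order \<phi> \<and> KV \<phi>" and con: "\<not> S \<turnstile> falsum"
  shows "\<exists>(M :: ('f, 'p, nat) model) e. closed_model L M \<and> range e \<subseteq> univ M \<and> (\<forall>\<phi> \<in> S. fsat M e \<phi>)"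
proof -
  from finite_list[OF S(1)] obtain \<phi>s where ps: "set \<phi>s = S" by blast
  let ?\<phi> = "Conj \<phi>s"
  have \<phi>: "first_order ?\<phi>" "KV ?\<phi>" using S(2) ps by (simp_all add: Conj_simps)
  from finite_list[OF finite_Fv[of ?\<phi>]] obtain xs where xs: "set xs = Fv ?\<phi>" by blast
  have "pv ?\<phi> (Exs xs ?\<phi>)" using \<phi>(2) by (rule pv_Exs_intro)
  moreover have d: "S \<turnstile> ?\<phi>"
  proof (rule der_Conj)
    show "S \<turnstile> \<phi>" if "\<phi> \<in> set \<phi>s" for \<phi> by (rule ax) (use S ps that in simp_all)
  qed (use S in simp)
  ultimately have d: "S \<turnstile> Exs xs ?\<phi>" by (rule pv_der) (use S in simp_all)
  have "\<not> {Exs xs ?\<phi>} \<turnstile> falsum"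
  proof
    assume "{Exs xs ?\<phi>} \<turnstile> falsum"
    then have "pv (Exs xs ?\<phi>) falsum" using \<phi> by (simp add: pv_def)
    from pv_der[OF this d] S con show False by blast
  qed
  from model_existence[OF _ _ _ this] \<phi> xs obtain M :: "('f, 'p, nat) model" and e where
    M: "closed_model L M" "range e \<subseteq> univ M" "fsat M e (Exs xs ?\<phi>)" by auto
  from fsat_Exs[OF M(3,2)] show ?thesis using M(1) ps by (auto simp: Conj_simps)
qed

lemma completeness:
  assumes D: "finite \<Delta>" "\<And>\<phi>. \<phi> \<in> \<Delta> \<Longrightarrow> first_order \<phi> \<and> KV \<phi>" and \<alpha>: "first_order \<alpha>" "KV \<alpha>"
    and sem: "\<And>(M :: ('f, 'p, nat) model) e. closed_model L M \<Longrightarrow> range e \<subseteq> univ M \<Longrightarrow>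
      (\<And>\<phi>. \<phi> \<in> \<Delta> \<Longrightarrow> fsat M e \<phi>) \<Longrightarrow> fsat M e \<alpha>"
  shows "\<Delta> \<turnstile> \<alpha>"
proof (rule ccontr)
  assume n: "\<not> \<Delta> \<turnstile> \<alpha>"
  have nn: "\<not> insert (Neg \<alpha>) \<Delta> \<turnstile> falsum" using n derives.raa[of L \<alpha> \<Delta>] \<alpha>(1) by blast
  have "\<exists>(M :: ('f, 'p, nat) model) e. closed_model L M \<and> range e \<subseteq> univ M \<and>
    (\<forall>\<phi> \<in> insert (Neg \<alpha>) \<Delta>. fsat M e \<phi>)"
    by (rule finite_model_existence[OF _ _ nn]) (use D \<alpha> in auto)
  then obtain M :: "('f, 'p, nat) model" and e where
    M: "closed_model L M" "range e \<subseteq> univ M" "\<forall>\<phi> \<in> insert (Neg \<alpha>) \<Delta>. fsat M e \<phi>" by blast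
  show False using sem[OF M(1,2)] M(3) by simp
qed

text \<open>The existence of two elements is hidden in the scope rule for \<open>\<forall>\<close>: applied to
  \<open>\<forall>a \<bottom> \<or> \<not>\<bottom>\<close>, it yields \<open>b\<close> and \<open>c\<close> such that all \<open>a\<close> satisfy
  \<open>(\<bottom> \<and> b = c) \<or> (\<not>\<bottom> \<and> b \<noteq> c)\<close>.\<close>

lemma two_elements:
  assumes "y \<noteq> z" shows "{} \<turnstile> Ex y (Ex z (Neg (Eq (Var y) (Var z))))"
proof -
  let ?u = "undefined :: 'v"
  obtain vs where vs: "length vs = 3" "distinct vs" "set vs \<inter> {?u} = {}" using fresh_list[of "{?u}" 3] by auto
  then obtain a b c where e: "vs = [a, b, c]"
    by (auto simp: numeral_3_eq_3 length_Suc_conv)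
  have "{} \<turnstile> Or (All a falsum) (Neg falsum)"
    by (rule derives.orI2[OF neg_falsum]) simp_all
  then have "{} \<turnstile> Ex b (Ex c (All a (Or (And falsum (Eq (Var b) (Var c)))
      (And (Neg falsum) (Neg (Eq (Var b) (Var c)))))))" (is "{} \<turnstile> ?\<phi>")
    by (rule derives.all_scope) (use vs e in \<open>auto simp: falsum_def\<close>)
  moreover have "{?\<phi>} \<turnstile> Ex y (Ex z (Neg (Eq (Var y) (Var z))))"
  proof (rule completeness)
    fix M :: "('f, 'p, nat) model" and e :: "'v \<Rightarrow> nat"
    assume M: "closed_model L M" "\<And>\<phi>. \<phi> \<in> {?\<phi>} \<Longrightarrow> fsat M e \<phi>"
    then have "fsat M e ?\<phi>" by simp
    moreover obtain m where "m \<in> univ M" using M(1) by (auto simp: closed_model_def)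
    ultimately obtain p q where "p \<in> univ M" "q \<in> univ M" "p \<noteq> q" using vs(2) e by auto
    then show "fsat M e (Ex y (Ex z (Neg (Eq (Var y) (Var z)))))"
      using assms by simp blast
  qed simp_all
  ultimately show ?thesis using cuts[of "{?\<phi>}" "{}"] by auto
qed

lemma is_model_closed:
  "is_model L M \<longleftrightarrow> closed_model L M \<and> (\<exists>a \<in> univ M. \<exists>b \<in> univ M. a \<noteq> b)"
  by (auto simp: is_model_def closed_model_def)

lemma consistent_has_model:
  assumes S: "finite S" "\<And>\<phi>. \<phi> \<in> S \<Longrightarrow> first_order \<phi> \<and> KV \<phi>" and con: "\<not> S \<turnstile> falsum"
  shows "\<exists>(M :: ('f, 'p, nat) model) e. is_model L M \<and> range e \<subseteq> univ M \<and> (\<forall>\<phi> \<in> S. fsat M e \<phi>)"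
proof -
  obtain y z :: 'v where yz: "y \<noteq> z" using fresh[of "{undefined}"] by auto
  let ?two = "Ex y (Ex z (Neg (Eq (Var y) (Var z)))) :: ('f, 'p, 'v) fm"
  have t: "S \<turnstile> ?two" by (rule derives.weaken[OF two_elements[OF yz]]) (use S in auto)
  have nn: "\<not> insert ?two S \<turnstile> falsum" using cut[OF t _ S(1), of falsum] con by auto
  have "\<exists>(M :: ('f, 'p, nat) model) e. closed_model L M \<and> range e \<subseteq> univ M \<and>
    (\<forall>\<phi> \<in> insert ?two S. fsat M e \<phi>)"
    by (rule finite_model_existence[OF _ _ nn]) (use S in auto)
  then obtain M :: "('f, 'p, nat) model" and e where
    M: "closed_model L M" "range e \<subseteq> univ M" "\<forall>\<phi> \<in> insert ?two S. fsat M e \<phi>" by blast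
  then have "is_model L M" using yz by (auto simp: is_model_closed)
  then show ?thesis using M by blast
qed

end

section \<open>Reductions\<close>

text \<open>In a reduction of \<open>\<phi>\<close> to \<open>\<psi>\<close>, the calculus leads from \<open>\<phi>\<close> to \<open>\<psi>\<close>, but only truth has to lead
  back from \<open>\<psi>\<close> to \<open>\<phi>\<close>. On the way back only models on the type \<open>'u\<close> are considered, over which the
  semantic consequence of the theorem ranges.\<close>

definition refines :: "'u itself \<Rightarrow> ('f, 'p, 'v) fm \<Rightarrow> ('f, 'p, 'v) fm \<Rightarrow> bool" where
  "refines U \<psi> \<phi> \<longleftrightarrow> (\<forall>(M :: ('f, 'p, 'u) model) X. univ M \<noteq> {} \<longrightarrow> sat M X \<psi> \<longrightarrow> sat M X \<phi>)"

lemma refinesI: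
  "(\<And>(M :: ('f, 'p, 'u) model) X. univ M \<noteq> {} \<Longrightarrow> sat M X \<psi> \<Longrightarrow> sat M X \<phi>) \<Longrightarrow> refines (U :: 'u itself) \<psi> \<phi>"
  by (simp add: refines_def)

locale dep_logic_sem = dep_logic L V for L :: "('f, 'p) vocab" and V :: "'v itself" +
  fixes U :: "'u itself"
begin

definition red :: "('f, 'p, 'v) fm \<Rightarrow> ('f, 'p, 'v) fm \<Rightarrow> bool" (infix "\<leadsto>" 50) where
  "\<phi> \<leadsto> \<psi> \<longleftrightarrow> pv \<phi> \<psi> \<and> refines U \<psi> \<phi>"

lemma red_KV: "\<phi> \<leadsto> \<psi> \<Longrightarrow> KV \<phi>" "\<phi> \<leadsto> \<psi> \<Longrightarrow> KV \<psi>"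
  using pv_KV by (auto simp: red_def)

lemma red_refl: "KV \<phi> \<Longrightarrow> \<phi> \<leadsto> \<phi>"
  by (simp add: red_def pv_refl refines_def)

lemma red_trans [trans]: "\<phi> \<leadsto> \<psi> \<Longrightarrow> \<psi> \<leadsto> \<chi> \<Longrightarrow> \<phi> \<leadsto> \<chi>"
  using pv_trans[of \<phi> \<psi> \<chi>] by (simp add: red_def refines_def)

lemma red_and: "\<phi> \<leadsto> \<phi>' \<Longrightarrow> \<psi> \<leadsto> \<psi>' \<Longrightarrow> And \<phi> \<psi> \<leadsto> And \<phi>' \<psi>'"
  using pv_and_mono[of \<phi> \<phi>' \<psi> \<psi>'] by (simp add: red_def refines_def)

lemma red_or: "\<phi> \<leadsto> \<phi>' \<Longrightarrow> \<psi> \<leadsto> \<psi>' \<Longrightarrow> Or \<phi> \<psi> \<leadsto> Or \<phi>' \<psi>'"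
  using pv_or_mono[of \<phi> \<phi>' \<psi> \<psi>'] unfolding red_def refines_def sat.simps by (metis (no_types))

lemma red_ex: "\<phi> \<leadsto> \<phi>' \<Longrightarrow> Ex x \<phi> \<leadsto> Ex x \<phi>'"
  using pv_ex_mono[of \<phi> \<phi>' x] unfolding red_def refines_def sat.simps by (metis (no_types))

lemma red_all: "\<phi> \<leadsto> \<phi>' \<Longrightarrow> All x \<phi> \<leadsto> All x \<phi>'"
  using pv_all_mono[of \<phi> \<phi>' x] by (simp add: red_def refines_def)

lemma red_Exs: "\<phi> \<leadsto> \<phi>' \<Longrightarrow> Exs xs \<phi> \<leadsto> Exs xs \<phi>'"
  by (induction xs) (simp_all add: red_ex)

text \<open>Between first-order formulas, logical equivalence is enough. The two directions refer to
  different models: completeness is about models on the natural numbers, refinement about models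
  on \<open>'u\<close>.\<close>

lemma red_fo:
  assumes "first_order \<phi>" "first_order \<psi>" "KV \<phi>" "KV \<psi>"
    and "\<And>(M :: ('f, 'p, nat) model) e. univ M \<noteq> {} \<Longrightarrow> fsat M e \<phi> \<Longrightarrow> fsat M e \<psi>"
    and "\<And>(M :: ('f, 'p, 'u) model) e. univ M \<noteq> {} \<Longrightarrow> fsat M e \<psi> \<Longrightarrow> fsat M e \<phi>"
  shows "\<phi> \<leadsto> \<psi>"
proof -
  have "{\<phi>} \<turnstile> \<psi>"
    by (rule completeness) (use assms(1-4) in \<open>auto intro!: assms(5) simp: closed_model_def\<close>)
  moreover have "refines U \<psi> \<phi>"
    by (rule refinesI) (use assms in \<open>auto simp: flat\<close>)
  ultimately show ?thesis using assms by (simp add: red_def pv_def)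
qed

lemma red_and_comm: "KV \<phi> \<Longrightarrow> KV \<psi> \<Longrightarrow> And \<phi> \<psi> \<leadsto> And \<psi> \<phi>"
  using pv_andI[OF pv_and2 pv_and1, of \<phi> \<psi>] by (simp add: red_def refines_def)

lemma red_or_comm: "KV \<phi> \<Longrightarrow> KV \<psi> \<Longrightarrow> Or \<phi> \<psi> \<leadsto> Or \<psi> \<phi>"
  using pv_or_comm[of \<phi> \<psi>] unfolding red_def refines_def sat.simps by (metis (no_types) Un_commute)

lemma red_and_ex:
  assumes "KV \<phi>" "KV \<psi>" "x \<notin> Fv \<psi>" shows "And (Ex x \<phi>) \<psi> \<leadsto> Ex x (And \<phi> \<psi>)"
  unfolding red_def
proof
  show "refines U (Ex x (And \<phi> \<psi>)) (And (Ex x \<phi>) \<psi>)"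
  proof (rule refinesI)
    fix M :: "('f, 'p, 'u) model" and X assume "sat M X (Ex x (And \<phi> \<psi>))"
    then obtain F where F: "\<forall>s \<in> X. F s \<noteq> {} \<and> F s \<subseteq> univ M" "sat M (supp X F x) \<phi>" "sat M (supp X F x) \<psi>"
      by auto
    have "sat M X \<psi>"
    proof (rule sat_local[OF KV_D[OF assms(2)] _ F(3)])
      fix s assume s: "s \<in> X"
      then obtain a where "a \<in> F s" using F(1) by blast
      then have "s(x \<mapsto> a) \<in> supp X F x" using s by (auto simp: supp_def)
      then show "\<exists>t \<in> supp X F x. \<forall>z \<in> Fv \<psi>. the (s z) = the (t z)"
        by (rule rev_bexI) (use assms(3) in auto)
    qed
    then show "sat M X (And (Ex x \<phi>) \<psi>)" using F by auto
  qed
qed (rule pv_Ex_and[OF assms])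

lemma red_and_all:
  assumes "KV \<phi>" "KV \<psi>" "x \<notin> Fv \<psi>" shows "And (All x \<phi>) \<psi> \<leadsto> All x (And \<phi> \<psi>)"
  unfolding red_def
proof
  show "refines U (All x (And \<phi> \<psi>)) (And (All x \<phi>) \<psi>)"
  proof (rule refinesI)
    fix M :: "('f, 'p, 'u) model" and X assume ne: "univ M \<noteq> {}" and "sat M X (All x (And \<phi> \<psi>))"
    then have F: "sat M (supp X (\<lambda>_. univ M) x) \<phi>" "sat M (supp X (\<lambda>_. univ M) x) \<psi>" by auto
    have "sat M X \<psi>"
    proof (rule sat_local[OF KV_D[OF assms(2)] _ F(2)])
      fix s assume s: "s \<in> X"
      from ne obtain a where "a \<in> univ M" by blast
      then have "s(x \<mapsto> a) \<in> supp X (\<lambda>_. univ M) x" using s by (auto simp: supp_def)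
      then show "\<exists>t \<in> supp X (\<lambda>_. univ M) x. \<forall>z \<in> Fv \<psi>. the (s z) = the (t z)"
        by (rule rev_bexI) (use assms(3) in auto)
    qed
    then show "sat M X (And (All x \<phi>) \<psi>)" using F by auto
  qed
qed (rule pv_All_and[OF assms])

lemma red_or_ex:
  assumes "KV \<phi>" "KV \<psi>" "x \<notin> Fv \<psi>" shows "Or (Ex x \<phi>) \<psi> \<leadsto> Ex x (Or \<phi> \<psi>)"
  unfolding red_def
proof
  have "{Or (Ex x \<phi>) \<psi>} \<turnstile> Ex x (Or \<phi> \<psi>)"
    by (rule derives.ex_scope[OF ax1]) (use assms in simp_all)
  then show "pv (Or (Ex x \<phi>) \<psi>) (Ex x (Or \<phi> \<psi>))" using assms by (simp add: pv_def)
  show "refines U (Ex x (Or \<phi> \<psi>)) (Or (Ex x \<phi>) \<psi>)"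
  proof (rule refinesI)
    fix M :: "('f, 'p, 'u) model" and X assume "sat M X (Ex x (Or \<phi> \<psi>))"
    then obtain F Y Z where F0: "\<forall>s \<in> X. F s \<noteq> {} \<and> F s \<subseteq> univ M"
      and YZ: "supp X F x = Y \<union> Z" "sat M Y \<phi>" "sat M Z \<psi>" by auto
    have F: "F s \<noteq> {} \<and> F s \<subseteq> univ M" if "s \<in> X" for s using F0 that by blast
    \<comment> \<open>As \<open>F s\<close> may have several elements, an assignment can go to both disjuncts.\<close>
    let ?F = "\<lambda>s. {a \<in> F s. s(x \<mapsto> a) \<in> Y}"
    let ?Y = "{s \<in> X. ?F s \<noteq> {}}" and ?Z = "{s \<in> X. \<exists>a. s(x \<mapsto> a) \<in> Z}"
    have "X = ?Y \<union> ?Z"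
    proof -
      have "s \<in> ?Y \<union> ?Z" if s: "s \<in> X" for s
      proof -
        from F[OF s] obtain a where a: "a \<in> F s" by blast
        then have "s(x \<mapsto> a) \<in> Y \<union> Z" using s unfolding YZ(1)[symmetric] supp_def by blast
        then show ?thesis using s a by blast
      qed
      then show ?thesis by blast
    qed
    moreover have "sat M ?Y (Ex x \<phi>)"
    proof (rule sat_ExI[where F = ?F])
      show "sat M (supp ?Y ?F x) \<phi>"
      proof (rule sat_local[OF KV_D[OF assms(1)] _ YZ(2)])
        fix s assume "s \<in> supp ?Y ?F x"
        then have "s \<in> Y" by (auto simp: supp_def)
        then show "\<exists>t \<in> Y. \<forall>z \<in> Fv \<phi>. the (s z) = the (t z)" by blast
      qed
    qed (use F in blast)
    moreover have "sat M ?Z \<psi>"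
    proof (rule sat_local[OF KV_D[OF assms(2)] _ YZ(3)])
      fix s assume "s \<in> ?Z"
      then obtain a where "s(x \<mapsto> a) \<in> Z" by blast
      then show "\<exists>t \<in> Z. \<forall>z \<in> Fv \<psi>. the (s z) = the (t z)"
        by (rule rev_bexI) (use assms(3) in auto)
    qed
    ultimately show "sat M X (Or (Ex x \<phi>) \<psi>)" by (rule sat_OrI)
  qed
qed

text \<open>Whether \<open>y = z\<close> records which disjunct an assignment is sent to. For the way back: if
  the values of \<open>y\<close> and \<open>z\<close> coincide, all extensions by \<open>x\<close> are on the side of \<open>\<phi>\<close>; otherwise all
  are on the side of \<open>\<psi>\<close>, which does not depend on \<open>x\<close>.\<close>

lemma red_or_all:
  assumes "KV \<phi>" "KV \<psi>" "x \<notin> Fv \<psi>" "distinct [x, y, z]" "{y, z} \<inter> (vars \<phi> \<union> vars \<psi>) = {}"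
  shows "Or (All x \<phi>) \<psi> \<leadsto> Ex y (Ex z (All x
    (Or (And \<phi> (Eq (Var y) (Var z))) (And \<psi> (Neg (Eq (Var y) (Var z)))))))" (is "_ \<leadsto> ?\<chi>")
  unfolding red_def
proof
  have "{Or (All x \<phi>) \<psi>} \<turnstile> ?\<chi>"
    by (rule derives.all_scope[OF ax1]) (use assms in simp_all)
  then show "pv (Or (All x \<phi>) \<psi>) ?\<chi>" using assms by (simp add: pv_def)
  show "refines U ?\<chi> (Or (All x \<phi>) \<psi>)"
  proof (rule refinesI)
    fix M :: "('f, 'p, 'u) model" and X assume ne: "univ M \<noteq> {}" and "sat M X ?\<chi>"
    then obtain F G A B where F0: "\<forall>s \<in> X. F s \<noteq> {} \<and> F s \<subseteq> univ M"
      and G0: "\<forall>s \<in> supp X F y. G s \<noteq> {} \<and> G s \<subseteq> univ M"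
      and AB: "supp (supp (supp X F y) G z) (\<lambda>_. univ M) x = A \<union> B"
      "sat M A \<phi>" "sat M A (Eq (Var y) (Var z))" "sat M B \<psi>" "sat M B (Neg (Eq (Var y) (Var z)))"
      unfolding sat.simps(5-8) by blast
    have F: "F s \<noteq> {} \<and> F s \<subseteq> univ M" if "s \<in> X" for s using F0 that by blast
    have G: "G s \<noteq> {} \<and> G s \<subseteq> univ M" if "s \<in> supp X F y" for s using G0 that by blast
    have A: "the (s y) = the (s z)" if "s \<in> A" for s using AB(3) that by simp
    have B: "the (s y) \<noteq> the (s z)" if "s \<in> B" for s using AB(5) that by simp
    have ext: "\<exists>b c. (\<forall>a \<in> univ M. s(y \<mapsto> b, z \<mapsto> c, x \<mapsto> a) \<in> A \<union> B)" if s: "s \<in> X" for s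
    proof -
      from F[OF s] obtain b where b: "b \<in> F s" by blast
      then have sb: "s(y \<mapsto> b) \<in> supp X F y" using s by (auto simp: supp_def)
      from G[OF this] obtain c where c: "c \<in> G (s(y \<mapsto> b))" by blast
      then have "s(y \<mapsto> b, z \<mapsto> c) \<in> supp (supp X F y) G z" using sb unfolding supp_def[of "supp X F y"] by blast
      then have "s(y \<mapsto> b, z \<mapsto> c, x \<mapsto> a) \<in> A \<union> B" if "a \<in> univ M" for a
        using that unfolding AB(1)[symmetric] supp_def[of "supp (supp X F y) G z"] by blast
      then show ?thesis by blast
    qed
    let ?P = "\<lambda>s. \<exists>b. \<forall>a \<in> univ M. s(y \<mapsto> b, z \<mapsto> b, x \<mapsto> a) \<in> A"
    let ?Y = "{s \<in> X. ?P s}" and ?Z = "{s \<in> X. \<not> ?P s}"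
    have "X = ?Y \<union> ?Z" by blast
    moreover have "sat M ?Y (All x \<phi>)"
      unfolding sat.simps
    proof (rule sat_local[OF KV_D[OF assms(1)] _ AB(2)])
      fix t assume "t \<in> supp ?Y (\<lambda>_. univ M) x"
      then obtain s a where t: "t = s(x \<mapsto> a)" "s \<in> ?Y" "a \<in> univ M" unfolding supp_def by blast
      then obtain b where "s(y \<mapsto> b, z \<mapsto> b, x \<mapsto> a) \<in> A" by blast
      then show "\<exists>r \<in> A. \<forall>v \<in> Fv \<phi>. the (t v) = the (r v)"
        by (rule rev_bexI) (use t assms(4,5) in \<open>auto simp: vars_eq\<close>)
    qed
    moreover have "sat M ?Z \<psi>"
    proof (rule sat_local[OF KV_D[OF assms(2)] _ AB(4)])
      fix s assume s: "s \<in> ?Z"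
      then obtain b c where bc: "\<forall>a \<in> univ M. s(y \<mapsto> b, z \<mapsto> c, x \<mapsto> a) \<in> A \<union> B" using ext by blast
      have "\<exists>a \<in> univ M. s(y \<mapsto> b, z \<mapsto> c, x \<mapsto> a) \<in> B"
      proof (rule ccontr)
        assume "\<not> ?thesis"
        then have inA: "\<forall>a \<in> univ M. s(y \<mapsto> b, z \<mapsto> c, x \<mapsto> a) \<in> A" using bc by blast
        obtain a where "a \<in> univ M" using ne by blast
        then have "b = c" using A[of "s(y \<mapsto> b, z \<mapsto> c, x \<mapsto> a)"] inA assms(4) by auto
        then show False using inA s by blast
      qed
      then obtain a where "s(y \<mapsto> b, z \<mapsto> c, x \<mapsto> a) \<in> B" by blast
      then show "\<exists>t \<in> B. \<forall>v \<in> Fv \<psi>. the (s v) = the (t v)"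
        by (rule rev_bexI) (use assms(3-5) in \<open>auto simp: vars_eq\<close>)
    qed
    ultimately show "sat M X (Or (All x \<phi>) \<psi>)" by (rule sat_OrI)
  qed
qed

end

section \<open>Prenex form\<close>

subsection \<open>Negations in front of atoms only\<close>

text \<open>The negation normal form of \<open>\<phi>\<close> for \<open>b = True\<close>, and of \<open>\<not>\<phi>\<close> for \<open>b = False\<close>.\<close>

primrec nnf :: "('f, 'p, 'v) fm \<Rightarrow> bool \<Rightarrow> ('f, 'p, 'v) fm" where
  "nnf (Eq t u) b = (if b then Eq t u else Neg (Eq t u))"
| "nnf (Rel p ts) b = (if b then Rel p ts else Neg (Rel p ts))"
| "nnf (Dep ts us) b = Dep ts us"
| "nnf (Neg \<phi>) b = nnf \<phi> (\<not> b)"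
| "nnf (And \<phi> \<psi>) b = (if b then And (nnf \<phi> b) (nnf \<psi> b) else Or (nnf \<phi> b) (nnf \<psi> b))"
| "nnf (Or \<phi> \<psi>) b = (if b then Or (nnf \<phi> b) (nnf \<psi> b) else And (nnf \<phi> b) (nnf \<psi> b))"
| "nnf (Ex x \<phi>) b = (if b then Ex x (nnf \<phi> b) else All x (nnf \<phi> b))"
| "nnf (All x \<phi>) b = (if b then All x (nnf \<phi> b) else Ex x (nnf \<phi> b))"

primrec push_neg :: "('f, 'p, 'v) fm \<Rightarrow> ('f, 'p, 'v) fm" where
  "push_neg (Eq t u) = Eq t u"
| "push_neg (Rel p ts) = Rel p ts"
| "push_neg (Dep ts us) = Dep ts us"
| "push_neg (Neg \<phi>) = nnf \<phi> False"
| "push_neg (And \<phi> \<psi>) = And (push_neg \<phi>) (push_neg \<psi>)"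
| "push_neg (Or \<phi> \<psi>) = Or (push_neg \<phi>) (push_neg \<psi>)"
| "push_neg (Ex x \<phi>) = Ex x (push_neg \<phi>)"
| "push_neg (All x \<phi>) = All x (push_neg \<phi>)"

primrec inner_neg :: "('f, 'p, 'v) fm \<Rightarrow> bool" where
  "inner_neg (Eq t u) \<longleftrightarrow> True"
| "inner_neg (Rel p ts) \<longleftrightarrow> True"
| "inner_neg (Dep ts us) \<longleftrightarrow> True"
| "inner_neg (Neg \<phi>) \<longleftrightarrow> first_order \<phi> \<and> quantifier_free \<phi>"
| "inner_neg (And \<phi> \<psi>) \<longleftrightarrow> inner_neg \<phi> \<and> inner_neg \<psi>"
| "inner_neg (Or \<phi> \<psi>) \<longleftrightarrow> inner_neg \<phi> \<and> inner_neg \<psi>"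
| "inner_neg (Ex x \<phi>) \<longleftrightarrow> inner_neg \<phi>"
| "inner_neg (All x \<phi>) \<longleftrightarrow> inner_neg \<phi>"

text \<open>Negated formulas have complexity 0 because they are left as they are in the prenex form.\<close>

primrec complexity :: "('f, 'p, 'v) fm \<Rightarrow> nat" where
  "complexity (Eq t u) = 0"
| "complexity (Rel p ts) = 0"
| "complexity (Dep ts us) = 0"
| "complexity (Neg \<phi>) = 0"
| "complexity (And \<phi> \<psi>) = Suc (complexity \<phi> + complexity \<psi>)"
| "complexity (Or \<phi> \<psi>) = Suc (complexity \<phi> + complexity \<psi>)"
| "complexity (Ex x \<phi>) = Suc (complexity \<phi>)"
| "complexity (All x \<phi>) = Suc (complexity \<phi>)"

lemma complexity_subst [simp]: "complexity (subst_fm \<theta> \<phi>) = complexity \<phi>"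
  by (induction \<phi> arbitrary: \<theta>) auto

lemma inner_neg_subst [simp]: "inner_neg (subst_fm \<theta> \<phi>) = inner_neg \<phi>"
  by (induction \<phi> arbitrary: \<theta>) auto

lemma nnf_props:
  "first_order \<phi> \<Longrightarrow> first_order (nnf \<phi> b) \<and> inner_neg (nnf \<phi> b) \<and> (KV_formula L \<phi> \<longrightarrow> KV_formula L (nnf \<phi> b))"
  by (induction \<phi> arbitrary: b) simp_all

lemma nnf_fsat: "first_order \<phi> \<Longrightarrow> fsat M e (nnf \<phi> b) \<longleftrightarrow> (fsat M e \<phi> \<longleftrightarrow> b)"
proof (induction \<phi> arbitrary: b e)
  case (Neg \<phi>)
  then show ?case by auto
qed simp_all

lemma nnf_Fv: "Fv (nnf \<phi> b) = Fv \<phi>"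
  by (induction \<phi> arbitrary: b) simp_all

lemma push_neg_props: "KV_formula L \<phi> \<Longrightarrow> inner_neg (push_neg \<phi>) \<and> Fv (push_neg \<phi>) = Fv \<phi>"
  by (induction \<phi>) (simp_all add: nnf_props nnf_Fv)

subsection \<open>Quantifier prefixes and matrices\<close>

primrec Qs :: "(bool \<times> 'v) list \<Rightarrow> ('f, 'p, 'v) fm \<Rightarrow> ('f, 'p, 'v) fm" where
  "Qs [] \<phi> = \<phi>"
| "Qs (q # Q) \<phi> = (if fst q then All (snd q) (Qs Q \<phi>) else Ex (snd q) (Qs Q \<phi>))"

definition allv :: "(bool \<times> 'v) list \<Rightarrow> 'v list" where
  "allv Q = map snd (filter fst Q)"

definition exv :: "(bool \<times> 'v) list \<Rightarrow> 'v list" where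
  "exv Q = map snd (filter (\<lambda>q. \<not> fst q) Q)"

lemma exv_simps [simp]:
  "exv [] = []" "exv (q # Q) = (if fst q then exv Q else snd q # exv Q)" "exv (Q @ Q') = exv Q @ exv Q'"
  by (simp_all add: exv_def)

lemma allv_simps [simp]:
  "allv [] = []" "allv (q # Q) = (if fst q then snd q # allv Q else allv Q)"
  by (simp_all add: allv_def)

lemma Qs_append: "Qs (Q @ Q') \<phi> = Qs Q (Qs Q' \<phi>)"
  by (induction Q) auto

lemma Qs_props [simp]:
  "KV_formula L (Qs Q \<phi>) = KV_formula L \<phi>" "Fv (Qs Q \<phi>) = Fv \<phi> - snd ` set Q"
  by (induction Q) auto

text \<open>Quantifier-free formulas whose dependence atoms are determined by variables. The order of
  these variables is that of \<open>ys\<close>, because dependence elimination applies to atoms whose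
  determining variables form a subsequence of the quantifier prefix.\<close>

primrec is_matrix :: "'v list \<Rightarrow> ('f, 'p, 'v) fm \<Rightarrow> bool" where
  "is_matrix ys (Eq t u) \<longleftrightarrow> True"
| "is_matrix ys (Rel p ts) \<longleftrightarrow> True"
| "is_matrix ys (Dep ts us) \<longleftrightarrow> (\<exists>vs. ts = map Var vs \<and> subseq vs ys)"
| "is_matrix ys (Neg \<phi>) \<longleftrightarrow> first_order \<phi> \<and> quantifier_free \<phi>"
| "is_matrix ys (And \<phi> \<psi>) \<longleftrightarrow> is_matrix ys \<phi> \<and> is_matrix ys \<psi>"
| "is_matrix ys (Or \<phi> \<psi>) \<longleftrightarrow> is_matrix ys \<phi> \<and> is_matrix ys \<psi>"
| "is_matrix ys (Ex x \<phi>) \<longleftrightarrow> False"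
| "is_matrix ys (All x \<phi>) \<longleftrightarrow> False"

lemma is_matrix_mono: "is_matrix ys \<theta> \<Longrightarrow> subseq ys ys' \<Longrightarrow> is_matrix ys' \<theta>"
  by (induction \<theta>) (auto intro: subseq_order.order_trans)

lemma is_matrix_fo: "first_order \<theta> \<Longrightarrow> quantifier_free \<theta> \<Longrightarrow> is_matrix ys \<theta>"
  by (induction \<theta>) auto

text \<open>Side formulas arise one by one and are added on the right; with nesting to the left this is done
  without reassociating.\<close>

abbreviation ands :: "('f, 'p, 'v) fm \<Rightarrow> ('f, 'p, 'v) fm list \<Rightarrow> ('f, 'p, 'v) fm" where
  "ands \<equiv> foldl And"

lemma ands_props:
  "KV_formula L (ands \<theta> es) \<longleftrightarrow> KV_formula L \<theta> \<and> (\<forall>e \<in> set es. KV_formula L e)"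
  "Fv (ands \<theta> es) = Fv \<theta> \<union> (\<Union>e \<in> set es. Fv e)"
  "is_matrix ys (ands \<theta> es) \<longleftrightarrow> is_matrix ys \<theta> \<and> (\<forall>e \<in> set es. is_matrix ys e)"
  by (induction es arbitrary: \<theta>) auto

definition qf_fo :: "('f, 'p) vocab \<Rightarrow> ('f, 'p, 'v) fm \<Rightarrow> bool" where
  "qf_fo L e \<longleftrightarrow> first_order e \<and> quantifier_free e \<and> KV_formula L e"

lemma KV_Dep: "KV_formula L (Dep ts us) \<longleftrightarrow> (\<forall>t \<in> set ts \<union> set us. wf_tm L t) \<and> length us = 1"
  by (simp add: KV_formula_def)

context dep_logic_sem
begin

lemma red_push_neg: "KV \<phi> \<Longrightarrow> \<phi> \<leadsto> push_neg \<phi>"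
proof (induction \<phi>)
  case (Neg \<phi>)
  have fo: "first_order \<phi>" "KV \<phi>" using Neg.prems by simp_all
  show ?case
    by (rule red_fo) (use fo nnf_props[OF fo(1), of False L] in \<open>simp_all add: nnf_fsat\<close>)
qed (simp_all add: red_refl red_and red_or red_ex red_all)

lemma red_Qs: "\<phi> \<leadsto> \<psi> \<Longrightarrow> Qs Q \<phi> \<leadsto> Qs Q \<psi>"
  by (induction Q) (simp_all add: red_ex red_all)

lemma red_and_Qs:
  assumes "KV \<phi>" "KV \<psi>" "snd ` set Q \<inter> Fv \<psi> = {}"
  shows "And (Qs Q \<phi>) \<psi> \<leadsto> Qs Q (And \<phi> \<psi>)"
  using assms(3)
proof (induction Q)
  case (Cons q Q)
  have IH: "And (Qs Q \<phi>) \<psi> \<leadsto> Qs Q (And \<phi> \<psi>)" using Cons by simp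
  have x: "snd q \<notin> Fv \<psi>" using Cons.prems by auto
  have k: "KV (Qs Q \<phi>)" using assms by simp
  show ?case
  proof (cases "fst q")
    case True
    then show ?thesis using red_trans[OF red_and_all[OF k assms(2) x] red_all[OF IH]] by simp
  next
    case False
    then show ?thesis using red_trans[OF red_and_ex[OF k assms(2) x] red_ex[OF IH]] by simp
  qed
qed (use assms in \<open>simp add: red_refl\<close>)

lemma red_ands: "\<phi> \<leadsto> \<psi> \<Longrightarrow> \<forall>e \<in> set es. KV e \<Longrightarrow> ands \<phi> es \<leadsto> ands \<psi> es"
  by (induction es arbitrary: \<phi> \<psi>) (simp_all add: red_and red_refl)

lemma red_ands_Qs:
  "KV \<phi> \<Longrightarrow> \<forall>e \<in> set es. KV e \<and> snd ` set Q \<inter> Fv e = {} \<Longrightarrow> ands (Qs Q \<phi>) es \<leadsto> Qs Q (ands \<phi> es)"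
proof (induction es arbitrary: \<phi>)
  case (Cons e es)
  have "ands (And (Qs Q \<phi>) e) es \<leadsto> ands (Qs Q (And \<phi> e)) es"
    by (rule red_ands[OF red_and_Qs]) (use Cons.prems in simp_all)
  also have "\<dots> \<leadsto> Qs Q (ands (And \<phi> e) es)" by (rule Cons.IH) (use Cons.prems in simp_all)
  finally show ?case by simp
qed (simp add: red_refl)

text \<open>A prefix pulled out of the first disjunct of a disjunction. Each \<open>\<forall>\<close> that passes the
  disjunction creates two existential variables and marks both disjuncts with an equation or an
  inequation between them; these are the side formulas \<open>es\<close> and \<open>ds\<close>. New variables avoid \<open>A\<close>.\<close>

definition or_split where
  "or_split Q \<phi> \<psi> A Q' es ds \<longleftrightarrow> Or (Qs Q \<phi>) \<psi> \<leadsto> Qs Q' (Or (ands \<phi> es) (ands \<psi> ds)) \<and>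
    (\<forall>e \<in> set es \<union> set ds. qf_fo L e \<and> Fv e \<subseteq> snd ` set Q') \<and> distinct (map snd Q') \<and>
    snd ` set Q' \<subseteq> snd ` set Q \<union> - A \<and> snd ` set Q \<subseteq> snd ` set Q' \<and> subseq (exv Q) (exv Q')"

lemma red_or_Qs:
  assumes "KV \<phi>" "KV \<psi>" "distinct (map snd Q)" "snd ` set Q \<inter> Fv \<psi> = {}" "finite A"
  shows "\<exists>Q' es ds. or_split Q \<phi> \<psi> A Q' es ds"
  using assms
proof (induction Q arbitrary: \<phi> \<psi> A)
  case Nil
  then show ?case
    by (intro HOL.exI[of _ "[]"]) (simp add: red_refl or_split_def)
next
  case (Cons q Q)
  let ?x = "snd q"
  have x: "?x \<notin> Fv \<psi>" "?x \<notin> snd ` set Q" using Cons.prems by auto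
  show ?case
  proof (cases "fst q")
    case False
    have "finite (insert ?x A)" using Cons.prems by simp
    from Cons.IH[OF Cons.prems(1,2) _ _ this] Cons.prems obtain Q' es ds where
      "or_split Q \<phi> \<psi> (insert ?x A) Q' es ds" by auto
    then have
      r: "Or (Qs Q \<phi>) \<psi> \<leadsto> Qs Q' (Or (ands \<phi> es) (ands \<psi> ds))"
      and es: "\<forall>e \<in> set es \<union> set ds. qf_fo L e \<and> Fv e \<subseteq> snd ` set Q'"
      and Q': "distinct (map snd Q')" "snd ` set Q' \<subseteq> snd ` set Q \<union> - insert ?x A" "subseq (exv Q) (exv Q')"
        "snd ` set Q \<subseteq> snd ` set Q'"
      unfolding or_split_def by simp_all
    have "Or (Ex ?x (Qs Q \<phi>)) \<psi> \<leadsto> Ex ?x (Or (Qs Q \<phi>) \<psi>)"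
      by (rule red_or_ex) (use Cons.prems x in simp_all)
    also have "\<dots> \<leadsto> Ex ?x (Qs Q' (Or (ands \<phi> es) (ands \<psi> ds)))" by (rule red_ex[OF r])
    finally have "Or (Qs (q # Q) \<phi>) \<psi> \<leadsto> Qs (q # Q') (Or (ands \<phi> es) (ands \<psi> ds))" using False by simp
    moreover have "\<forall>e \<in> set es \<union> set ds. qf_fo L e \<and> Fv e \<subseteq> snd ` set (q # Q')" using es by auto
    moreover have "distinct (map snd (q # Q'))" using Q' x by auto
    moreover have "snd ` set (q # Q') \<subseteq> snd ` set (q # Q) \<union> - A" using Q' by auto
    moreover have "snd ` set (q # Q) \<subseteq> snd ` set (q # Q')" using Q' by auto
    moreover have "subseq (exv (q # Q)) (exv (q # Q'))" using Q' False by simp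
    ultimately show ?thesis unfolding or_split_def by blast
  next
    case True
    have "finite (A \<union> vars (Qs Q \<phi>) \<union> vars \<psi> \<union> snd ` set (q # Q))" using Cons.prems by simp
    from fresh_list[OF this, of 2] obtain yz where yz: "length yz = 2" "distinct yz"
      "set yz \<inter> (A \<union> vars (Qs Q \<phi>) \<union> vars \<psi> \<union> snd ` set (q # Q)) = {}" by blast
    then obtain y z where e: "yz = [y, z]" by (auto simp: numeral_2_eq_2 length_Suc_conv)
    let ?e = "Eq (Var y) (Var z)" and ?d = "Neg (Eq (Var y) (Var z))"
    have fin: "finite (insert ?x (insert y (insert z A)))" using Cons.prems by simp
    have "\<exists>Q' es ds. or_split Q (And \<phi> ?e) (And \<psi> ?d) (insert ?x (insert y (insert z A))) Q' es ds"
      by (rule Cons.IH[OF _ _ _ _ fin]) (use Cons.prems yz e in auto)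
    then obtain Q' es ds where
      "or_split Q (And \<phi> ?e) (And \<psi> ?d) (insert ?x (insert y (insert z A))) Q' es ds" by blast
    then have
      r: "Or (Qs Q (And \<phi> ?e)) (And \<psi> ?d) \<leadsto> Qs Q' (Or (ands (And \<phi> ?e) es) (ands (And \<psi> ?d) ds))"
      and es: "\<forall>e \<in> set es \<union> set ds. qf_fo L e \<and> Fv e \<subseteq> snd ` set Q'"
      and Q': "distinct (map snd Q')" "snd ` set Q' \<subseteq> snd ` set Q \<union> - (insert ?x (insert y (insert z A)))"
        "subseq (exv Q) (exv Q')" "snd ` set Q \<subseteq> snd ` set Q'"
      unfolding or_split_def by simp_all
    have "Or (All ?x (Qs Q \<phi>)) \<psi> \<leadsto> Ex y (Ex z (All ?x (Or (And (Qs Q \<phi>) ?e) (And \<psi> ?d))))"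
      by (rule red_or_all) (use Cons.prems x yz e in auto)
    also have "\<dots> \<leadsto> Ex y (Ex z (All ?x (Or (Qs Q (And \<phi> ?e)) (And \<psi> ?d))))"
      by (intro red_ex red_all red_or red_and_Qs red_refl) (use Cons.prems yz e in auto)
    also have "\<dots> \<leadsto> Ex y (Ex z (All ?x (Qs Q' (Or (ands (And \<phi> ?e) es) (ands (And \<psi> ?d) ds)))))"
      by (intro red_ex red_all r)
    finally have "Or (Qs (q # Q) \<phi>) \<psi> \<leadsto>
      Qs ((False, y) # (False, z) # q # Q') (Or (ands \<phi> (?e # es)) (ands \<psi> (?d # ds)))" using True by simp
    moreover have "\<forall>e \<in> set (?e # es) \<union> set (?d # ds). qf_fo L e \<and>
        Fv e \<subseteq> snd ` set ((False, y) # (False, z) # q # Q')"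
      using es by (auto simp: qf_fo_def)
    moreover have "distinct (map snd ((False, y) # (False, z) # q # Q'))" using Q' x yz e by auto
    moreover have "snd ` set ((False, y) # (False, z) # q # Q') \<subseteq> snd ` set (q # Q) \<union> - A"
      using Q' yz e by auto
    moreover have "snd ` set (q # Q) \<subseteq> snd ` set ((False, y) # (False, z) # q # Q')" using Q' by auto
    moreover have "subseq (exv (q # Q)) (exv ((False, y) # (False, z) # q # Q'))"
      using Q'(3) True by simp (intro list_emb_Cons)
    ultimately show ?thesis unfolding or_split_def by blast
  qed
qed

subsection \<open>Renaming, unnesting\<close>

lemma rename_ex:
  assumes "KV \<phi>" "v \<notin> vars \<phi>"
  shows "Ex x \<phi> \<leadsto> Ex v (subst_fm (single x (Var v)) \<phi>)" (is "_ \<leadsto> Ex v ?\<phi>")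
  unfolding red_def
proof
  have ff: "free_for (single x (Var v)) \<phi>" using assms(2) by (rule free_for_single_fresh)
  have KVs: "KV ?\<phi>" using assms(1) by (rule KV_subst) simp
  have v: "v \<notin> Fv \<phi>" using assms(2) by (simp add: vars_eq)
  have "{Ex x \<phi>} \<turnstile> Ex v ?\<phi>"
  proof (rule derives.exE[OF ax1])
    show "insert ?\<phi> {Ex x \<phi>} \<turnstile> Ex v ?\<phi>"
      by (rule ex_intro_self[OF ax]) (use KVs assms in auto)
  qed (use assms ff v in simp_all)
  then show "pv (Ex x \<phi>) (Ex v ?\<phi>)" using KVs assms by (simp add: pv_def)
  show "refines U (Ex v ?\<phi>) (Ex x \<phi>)"
  proof (rule refinesI)
    fix M :: "('f, 'p, 'u) model" and X assume "sat M X (Ex v ?\<phi>)"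
    then obtain F where F: "\<forall>s \<in> X. F s \<noteq> {} \<and> F s \<subseteq> univ M" "sat M (supp X F v) ?\<phi>" by auto
    have "sat M (supp X F x) \<phi>"
    proof (rule sat_subst[OF KV_D[OF assms(1)] ff _ F(2)])
      fix t assume "t \<in> supp X F x"
      then obtain s a where t: "t = s(x \<mapsto> a)" "s \<in> X" "a \<in> F s" unfolding supp_def by blast
      have "s(v \<mapsto> a) \<in> supp X F v" using t unfolding supp_def by blast
      then show "\<exists>r \<in> supp X F v. \<forall>z \<in> Fv \<phi>. the (t z) = val M r (single x (Var v) z)"
        by (rule rev_bexI) (use t v in auto)
    qed
    then show "sat M X (Ex x \<phi>)" using F(1) by auto
  qed
qed

lemma rename_all:
  assumes "KV \<phi>" "v \<notin> vars \<phi>"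
  shows "All x \<phi> \<leadsto> All v (subst_fm (single x (Var v)) \<phi>)" (is "_ \<leadsto> All v ?\<phi>")
  unfolding red_def
proof
  have ff: "free_for (single x (Var v)) \<phi>" using assms(2) by (rule free_for_single_fresh)
  have KVs: "KV ?\<phi>" using assms(1) by (rule KV_subst) simp
  have v: "v \<notin> Fv \<phi>" using assms(2) by (simp add: vars_eq)
  have "{All x \<phi>} \<turnstile> ?\<phi>" by (rule derives.allE[OF ax1]) (use assms ff in simp_all)
  then have "{All x \<phi>} \<turnstile> All v ?\<phi>" by (rule derives.allI) (use v in simp)
  then show "pv (All x \<phi>) (All v ?\<phi>)" using KVs assms by (simp add: pv_def)
  show "refines U (All v ?\<phi>) (All x \<phi>)"
  proof (rule refinesI)
    fix M :: "('f, 'p, 'u) model" and X assume "sat M X (All v ?\<phi>)"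
    then have F: "sat M (supp X (\<lambda>_. univ M) v) ?\<phi>" by simp
    have "sat M (supp X (\<lambda>_. univ M) x) \<phi>"
    proof (rule sat_subst[OF KV_D[OF assms(1)] ff _ F])
      fix t assume "t \<in> supp X (\<lambda>_. univ M) x"
      then obtain s a where t: "t = s(x \<mapsto> a)" "s \<in> X" "a \<in> univ M" unfolding supp_def by blast
      have "s(v \<mapsto> a) \<in> supp X (\<lambda>_. univ M) v" using t unfolding supp_def by blast
      then show "\<exists>r \<in> supp X (\<lambda>_. univ M) v. \<forall>z \<in> Fv \<phi>. the (t z) = val M r (single x (Var v) z)"
        by (rule rev_bexI) (use t v in auto)
    qed
    then show "sat M X (All x \<phi>)" by simp
  qed
qed

lemma red_unnest1:
  assumes "KV (Dep ts [t])" "i < length ts" "z \<notin> vars (Dep ts [t] :: ('f, 'p, 'v) fm)"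
  shows "Dep ts [t] \<leadsto> Ex z (And (Dep (ts[i := Var z]) [t]) (Eq (Var z) (ts ! i)))" (is "_ \<leadsto> ?\<psi>")
  unfolding red_def
proof
  have "{Dep ts [t]} \<turnstile> ?\<psi>" by (rule derives.unnest1[OF ax1]) (use assms in simp_all)
  moreover have "set (ts[i := Var z]) \<subseteq> insert (Var z) (set ts)" by (rule set_update_subset_insert)
  then have "KV ?\<psi>" using assms(1,2) by (auto simp: KV_Dep)
  ultimately show "pv (Dep ts [t]) ?\<psi>" using assms by (simp add: pv_def)
  show "refines U ?\<psi> (Dep ts [t])"
  proof (rule refinesI)
    fix M :: "('f, 'p, 'u) model" and X assume "sat M X ?\<psi>"
    then obtain F where F: "\<forall>s \<in> X. F s \<noteq> {} \<and> F s \<subseteq> univ M"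
      "sat M (supp X F z) (Dep (ts[i := Var z]) [t])" "sat M (supp X F z) (Eq (Var z) (ts ! i))" by auto
    have inv: "val M (s(z \<mapsto> a)) r = val M s r" if "r \<in> insert t (set ts)" for r s a
      by (rule val_cong) (use that assms(3) in auto)
    have ext: "\<exists>a. s(z \<mapsto> a) \<in> supp X F z \<and>
        map (val M (s(z \<mapsto> a))) (ts[i := Var z]) = map (val M s) ts" if s: "s \<in> X" for s
    proof -
      from F(1) s obtain a where a: "a \<in> F s" by blast
      then have m: "s(z \<mapsto> a) \<in> supp X F z" using s unfolding supp_def by blast
      then have "a = val M (s(z \<mapsto> a)) (ts ! i)" using F(3) by auto
      also have "\<dots> = val M s (ts ! i)" by (rule inv) (use assms(2) in simp)
      finally have "a = val M s (ts ! i)" .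
      then have "map (val M (s(z \<mapsto> a))) (ts[i := Var z]) = map (val M s) ts"
        using inv assms(2) by (auto simp: list_eq_iff_nth_eq nth_list_update simp del: fun_upd_apply)
          (auto simp: nth_list_update)
      then show ?thesis using m by blast
    qed
    show "sat M X (Dep ts [t])" unfolding sat.simps
    proof (intro ballI impI)
      fix s s' assume s: "s \<in> X" "s' \<in> X" "map (val M s) ts = map (val M s') ts"
      from ext[OF s(1)] ext[OF s(2)] obtain a a' where
        a: "s(z \<mapsto> a) \<in> supp X F z" "s'(z \<mapsto> a') \<in> supp X F z"
        "map (val M (s(z \<mapsto> a))) (ts[i := Var z]) = map (val M (s'(z \<mapsto> a'))) (ts[i := Var z])"
        using s(3) by metis
      then have "map (val M (s(z \<mapsto> a))) [t] = map (val M (s'(z \<mapsto> a'))) [t]"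
        using F(2) unfolding sat.simps by blast
      then show "map (val M s) [t] = map (val M s') [t]" using inv by simp
    qed
  qed
qed

text \<open>The first \<open>length us\<close> determining terms are variables already. A later one is replaced by a
  fresh variable, which is quantified in front.\<close>

lemma unnest_all:
  assumes "KV (Dep (map Var us @ ts) [t])" "finite A"
  shows "\<exists>zs es. Dep (map Var us @ ts) [t] \<leadsto> Qs (map (Pair False) zs) (ands (Dep (map Var (us @ zs)) [t]) es) \<and>
    distinct zs \<and> set zs \<inter> (A \<union> Fv (Dep (map Var us @ ts) [t] :: ('f, 'p, 'v) fm)) = {} \<and>
    (\<forall>e \<in> set es. qf_fo L e \<and> Fv e \<subseteq> Fv (Dep (map Var us @ ts) [t] :: ('f, 'p, 'v) fm) \<union> set zs)"
  using assms
proof (induction ts arbitrary: us A)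
  case Nil
  then show ?case by (intro HOL.exI[of _ "[]"]) (simp add: red_refl)
next
  case (Cons r ts)
  let ?D = "\<lambda>rs. Dep rs [t] :: ('f, 'p, 'v) fm"
  let ?a = "map Var us @ r # ts"
  have "finite (A \<union> vars (?D ?a))" using Cons.prems by simp
  from fresh[OF this] obtain z where z: "z \<notin> A \<union> vars (?D ?a)" by blast
  let ?e = "Eq (Var z) r :: ('f, 'p, 'v) fm"
  have upd: "?a[length us := Var z] = map Var (us @ [z]) @ ts" "?a ! length us = r"
    by (simp_all add: list_update_append nth_append)
  have KV': "KV (?D (map Var (us @ [z]) @ ts))" using Cons.prems by (auto simp: KV_Dep)
  from Cons.IH[OF KV', of "insert z (A \<union> Fv (?D ?a))"] Cons.prems(2) obtain zs es where
    r: "?D (map Var (us @ [z]) @ ts) \<leadsto> Qs (map (Pair False) zs) (ands (?D (map Var ((us @ [z]) @ zs))) es)"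
    and zs: "distinct zs" "set zs \<inter> (insert z (A \<union> Fv (?D ?a)) \<union> Fv (?D (map Var (us @ [z]) @ ts))) = {}"
    and es: "\<forall>e \<in> set es. qf_fo L e \<and> Fv e \<subseteq> Fv (?D (map Var (us @ [z]) @ ts)) \<union> set zs"
    by auto
  have KVe: "KV ?e" using Cons.prems by (simp add: KV_Dep)
  have KVr: "KV (ands (?D (map Var ((us @ [z]) @ zs))) es)" using red_KV(2)[OF r] by simp
  have "?D ?a \<leadsto> Ex z (And (?D (map Var (us @ [z]) @ ts)) ?e)"
    using red_unnest1[of ?a t "length us" z] Cons.prems z unfolding upd by simp
  also have "\<dots> \<leadsto> Ex z (And (Qs (map (Pair False) zs) (ands (?D (map Var ((us @ [z]) @ zs))) es)) ?e)"
    by (intro red_ex red_and r red_refl KVe)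
  also have "\<dots> \<leadsto> Ex z (Qs (map (Pair False) zs) (And (ands (?D (map Var ((us @ [z]) @ zs))) es) ?e))"
  proof (rule red_ex, rule red_and_Qs[OF KVr KVe])
    have "snd ` set (map (Pair False) zs) = set zs" by force
    moreover have "set zs \<inter> Fv ?e = {}" using zs(2) by auto
    ultimately show "snd ` set (map (Pair False) zs) \<inter> Fv ?e = {}" by simp
  qed
  finally have "?D ?a \<leadsto> Qs (map (Pair False) (z # zs)) (ands (?D (map Var (us @ (z # zs)))) (es @ [?e]))"
    by simp
  moreover have "distinct (z # zs)" using zs by auto
  moreover have "set (z # zs) \<inter> (A \<union> Fv (?D ?a)) = {}" using zs z by auto
  moreover have "\<forall>e \<in> set (es @ [?e]). qf_fo L e \<and> Fv e \<subseteq> Fv (?D ?a) \<union> set (z # zs)"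
    using es KVe by (auto simp: qf_fo_def)
  ultimately show ?case by blast
qed

subsection \<open>The prenex form\<close>

lemma is_matrix_qf_fo: "qf_fo L e \<Longrightarrow> is_matrix ys e"
  by (simp add: qf_fo_def is_matrix_fo)

text \<open>In the case of a disjunction both prefixes are pulled out one after the other. The marking
  formulas of the first step are carried along inside the second disjunct, and it matters that
  the old existential variables remain in their order, since the dependence atoms refer to it.\<close>

lemma prenex:
  assumes "inner_neg \<phi>" "KV \<phi>" "finite A"
  shows "\<exists>Q \<theta>. \<phi> \<leadsto> Qs Q \<theta> \<and> is_matrix (exv Q) \<theta> \<and> distinct (map snd Q) \<and>
    snd ` set Q \<inter> (A \<union> Fv \<phi>) = {} \<and> Fv \<theta> \<subseteq> Fv \<phi> \<union> snd ` set Q"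
  using assms
proof (induction "complexity \<phi>" arbitrary: \<phi> A rule: less_induct)
  case less
  have atom: ?case if "is_matrix [] \<phi>"
    using that less.prems(2) by (intro HOL.exI[of _ "[]"] HOL.exI[of _ \<phi>]) (simp add: red_refl)
  show ?case
  proof (cases \<phi>)
    case (Dep ts us)
    then obtain t where us: "us = [t]" using less.prems(2) by (auto simp: KV_Dep length_Suc_conv)
    from unnest_all[of "[]" ts t A] less.prems Dep us obtain zs es where
      r: "\<phi> \<leadsto> Qs (map (Pair False) zs) (ands (Dep (map Var zs) [t]) es)"
      and zs: "distinct zs" "set zs \<inter> (A \<union> Fv \<phi>) = {}"
      and es: "\<forall>e \<in> set es. qf_fo L e \<and> Fv e \<subseteq> Fv \<phi> \<union> set zs" by auto
    have ex: "exv (map (Pair False) zs) = zs" by (induction zs) auto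
    have s: "snd ` set (map (Pair False) zs) = set zs" by force
    have "is_matrix zs (ands (Dep (map Var zs) [t]) es)" using es by (auto simp: ands_props is_matrix_qf_fo)
    moreover have "distinct (map snd (map (Pair False) zs))" using zs by (simp add: o_def)
    moreover have "Fv (ands (Dep (map Var zs) [t]) es) \<subseteq> Fv \<phi> \<union> set zs"
      using es Dep us by (auto simp: ands_props)
    ultimately show ?thesis using r zs ex s by metis
  next
    case (And \<phi>1 \<phi>2)
    have l: "complexity \<phi>1 < complexity \<phi>" "complexity \<phi>2 < complexity \<phi>" and p: "inner_neg \<phi>1" "inner_neg \<phi>2" "KV \<phi>1" "KV \<phi>2"
      using less.prems And by auto
    have f1: "finite (A \<union> Fv \<phi>2)" using less.prems by simp
    from less.hyps[OF l(1) p(1,3) f1] obtain Q1 \<theta>1 where r1: "\<phi>1 \<leadsto> Qs Q1 \<theta>1" and m1: "is_matrix (exv Q1) \<theta>1"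
      and d1: "distinct (map snd Q1)" "snd ` set Q1 \<inter> ((A \<union> Fv \<phi>2) \<union> Fv \<phi>1) = {}" "Fv \<theta>1 \<subseteq> Fv \<phi>1 \<union> snd ` set Q1"
      by blast
    have f2: "finite (A \<union> Fv \<phi>1 \<union> snd ` set Q1)" using less.prems by simp
    from less.hyps[OF l(2) p(2,4) f2] obtain Q2 \<theta>2 where r2: "\<phi>2 \<leadsto> Qs Q2 \<theta>2" and m2: "is_matrix (exv Q2) \<theta>2"
      and d2: "distinct (map snd Q2)" "snd ` set Q2 \<inter> ((A \<union> Fv \<phi>1 \<union> snd ` set Q1) \<union> Fv \<phi>2) = {}"
        "Fv \<theta>2 \<subseteq> Fv \<phi>2 \<union> snd ` set Q2"
      by blast
    have k: "KV \<theta>1" "KV \<theta>2" using red_KV(2)[OF r1] red_KV(2)[OF r2] by simp_all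
    have "And \<phi>1 \<phi>2 \<leadsto> And (Qs Q1 \<theta>1) (Qs Q2 \<theta>2)" by (rule red_and[OF r1 r2])
    also have "\<dots> \<leadsto> Qs Q1 (And \<theta>1 (Qs Q2 \<theta>2))"
      by (rule red_and_Qs) (use k d1 d2 in auto)
    also have "\<dots> \<leadsto> Qs Q1 (And (Qs Q2 \<theta>2) \<theta>1)" by (intro red_Qs red_and_comm) (use k in simp_all)
    also have "\<dots> \<leadsto> Qs Q1 (Qs Q2 (And \<theta>2 \<theta>1))" by (intro red_Qs red_and_Qs) (use k d1 d2 in auto)
    finally have "\<phi> \<leadsto> Qs (Q1 @ Q2) (And \<theta>2 \<theta>1)" unfolding And by (simp add: Qs_append)
    moreover have "is_matrix (exv (Q1 @ Q2)) (And \<theta>2 \<theta>1)" using m1 m2 by (auto intro: is_matrix_mono)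
    moreover have "distinct (map snd (Q1 @ Q2))" using d1 d2 by auto
    moreover have "snd ` set (Q1 @ Q2) \<inter> (A \<union> Fv \<phi>) = {}" using d1 d2 And by auto
    moreover have "Fv (And \<theta>2 \<theta>1) \<subseteq> Fv \<phi> \<union> snd ` set (Q1 @ Q2)" using d1 d2 And by auto
    ultimately show ?thesis by blast
  next
    case (Or \<phi>1 \<phi>2)
    have l: "complexity \<phi>1 < complexity \<phi>" "complexity \<phi>2 < complexity \<phi>" and p: "inner_neg \<phi>1" "inner_neg \<phi>2" "KV \<phi>1" "KV \<phi>2"
      using less.prems Or by auto
    have f1: "finite (A \<union> Fv \<phi>2)" using less.prems by simp
    from less.hyps[OF l(1) p(1,3) f1] obtain Q1 \<theta>1 where r1: "\<phi>1 \<leadsto> Qs Q1 \<theta>1" and m1: "is_matrix (exv Q1) \<theta>1"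
      and d1: "distinct (map snd Q1)" "snd ` set Q1 \<inter> ((A \<union> Fv \<phi>2) \<union> Fv \<phi>1) = {}" "Fv \<theta>1 \<subseteq> Fv \<phi>1 \<union> snd ` set Q1"
      by blast
    have k1: "KV \<theta>1" using red_KV(2)[OF r1] by simp
    have f2: "finite (A \<union> Fv \<phi>1 \<union> snd ` set Q1)" using less.prems by simp
    from less.hyps[OF l(2) p(2,4) f2] obtain Q2 \<theta>2 where r2: "\<phi>2 \<leadsto> Qs Q2 \<theta>2" and m2: "is_matrix (exv Q2) \<theta>2"
      and d2: "distinct (map snd Q2)" "snd ` set Q2 \<inter> ((A \<union> Fv \<phi>1 \<union> snd ` set Q1) \<union> Fv \<phi>2) = {}"
        "Fv \<theta>2 \<subseteq> Fv \<phi>2 \<union> snd ` set Q2"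
      by blast
    have k2: "KV \<theta>2" using red_KV(2)[OF r2] by simp
    have f3: "finite (A \<union> Fv \<phi> \<union> snd ` set Q1 \<union> snd ` set Q2)" using less.prems by simp
    have s1: "snd ` set Q1 \<inter> Fv (Qs Q2 \<theta>2) = {}" using d1 d2 by auto
    have "\<exists>Q' es ds. or_split Q1 \<theta>1 (Qs Q2 \<theta>2) (A \<union> Fv \<phi> \<union> snd ` set Q1 \<union> snd ` set Q2) Q' es ds"
      by (rule red_or_Qs[OF k1 _ d1(1) s1 f3]) (use k2 in simp)
    then obtain R1 es1 ds1 where
      "or_split Q1 \<theta>1 (Qs Q2 \<theta>2) (A \<union> Fv \<phi> \<union> snd ` set Q1 \<union> snd ` set Q2) R1 es1 ds1" by blast
    then have r3: "Or (Qs Q1 \<theta>1) (Qs Q2 \<theta>2) \<leadsto> Qs R1 (Or (ands \<theta>1 es1) (ands (Qs Q2 \<theta>2) ds1))"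
      and es1: "\<forall>e \<in> set es1 \<union> set ds1. qf_fo L e \<and> Fv e \<subseteq> snd ` set R1"
      and R1: "distinct (map snd R1)" "subseq (exv Q1) (exv R1)"
        "snd ` set R1 \<subseteq> snd ` set Q1 \<union> - (A \<union> Fv \<phi> \<union> snd ` set Q1 \<union> snd ` set Q2)"
        "snd ` set Q1 \<subseteq> snd ` set R1"
      unfolding or_split_def by simp_all
    let ?\<theta>1 = "ands \<theta>1 es1" and ?\<theta>2 = "ands \<theta>2 ds1"
    have R1': "snd ` set R1 \<inter> (A \<union> Fv \<phi> \<union> snd ` set Q2) = {}"
    proof -
      have "Fv \<phi> = Fv \<phi>1 \<union> Fv \<phi>2" using Or by simp
      then show ?thesis using R1(3) d1(2) d2(2) by blast
    qed
    have k: "KV ?\<theta>1" "KV ?\<theta>2" using es1 k1 k2 by (auto simp: ands_props qf_fo_def)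
    have Fv1: "Fv ?\<theta>1 \<subseteq> Fv \<phi>1 \<union> snd ` set R1" using es1 d1 R1(4) unfolding ands_props by blast
    have Fv2: "Fv ?\<theta>2 \<subseteq> Fv \<phi>2 \<union> snd ` set Q2 \<union> snd ` set R1" using es1 d2 unfolding ands_props by blast
    have f4: "finite (A \<union> Fv \<phi> \<union> snd ` set Q1 \<union> snd ` set Q2 \<union> snd ` set R1)" using less.prems by simp
    have s2: "snd ` set Q2 \<inter> Fv ?\<theta>1 = {}"
      using Fv1 d2(2) R1' by blast
    from red_or_Qs[OF k(2,1) d2(1) s2 f4] obtain R2 es2 ds2 where
      "or_split Q2 ?\<theta>2 ?\<theta>1 (A \<union> Fv \<phi> \<union> snd ` set Q1 \<union> snd ` set Q2 \<union> snd ` set R1) R2 es2 ds2"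
      by blast
    then have
      r4: "Or (Qs Q2 ?\<theta>2) ?\<theta>1 \<leadsto> Qs R2 (Or (ands ?\<theta>2 es2) (ands ?\<theta>1 ds2))"
      and es2: "\<forall>e \<in> set es2 \<union> set ds2. qf_fo L e \<and> Fv e \<subseteq> snd ` set R2"
      and R2: "distinct (map snd R2)" "subseq (exv Q2) (exv R2)"
        "snd ` set R2 \<subseteq> snd ` set Q2 \<union> - (A \<union> Fv \<phi> \<union> snd ` set Q1 \<union> snd ` set Q2 \<union> snd ` set R1)"
        "snd ` set Q2 \<subseteq> snd ` set R2"
      unfolding or_split_def by simp_all
    have R2': "snd ` set R2 \<inter> (A \<union> Fv \<phi> \<union> snd ` set R1) = {}"
    proof -
      have "Fv \<phi> = Fv \<phi>1 \<union> Fv \<phi>2" using Or by simp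
      then show ?thesis using R2(3) R1' d2(2) by blast
    qed
    have "Or \<phi>1 \<phi>2 \<leadsto> Or (Qs Q1 \<theta>1) (Qs Q2 \<theta>2)" by (rule red_or[OF r1 r2])
    also note r3
    also have "Qs R1 (Or ?\<theta>1 (ands (Qs Q2 \<theta>2) ds1)) \<leadsto> Qs R1 (Or ?\<theta>1 (Qs Q2 ?\<theta>2))"
    proof (intro red_Qs red_or red_refl red_ands_Qs k k2 ballI conjI)
      fix e assume e: "e \<in> set ds1"
      then show "KV e" using es1 by (simp add: qf_fo_def)
      show "snd ` set Q2 \<inter> Fv e = {}" using e es1 R1' by blast
    qed
    also have "\<dots> \<leadsto> Qs R1 (Or (Qs Q2 ?\<theta>2) ?\<theta>1)" by (intro red_Qs red_or_comm) (use k in simp_all)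
    also have "\<dots> \<leadsto> Qs R1 (Qs R2 (Or (ands ?\<theta>2 es2) (ands ?\<theta>1 ds2)))" by (intro red_Qs r4)
    finally have "\<phi> \<leadsto> Qs (R1 @ R2) (Or (ands ?\<theta>2 es2) (ands ?\<theta>1 ds2))" unfolding Or by (simp add: Qs_append)
    moreover have "is_matrix (exv (R1 @ R2)) (Or (ands ?\<theta>2 es2) (ands ?\<theta>1 ds2))"
    proof -
      have "subseq (exv Q1) (exv (R1 @ R2))" "subseq (exv Q2) (exv (R1 @ R2))"
        using R1(2) R2(2) by (auto intro: subseq_order.order_trans)
      then show ?thesis using m1 m2 es1 es2 by (auto simp: ands_props is_matrix_qf_fo intro: is_matrix_mono)
    qed
    moreover have "distinct (map snd (R1 @ R2))" using R1 R2 R2' by auto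
    moreover have "snd ` set (R1 @ R2) \<inter> (A \<union> Fv \<phi>) = {}" using R1' R2' by auto
    moreover have "Fv (Or (ands ?\<theta>2 es2) (ands ?\<theta>1 ds2)) \<subseteq> Fv \<phi> \<union> snd ` set (R1 @ R2)"
    proof -
      have "Fv (ands ?\<theta>2 es2) \<subseteq> Fv ?\<theta>2 \<union> snd ` set R2" "Fv (ands ?\<theta>1 ds2) \<subseteq> Fv ?\<theta>1 \<union> snd ` set R2"
        using es2 unfolding ands_props(2)[of ?\<theta>2] ands_props(2)[of ?\<theta>1] by blast+
      moreover have "Fv \<phi> = Fv \<phi>1 \<union> Fv \<phi>2" using Or by simp
      ultimately show ?thesis
        using Fv1 Fv2 R2(4) unfolding Fv.simps set_append image_Un by blast
    qed
    ultimately show ?thesis by blast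
  next
    case (Ex x \<psi>)
    have p: "inner_neg \<psi>" "KV \<psi>" using less.prems Ex by auto
    have "finite (A \<union> vars \<phi>)" using less.prems by simp
    from fresh[OF this] obtain v where v: "v \<notin> A \<union> vars \<phi>" by blast
    let ?\<psi> = "subst_fm (single x (Var v)) \<psi>"
    have ff: "free_for (single x (Var v)) \<psi>" by (rule free_for_single_fresh) (use v Ex in simp)
    have F: "Fv ?\<psi> \<subseteq> Fv \<phi> \<union> {v}" "Fv \<phi> \<subseteq> Fv ?\<psi>" using Ex by (auto simp: Fv_subst[OF ff] split: if_splits)
    have l: "complexity ?\<psi> < complexity \<phi>" using Ex by simp
    have p': "inner_neg ?\<psi>" "KV ?\<psi>" using p by (simp_all add: KV_subst)
    have fin: "finite (insert v A)" using less.prems by simp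
    from less.hyps[OF l p' fin] obtain Q \<theta> where r: "?\<psi> \<leadsto> Qs Q \<theta>" and m: "is_matrix (exv Q) \<theta>"
      and d: "distinct (map snd Q)" "snd ` set Q \<inter> (insert v A \<union> Fv ?\<psi>) = {}" "Fv \<theta> \<subseteq> Fv ?\<psi> \<union> snd ` set Q"
      by blast
    have "Ex x \<psi> \<leadsto> Ex v ?\<psi>" by (rule rename_ex) (use p v Ex in simp_all)
    also have "\<dots> \<leadsto> Ex v (Qs Q \<theta>)" by (rule red_ex[OF r])
    finally have "\<phi> \<leadsto> Qs ((False, v) # Q) \<theta>" using Ex by simp
    moreover have "is_matrix (exv ((False, v) # Q)) \<theta>" using m by (auto intro: is_matrix_mono)
    moreover have "distinct (map snd ((False, v) # Q))" using d by auto
    moreover have "snd ` set ((False, v) # Q) \<inter> (A \<union> Fv \<phi>) = {}" using d v F Fv_vars[of \<phi>] by auto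
    moreover have "Fv \<theta> \<subseteq> Fv \<phi> \<union> snd ` set ((False, v) # Q)" using d F by auto
    ultimately show ?thesis by blast
  next
    case (All x \<psi>)
    have p: "inner_neg \<psi>" "KV \<psi>" using less.prems All by auto
    have "finite (A \<union> vars \<phi>)" using less.prems by simp
    from fresh[OF this] obtain v where v: "v \<notin> A \<union> vars \<phi>" by blast
    let ?\<psi> = "subst_fm (single x (Var v)) \<psi>"
    have ff: "free_for (single x (Var v)) \<psi>" by (rule free_for_single_fresh) (use v All in simp)
    have F: "Fv ?\<psi> \<subseteq> Fv \<phi> \<union> {v}" "Fv \<phi> \<subseteq> Fv ?\<psi>" using All by (auto simp: Fv_subst[OF ff] split: if_splits)
    have l: "complexity ?\<psi> < complexity \<phi>" using All by simp
    have p': "inner_neg ?\<psi>" "KV ?\<psi>" using p by (simp_all add: KV_subst)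
    have fin: "finite (insert v A)" using less.prems by simp
    from less.hyps[OF l p' fin] obtain Q \<theta> where r: "?\<psi> \<leadsto> Qs Q \<theta>" and m: "is_matrix (exv Q) \<theta>"
      and d: "distinct (map snd Q)" "snd ` set Q \<inter> (insert v A \<union> Fv ?\<psi>) = {}" "Fv \<theta> \<subseteq> Fv ?\<psi> \<union> snd ` set Q"
      by blast
    have "All x \<psi> \<leadsto> All v ?\<psi>" by (rule rename_all) (use p v All in simp_all)
    also have "\<dots> \<leadsto> All v (Qs Q \<theta>)" by (rule red_all[OF r])
    finally have "\<phi> \<leadsto> Qs ((True, v) # Q) \<theta>" using All by simp
    moreover have "is_matrix (exv ((True, v) # Q)) \<theta>" using m by simp
    moreover have "distinct (map snd ((True, v) # Q))" using d by auto
    moreover have "snd ` set ((True, v) # Q) \<inter> (A \<union> Fv \<phi>) = {}" using d v F Fv_vars[of \<phi>] by auto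
    moreover have "Fv \<theta> \<subseteq> Fv \<phi> \<union> snd ` set ((True, v) # Q)" using d F by auto
    ultimately show ?thesis by blast
  qed (use less.prems atom in simp_all)
qed

end

section \<open>Normal form\<close>

subsection \<open>Blocks of quantifiers\<close>

text \<open>\<open>Y\<close> contains, for each assignment of \<open>X\<close>, one that results from changing \<open>ys\<close>. By locality and
  downward closure, other members of \<open>Y\<close> do no harm when \<open>Y\<close> satisfies a formula.\<close>

definition cov :: "('f, 'p, 'u) model \<Rightarrow> 'v list \<Rightarrow> ('v \<rightharpoonup> 'u) set \<Rightarrow> ('v \<rightharpoonup> 'u) set \<Rightarrow> bool" where
  "cov M ys X Y \<longleftrightarrow> (\<forall>s \<in> X. \<exists>t \<in> Y. (\<forall>v. v \<notin> set ys \<longrightarrow> t v = s v) \<and> (\<forall>y \<in> set ys. \<exists>a \<in> univ M. t y = Some a))"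

lemma sat_Exs_elim: "sat M X (Exs ys \<phi>) \<Longrightarrow> \<exists>Y. cov M ys X Y \<and> sat M Y \<phi>"
proof (induction ys arbitrary: X)
  case Nil
  then show ?case by (intro HOL.exI[of _ X]) (auto simp: cov_def)
next
  case (Cons y ys)
  then obtain F where F: "\<forall>s \<in> X. F s \<noteq> {} \<and> F s \<subseteq> univ M" "sat M (supp X F y) (Exs ys \<phi>)" by auto
  from Cons.IH[OF F(2)] obtain Y where Y: "cov M ys (supp X F y) Y" "sat M Y \<phi>" by blast
  have "cov M (y # ys) X Y" unfolding cov_def
  proof
    fix s assume s: "s \<in> X"
    then obtain a where a: "a \<in> F s" "a \<in> univ M" using F(1) by blast
    then have "s(y \<mapsto> a) \<in> supp X F y" using s unfolding supp_def by blast
    then obtain t where t: "t \<in> Y" "\<forall>v. v \<notin> set ys \<longrightarrow> t v = (s(y \<mapsto> a)) v"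
      "\<forall>y \<in> set ys. \<exists>a \<in> univ M. t y = Some a" using Y(1) unfolding cov_def by blast
    have "\<forall>v. v \<notin> set (y # ys) \<longrightarrow> t v = s v" using t(2) by simp
    moreover have "\<forall>z \<in> set (y # ys). \<exists>a \<in> univ M. t z = Some a"
    proof
      fix z assume "z \<in> set (y # ys)"
      then show "\<exists>a \<in> univ M. t z = Some a" using t(2,3) a(2) by (cases "z \<in> set ys") auto
    qed
    ultimately show "\<exists>t \<in> Y. (\<forall>v. v \<notin> set (y # ys) \<longrightarrow> t v = s v) \<and>
      (\<forall>z \<in> set (y # ys). \<exists>a \<in> univ M. t z = Some a)" using t(1) by blast
  qed
  then show ?case using Y(2) by blast
qed

lemma sat_Exs_intro: "D_formula L \<phi> \<Longrightarrow> cov M ys X Y \<Longrightarrow> sat M Y \<phi> \<Longrightarrow> sat M X (Exs ys \<phi>)"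
proof (induction ys arbitrary: X)
  case Nil
  have "s \<in> Y" if "s \<in> X" for s
  proof -
    from Nil(2) that obtain t where "t \<in> Y" "\<forall>v. t v = s v" unfolding cov_def by auto
    moreover then have "t = s" by auto
    ultimately show ?thesis by simp
  qed
  then have "sat M X \<phi>" by (intro sat_local[OF Nil(1) _ Nil(3)]) blast
  then show ?case by simp
next
  case (Cons y ys)
  let ?P = "\<lambda>s t. t \<in> Y \<and> (\<forall>v. v \<notin> set (y # ys) \<longrightarrow> t v = s v) \<and> (\<forall>z \<in> set (y # ys). \<exists>a \<in> univ M. t z = Some a)"
  let ?F = "\<lambda>s. {a \<in> univ M. \<exists>t. ?P s t \<and> t y = Some a}"
  have "cov M ys (supp X ?F y) Y" unfolding cov_def
  proof
    fix r assume "r \<in> supp X ?F y"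
    then obtain s a t where r: "r = s(y \<mapsto> a)" "s \<in> X" "?P s t" "t y = Some a" unfolding supp_def by blast
    have "\<forall>v. v \<notin> set ys \<longrightarrow> t v = r v" using r(3,4) unfolding r(1) by auto
    then show "\<exists>t \<in> Y. (\<forall>v. v \<notin> set ys \<longrightarrow> t v = r v) \<and> (\<forall>z \<in> set ys. \<exists>a \<in> univ M. t z = Some a)"
      using r(3) by auto
  qed
  from Cons.IH[OF Cons.prems(1) this Cons.prems(3)] have "sat M (supp X ?F y) (Exs ys \<phi>)" .
  moreover have "?F s \<noteq> {} \<and> ?F s \<subseteq> univ M" if "s \<in> X" for s
  proof -
    from Cons.prems(2) that obtain t where t: "?P s t" unfolding cov_def by blast
    then obtain a where "a \<in> univ M" "t y = Some a" by auto
    then have "a \<in> ?F s" using t by blast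
    then show ?thesis by blast
  qed
  ultimately have "sat M X (Ex y (Exs ys \<phi>))" by (rule sat_ExI[rotated])
  then show ?case by simp
qed

lemma sat_Alls_intro:
  "(\<And>s t. s \<in> X \<Longrightarrow> (\<forall>v. v \<notin> set xs \<longrightarrow> t v = s v) \<Longrightarrow> (\<forall>x \<in> set xs. \<exists>a \<in> univ M. t x = Some a) \<Longrightarrow> t \<in> Y) \<Longrightarrow>
    D_formula L \<phi> \<Longrightarrow> sat M Y \<phi> \<Longrightarrow> sat M X (Alls xs \<phi>)"
proof (induction xs arbitrary: X)
  case Nil
  have "sat M X \<phi>" by (rule sat_local[OF Nil(2) _ Nil(3)]) (use Nil(1) in auto)
  then show ?case by simp
next
  case (Cons x xs)
  have "sat M (supp X (\<lambda>_. univ M) x) (Alls xs \<phi>)"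
  proof (rule Cons.IH[OF _ Cons.prems(2,3)])
    fix r t assume r: "r \<in> supp X (\<lambda>_. univ M) x" and t: "\<forall>v. v \<notin> set xs \<longrightarrow> t v = r v"
      "\<forall>x \<in> set xs. \<exists>a \<in> univ M. t x = Some a"
    then obtain s a where s: "r = s(x \<mapsto> a)" "s \<in> X" "a \<in> univ M" unfolding supp_def by blast
    show "t \<in> Y"
    proof (rule Cons.prems(1)[OF s(2)])
      show "\<forall>v. v \<notin> set (x # xs) \<longrightarrow> t v = s v" using t(1) s(1) by simp
      show "\<forall>z \<in> set (x # xs). \<exists>a \<in> univ M. t z = Some a"
      proof
        fix z assume "z \<in> set (x # xs)"
        then show "\<exists>a \<in> univ M. t z = Some a" using t s by (cases "z \<in> set xs") auto
      qed
    qed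
  qed
  then show ?case by simp
qed

lemma Alls_Qs: "Alls xs \<phi> = Qs (map (Pair True) xs) \<phi>"
  by (induction xs) auto

lemma Exs_Qs: "Exs xs \<phi> = Qs (map (Pair False) xs) \<phi>"
  by (induction xs) auto

lemma snd_set_Pair [simp]: "snd ` set (map (Pair b) xs) = set xs"
  by force

lemma Exs_append: "Exs (xs @ ys) \<phi> = Exs xs (Exs ys \<phi>)"
  by (induction xs) auto

abbreviation dconj :: "('v list \<times> 'v) list \<Rightarrow> ('f, 'p, 'v) fm" where
  "dconj ds \<equiv> Conj (map dep_atom ds)"

lemma KV_dep_atom [simp]: "KV_formula L (dep_atom d)"
  by (simp add: dep_atom_def KV_Dep)

lemma Fv_dep_atom [simp]: "Fv (dep_atom d) = insert (snd d) (set (fst d))"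
  by (auto simp: dep_atom_def)

lemma KV_dconj [simp]: "KV_formula L (dconj ds)"
  by (simp add: Conj_simps)

lemma bvs_Conj: "bvs (Conj \<phi>s) \<subseteq> insert undefined (\<Union>\<phi> \<in> set \<phi>s. bvs \<phi>)"
  by (induction \<phi>s rule: Conj.induct) (auto simp: falsum_def)

lemma Fv_dconj: "Fv (dconj ds) = (\<Union>d \<in> set ds. insert (snd d) (set (fst d)))"
  by (simp add: Conj_simps)

context dep_logic_sem
begin

lemma red_and_Exs: "KV \<phi> \<Longrightarrow> KV \<psi> \<Longrightarrow> set xs \<inter> Fv \<psi> = {} \<Longrightarrow> And (Exs xs \<phi>) \<psi> \<leadsto> Exs xs (And \<phi> \<psi>)"
  using red_and_Qs[of \<phi> \<psi> "map (Pair False) xs"] unfolding snd_set_Pair Exs_Qs[symmetric] by blast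

lemma red_and_Alls: "KV \<phi> \<Longrightarrow> KV \<psi> \<Longrightarrow> set xs \<inter> Fv \<psi> = {} \<Longrightarrow> And (Alls xs \<phi>) \<psi> \<leadsto> Alls xs (And \<phi> \<psi>)"
  using red_and_Qs[of \<phi> \<psi> "map (Pair True) xs"] unfolding snd_set_Pair Alls_Qs[symmetric] by blast

lemma pv_elim1: "pv \<theta> (And \<phi> \<psi>) \<Longrightarrow> pv \<theta> \<phi>"
  using pv_trans[OF _ pv_and1] pv_KV(2)[of \<theta> "And \<phi> \<psi>"] by simp

lemma pv_elim2: "pv \<theta> (And \<phi> \<psi>) \<Longrightarrow> pv \<theta> \<psi>"
  using pv_trans[OF _ pv_and2] pv_KV(2)[of \<theta> "And \<phi> \<psi>"] by simp

lemma pv_Conj_elim: "pv \<theta> (Conj \<phi>s) \<Longrightarrow> \<phi> \<in> set \<phi>s \<Longrightarrow> pv \<theta> \<phi>"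
  unfolding pv_def using Conj_der[of "{\<theta>}" \<phi>s \<phi>] by (simp add: Conj_simps)

lemma pv_Conj_intro: "(\<And>\<phi>. \<phi> \<in> set \<phi>s \<Longrightarrow> pv \<theta> \<phi>) \<Longrightarrow> KV \<theta> \<Longrightarrow> pv \<theta> (Conj \<phi>s)"
  unfolding pv_def using der_Conj[of \<phi>s "{\<theta>}"] by (simp add: Conj_simps)

lemma red_Alls: "\<phi> \<leadsto> \<psi> \<Longrightarrow> Alls xs \<phi> \<leadsto> Alls xs \<psi>"
  unfolding Alls_Qs by (rule red_Qs)

subsection \<open>Collecting dependence atoms\<close>

lemma red_join:
  assumes "KV \<alpha>" "KV \<beta>"
  shows "And (And (dconj es) \<beta>) (And (dconj ds) \<alpha>) \<leadsto> And (dconj (ds @ es)) (And \<alpha> \<beta>)" (is "?a \<leadsto> ?b")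
proof -
  have a: "pv ?a ?a" using assms by (simp add: pv_refl)
  note l = pv_elim1[OF a] and r = pv_elim2[OF a]
  have "pv ?a (dconj (ds @ es))"
  proof (rule pv_Conj_intro)
    fix \<phi> :: "('f, 'p, 'v) fm" assume "\<phi> \<in> set (map dep_atom (ds @ es))"
    then consider "\<phi> \<in> set (map dep_atom ds)" | "\<phi> \<in> set (map dep_atom es)" by auto
    then show "pv ?a \<phi>"
      by cases (rule pv_Conj_elim[OF pv_elim1[OF r]] pv_Conj_elim[OF pv_elim1[OF l]], assumption)+
  qed (use assms in simp)
  then have "pv ?a ?b" by (intro pv_andI pv_elim2[OF l] pv_elim2[OF r])
  moreover have "refines U ?b ?a" by (rule refinesI) (auto simp: Conj_simps)
  ultimately show ?thesis by (simp add: red_def)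
qed

lemma red_push:
  assumes "KV \<alpha>"
  shows "And (And (dconj es) \<alpha>) (dep_atom d) \<leadsto> And (dconj (d # es)) \<alpha>" (is "?a \<leadsto> ?b")
proof -
  have a: "pv ?a ?a" using assms by (simp add: pv_refl)
  note l = pv_elim1[OF a] and r = pv_elim2[OF a]
  have "pv ?a (dconj (d # es))"
  proof (rule pv_Conj_intro)
    fix \<phi> :: "('f, 'p, 'v) fm" assume "\<phi> \<in> set (map dep_atom (d # es))"
    then consider "\<phi> = dep_atom d" | "\<phi> \<in> set (map dep_atom es)" by auto
    then show "pv ?a \<phi>"
    proof cases
      case 1
      then show ?thesis using r by simp
    next
      case 2
      then show ?thesis by (rule pv_Conj_elim[OF pv_elim1[OF l]])
    qed
  qed (use assms in simp)
  then have "pv ?a ?b" by (intro pv_andI pv_elim2[OF l])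
  moreover have "refines U ?b ?a" by (rule refinesI) (auto simp: Conj_simps)
  ultimately show ?thesis by (simp add: red_def)
qed

lemma red_unnest2:
  assumes "KV (Dep ts [t])" "z \<notin> vars (Dep ts [t] :: ('f, 'p, 'v) fm)"
  shows "Dep ts [t] \<leadsto> Ex z (And (Dep ts [Var z]) (Eq (Var z) t))" (is "_ \<leadsto> ?\<psi>")
  unfolding red_def
proof
  have "{Dep ts [t]} \<turnstile> ?\<psi>" by (rule derives.unnest2[OF ax1]) (use assms in simp_all)
  moreover have "KV ?\<psi>" using assms(1) by (simp add: KV_Dep)
  ultimately show "pv (Dep ts [t]) ?\<psi>" using assms by (simp add: pv_def)
  show "refines U ?\<psi> (Dep ts [t])"
  proof (rule refinesI)
    fix M :: "('f, 'p, 'u) model" and X assume "sat M X ?\<psi>"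
    then obtain F where F: "\<forall>s \<in> X. F s \<noteq> {} \<and> F s \<subseteq> univ M"
      "sat M (supp X F z) (Dep ts [Var z])" "sat M (supp X F z) (Eq (Var z) t)"
      unfolding sat.simps(5,7) by blast
    have inv: "val M (s(z \<mapsto> a)) r = val M s r" if "r \<in> insert t (set ts)" for r s a
      by (rule val_cong) (use that assms(2) in auto)
    have ext: "\<exists>a. s(z \<mapsto> a) \<in> supp X F z \<and> a = val M s t" if s: "s \<in> X" for s
    proof -
      from F(1) s obtain a where a: "a \<in> F s" by blast
      then have m: "s(z \<mapsto> a) \<in> supp X F z" using s unfolding supp_def by blast
      then have "a = val M (s(z \<mapsto> a)) t" using F(3) by auto
      also have "\<dots> = val M s t" by (rule inv) simp
      finally show ?thesis using m by blast
    qed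
    show "sat M X (Dep ts [t])" unfolding sat.simps
    proof (intro ballI impI)
      fix s s' assume s: "s \<in> X" "s' \<in> X" "map (val M s) ts = map (val M s') ts"
      from ext[OF s(1)] ext[OF s(2)] obtain a a' where
        a: "s(z \<mapsto> a) \<in> supp X F z" "s'(z \<mapsto> a') \<in> supp X F z" "a = val M s t" "a' = val M s' t" by blast
      have inv': "map (val M (s(z \<mapsto> a))) ts = map (val M s) ts" for s a
        by (rule map_cong[OF refl], rule inv) simp
      have "map (val M (s(z \<mapsto> a))) ts = map (val M (s'(z \<mapsto> a'))) ts"
        unfolding inv' by (rule s(3))
      then have "map (val M (s(z \<mapsto> a))) [Var z] = map (val M (s'(z \<mapsto> a'))) [Var z]"
        using F(2) a(1,2) unfolding sat.simps by blast
      then show "map (val M s) [t] = map (val M s') [t]" using a by simp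
    qed
  qed
qed

lemma vars_dep_block: "qf_fo L \<alpha> \<Longrightarrow> vars (dep_block ds \<alpha> :: ('f, 'p, 'v) fm) \<subseteq>
  insert undefined (set (map snd ds) \<union> (\<Union>d \<in> set ds. set (fst d)) \<union> Fv \<alpha>)"
proof -
  assume "qf_fo L \<alpha>"
  then have "bvs \<alpha> = {}" unfolding qf_fo_def by (induction \<alpha>) auto
  moreover have "bvs (dconj ds :: ('f, 'p, 'v) fm) \<subseteq> {undefined}"
    using bvs_Conj[of "map dep_atom ds :: ('f, 'p, 'v) fm list"] by (auto simp: dep_atom_def)
  moreover have "bvs (Exs ys \<phi>) = set ys \<union> bvs \<phi>" for ys and \<phi> :: "('f, 'p, 'v) fm"
    by (induction ys) auto
  ultimately show ?thesis by (auto simp: dep_block_def vars_eq Conj_simps)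
qed

lemma KV_dep_block [simp]: "KV_formula L (dep_block ds \<alpha>) = KV_formula L \<alpha>"
  by (simp add: dep_block_def)

text \<open>For the way back, an assignment goes to the disjunct that a chosen extension satisfies. In the
  block of this disjunct, the variables of the other block keep their old values, which the first
  block does not mention.\<close>

lemma red_dist:
  assumes "qf_fo L \<alpha>" "qf_fo L \<beta>" "distinct (map snd ds)" "distinct (map snd es)"
    "set (map snd ds) \<inter> vars (dep_block es \<beta>) = {}" "set (map snd es) \<inter> vars (dep_block ds \<alpha>) = {}"
    "\<forall>d \<in> set ds. set (fst d) \<inter> set (map snd ds) = {}" "\<forall>e \<in> set es. set (fst e) \<inter> set (map snd es) = {}"
  shows "Or (dep_block ds \<alpha>) (dep_block es \<beta>) \<leadsto> dep_block (ds @ es) (Or \<alpha> \<beta>)" (is "?a \<leadsto> ?b")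
  unfolding red_def
proof
  have KVs: "KV \<alpha>" "KV \<beta>" using assms by (simp_all add: qf_fo_def)
  have "{?a} \<turnstile> ?b"
    by (rule derives.dep_dist[OF ax1]) (use assms KVs in \<open>simp_all add: qf_fo_def\<close>)
  then show "pv ?a ?b" using KVs by (simp add: pv_def)
  have step: "sat M (X1 :: ('v \<rightharpoonup> 'u) set) (dep_block gs \<gamma>)"
    if Y: "sat M Y (dconj fs)" "sat M Y' \<gamma>" "Y' \<subseteq> Y" "set gs \<subseteq> set fs" and KVg: "KV \<gamma>"
      and c: "\<forall>s \<in> X1. \<exists>t \<in> Y'. (\<forall>v. v \<notin> set (map snd fs) \<longrightarrow> t v = s v) \<and>
        (\<forall>y \<in> set (map snd fs). \<exists>a \<in> univ M. t y = Some a)"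
      and fr: "(set (map snd fs) - set (map snd gs)) \<inter> (Fv \<gamma> \<union> (\<Union>d \<in> set gs. insert (snd d) (set (fst d)))) = {}"
    for M :: "('f, 'p, 'u) model" and X1 Y Y' and fs gs and \<gamma> :: "('f, 'p, 'v) fm"
  proof -
    let ?g = "\<lambda>t s v. if v \<in> set (map snd gs) then t v else s v"
    let ?Z = "{?g t s | t s. t \<in> Y' \<and> s \<in> X1 \<and> (\<forall>v. v \<notin> set (map snd fs) \<longrightarrow> t v = s v) \<and>
        (\<forall>y \<in> set (map snd fs). \<exists>a \<in> univ M. t y = Some a)}"
    have "cov M (map snd gs) X1 ?Z" unfolding cov_def
    proof
      fix s assume s: "s \<in> X1"
      then obtain t where t: "t \<in> Y'" "\<forall>v. v \<notin> set (map snd fs) \<longrightarrow> t v = s v"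
        "\<forall>y \<in> set (map snd fs). \<exists>a \<in> univ M. t y = Some a" using c by blast
      have "?g t s \<in> ?Z" using s t by blast
      moreover have "\<forall>v. v \<notin> set (map snd gs) \<longrightarrow> ?g t s v = s v" by simp
      moreover have "\<forall>y \<in> set (map snd gs). \<exists>a \<in> univ M. ?g t s y = Some a" using t(3) Y(4) by auto
      ultimately show "\<exists>t \<in> ?Z. (\<forall>v. v \<notin> set (map snd gs) \<longrightarrow> t v = s v) \<and>
        (\<forall>y \<in> set (map snd gs). \<exists>a \<in> univ M. t y = Some a)" by (intro bexI[of _ "?g t s"] conjI)
    qed
    moreover have "sat M ?Z (And (dconj gs) \<gamma>)"
    proof (rule sat_local[where X = Y', OF KV_D])
      show "KV (And (dconj gs) \<gamma>)" using KVg by simp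
      fix z assume "z \<in> ?Z"
      then obtain t s where z: "z = ?g t s" "t \<in> Y'" "\<forall>v. v \<notin> set (map snd fs) \<longrightarrow> t v = s v" by blast
      have "z v = t v" if v: "v \<in> Fv (And (dconj gs) \<gamma>)" for v
      proof (cases "v \<in> set (map snd gs)")
        case False
        have "v \<in> Fv \<gamma> \<union> (\<Union>d \<in> set gs. insert (snd d) (set (fst d)))"
          using v unfolding Fv.simps Fv_dconj by blast
        then have "v \<notin> set (map snd fs)" using fr False by blast
        then show ?thesis using z(1,3) False by simp
      qed (simp add: z(1))
      then show "\<exists>t \<in> Y'. \<forall>v \<in> Fv (And (dconj gs) \<gamma>). the (z v) = the (t v)" using z(2) by auto
    next
      have "sat M Y' (dconj fs)"
        by (rule sat_local[OF KV_D[OF KV_dconj] _ Y(1)]) (use Y(3) in blast)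
      then show "sat M Y' (And (dconj gs) \<gamma>)" using Y(2,4) by (auto simp: Conj_simps)
    qed
    ultimately show ?thesis unfolding dep_block_def
      by (intro sat_Exs_intro[OF KV_D[of L]]) (use KVg in simp_all)
  qed
  show "refines U ?b ?a"
  proof (rule refinesI)
    fix M :: "('f, 'p, 'u) model" and X assume "sat M X ?b"
    then obtain Y where Y: "cov M (map snd (ds @ es)) X Y" "sat M Y (And (dconj (ds @ es)) (Or \<alpha> \<beta>))"
      using sat_Exs_elim unfolding dep_block_def by blast
    then obtain Y1 Y2 where Y12: "Y = Y1 \<union> Y2" "sat M Y1 \<alpha>" "sat M Y2 \<beta>" and D: "sat M Y (dconj (ds @ es))" by auto
    let ?P = "\<lambda>s t. (\<forall>v. v \<notin> set (map snd (ds @ es)) \<longrightarrow> t v = s v) \<and>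
        (\<forall>y \<in> set (map snd (ds @ es)). \<exists>a \<in> univ M. t y = Some a)"
    let ?X1 = "{s \<in> X. \<exists>t \<in> Y1. ?P s t}" and ?X2 = "{s \<in> X. \<exists>t \<in> Y2. ?P s t}"
    have v1: "Fv \<alpha> \<union> (\<Union>d \<in> set ds. insert (snd d) (set (fst d))) \<subseteq> vars (dep_block ds \<alpha>) \<union> set (map snd ds)"
      "Fv \<beta> \<union> (\<Union>d \<in> set es. insert (snd d) (set (fst d))) \<subseteq> vars (dep_block es \<beta>) \<union> set (map snd es)"
      by (auto simp: dep_block_def vars_eq Conj_simps)
    have "X = ?X1 \<union> ?X2" using Y(1) unfolding cov_def Y12(1) by blast
    moreover have "sat M ?X1 (dep_block ds \<alpha>)"
    proof (rule step[OF D Y12(2)])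
      show "(set (map snd (ds @ es)) - set (map snd ds)) \<inter>
        (Fv \<alpha> \<union> (\<Union>d \<in> set ds. insert (snd d) (set (fst d)))) = {}"
        using v1(1) assms(6) unfolding map_append set_append by blast
    qed (use Y12(1) KVs in auto)
    moreover have "sat M ?X2 (dep_block es \<beta>)"
    proof (rule step[OF D Y12(3)])
      show "(set (map snd (ds @ es)) - set (map snd es)) \<inter>
        (Fv \<beta> \<union> (\<Union>d \<in> set es. insert (snd d) (set (fst d)))) = {}"
        using v1(2) assms(5) unfolding map_append set_append by blast
    qed (use Y12(1) KVs in auto)
    ultimately show "sat M X ?a" by (rule sat_OrI)
  qed
qed

text \<open>Dependence atoms are moved from the inside of conjunctions and disjunctions to the front, where
  they apply to the whole team. Each gets a fresh determined variable \<open>w\<close>, with the equation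
  \<open>w = t\<close> left in its old place; as \<open>w\<close> is fresh, extending the dependence from the part of the team
  in one disjunct to the whole team does no harm.\<close>

lemma matrix_block:
  assumes "is_matrix ys \<theta>" "KV \<theta>" "finite A"
  shows "\<exists>ds \<alpha>. \<theta> \<leadsto> dep_block ds \<alpha> \<and> qf_fo L \<alpha> \<and> distinct (map snd ds) \<and>
    set (map snd ds) \<inter> (A \<union> Fv \<theta>) = {} \<and> Fv \<alpha> \<subseteq> Fv \<theta> \<union> set (map snd ds) \<and>
    (\<forall>d \<in> set ds. subseq (fst d) ys \<and> set (fst d) \<subseteq> Fv \<theta>)"
  using assms
proof (induction \<theta> arbitrary: A)
  have fo: "\<exists>ds \<alpha>. \<theta> \<leadsto> dep_block ds \<alpha> \<and> qf_fo L \<alpha> \<and> distinct (map snd ds) \<and>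
    set (map snd ds) \<inter> (A \<union> Fv \<theta>) = {} \<and> Fv \<alpha> \<subseteq> Fv \<theta> \<union> set (map snd ds) \<and>
    (\<forall>d \<in> set ds. subseq (fst d) ys \<and> set (fst d) \<subseteq> Fv \<theta>)" if q: "qf_fo L \<theta>" for \<theta> A
  proof -
    have "\<theta> \<leadsto> dep_block [] \<theta>"
      by (rule red_fo) (use q in \<open>simp_all add: qf_fo_def dep_block_def\<close>)
    then show ?thesis using q by (intro HOL.exI[of _ "[]"] HOL.exI[of _ \<theta>]) simp
  qed
  case (Eq t u) show ?case by (rule fo) (use Eq in \<open>simp add: qf_fo_def\<close>)
next
  case (Rel p ts)
  have "Rel p ts \<leadsto> dep_block [] (Rel p ts)"
    by (rule red_fo) (use Rel in \<open>simp_all add: dep_block_def\<close>)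
  then show ?case using Rel by (intro HOL.exI[of _ "[]"] HOL.exI[of _ "Rel p ts"]) (simp add: qf_fo_def)
next
  case (Neg \<phi>)
  have "Neg \<phi> \<leadsto> dep_block [] (Neg \<phi>)"
    by (rule red_fo) (use Neg in \<open>simp_all add: dep_block_def\<close>)
  then show ?case using Neg by (intro HOL.exI[of _ "[]"] HOL.exI[of _ "Neg \<phi>"]) (simp add: qf_fo_def)
next
  case (Dep ts us)
  then obtain t vs where e: "us = [t]" "ts = map Var vs" "subseq vs ys"
    by (auto simp: KV_Dep length_Suc_conv)
  have "finite (A \<union> vars (Dep ts us :: ('f, 'p, 'v) fm))" using Dep.prems by simp
  from fresh[OF this] obtain w where w: "w \<notin> A \<union> vars (Dep ts us :: ('f, 'p, 'v) fm)" by blast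
  have "Dep ts us \<leadsto> Ex w (And (Dep ts [Var w]) (Eq (Var w) t))"
    unfolding e(1) by (rule red_unnest2) (use Dep.prems w e in simp_all)
  then have "Dep ts us \<leadsto> dep_block [(vs, w)] (Eq (Var w) t)"
    using e by (simp add: dep_block_def dep_atom_def)
  moreover have "qf_fo L (Eq (Var w) t)" using Dep.prems e by (simp add: qf_fo_def KV_Dep)
  ultimately show ?case using w e
    by (intro HOL.exI[of _ "[(vs, w)]"] HOL.exI[of _ "Eq (Var w) t"]) auto
next
  case (And \<phi>1 \<phi>2)
  have p: "is_matrix ys \<phi>1" "is_matrix ys \<phi>2" "KV \<phi>1" "KV \<phi>2" using And.prems by simp_all
  have f1: "finite (A \<union> Fv \<phi>2)" using And.prems by simp
  from And.IH(1)[OF p(1,3) f1] obtain ds \<alpha> where r1: "\<phi>1 \<leadsto> dep_block ds \<alpha>" "qf_fo L \<alpha>"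
    and d1: "distinct (map snd ds)" "set (map snd ds) \<inter> ((A \<union> Fv \<phi>2) \<union> Fv \<phi>1) = {}"
      "Fv \<alpha> \<subseteq> Fv \<phi>1 \<union> set (map snd ds)" "\<forall>d \<in> set ds. subseq (fst d) ys \<and> set (fst d) \<subseteq> Fv \<phi>1" by blast
  have f2: "finite (A \<union> Fv \<phi>1 \<union> set (map snd ds))" using And.prems by simp
  from And.IH(2)[OF p(2,4) f2] obtain es \<beta> where r2: "\<phi>2 \<leadsto> dep_block es \<beta>" "qf_fo L \<beta>"
    and d2: "distinct (map snd es)" "set (map snd es) \<inter> ((A \<union> Fv \<phi>1 \<union> set (map snd ds)) \<union> Fv \<phi>2) = {}"
      "Fv \<beta> \<subseteq> Fv \<phi>2 \<union> set (map snd es)" "\<forall>d \<in> set es. subseq (fst d) ys \<and> set (fst d) \<subseteq> Fv \<phi>2" by blast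
  let ?a = "And (dconj ds) \<alpha>" and ?b = "And (dconj es) \<beta>"
  have k: "KV \<alpha>" "KV \<beta>" using r1 r2 by (simp_all add: qf_fo_def)
  have s1: "set (map snd ds) \<inter> Fv (Exs (map snd es) ?b) = {}"
  proof -
    have "Fv (Exs (map snd es) ?b) \<subseteq> Fv \<phi>2 \<union> set (map snd es)" using d2(3,4) by (auto simp: Fv_dconj)
    then show ?thesis using d1(2) by (auto simp del: Fv.simps)
  qed
  have s2: "set (map snd es) \<inter> Fv ?a = {}"
  proof -
    have "Fv ?a \<subseteq> Fv \<phi>1 \<union> set (map snd ds)" using d1(3,4) by (auto simp: Fv_dconj)
    then show ?thesis using d2(2) by blast
  qed
  have "And \<phi>1 \<phi>2 \<leadsto> And (Exs (map snd ds) ?a) (Exs (map snd es) ?b)"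
    using red_and[OF r1(1) r2(1)] by (simp add: dep_block_def)
  also have "\<dots> \<leadsto> Exs (map snd ds) (And ?a (Exs (map snd es) ?b))"
    by (rule red_and_Exs[OF _ _ s1]) (use k in simp_all)
  also have "\<dots> \<leadsto> Exs (map snd ds) (And (Exs (map snd es) ?b) ?a)"
    by (intro red_Exs red_and_comm) (use k in simp_all)
  also have "\<dots> \<leadsto> Exs (map snd ds) (Exs (map snd es) (And ?b ?a))"
    by (rule red_Exs[OF red_and_Exs[OF _ _ s2]]) (use k in simp_all)
  also have "\<dots> \<leadsto> Exs (map snd ds) (Exs (map snd es) (And (dconj (ds @ es)) (And \<alpha> \<beta>)))"
    by (intro red_Exs red_join k)
  finally have "And \<phi>1 \<phi>2 \<leadsto> dep_block (ds @ es) (And \<alpha> \<beta>)"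
    by (simp only: dep_block_def map_append Exs_append)
  moreover have "qf_fo L (And \<alpha> \<beta>)" using r1 r2 by (simp add: qf_fo_def)
  moreover have "distinct (map snd (ds @ es))" using d1(1) d2(1,2) by auto
  moreover have "set (map snd (ds @ es)) \<inter> (A \<union> Fv (And \<phi>1 \<phi>2)) = {}" using d1(2) d2(2) by auto
  moreover have "Fv (And \<alpha> \<beta>) \<subseteq> Fv (And \<phi>1 \<phi>2) \<union> set (map snd (ds @ es))" using d1(3) d2(3) by auto
  moreover have "\<forall>d \<in> set (ds @ es). subseq (fst d) ys \<and> set (fst d) \<subseteq> Fv (And \<phi>1 \<phi>2)"
    using d1(4) d2(4) by auto
  ultimately show ?case by blast
next
  case (Or \<phi>1 \<phi>2)
  have p: "is_matrix ys \<phi>1" "is_matrix ys \<phi>2" "KV \<phi>1" "KV \<phi>2" using Or.prems by simp_all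
  \<comment> \<open>The empty conjunction has \<open>undefined\<close> as a bound variable, and \<open>red_dist\<close> wants the new
    variables to occur nowhere in the other block.\<close>
  have f1: "finite (insert undefined A \<union> Fv \<phi>2)" using Or.prems by simp
  from Or.IH(1)[OF p(1,3) f1] obtain ds \<alpha> where r1: "\<phi>1 \<leadsto> dep_block ds \<alpha>" "qf_fo L \<alpha>"
    and d1: "distinct (map snd ds)" "set (map snd ds) \<inter> ((insert undefined A \<union> Fv \<phi>2) \<union> Fv \<phi>1) = {}"
      "Fv \<alpha> \<subseteq> Fv \<phi>1 \<union> set (map snd ds)" "\<forall>d \<in> set ds. subseq (fst d) ys \<and> set (fst d) \<subseteq> Fv \<phi>1" by blast
  have f2: "finite (insert undefined A \<union> Fv \<phi>1 \<union> set (map snd ds))" using Or.prems by simp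
  from Or.IH(2)[OF p(2,4) f2] obtain es \<beta> where r2: "\<phi>2 \<leadsto> dep_block es \<beta>" "qf_fo L \<beta>"
    and d2: "distinct (map snd es)" "set (map snd es) \<inter> ((insert undefined A \<union> Fv \<phi>1 \<union> set (map snd ds)) \<union> Fv \<phi>2) = {}"
      "Fv \<beta> \<subseteq> Fv \<phi>2 \<union> set (map snd es)" "\<forall>d \<in> set es. subseq (fst d) ys \<and> set (fst d) \<subseteq> Fv \<phi>2" by blast
  have v1: "vars (dep_block ds \<alpha>) \<subseteq> insert undefined (set (map snd ds) \<union> Fv \<phi>1)"
    using vars_dep_block[OF r1(2), of ds] d1(3,4) by blast
  have v2: "vars (dep_block es \<beta>) \<subseteq> insert undefined (set (map snd es) \<union> Fv \<phi>2)"
    using vars_dep_block[OF r2(2), of es] d2(3,4) by blast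
  have "Or \<phi>1 \<phi>2 \<leadsto> Or (dep_block ds \<alpha>) (dep_block es \<beta>)" by (rule red_or[OF r1(1) r2(1)])
  also have "\<dots> \<leadsto> dep_block (ds @ es) (Or \<alpha> \<beta>)"
  proof (rule red_dist[OF r1(2) r2(2) d1(1) d2(1)])
    show "set (map snd ds) \<inter> vars (dep_block es \<beta>) = {}" using v2 d1(2) d2(2) by blast
    show "set (map snd es) \<inter> vars (dep_block ds \<alpha>) = {}" using v1 d2(2) by blast
    show "\<forall>d \<in> set ds. set (fst d) \<inter> set (map snd ds) = {}" using d1(2,4) by blast
    show "\<forall>e \<in> set es. set (fst e) \<inter> set (map snd es) = {}" using d2(2,4) by blast
  qed
  finally have "Or \<phi>1 \<phi>2 \<leadsto> dep_block (ds @ es) (Or \<alpha> \<beta>)" .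
  moreover have "qf_fo L (Or \<alpha> \<beta>)" using r1 r2 by (simp add: qf_fo_def)
  moreover have "distinct (map snd (ds @ es))" using d1(1) d2(1,2) by auto
  moreover have "set (map snd (ds @ es)) \<inter> (A \<union> Fv (Or \<phi>1 \<phi>2)) = {}" using d1(2) d2(2) by auto
  moreover have "Fv (Or \<alpha> \<beta>) \<subseteq> Fv (Or \<phi>1 \<phi>2) \<union> set (map snd (ds @ es))" using d1(3) d2(3) by auto
  moreover have "\<forall>d \<in> set (ds @ es). subseq (fst d) ys \<and> set (fst d) \<subseteq> Fv (Or \<phi>1 \<phi>2)"
    using d1(4) d2(4) by auto
  ultimately show ?case by blast
qed simp_all

end

subsection \<open>Universal quantifiers in front\<close>

lemma subseq_mid: "subseq (xs @ ys @ zs) (xs @ us @ ys @ vs @ zs)"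
proof -
  have "subseq zs (vs @ zs)" by (rule list_emb_append2) simp
  then have "subseq (ys @ zs) (ys @ vs @ zs)" by (rule list_emb_append_mono[OF subseq_order.order_refl])
  then have "subseq (ys @ zs) (us @ ys @ vs @ zs)" by (rule list_emb_append2)
  then show ?thesis by (rule list_emb_append_mono[OF subseq_order.order_refl])
qed

lemma subseq_set: "subseq xs ys \<Longrightarrow> set xs \<subseteq> set ys"
  by (induction rule: list_emb.induct) auto

context dep_logic_sem
begin

abbreviation datom :: "'v list \<Rightarrow> 'v \<Rightarrow> ('f, 'p, 'v) fm" where
  "datom zs u \<equiv> dep_atom (zs, u)"

lemma sat_datom: "sat M X (datom zs u) \<longleftrightarrow>
  (\<forall>s \<in> X. \<forall>s' \<in> X. (\<forall>z \<in> set zs. the (s z) = the (s' z)) \<longrightarrow> the (s u) = the (s' u))"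
  by (simp add: dep_atom_def o_def map_eq_conv)

text \<open>Since \<open>u\<close> is determined by variables other than \<open>x\<close>, its value may be chosen before \<open>x\<close>.\<close>

lemma swap_sem:
  fixes M :: "('f, 'p, 'w) model"
  assumes ne: "univ M \<noteq> {}" and d: "x \<notin> set zs" "u \<notin> set zs" "x \<noteq> u" and KVr: "KV \<rho>"
    and D: "\<And>Y :: ('v \<rightharpoonup> 'w) set. sat M Y \<rho> \<Longrightarrow> sat M Y (datom zs u)"
    and s: "sat M X (All x (Ex u \<rho>))"
  shows "sat M X (Ex u (All x \<rho>))"
proof -
  from s obtain F where F: "\<forall>s \<in> supp X (\<lambda>_. univ M) x. F s \<noteq> {} \<and> F s \<subseteq> univ M"
    "sat M (supp (supp X (\<lambda>_. univ M) x) F u) \<rho>" unfolding sat.simps(7,8) by blast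
  let ?Y = "supp (supp X (\<lambda>_. univ M) x) F u"
  have mem: "s(x \<mapsto> b, u \<mapsto> a) \<in> ?Y" if "s \<in> X" "b \<in> univ M" "a \<in> F (s(x \<mapsto> b))" for s a b
  proof -
    have "s(x \<mapsto> b) \<in> supp X (\<lambda>_. univ M) x" using that unfolding supp_def by blast
    then show ?thesis using that unfolding supp_def[of _ F] by blast
  qed
  have det: "a = a'" if "s \<in> X" "b \<in> univ M" "a \<in> F (s(x \<mapsto> b))" "b' \<in> univ M" "a' \<in> F (s(x \<mapsto> b'))" for s a b a' b'
  proof -
    have "\<forall>z \<in> set zs. the ((s(x \<mapsto> b, u \<mapsto> a)) z) = the ((s(x \<mapsto> b', u \<mapsto> a')) z)" using d by auto
    then have "the ((s(x \<mapsto> b, u \<mapsto> a)) u) = the ((s(x \<mapsto> b', u \<mapsto> a')) u)"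
      using D[OF F(2)] mem[OF that(1,2,3)] mem[OF that(1,4,5)] unfolding sat_datom by blast
    then show ?thesis by simp
  qed
  let ?G = "\<lambda>s. {a. \<exists>b \<in> univ M. a \<in> F (s(x \<mapsto> b))}"
  have Fx: "F (s(x \<mapsto> b)) \<noteq> {} \<and> F (s(x \<mapsto> b)) \<subseteq> univ M" if "s \<in> X" "b \<in> univ M" for s b
  proof -
    have "s(x \<mapsto> b) \<in> supp X (\<lambda>_. univ M) x" using that unfolding supp_def by blast
    then show ?thesis using F(1) by blast
  qed
  have "sat M (supp (supp X ?G u) (\<lambda>_. univ M) x) \<rho>"
  proof (rule sat_local[OF KV_D[OF KVr] _ F(2)])
    fix r assume "r \<in> supp (supp X ?G u) (\<lambda>_. univ M) x"
    then obtain s a b where r: "r = s(u \<mapsto> a, x \<mapsto> b)" "s \<in> X" "a \<in> ?G s" "b \<in> univ M" unfolding supp_def by blast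
    from Fx[OF r(2,4)] obtain a' where a': "a' \<in> F (s(x \<mapsto> b))" by blast
    then have "a = a'" using r(3) det[OF r(2) _ _ r(4) a'] by blast
    then have "r = s(x \<mapsto> b, u \<mapsto> a')" using r(1) d(3) by (simp add: fun_upd_twist)
    then have "r \<in> ?Y" using mem[OF r(2,4) a'] by simp
    then show "\<exists>t \<in> ?Y. \<forall>z \<in> Fv \<rho>. the (r z) = the (t z)" by blast
  qed
  then have "sat M (supp X ?G u) (All x \<rho>)" by simp
  moreover have "?G s \<noteq> {} \<and> ?G s \<subseteq> univ M" if "s \<in> X" for s
  proof -
    obtain b where b: "b \<in> univ M" using ne by blast
    then have "?G s \<noteq> {}" using Fx[OF that b] by blast
    moreover have "?G s \<subseteq> univ M" using Fx[OF that] by blast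
    ultimately show ?thesis ..
  qed
  ultimately show ?thesis by (rule sat_ExI[rotated])
qed

text \<open>Dependence introduction for one existential quantifier. The list \<open>zs\<close> may contain variables
  that are not free in \<open>R\<close>, which is used to put the atom into a prescribed form.\<close>

lemma pv_dep_intro:
  assumes "distinct (u # x # zs)" "Fv R \<subseteq> {u, x} \<union> set zs" "KV R"
  shows "pv (Ex u (All x R)) (All x (Ex u (And (datom zs u) R)))"
proof -
  have "{Ex u (All x R)} \<turnstile> Exs [u] (All x R)" using ax1[of "Ex u (All x R)"] assms(3) by simp
  then have "{Ex u (All x R)} \<turnstile> All x (Exs [u] (And (dep_shorthand (map Var zs) (map Var [u])) R))"
    by (rule derives.dep_intro) (use assms in auto)
  then show ?thesis using assms(3) by (simp add: pv_def dep_shorthand_def dep_atom_def KV_Dep)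
qed

lemma red_swap_first:
  assumes "distinct (u # x # zs)" "Fv R \<subseteq> {u, x} \<union> set zs" "KV R"
  shows "Ex u (All x R) \<leadsto> All x (Ex u (And (datom zs u) R))"
  unfolding red_def
proof
  show "refines U (All x (Ex u (And (datom zs u) R))) (Ex u (All x R))"
  proof (rule refinesI)
    fix M :: "('f, 'p, 'u) model" and X assume ne: "univ M \<noteq> {}" and s: "sat M X (All x (Ex u (And (datom zs u) R)))"
    have "sat M X (Ex u (All x (And (datom zs u) R)))"
      by (rule swap_sem[OF ne _ _ _ _ _ s, of zs]) (use assms in auto)
    then show "sat M X (Ex u (All x R))" unfolding sat.simps(5,7,8) by blast
  qed
qed (rule pv_dep_intro[OF assms])

text \<open>If \<open>\<rho>\<close> contains the dependence of \<open>u\<close> already, the atom that dependence introduction adds can be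
  dropped.\<close>

lemma red_swap_keep:
  assumes "distinct (u # x # zs)" "KV \<rho>" "refines U \<rho> (datom zs u)"
  shows "Ex u (All x \<rho>) \<leadsto> All x (Ex u \<rho>)"
  unfolding red_def
proof
  from finite_distinct_list[of "Fv \<rho> - {u, x}"] obtain ws where ws: "set ws = Fv \<rho> - {u, x}" "distinct ws" by auto
  have "pv (Ex u (All x \<rho>)) (All x (Ex u (And (datom ws u) \<rho>)))"
    by (rule pv_dep_intro) (use assms ws in auto)
  moreover have "pv (All x (Ex u (And (datom ws u) \<rho>))) (All x (Ex u \<rho>))"
    by (intro pv_all_mono pv_ex_mono pv_and2) (use assms in simp_all)
  ultimately show "pv (Ex u (All x \<rho>)) (All x (Ex u \<rho>))" by (rule pv_trans)
  show "refines U (All x (Ex u \<rho>)) (Ex u (All x \<rho>))"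
  proof (rule refinesI)
    fix M :: "('f, 'p, 'u) model" and X assume ne: "univ M \<noteq> {}" and s: "sat M X (All x (Ex u \<rho>))"
    show "sat M X (Ex u (All x \<rho>))"
      by (rule swap_sem[OF ne _ _ _ _ _ s, of zs]) (use assms ne in \<open>auto simp: refines_def\<close>)
  qed
qed

lemma refines_Alls:
  assumes "KV D" "set xs \<inter> Fv D = {}"
  shows "refines U (Alls xs (And D R)) D"
  using assms(2)
proof (induction xs)
  case Nil
  show ?case by (rule refinesI) simp
next
  case (Cons x xs)
  have IH: "refines U (Alls xs (And D R)) D" using Cons by simp
  show ?case
  proof (rule refinesI)
    fix M :: "('f, 'p, 'u) model" and X assume ne: "univ M \<noteq> {}" and s: "sat M X (Alls (x # xs) (And D R))"
    then have s': "sat M (supp X (\<lambda>_. univ M) x) D" using IH by (simp add: refines_def)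
    show "sat M X D"
    proof (rule sat_local[OF KV_D[OF assms(1)] _ s'])
      fix s assume s: "s \<in> X"
      from ne obtain a where "a \<in> univ M" by blast
      then have "s(x \<mapsto> a) \<in> supp X (\<lambda>_. univ M) x" using s unfolding supp_def by blast
      then show "\<exists>t \<in> supp X (\<lambda>_. univ M) x. \<forall>z \<in> Fv D. the (s z) = the (t z)"
        by (rule rev_bexI) (use Cons.prems in auto)
    qed
  qed
qed

lemma red_swap_keeps:
  assumes "distinct (u # xs @ zs)" "KV R"
  shows "Ex u (Alls xs (And (datom zs u) R)) \<leadsto> Alls xs (Ex u (And (datom zs u) R))"
  using assms(1)
proof (induction xs)
  case Nil
  show ?case using assms(2) by (simp add: red_refl)
next
  case (Cons x xs)
  have "Ex u (All x (Alls xs (And (datom zs u) R))) \<leadsto> All x (Ex u (Alls xs (And (datom zs u) R)))"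
    by (rule red_swap_keep[of _ _ zs]) (use Cons.prems assms(2) in \<open>auto intro!: refines_Alls\<close>)
  also have "\<dots> \<leadsto> All x (Alls xs (Ex u (And (datom zs u) R)))"
    by (rule red_all[OF Cons.IH]) (use Cons.prems in auto)
  finally show ?case by simp
qed

text \<open>Only the first swap has to add the dependence atom; in each further one it is already there.\<close>

lemma red_swap_all:
  assumes "distinct (u # xs @ zs)" "KV R" "Fv R \<subseteq> {u} \<union> set xs \<union> set zs" "xs \<noteq> []"
  shows "Ex u (Alls xs R) \<leadsto> Alls xs (Ex u (And R (datom zs u)))"
proof -
  from assms(4) obtain x xs' where e: "xs = x # xs'" by (cases xs) auto
  have "Ex u (All x (Alls xs' R)) \<leadsto> All x (Ex u (And (datom zs u) (Alls xs' R)))"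
    by (rule red_swap_first) (use assms e in auto)
  also have "\<dots> \<leadsto> All x (Ex u (And (Alls xs' R) (datom zs u)))"
    by (intro red_all red_ex red_and_comm) (use assms in simp_all)
  also have "\<dots> \<leadsto> All x (Ex u (Alls xs' (And R (datom zs u))))"
    by (intro red_all red_ex red_and_Alls) (use assms e in auto)
  also have "\<dots> \<leadsto> All x (Ex u (Alls xs' (And (datom zs u) R)))"
    by (intro red_all red_ex red_Alls red_and_comm) (use assms in simp_all)
  also have "\<dots> \<leadsto> All x (Alls xs' (Ex u (And (datom zs u) R)))"
    by (rule red_all[OF red_swap_keeps]) (use assms e in auto)
  also have "\<dots> \<leadsto> All x (Alls xs' (Ex u (And R (datom zs u))))"
    by (intro red_all red_Alls red_ex red_and_comm) (use assms in simp_all)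
  finally show ?thesis using e by simp
qed

text \<open>An existential quantifier that passes universal ones gets a dependence atom that makes it
  depend only on the variables outside its old scope: \<open>ox\<close> and \<open>oy\<close>, which are quantified
  universally and existentially further outside, and the free variables \<open>vs\<close>. They are listed in
  the order in which the final prefix has them.\<close>

lemma front:
  assumes "KV \<alpha>" "distinct (ox @ oy @ map snd Q @ ws @ vs)"
    "Fv (And (dconj ds) \<alpha>) \<subseteq> set (ox @ oy @ map snd Q @ ws @ vs)"
  shows "\<exists>es. Qs Q (Exs ws (And (dconj ds) \<alpha>)) \<leadsto>
      Alls (allv Q) (Exs (exv Q @ ws) (And (dconj (es @ ds)) \<alpha>)) \<and>
    (\<forall>(zs, y) \<in> set es. y \<in> set (exv Q) \<and> subseq zs ((ox @ allv Q) @ (oy @ exv Q) @ vs))"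
  using assms
proof (induction Q arbitrary: ox oy)
  case Nil
  then show ?case by (intro HOL.exI[of _ "[]"]) (simp add: red_refl)
next
  case (Cons q Q)
  obtain b u where q: "q = (b, u)" by (cases q)
  show ?case
  proof (cases b)
    case True
    from Cons.IH[of "ox @ [u]" oy] Cons.prems q obtain es where
      r: "Qs Q (Exs ws (And (dconj ds) \<alpha>)) \<leadsto> Alls (allv Q) (Exs (exv Q @ ws) (And (dconj (es @ ds)) \<alpha>))"
      and es: "\<forall>(zs, y) \<in> set es. y \<in> set (exv Q) \<and> subseq zs (((ox @ [u]) @ allv Q) @ (oy @ exv Q) @ vs)"
      by auto
    from red_all[OF r, of u] es show ?thesis using q True by auto
  next
    case False
    from Cons.IH[of ox "oy @ [u]"] Cons.prems q obtain es where
      r: "Qs Q (Exs ws (And (dconj ds) \<alpha>)) \<leadsto> Alls (allv Q) (Exs (exv Q @ ws) (And (dconj (es @ ds)) \<alpha>))"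
      and es: "\<forall>(zs, y) \<in> set es. y \<in> set (exv Q) \<and> subseq zs ((ox @ allv Q) @ ((oy @ [u]) @ exv Q) @ vs)"
      by auto
    have s: "set (allv Q) \<subseteq> snd ` set Q" "set (exv Q) \<subseteq> snd ` set Q"
      by (auto simp: allv_def exv_def)
    let ?R = "Exs (exv Q @ ws) (And (dconj (es @ ds)) \<alpha>)"
    have ru: "Ex u (Qs Q (Exs ws (And (dconj ds) \<alpha>))) \<leadsto> Ex u (Alls (allv Q) ?R)" by (rule red_ex[OF r])
    \<comment> \<open>Without a universal quantifier inside, nothing is passed and no atom is needed.\<close>
    show ?thesis
    proof (cases "allv Q = []")
      case True
      then show ?thesis using ru es q False by (intro HOL.exI[of _ es]) auto
    next
      case ne: False
      \<comment> \<open>The values of \<open>u\<close> are determined by everything quantified before it.\<close>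
      let ?zs = "ox @ oy @ vs"
      have dall: "distinct (allv Q)" "distinct (exv Q)" "set (allv Q) \<inter> set (exv Q) = {}"
        using Cons.prems(2) unfolding allv_def exv_def by (auto simp: distinct_map inj_on_def)
      have dis: "distinct (u # allv Q @ ?zs)" using Cons.prems(2) q s dall by auto
      have Fes: "Fv (dconj es :: ('f, 'p, 'v) fm) \<subseteq> set ox \<union> set oy \<union> set vs \<union> set (allv Q) \<union> set (exv Q) \<union> {u}"
      proof
        fix v assume "v \<in> Fv (dconj es :: ('f, 'p, 'v) fm)"
        then obtain d where d: "d \<in> set es" "v \<in> insert (snd d) (set (fst d))" unfolding Fv_dconj by blast
        obtain zs y where dzy: "d = (zs, y)" by (cases d)
        have e: "y \<in> set (exv Q)" "subseq zs ((ox @ allv Q) @ ((oy @ [u]) @ exv Q) @ vs)"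
          using es d(1) unfolding dzy by blast+
        then show "v \<in> set ox \<union> set oy \<union> set vs \<union> set (allv Q) \<union> set (exv Q) \<union> {u}"
          using d(2) dzy e(1) subseq_set[OF e(2)] by auto
      qed
      have F0: "Fv (And (dconj (es @ ds)) \<alpha>) = Fv (dconj es :: ('f, 'p, 'v) fm) \<union> Fv (And (dconj ds) \<alpha>)"
        unfolding Fv.simps Fv_dconj set_append by blast
      have sQ: "snd ` set Q = set (allv Q) \<union> set (exv Q)" by (auto simp: allv_def exv_def image_iff)
      have F1: "Fv ?R \<subseteq> {u} \<union> set (allv Q) \<union> set ?zs"
      proof -
        have "Fv (And (dconj ds) \<alpha>) \<subseteq>
          set ox \<union> set oy \<union> {u} \<union> set (allv Q) \<union> set (exv Q) \<union> set ws \<union> set vs"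
          using Cons.prems(3) q sQ by auto
        then show ?thesis using Fes unfolding Exs_props F0 set_append by blast
      qed
      have KVR: "KV ?R" using Cons.prems(1) by (simp del: map_append)
      have dj: "set (exv Q @ ws) \<inter> Fv (datom ?zs u :: ('f, 'p, 'v) fm) = {}" using Cons.prems(2) q s by auto
      have "Ex u (Alls (allv Q) ?R) \<leadsto> Alls (allv Q) (Ex u (And ?R (datom ?zs u)))"
        by (rule red_swap_all[OF dis KVR F1 ne])
      also have "\<dots> \<leadsto> Alls (allv Q) (Ex u (Exs (exv Q @ ws) (And (And (dconj (es @ ds)) \<alpha>) (datom ?zs u))))"
        by (intro red_Alls red_ex, rule red_and_Exs[OF _ _ dj]) (use Cons.prems(1) in \<open>simp_all del: map_append\<close>)
      also have "\<dots> \<leadsto> Alls (allv Q) (Ex u (Exs (exv Q @ ws) (And (dconj ((?zs, u) # es @ ds)) \<alpha>)))"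
        by (intro red_Alls red_ex red_Exs red_push) (use Cons.prems in simp)
      finally have "Qs (q # Q) (Exs ws (And (dconj ds) \<alpha>)) \<leadsto>
        Alls (allv (q # Q)) (Exs (exv (q # Q) @ ws) (And (dconj (((?zs, u) # es) @ ds)) \<alpha>))"
        using red_trans[OF ru] q False by simp
      moreover have "subseq ?zs ((ox @ allv Q) @ (oy @ u # exv Q) @ vs)"
        using subseq_mid[of ox oy vs "allv Q" "u # exv Q"] by simp
      then have "\<forall>(zs, y) \<in> set ((?zs, u) # es). y \<in> set (exv (q # Q)) \<and>
        subseq zs ((ox @ allv (q # Q)) @ (oy @ exv (q # Q)) @ vs)"
        using es q False by auto
      ultimately show ?thesis by blast
    qed
  qed
qed

subsection \<open>The normal form\<close>

definition nform :: "'v list \<Rightarrow> 'v list \<Rightarrow> 'v list \<Rightarrow> ('v list \<times> 'v) list \<Rightarrow> ('f, 'p, 'v) fm \<Rightarrow> bool" where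
  "nform xs ys vs ds \<alpha> \<longleftrightarrow> distinct (xs @ ys @ vs) \<and> qf_fo L \<alpha> \<and> Fv \<alpha> \<subseteq> set (xs @ ys @ vs) \<and>
     (\<forall>(zs, y) \<in> set ds. subseq zs (xs @ ys @ vs) \<and> y \<in> set ys)"

text \<open>Negations are pushed inside, then the quantifiers are pulled out, then the dependence atoms are
  collected in front of the matrix, and then the universal quantifiers are pulled to the front.\<close>

theorem normal_form:
  assumes "KV \<phi>"
  shows "\<exists>xs ys vs ds \<alpha>. nform xs ys vs ds \<alpha> \<and> \<phi> \<leadsto> Alls xs (Exs ys (And (dconj ds) \<alpha>))"
proof -
  from finite_distinct_list[of "Fv \<phi>"] obtain vs where vs: "set vs = Fv \<phi>" "distinct vs" by auto
  have r0: "\<phi> \<leadsto> push_neg \<phi>" by (rule red_push_neg[OF assms])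
  have n: "inner_neg (push_neg \<phi>)" "Fv (push_neg \<phi>) = Fv \<phi>" using push_neg_props[OF assms] by simp_all
  from prenex[OF n(1) red_KV(2)[OF r0], of "{}"] obtain Q \<theta> where r1: "push_neg \<phi> \<leadsto> Qs Q \<theta>"
    and m: "is_matrix (exv Q) \<theta>" and Q: "distinct (map snd Q)" "snd ` set Q \<inter> Fv \<phi> = {}" "Fv \<theta> \<subseteq> Fv \<phi> \<union> snd ` set Q"
    using n(2) by auto
  have k: "KV \<theta>" using red_KV(2)[OF r1] by simp
  have fin: "finite (snd ` set Q \<union> Fv \<phi>)" by simp
  from matrix_block[OF m k fin] obtain ds \<alpha> where r2: "\<theta> \<leadsto> dep_block ds \<alpha>" and a: "qf_fo L \<alpha>"
    and d: "distinct (map snd ds)" "set (map snd ds) \<inter> ((snd ` set Q \<union> Fv \<phi>) \<union> Fv \<theta>) = {}"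
      "Fv \<alpha> \<subseteq> Fv \<theta> \<union> set (map snd ds)" "\<forall>d \<in> set ds. subseq (fst d) (exv Q) \<and> set (fst d) \<subseteq> Fv \<theta>" by blast
  let ?ws = "map snd ds"
  have ka: "KV \<alpha>" using a by (simp add: qf_fo_def)
  have dis: "distinct ([] @ [] @ map snd Q @ ?ws @ vs)" using Q d(1,2) vs by auto
  have Fa: "Fv (And (dconj ds) \<alpha>) \<subseteq> set ([] @ [] @ map snd Q @ ?ws @ vs)"
  proof -
    have "Fv (dconj ds) \<subseteq> Fv \<theta> \<union> set ?ws" using d(4) unfolding Fv_dconj by auto
    then show ?thesis using d(3) Q(3) vs by auto
  qed
  from front[OF ka dis Fa] obtain es where
    r3: "Qs Q (Exs ?ws (And (dconj ds) \<alpha>)) \<leadsto> Alls (allv Q) (Exs (exv Q @ ?ws) (And (dconj (es @ ds)) \<alpha>))"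
    and es: "\<forall>(zs, y) \<in> set es. y \<in> set (exv Q) \<and> subseq zs (allv Q @ exv Q @ vs)" by auto
  have "\<phi> \<leadsto> Qs Q \<theta>" by (rule red_trans[OF r0 r1])
  also have "\<dots> \<leadsto> Qs Q (Exs ?ws (And (dconj ds) \<alpha>))" using red_Qs[OF r2] by (simp add: dep_block_def)
  also note r3
  finally have "\<phi> \<leadsto> Alls (allv Q) (Exs (exv Q @ ?ws) (And (dconj (es @ ds)) \<alpha>))" .
  moreover have "nform (allv Q) (exv Q @ ?ws) vs (es @ ds) \<alpha>" unfolding nform_def
  proof (intro conjI)
    have sQ: "snd ` set Q = set (allv Q) \<union> set (exv Q)" by (auto simp: allv_def exv_def image_iff)
    have dall: "distinct (allv Q)" "distinct (exv Q)" "set (allv Q) \<inter> set (exv Q) = {}"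
      using Q(1) unfolding allv_def exv_def by (auto simp: distinct_map inj_on_def)
    show "distinct (allv Q @ (exv Q @ ?ws) @ vs)" using dis dall sQ by auto
    show "Fv \<alpha> \<subseteq> set (allv Q @ (exv Q @ ?ws) @ vs)" using Fa sQ by auto
    have 1: "subseq (allv Q @ exv Q @ vs) (allv Q @ (exv Q @ ?ws) @ vs)"
      using subseq_mid[of "allv Q" "exv Q" vs "[]" ?ws] by simp
    have 2: "subseq (exv Q) (allv Q @ (exv Q @ ?ws) @ vs)"
    proof (rule list_emb_append2)
      have "subseq (exv Q @ []) (exv Q @ ?ws @ vs)" by (rule list_emb_append_mono) simp_all
      then show "subseq (exv Q) ((exv Q @ ?ws) @ vs)" by simp
    qed
    show "\<forall>(zs, y) \<in> set (es @ ds). subseq zs (allv Q @ (exv Q @ ?ws) @ vs) \<and> y \<in> set (exv Q @ ?ws)"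
    proof
      fix e assume "e \<in> set (es @ ds)"
      then consider "e \<in> set es" | "e \<in> set ds" by auto
      then show "case e of (zs, y) \<Rightarrow> subseq zs (allv Q @ (exv Q @ ?ws) @ vs) \<and> y \<in> set (exv Q @ ?ws)"
      proof cases
        case 1
        then show ?thesis using es \<open>subseq (allv Q @ exv Q @ vs) (allv Q @ (exv Q @ ?ws) @ vs)\<close>
          by (cases e) (auto intro: subseq_order.order_trans)
      next
        case 2
        then have "subseq (fst e) (exv Q)" "snd e \<in> set ?ws" using d(4) by auto
        then show ?thesis using \<open>subseq (exv Q) (allv Q @ (exv Q @ ?ws) @ vs)\<close>
          by (cases e) (auto intro: subseq_order.order_trans)
      qed
    qed
  qed (rule a)
  ultimately show ?thesis by blast
qed

end

section \<open>First-order approximations\<close>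

definition ovr :: "('v \<Rightarrow> 'u) \<Rightarrow> 'v list \<Rightarrow> 'u list \<Rightarrow> 'v \<Rightarrow> 'u" where
  "ovr e xs as v = (case map_of (zip xs as) v of Some a \<Rightarrow> a | None \<Rightarrow> e v)"

lemma ovr_Nil [simp]: "ovr e [] as = e"
  by (auto simp: ovr_def)

lemma ovr_notin: "v \<notin> set xs \<Longrightarrow> ovr e xs as v = e v"
proof -
  assume "v \<notin> set xs"
  then have "map_of (zip xs as) v = None" by (auto simp: map_of_eq_None_iff dest: set_zip_leftD)
  then show ?thesis by (simp add: ovr_def)
qed

lemma ovr_nth: "distinct xs \<Longrightarrow> length as = length xs \<Longrightarrow> i < length xs \<Longrightarrow> ovr e xs as (xs ! i) = as ! i"
  by (simp add: ovr_def map_of_zip_nth)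

lemma ovr_Cons: "x \<notin> set xs \<Longrightarrow> ovr e (x # xs) (a # as) = ovr (e(x := a)) xs as"
proof
  fix v assume x: "x \<notin> set xs"
  show "ovr e (x # xs) (a # as) v = ovr (e(x := a)) xs as v"
  proof (cases "v = x")
    case True
    then show ?thesis using x by (simp add: ovr_notin) (simp add: ovr_def)
  qed (simp add: ovr_def split: option.split)
qed

lemma ovr_append:
  "distinct (xs @ ys) \<Longrightarrow> length as = length xs \<Longrightarrow> ovr (ovr e xs as) ys bs = ovr e (xs @ ys) (as @ bs)"
proof (induction xs arbitrary: e as)
  case (Cons x xs)
  then obtain a as' where as: "as = a # as'" by (cases as) auto
  have "ovr (ovr (e(x := a)) xs as') ys bs = ovr (e(x := a)) (xs @ ys) (as' @ bs)"
    by (rule Cons.IH) (use Cons.prems as in auto)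
  then show ?case using Cons.prems as by (simp add: ovr_Cons)
qed simp

lemma ovr_map: "g (ovr e xs as v) = ovr (\<lambda>v. g (e v)) xs (map g as) v"
proof -
  have "map_of (zip xs (map g as)) v = map_option g (map_of (zip xs as) v)"
    by (induction xs arbitrary: as) (auto simp: zip_Cons1 split: list.split)
  then show ?thesis by (simp add: ovr_def split: option.split)
qed

lemma fsat_Alls:
  "distinct xs \<Longrightarrow> fsat M e (Alls xs \<phi>) \<longleftrightarrow>
    (\<forall>as. length as = length xs \<and> set as \<subseteq> univ M \<longrightarrow> fsat M (ovr e xs as) \<phi>)"
proof (induction xs arbitrary: e)
  case (Cons x xs)
  have "fsat M e (Alls (x # xs) \<phi>) \<longleftrightarrow> (\<forall>a \<in> univ M. \<forall>as. length as = length xs \<and> set as \<subseteq> univ M \<longrightarrow>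
      fsat M (ovr e (x # xs) (a # as)) \<phi>)" using Cons by (simp add: ovr_Cons)
  also have "\<dots> \<longleftrightarrow> (\<forall>as. length as = length (x # xs) \<and> set as \<subseteq> univ M \<longrightarrow> fsat M (ovr e (x # xs) as) \<phi>)"
    by (auto simp: length_Suc_conv)
  finally show ?case .
qed simp

lemma fsat_Exs_iff:
  "distinct xs \<Longrightarrow> fsat M e (Exs xs \<phi>) \<longleftrightarrow>
    (\<exists>as. length as = length xs \<and> set as \<subseteq> univ M \<and> fsat M (ovr e xs as) \<phi>)"
proof (induction xs arbitrary: e)
  case (Cons x xs)
  have "fsat M e (Exs (x # xs) \<phi>) \<longleftrightarrow> (\<exists>a \<in> univ M. \<exists>as. length as = length xs \<and> set as \<subseteq> univ M \<and>
      fsat M (ovr e (x # xs) (a # as)) \<phi>)" using Cons by (simp add: ovr_Cons)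
  also have "\<dots> \<longleftrightarrow> (\<exists>as. length as = length (x # xs) \<and> set as \<subseteq> univ M \<and> fsat M (ovr e (x # xs) as) \<phi>)"
  proof
    assume "\<exists>a \<in> univ M. \<exists>as. length as = length xs \<and> set as \<subseteq> univ M \<and> fsat M (ovr e (x # xs) (a # as)) \<phi>"
    then obtain a as where "a \<in> univ M" "length as = length xs" "set as \<subseteq> univ M"
      "fsat M (ovr e (x # xs) (a # as)) \<phi>" by blast
    then show "\<exists>as. length as = length (x # xs) \<and> set as \<subseteq> univ M \<and> fsat M (ovr e (x # xs) as) \<phi>"
      by (intro HOL.exI[of _ "a # as"]) simp
  next
    assume "\<exists>as. length as = length (x # xs) \<and> set as \<subseteq> univ M \<and> fsat M (ovr e (x # xs) as) \<phi>"
    then obtain bs where bs: "length bs = length (x # xs)" "set bs \<subseteq> univ M" "fsat M (ovr e (x # xs) bs) \<phi>" by blast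
    then obtain a as where "bs = a # as" by (cases bs) auto
    then show "\<exists>a \<in> univ M. \<exists>as. length as = length xs \<and> set as \<subseteq> univ M \<and> fsat M (ovr e (x # xs) (a # as)) \<phi>"
      using bs by auto
  qed
  finally show ?case .
qed simp

text \<open>One player chooses values of the universally quantified variables, the other answers with
  values of the existentially quantified ones. Each round must satisfy \<open>C\<close> and be compatible with
  all earlier rounds in the sense of \<open>R\<close>, which is why \<open>C\<close> is strengthened after every round.\<close>

primrec game :: "'u set \<Rightarrow> nat \<Rightarrow> nat \<Rightarrow> ('u list \<times> 'u list \<Rightarrow> 'u list \<times> 'u list \<Rightarrow> bool) \<Rightarrow> nat \<Rightarrow>
    ('u list \<times> 'u list \<Rightarrow> bool) \<Rightarrow> bool" where
  "game A k m R 0 C \<longleftrightarrow> True"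
| "game A k m R (Suc n) C \<longleftrightarrow> (\<forall>a. length a = k \<and> set a \<subseteq> A \<longrightarrow>
     (\<exists>b. length b = m \<and> set b \<subseteq> A \<and> C (a, b) \<and> game A k m R n (\<lambda>q. C q \<and> R (a, b) q)))"

lemma game_mono:
  assumes "\<And>a b a' b'. length a = k \<Longrightarrow> length b = m \<Longrightarrow> length a' = k \<Longrightarrow> length b' = m \<Longrightarrow>
      R' (a, b) (a', b') \<Longrightarrow> R (a, b) (a', b')"
  shows "(\<And>a b. length a = k \<Longrightarrow> length b = m \<Longrightarrow> C' (a, b) \<Longrightarrow> C (a, b)) \<Longrightarrow>
    game A k m R' n C' \<Longrightarrow> game A k m R n C"
proof (induction n arbitrary: C C')
  case (Suc n)
  show ?case unfolding game.simps
  proof (intro HOL.allI impI)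
    fix a assume a: "length a = k \<and> set a \<subseteq> A"
    with Suc.prems(2) obtain b where b: "length b = m" "set b \<subseteq> A" "C' (a, b)"
      "game A k m R' n (\<lambda>q. C' q \<and> R' (a, b) q)" by auto
    have "game A k m R n (\<lambda>q. C q \<and> R (a, b) q)"
      by (rule Suc.IH[OF _ b(4)]) (use Suc.prems(1) assms a b in blast)
    then show "\<exists>b. length b = m \<and> set b \<subseteq> A \<and> C (a, b) \<and> game A k m R n (\<lambda>q. C q \<and> R (a, b) q)"
      using a b Suc.prems(1) by blast
  qed
qed simp

definition asgn :: "('v \<Rightarrow> 'u) \<Rightarrow> 'v list \<Rightarrow> 'v list \<Rightarrow> 'u list \<times> 'u list \<Rightarrow> 'v \<Rightarrow> 'u" where
  "asgn e xs ys q = ovr e (xs @ ys) (fst q @ snd q)"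

definition compat :: "('v \<Rightarrow> 'u) \<Rightarrow> 'v list \<Rightarrow> 'v list \<Rightarrow> ('v list \<times> 'v) list \<Rightarrow>
    'u list \<times> 'u list \<Rightarrow> 'u list \<times> 'u list \<Rightarrow> bool" where
  "compat e xs ys ds p q \<longleftrightarrow> (\<forall>(zs, y) \<in> set ds.
     map (asgn e xs ys p) zs = map (asgn e xs ys q) zs \<longrightarrow> asgn e xs ys p y = asgn e xs ys q y)"

lemma compat_sym: "compat e xs ys ds p q \<Longrightarrow> compat e xs ys ds q p"
  unfolding compat_def by (metis (mono_tags, lifting) case_prod_conv prod.collapse)

lemma compat_refl: "compat e xs ys ds p p"
  by (auto simp: compat_def)

lemma Eqs_map: "Eqs (map f zs) (map g zs) = Conj (map (\<lambda>z. Eq (f z) (g z)) zs)"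
  by (simp add: Eqs_def zip_map_map zip_same_conv_map o_def)

text \<open>Compatibility of the values of \<open>xs ys\<close> with those of their copies under the renaming \<open>r\<close>, as it
  occurs in the conclusion of dependence elimination.\<close>

definition link :: "('v \<Rightarrow> 'v) \<Rightarrow> ('v list \<times> 'v) list \<Rightarrow> ('f, 'p, 'v) fm" where
  "link r ds = Conj (map (\<lambda>(zs, y). imp (Eqs (map Var zs) (map (Var \<circ> r) zs)) (Eq (Var y) (Var (r y)))) ds)"

lemma link_props:
  "first_order (link r ds)" "KV_formula L (link r ds)"
  "Fv (link r ds) \<subseteq> (\<Union>d \<in> set ds. insert (snd d) (set (fst d)) \<union> insert (r (snd d)) (r ` set (fst d)))"
  "bvs (link r ds :: ('f, 'p, 'v) fm) \<subseteq> {undefined}"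
  "fsat M e (link r ds) \<longleftrightarrow> (\<forall>(zs, y) \<in> set ds. map e zs = map (\<lambda>v. e (r v)) zs \<longrightarrow> e y = e (r y))"
proof -
  show "first_order (link r ds)" "KV_formula L (link r ds)"
    by (auto simp: link_def Conj_simps imp_def Eqs_map)
  show "Fv (link r ds) \<subseteq> (\<Union>d \<in> set ds. insert (snd d) (set (fst d)) \<union> insert (r (snd d)) (r ` set (fst d)))"
    by (force simp: link_def Conj_simps imp_def Eqs_map)
  have B: "bvs (Eqs (map Var zs) (map (Var \<circ> r) zs) :: ('f, 'p, 'v) fm) \<subseteq> {undefined}" for zs
    unfolding Eqs_map by (rule order_trans[OF bvs_Conj]) auto
  then show "bvs (link r ds :: ('f, 'p, 'v) fm) \<subseteq> {undefined}"
    unfolding link_def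
  proof (intro order_trans[OF bvs_Conj] insert_subsetI UN_least)
    fix \<phi> :: "('f, 'p, 'v) fm"
    assume "\<phi> \<in> set (map (\<lambda>(zs, y). imp (Eqs (map Var zs) (map (Var \<circ> r) zs)) (Eq (Var y) (Var (r y)))) ds)"
    then obtain zs y where "\<phi> = imp (Eqs (map Var zs) (map (Var \<circ> r) zs)) (Eq (Var y) (Var (r y)))" by auto
    then show "bvs \<phi> \<subseteq> {undefined}" using B[of zs] by (simp add: imp_def)
  qed simp
  show "fsat M e (link r ds) \<longleftrightarrow> (\<forall>(zs, y) \<in> set ds. map e zs = map (\<lambda>v. e (r v)) zs \<longrightarrow> e y = e (r y))"
    by (auto simp: link_def Conj_simps imp_def Eqs_map map_eq_conv)
qed

lemma rename_props:
  assumes "distinct (xs @ xs')" "length xs' = length xs"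
  shows "v \<notin> set xs \<Longrightarrow> rename xs xs' v = v" "i < length xs \<Longrightarrow> rename xs xs' (xs ! i) = xs' ! i"
    "map (rename xs xs') xs = xs'"
proof -
  show "v \<notin> set xs \<Longrightarrow> rename xs xs' v = v" for v
  proof -
    assume "v \<notin> set xs"
    then have "map_of (zip xs xs') v = None" by (auto simp: map_of_eq_None_iff dest: set_zip_leftD)
    then show ?thesis by (simp add: rename_def)
  qed
  show n: "rename xs xs' (xs ! i) = xs' ! i" if "i < length xs" for i
    using assms that by (simp add: rename_def map_of_zip_nth)
  show "map (rename xs xs') xs = xs'"
    by (rule nth_equalityI) (use n assms in auto)
qed

lemma subst_dconj:
  "subst_fm (Var \<circ> r) (dconj ds) = dconj (map (\<lambda>d. (map r (fst d), r (snd d))) ds)"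
proof -
  have "subst_fm (Var \<circ> r) (Conj \<phi>s) = Conj (map (subst_fm (Var \<circ> r)) \<phi>s)" for \<phi>s :: "('a, 'b, 'c) fm list"
    by (induction \<phi>s rule: Conj.induct) (simp_all add: falsum_def)
  then show ?thesis by (simp add: dep_atom_def o_def)
qed

context dep_logic
begin

lemma pv_Alls_mono: "pv \<phi> \<psi> \<Longrightarrow> pv (Alls xs \<phi>) (Alls xs \<psi>)"
  by (induction xs) (simp_all add: pv_all_mono)

lemma pv_Exs_mono: "pv \<phi> \<psi> \<Longrightarrow> pv (Exs xs \<phi>) (Exs xs \<psi>)"
  by (induction xs) (simp_all add: pv_ex_mono)

lemma pv_dep_elim:
  assumes "distinct (xs @ ys @ vs @ xs' @ ys')" "length xs' = length xs" "length ys' = length ys"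
    "Fv \<phi> \<subseteq> set (xs @ ys @ vs)" "\<forall>(zs, y) \<in> set ds. subseq zs (xs @ ys @ vs) \<and> y \<in> set ys"
    "r = rename (xs @ ys) (xs' @ ys')" "free_for (Var \<circ> r) \<phi>" "KV \<phi>"
  shows "pv (Alls xs (Exs ys (And (dconj ds) \<phi>)))
    (Alls xs (Exs ys (And \<phi> (Alls xs' (Exs ys' (And (subst_fm (Var \<circ> r) \<phi>) (link r ds)))))))"
proof -
  have "{Alls xs (Exs ys (And (dconj ds) \<phi>))} \<turnstile>
    Alls xs (Exs ys (And \<phi> (Alls xs' (Exs ys' (And (subst_fm (Var \<circ> r) \<phi>) (link r ds))))))"
    unfolding link_def by (rule derives.dep_elim[OF ax1 assms(1-7)]) (use assms(8) in simp)
  moreover have "KV (subst_fm (Var \<circ> r) \<phi>)" using assms(8) by (rule KV_subst) simp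
  ultimately show ?thesis using assms(8) link_props(2) by (simp add: pv_def)
qed

text \<open>One dependence elimination adds one round to the formula, but it uses up the dependence atoms.
  A copy of them is therefore first put into the matrix. The rule repeats the matrix in the new
  round, and so the atoms, renamed, are available for the next elimination in the innermost block.
  There the variables of the earlier rounds count as free variables, and the requirement of
  compatibility with the round before is a part of the matrix. Thus it is repeated too, which
  makes each round compatible with all earlier ones.\<close>

lemma approximation:
  assumes "distinct (xs @ ys @ vs)" "Fv \<chi> \<subseteq> set (xs @ ys @ vs)" "first_order \<chi>" "KV \<chi>" "bvs \<chi> \<subseteq> {undefined}"
    "\<forall>(zs, y) \<in> set ds. subseq zs (xs @ ys @ vs) \<and> y \<in> set ys"
  shows "\<exists>A. pv (Alls xs (Exs ys (And (dconj ds) \<chi>))) A \<and> first_order A \<and>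
    (\<forall>(M :: ('f, 'p, 'm) model) e. fsat M e A \<longrightarrow>
      game (univ M) (length xs) (length ys) (compat e xs ys ds) n (\<lambda>q. fsat M (asgn e xs ys q) \<chi>))"
  using assms
proof (induction n arbitrary: xs ys vs ds \<chi>)
  case 0
  have "pv (Alls xs (Exs ys (And (dconj ds) \<chi>))) (Neg falsum)"
    using neg_falsum[of "{Alls xs (Exs ys (And (dconj ds) \<chi>))}"] 0 by (simp add: pv_def)
  then show ?case by (intro HOL.exI[of _ "Neg falsum"]) simp
next
  case (Suc n)
  have "finite (insert undefined (set (xs @ ys @ vs)))" by simp
  from fresh_list[OF this, of "length xs + length ys"] obtain ws where
    ws: "length ws = length xs + length ys" "distinct ws" "set ws \<inter> insert undefined (set (xs @ ys @ vs)) = {}" by blast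
  define xs' where "xs' = take (length xs) ws"
  define ys' where "ys' = drop (length xs) ws"
  have ws_eq: "ws = xs' @ ys'" by (simp add: xs'_def ys'_def)
  have len: "length xs' = length xs" "length ys' = length ys" using ws(1) by (simp_all add: xs'_def ys'_def)
  have dis: "distinct (xs @ ys @ vs @ xs' @ ys')" using ws Suc.prems(1) unfolding ws_eq by auto
  define r where "r = rename (xs @ ys) (xs' @ ys')"
  have dr: "distinct ((xs @ ys) @ (xs' @ ys'))" "length (xs' @ ys') = length (xs @ ys)" using dis len by auto
  note rp = rename_props[OF dr, folded r_def]
  have r_vs: "r v = v" if "v \<in> set vs" for v by (rule rp(1)) (use dis that in auto)
  have r_map: "map r (xs @ ys @ vs) = xs' @ ys' @ vs"
    using rp(3) r_vs by (simp add: map_idI)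
  have r_in: "r z = z \<or> r z \<in> set ws" for z
  proof (cases "z \<in> set (xs @ ys)")
    case True
    then have "r z \<in> set (map r (xs @ ys))" unfolding set_map by (rule imageI)
    then show ?thesis unfolding rp(3) ws_eq by simp
  qed (use rp(1) in blast)
  let ?\<phi> = "And (dconj ds) \<chi>"
  let ?\<chi>' = "And (subst_fm (Var \<circ> r) \<chi>) (link r ds)"
  let ?ds' = "map (\<lambda>d. (map r (fst d), r (snd d))) ds"
  let ?K = "Alls xs' (Exs ys' (And (subst_fm (Var \<circ> r) ?\<phi>) (link r ds)))"
  let ?\<Psi>' = "Alls xs' (Exs ys' (And (dconj ?ds') ?\<chi>'))"
  have ds_in: "set zs \<subseteq> set (xs @ ys @ vs)" "y \<in> set ys" if "(zs, y) \<in> set ds" for zs y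
    using Suc.prems(6) that subseq_set[of zs "xs @ ys @ vs"] by auto
  have Fd: "Fv (dconj ds :: ('f, 'p, 'v) fm) \<subseteq> set (xs @ ys @ vs)"
    unfolding Fv_dconj using ds_in by fastforce
  have bd: "bvs (dconj ds :: ('f, 'p, 'v) fm) \<subseteq> {undefined}"
    using bvs_Conj[of "map dep_atom ds :: ('f, 'p, 'v) fm list"] by (auto simp: dep_atom_def)
  have ff: "free_for (Var \<circ> r) \<psi>" if "bvs \<psi> \<subseteq> {undefined}" for \<psi> :: "('f, 'p, 'v) fm"
  proof (rule free_for_bvs)
    fix z x assume "x \<in> Fvt ((Var \<circ> r) z)"
    then have "x = r z" by simp
    then show "x = z \<or> x \<notin> bvs \<psi>" using r_in[of z] that ws(3) by blast
  qed
  have ff\<phi>: "free_for (Var \<circ> r) ?\<phi>" by (rule ff) (use bd Suc.prems(5) in auto)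
  have ff\<chi>: "free_for (Var \<circ> r) \<chi>" by (rule ff) (use Suc.prems(5) in auto)
  have KV\<phi>: "KV ?\<phi>" using Suc.prems(4) by simp
  have KV\<chi>: "KV (subst_fm (Var \<circ> r) \<chi>)" using Suc.prems(4) by (rule KV_subst) simp
  have KVl: "KV (link r ds)" by (rule link_props)
  \<comment> \<open>One copy of the atoms is consumed, the other is a part of the matrix \<open>?\<phi>\<close>.\<close>
  have p1: "pv (Alls xs (Exs ys ?\<phi>)) (Alls xs (Exs ys (And (dconj ds) ?\<phi>)))"
    by (intro pv_Alls_mono pv_Exs_mono pv_andI pv_and1 pv_refl) (use Suc.prems(4) in simp_all)
  have p2: "pv (Alls xs (Exs ys (And (dconj ds) ?\<phi>))) (Alls xs (Exs ys (And ?\<phi> ?K)))"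
    by (rule pv_dep_elim[OF dis len _ Suc.prems(6) r_def ff\<phi> KV\<phi>]) (use Fd Suc.prems(2) in simp)
  have p3: "pv ?K ?\<Psi>'"
  proof (intro pv_Alls_mono pv_Exs_mono)
    let ?a = "And (subst_fm (Var \<circ> r) ?\<phi>) (link r ds)"
    have e: "?a = And (And (dconj ?ds') (subst_fm (Var \<circ> r) \<chi>)) (link r ds)" by (simp add: subst_dconj)
    have k: "KV (dconj ?ds')" by (rule KV_dconj)
    have 1: "pv ?a (And (dconj ?ds') (subst_fm (Var \<circ> r) \<chi>))" "pv ?a (link r ds)"
      unfolding e by (rule pv_and1 pv_and2; use k KV\<chi> KVl in simp)+
    have 2: "pv ?a (dconj ?ds')" "pv ?a (subst_fm (Var \<circ> r) \<chi>)"
      by (rule pv_trans[OF 1(1)], rule pv_and1 pv_and2, rule k, rule KV\<chi>)+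
    show "pv ?a (And (dconj ?ds') ?\<chi>')" by (intro pv_andI 1 2)
  qed
  have "\<exists>A. pv ?\<Psi>' A \<and> first_order A \<and> (\<forall>(M :: ('f, 'p, 'm) model) e. fsat M e A \<longrightarrow>
      game (univ M) (length xs') (length ys') (compat e xs' ys' ?ds') n (\<lambda>q. fsat M (asgn e xs' ys' q) ?\<chi>'))"
  proof (rule Suc.IH[of xs' ys' "vs @ xs @ ys"])
    show "distinct (xs' @ ys' @ vs @ xs @ ys)" using dis by auto
    have "Fv (subst_fm (Var \<circ> r) \<chi>) \<subseteq> r ` set (xs @ ys @ vs)"
      using Suc.prems(2) by (auto simp: Fv_subst[OF ff\<chi>])
    also have "\<dots> = set (xs' @ ys' @ vs)" unfolding r_map[symmetric] by (simp only: set_map)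
    finally have 1: "Fv (subst_fm (Var \<circ> r) \<chi>) \<subseteq> set (xs' @ ys' @ vs)" .
    have "Fv (link r ds :: ('f, 'p, 'v) fm) \<subseteq> set (xs @ ys @ vs) \<union> r ` set (xs @ ys @ vs)"
    proof (rule order_trans[OF link_props(3)], rule UN_least)
      fix d assume "d \<in> set ds"
      then have "(fst d, snd d) \<in> set ds" by simp
      from ds_in[OF this] show "insert (snd d) (set (fst d)) \<union> insert (r (snd d)) (r ` set (fst d))
        \<subseteq> set (xs @ ys @ vs) \<union> r ` set (xs @ ys @ vs)" by auto
    qed
    also have "r ` set (xs @ ys @ vs) = set (xs' @ ys' @ vs)" unfolding r_map[symmetric] by (simp only: set_map)
    finally show "Fv ?\<chi>' \<subseteq> set (xs' @ ys' @ vs @ xs @ ys)" using 1 by auto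
    show "first_order ?\<chi>'" using Suc.prems(3) link_props(1) by simp
    show "KV ?\<chi>'" using KV\<chi> KVl by simp
    show "bvs ?\<chi>' \<subseteq> {undefined}" using Suc.prems(5) link_props(4) by simp
    show "\<forall>(zs, y) \<in> set ?ds'. subseq zs (xs' @ ys' @ vs @ xs @ ys) \<and> y \<in> set ys'"
    proof
      fix d' assume "d' \<in> set ?ds'"
      then obtain zs y where d: "(zs, y) \<in> set ds" "d' = (map r zs, r y)" by auto
      have "subseq zs (xs @ ys @ vs)" using Suc.prems(6) d(1) by auto
      then have "subseq (map r zs) (xs' @ ys' @ vs)" unfolding r_map[symmetric] by (rule subseq_map)
      then have "subseq (map r zs @ []) ((xs' @ ys' @ vs) @ xs @ ys)" by (rule list_emb_append_mono) simp
      moreover have "map r xs = xs'" "map r ys = ys'" using rp(3) len by simp_all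
      then have "r y \<in> set ys'" using ds_in(2)[OF d(1)] by (metis image_eqI set_map)
      ultimately show "case d' of (zs, y) \<Rightarrow> subseq zs (xs' @ ys' @ vs @ xs @ ys) \<and> y \<in> set ys'"
        using d(2) by simp
    qed
  qed
  then obtain A where A: "pv ?\<Psi>' A" "first_order A"
    and sem: "\<And>(M :: ('f, 'p, 'm) model) e. fsat M e A \<Longrightarrow>
      game (univ M) (length xs') (length ys') (compat e xs' ys' ?ds') n (\<lambda>q. fsat M (asgn e xs' ys' q) ?\<chi>')"
    by blast
  let ?A = "Alls xs (Exs ys (And \<chi> A))"
  have p4: "pv (Alls xs (Exs ys (And ?\<phi> ?K))) ?A"
    by (intro pv_Alls_mono pv_Exs_mono pv_and_mono pv_and2 pv_trans[OF p3 A(1)]) (use Suc.prems(4) in simp_all)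
  have "pv (Alls xs (Exs ys ?\<phi>)) ?A" by (rule pv_trans[OF p1 pv_trans[OF p2 p4]])
  moreover have "first_order ?A" using A(2) Suc.prems(3) by simp
  moreover have "game (univ M) (length xs) (length ys) (compat e xs ys ds) (Suc n) (\<lambda>q. fsat M (asgn e xs ys q) \<chi>)"
    if s: "fsat M e ?A" for M :: "('f, 'p, 'm) model" and e
    unfolding game.simps
  proof (intro HOL.allI impI)
    fix a assume a: "length a = length xs \<and> set a \<subseteq> univ M"
    have dx: "distinct xs" "distinct ys" "distinct (xs @ ys)" using dis by auto
    from s a have "fsat M (ovr e xs a) (Exs ys (And \<chi> A))" by (simp add: fsat_Alls[OF dx(1)])
    then obtain b where b: "length b = length ys" "set b \<subseteq> univ M" "fsat M (ovr (ovr e xs a) ys b) (And \<chi> A)"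
      by (auto simp: fsat_Exs_iff[OF dx(2)])
    let ?e1 = "asgn e xs ys (a, b)"
    have "ovr (ovr e xs a) ys b = ?e1"
      unfolding asgn_def fst_conv snd_conv by (rule ovr_append[OF dx(3)]) (use a in simp)
    then have f: "fsat M ?e1 \<chi>" "fsat M ?e1 A" using b(3) by simp_all
    have g: "game (univ M) (length xs) (length ys) (compat ?e1 xs' ys' ?ds') n (\<lambda>q. fsat M (asgn ?e1 xs' ys' q) ?\<chi>')"
      using sem[OF f(2)] len by simp
    \<comment> \<open>A round played with the copies is a round played with the original variables.\<close>
    have r_asgn: "asgn ?e1 xs' ys' q (r v) = asgn e xs ys q v"
      if q: "length (fst q) = length xs" "length (snd q) = length ys" and v: "v \<in> set (xs @ ys @ vs)" for q v
    proof (cases "v \<in> set (xs @ ys)")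
      case True
      then obtain i where i: "i < length (xs @ ys)" "v = (xs @ ys) ! i" by (metis in_set_conv_nth)
      have "r v = (xs' @ ys') ! i" unfolding i(2) by (rule rp(2)[OF i(1)])
      moreover have "ovr ?e1 (xs' @ ys') (fst q @ snd q) ((xs' @ ys') ! i) = (fst q @ snd q) ! i"
        by (rule ovr_nth) (use dis len q i in auto)
      moreover have "ovr e (xs @ ys) (fst q @ snd q) ((xs @ ys) ! i) = (fst q @ snd q) ! i"
        by (rule ovr_nth) (use dis len q i in auto)
      ultimately show ?thesis unfolding asgn_def[of _ xs'] asgn_def[of _ xs ys q] i(2) by simp
    next
      case False
      then have vv: "v \<in> set vs" using v by auto
      have n: "v \<notin> set (xs' @ ys')" using dis vv by auto
      show ?thesis unfolding asgn_def r_vs[OF vv] ovr_notin[OF n] ovr_notin[OF False] ..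
    qed
    \<comment> \<open>It leaves the round of \<open>?e1\<close> in place, to which \<open>link\<close> compares it.\<close>
    have keep: "asgn ?e1 xs' ys' q v = ?e1 v" if "v \<in> set (xs @ ys @ vs)" for q v
    proof -
      have "v \<notin> set (xs' @ ys')" using dis that by auto
      then show ?thesis unfolding asgn_def[of _ xs'] by (rule ovr_notin)
    qed
    have "game (univ M) (length xs) (length ys) (compat e xs ys ds) n
      (\<lambda>q. fsat M (asgn e xs ys q) \<chi> \<and> compat e xs ys ds (a, b) q)"
    proof (rule game_mono[OF _ _ g])
      fix a1 b1 a2 b2
      assume l: "length a1 = length xs" "length b1 = length ys" "length a2 = length xs" "length b2 = length ys"
        and c: "compat ?e1 xs' ys' ?ds' (a1, b1) (a2, b2)"
      show "compat e xs ys ds (a1, b1) (a2, b2)" unfolding compat_def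
      proof (intro ballI, clarify)
        fix zs y assume d: "(zs, y) \<in> set ds" and eq: "map (asgn e xs ys (a1, b1)) zs = map (asgn e xs ys (a2, b2)) zs"
        have v: "v \<in> set (xs @ ys @ vs)" if "v \<in> insert y (set zs)" for v using ds_in[OF d] that by auto
        have "map (asgn ?e1 xs' ys' (a1, b1)) (map r zs) = map (asgn ?e1 xs' ys' (a2, b2)) (map r zs)"
          using eq v l by (simp add: r_asgn)
        moreover have "(map r zs, r y) \<in> set ?ds'" using d by force
        ultimately have "asgn ?e1 xs' ys' (a1, b1) (r y) = asgn ?e1 xs' ys' (a2, b2) (r y)"
          using c unfolding compat_def by blast
        then show "asgn e xs ys (a1, b1) y = asgn e xs ys (a2, b2) y" using v l by (simp add: r_asgn)
      qed
    next
      fix a2 b2 assume l: "length a2 = length xs" "length b2 = length ys"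
        and c: "fsat M (asgn ?e1 xs' ys' (a2, b2)) ?\<chi>'"
      let ?e2 = "asgn ?e1 xs' ys' (a2, b2)"
      have "fsat M (\<lambda>v. tval M ?e2 ((Var \<circ> r) v)) \<chi>" using c fsat_subst[OF ff\<chi>, of M ?e2] by simp
      moreover have "fsat M (\<lambda>v. tval M ?e2 ((Var \<circ> r) v)) \<chi> = fsat M (asgn e xs ys (a2, b2)) \<chi>"
      proof (rule fsat_cong)
        fix v assume "v \<in> Fv \<chi>"
        then have "v \<in> set (xs @ ys @ vs)" using Suc.prems(2) by blast
        then show "tval M ?e2 ((Var \<circ> r) v) = asgn e xs ys (a2, b2) v" using r_asgn[of "(a2, b2)" v] l by simp
      qed
      ultimately have "fsat M (asgn e xs ys (a2, b2)) \<chi>" by simp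
      moreover have "compat e xs ys ds (a, b) (a2, b2)" unfolding compat_def
      proof (intro ballI, clarify)
        fix zs y assume d: "(zs, y) \<in> set ds" and eq: "map ?e1 zs = map (asgn e xs ys (a2, b2)) zs"
        have v: "v \<in> set (xs @ ys @ vs)" if "v \<in> insert y (set zs)" for v using ds_in[OF d] that by auto
        have "map ?e2 zs = map (\<lambda>v. ?e2 (r v)) zs"
          using eq v l by (simp add: r_asgn keep)
        moreover have "fsat M ?e2 (link r ds)" using c by simp
        ultimately have "?e2 y = ?e2 (r y)" unfolding link_props(5) using d by blast
        then show "?e1 y = asgn e xs ys (a2, b2) y" using v l by (simp add: r_asgn keep)
      qed
      ultimately show "fsat M (asgn e xs ys (a2, b2)) \<chi> \<and> compat e xs ys ds (a, b) (a2, b2)" ..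
    qed
    then show "\<exists>b. length b = length ys \<and> set b \<subseteq> univ M \<and> fsat M (asgn e xs ys (a, b)) \<chi> \<and>
      game (univ M) (length xs) (length ys) (compat e xs ys ds) n
        (\<lambda>q. fsat M (asgn e xs ys q) \<chi> \<and> compat e xs ys ds (a, b) q)"
      using b f by blast
  qed
  ultimately show ?case by blast
qed

end

section \<open>Models with strategies\<close>

subsection \<open>Ultrafilters\<close>

definition fip :: "'a set set \<Rightarrow> bool" where
  "fip \<B> \<longleftrightarrow> (\<forall>F. finite F \<and> F \<subseteq> \<B> \<longrightarrow> \<Inter> F \<noteq> {})"

text \<open>A maximal family with the finite intersection property: if neither \<open>A\<close> nor \<open>- A\<close> can be added,
  some finite intersection misses \<open>A\<close> and some misses \<open>- A\<close>.\<close>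

lemma ultrafilter_exists:
  assumes "fip \<B>"
  shows "\<exists>\<U>. \<B> \<subseteq> \<U> \<and> fip \<U> \<and> (\<forall>A. A \<in> \<U> \<or> - A \<in> \<U>)"
proof -
  let ?\<C> = "{\<A>. \<B> \<subseteq> \<A> \<and> fip \<A>}"
  have "\<exists>\<U> \<in> ?\<C>. \<forall>X \<in> ?\<C>. \<U> \<subseteq> X \<longrightarrow> X = \<U>"
  proof (rule subset_Zorn_nonempty)
    show "?\<C> \<noteq> {}" using assms by blast
    fix \<D> assume D: "\<D> \<noteq> {}" "subset.chain ?\<C> \<D>"
    have "fip (\<Union> \<D>)" unfolding fip_def
    proof (intro HOL.allI impI)
      fix F assume F: "finite F \<and> F \<subseteq> \<Union> \<D>"
      then obtain \<A> where "\<A> \<in> \<D>" "F \<subseteq> \<A>"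
        using finite_subset_Union_chain[of F \<D> ?\<C>] D by blast
      moreover have "fip \<A>" using D(2) \<open>\<A> \<in> \<D>\<close> by (auto simp: subset.chain_def)
      ultimately show "\<Inter> F \<noteq> {}" using F unfolding fip_def by blast
    qed
    moreover have "\<B> \<subseteq> \<Union> \<D>"
    proof -
      from D(1) obtain \<A> where "\<A> \<in> \<D>" by blast
      moreover then have "\<B> \<subseteq> \<A>" using D(2) by (auto simp: subset.chain_def)
      ultimately show ?thesis by blast
    qed
    ultimately show "\<Union> \<D> \<in> ?\<C>" by blast
  qed
  then obtain \<U> where U0: "\<U> \<in> ?\<C>" "\<forall>X \<in> ?\<C>. \<U> \<subseteq> X \<longrightarrow> X = \<U>" by (elim bexE)
  then have U: "\<B> \<subseteq> \<U>" "fip \<U>" by simp_all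
  have U3: "X = \<U>" if "\<B> \<subseteq> X" "fip X" "\<U> \<subseteq> X" for X using U0(2) that by simp
  have key: "A \<in> \<U> \<or> (\<exists>F. finite F \<and> F \<subseteq> \<U> \<and> \<Inter> F \<inter> A = {})" for A
  proof (cases "fip (insert A \<U>)")
    case True
    then have "insert A \<U> = \<U>" by (intro U3) (use U in auto)
    then show ?thesis by blast
  next
    case False
    then obtain F where F: "finite F" "F \<subseteq> insert A \<U>" "\<Inter> F = {}" unfolding fip_def by blast
    have "finite (F - {A})" "F - {A} \<subseteq> \<U>" using F(1,2) by auto
    moreover have "\<Inter> (F - {A}) \<inter> A = {}" using F(3) by blast
    ultimately show ?thesis by blast
  qed
  have "A \<in> \<U> \<or> - A \<in> \<U>" for A
  proof (rule ccontr)
    assume n: "\<not> (A \<in> \<U> \<or> - A \<in> \<U>)"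
    obtain F where F: "finite F" "F \<subseteq> \<U>" "\<Inter> F \<inter> A = {}" using key[of A] n by blast
    obtain G where G: "finite G" "G \<subseteq> \<U>" "\<Inter> G \<inter> - A = {}" using key[of "- A"] n by blast
    have "\<Inter> (F \<union> G) = {}" using F(3) G(3) by blast
    moreover have "finite (F \<union> G)" "F \<union> G \<subseteq> \<U>" using F G by auto
    ultimately show False using U(2) unfolding fip_def by blast
  qed
  then show ?thesis using U by blast
qed

locale ultra =
  fixes \<U> :: "'a set set"
  assumes fip: "fip \<U>" and ultra: "\<And>A. A \<in> \<U> \<or> - A \<in> \<U>"
begin

lemma not_empty: "{} \<notin> \<U>"
proof
  assume "{} \<in> \<U>"
  then have "\<Inter> {{}} \<noteq> ({} :: 'a set)" using fip unfolding fip_def by (metis empty_subsetI finite.simps insert_subset)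
  then show False by simp
qed

lemma meet: "A \<in> \<U> \<Longrightarrow> B \<in> \<U> \<Longrightarrow> A \<inter> B \<in> \<U>"
proof (rule ccontr)
  assume a: "A \<in> \<U>" "B \<in> \<U>" "A \<inter> B \<notin> \<U>"
  then have "- (A \<inter> B) \<in> \<U>" using ultra by blast
  then have "{A, B, - (A \<inter> B)} \<subseteq> \<U>" using a by simp
  moreover have "finite {A, B, - (A \<inter> B)}" by simp
  ultimately have "\<Inter> {A, B, - (A \<inter> B)} \<noteq> {}" using fip unfolding fip_def by blast
  then show False by auto
qed

lemma up: "A \<in> \<U> \<Longrightarrow> A \<subseteq> B \<Longrightarrow> B \<in> \<U>"
proof (rule ccontr)
  assume a: "A \<in> \<U>" "A \<subseteq> B" "B \<notin> \<U>"
  then have "A \<inter> - B \<in> \<U>" using ultra meet by blast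
  moreover have "A \<inter> - B = {}" using a by blast
  ultimately show False using not_empty by simp
qed

lemma compl: "- A \<in> \<U> \<longleftrightarrow> A \<notin> \<U>"
proof
  assume "- A \<in> \<U>"
  show "A \<notin> \<U>"
  proof
    assume "A \<in> \<U>"
    from meet[OF this \<open>- A \<in> \<U>\<close>] show False using not_empty by simp
  qed
qed (use ultra in blast)

lemma cong_on: "S \<in> \<U> \<Longrightarrow> (\<And>x. x \<in> S \<Longrightarrow> x \<in> A \<Longrightarrow> x \<in> B) \<Longrightarrow> A \<in> \<U> \<Longrightarrow> B \<in> \<U>"
  using up[OF meet[of S A]] by blast

lemma all_list: "S \<in> \<U> \<Longrightarrow> (\<And>z. z \<in> set zs \<Longrightarrow> {x. P z x} \<in> \<U>) \<Longrightarrow> {x. \<forall>z \<in> set zs. P z x} \<in> \<U>"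
proof (induction zs)
  case Nil
  then show ?case using up[of S UNIV] by simp
next
  case (Cons z zs)
  have "{x. P z x} \<inter> {x. \<forall>z \<in> set zs. P z x} \<in> \<U>" by (rule meet) (use Cons in auto)
  then show ?case by (rule up) auto
qed

end

subsection \<open>Names\<close>

text \<open>Names of elements: the values of the variables, the values of functions, witnesses of
  existential formulas, and the components of answers in the game of a formula. The list in a
  witness name stands for the values of the free variables of the formula, the list in the name of
  an answer for the move that is answered. Since answers have names, they can be used in
  further moves and witnesses.\<close>

datatype ('f, 'p, 'v) nm = Par 'v | App 'f "('f, 'p, 'v) nm list"
  | Wit 'v "('f, 'p, 'v) fm" "('f, 'p, 'v) nm list" | Str "('f, 'p, 'v) fm" nat "('f, 'p, 'v) nm list"

definition fvl :: "('f, 'p, 'v) fm \<Rightarrow> 'v list" where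
  "fvl \<phi> = (SOME xs. set xs = Fv \<phi> \<and> distinct xs)"

lemma fvl: "set (fvl \<phi>) = Fv \<phi>" "distinct (fvl \<phi>)"
  using someI_ex[OF finite_distinct_list[OF finite_Fv[of \<phi>]]] by (simp_all add: fvl_def)

lemma ovr_map_self: "distinct xs \<Longrightarrow> v \<in> set xs \<Longrightarrow> ovr e xs (map g xs) v = g v"
  by (auto simp: in_set_conv_nth ovr_nth)

text \<open>Names are coded by formulas, so that an injection of the formulas into \<open>'u\<close> makes room for a
  model made of names. The symbol \<open>undefined\<close> need not belong to the vocabulary, as the codes need
  not be well-formed.\<close>

primrec encl :: "('f, 'p, 'v) fm list \<Rightarrow> ('f, 'p, 'v) fm" where
  "encl [] = Rel undefined []"
| "encl (\<phi> # \<phi>s) = And \<phi> (encl \<phi>s)"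

primrec enc :: "('f, 'p, 'v) nm \<Rightarrow> ('f, 'p, 'v) fm" where
  "enc (Par x) = Eq (Var x) (Var x)"
| "enc (App f ts) = And (Eq (Fn f []) (Fn f [])) (encl (map enc ts))"
| "enc (Wit x \<phi> ts) = Or (Ex x \<phi>) (encl (map enc ts))"
| "enc (Str \<phi> i ts) = Or (And \<phi> ((Neg ^^ i) (Rel undefined []))) (encl (map enc ts))"

lemma encl_inj: "encl \<phi>s = encl \<psi>s \<Longrightarrow> \<phi>s = \<psi>s"
proof (induction \<phi>s arbitrary: \<psi>s)
  case Nil
  then show ?case by (cases \<psi>s) auto
next
  case (Cons \<phi> \<phi>s)
  then show ?case by (cases \<psi>s) auto
qed

lemma Neg_pow_inj: "(Neg ^^ i) (Rel p []) = (Neg ^^ j) (Rel p []) \<Longrightarrow> i = j"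
proof (induction i arbitrary: j)
  case 0
  then show ?case by (cases j) auto
next
  case (Suc i)
  then show ?case by (cases j) auto
qed

lemma enc_inj: "inj enc"
proof (rule injI)
  fix s t :: "('f, 'p, 'v) nm"
  have l: "ts = us" if "map enc ts = map enc us" "\<And>s t. s \<in> set ts \<Longrightarrow> enc s = enc t \<Longrightarrow> s = t"
    for ts us :: "('f, 'p, 'v) nm list"
    using that
  proof (induction ts arbitrary: us)
    case (Cons t ts)
    then obtain u us' where us: "us = u # us'" "enc t = enc u" "map enc ts = map enc us'" by auto
    then show ?case using Cons by (metis list.set_intros)
  qed simp
  show "enc s = enc t \<Longrightarrow> s = t"
  proof (induction s arbitrary: t)
    case (Par x)
    then show ?case by (cases t) auto
  next
    case (App f ts)
    then obtain us where t: "t = App f us" "map enc ts = map enc us" by (cases t) (auto dest: encl_inj)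
    then show ?case using l[OF t(2)] App.IH by blast
  next
    case (Wit x \<phi> ts)
    then obtain us where t: "t = Wit x \<phi> us" "map enc ts = map enc us" by (cases t) (auto dest: encl_inj)
    then show ?case using l[OF t(2)] Wit.IH by blast
  next
    case (Str \<phi> i ts)
    then obtain us where t: "t = Str \<phi> i us" "map enc ts = map enc us"
      by (cases t) (auto dest: encl_inj Neg_pow_inj)
    then show ?case using l[OF t(2)] Str.IH by blast
  qed
qed

text \<open>The value of a name in a model, where \<open>w\<close> gives the answer to each named move. Where a name makes
  no sense, for example a function symbol at a wrong number of arguments, its value is some
  element of the universe.\<close>

primrec ev :: "('f, 'p, 'm) model \<Rightarrow> ('v \<Rightarrow> 'm) \<Rightarrow> (('f, 'p, 'v) fm \<times> ('f, 'p, 'v) nm list \<Rightarrow> 'm list) \<Rightarrow>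
    ('f, 'p, 'v) nm \<Rightarrow> 'm" where
  "ev M e w (Par x) = e x"
| "ev M e w (App f ts) =
    (let a = fint M f (map (ev M e w) ts) in if a \<in> univ M then a else e undefined)"
| "ev M e w (Wit x \<phi> ts) = (let P = \<lambda>a. a \<in> univ M \<and> fsat M ((ovr e (fvl \<phi>) (map (ev M e w) ts))(x := a)) \<phi>
    in if \<exists>a. P a then SOME a. P a else e undefined)"
| "ev M e w (Str \<phi> i ts) = (let a = w (\<phi>, ts) ! i in if a \<in> univ M then a else e undefined)"

lemma ev_univ: "range e \<subseteq> univ M \<Longrightarrow> ev M e w t \<in> univ M"
proof (cases t)
  case (Wit x \<phi> ts)
  assume e: "range e \<subseteq> univ M"
  let ?P = "\<lambda>a. a \<in> univ M \<and> fsat M ((ovr e (fvl \<phi>) (map (ev M e w) ts))(x := a)) \<phi>"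
  show ?thesis
  proof (cases "\<exists>a. ?P a")
    case True
    from someI_ex[OF this] show ?thesis using True Wit by (simp add: Let_def)
  next
    case False
    have "e undefined \<in> univ M" using e by blast
    then show ?thesis using False Wit by (simp only: ev.simps Let_def if_False)
  qed
qed (auto simp: Let_def)

text \<open>The size of a move. The answer to a move influences only the values of names that are longer
  than those in the move.\<close>

abbreviation keysize :: "('f, 'p, 'v) fm \<times> ('f, 'p, 'v) nm list \<Rightarrow> nat" where
  "keysize k \<equiv> size_list size (snd k)"

lemma ev_fresh: "size t \<le> keysize k \<Longrightarrow> ev M e (w(k := b)) t = ev M e w t"
proof (induction t)
  case (App f ts)
  have "size t \<le> keysize k" if "t \<in> set ts" for t
    using size_list_estimation'[OF that, of "size t" size] App.prems by simp
  then have "map (ev M e (w(k := b))) ts = map (ev M e w) ts"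
    by (intro map_cong refl App.IH)
  then show ?case by (simp only: ev.simps)
next
  case (Wit x \<phi> ts)
  have "size t \<le> keysize k" if "t \<in> set ts" for t
    using size_list_estimation'[OF that, of "size t" size] Wit.prems by simp
  then have "map (ev M e (w(k := b))) ts = map (ev M e w) ts"
    by (intro map_cong refl Wit.IH)
  then show ?case by (simp only: ev.simps)
next
  case (Str \<phi> i ts)
  then have "(\<phi>, ts) \<noteq> k" by auto
  then show ?case by simp
qed simp

lemma ev_fresh_list: "size_list size ts \<le> keysize k \<Longrightarrow> map (ev M e (w(k := b))) ts = map (ev M e w) ts"
proof (rule map_cong[OF refl])
  fix t assume a: "size_list size ts \<le> keysize k" "t \<in> set ts"
  show "ev M e (w(k := b)) t = ev M e w t"
    by (rule ev_fresh) (use size_list_estimation'[OF a(2), of "size t" size] a(1) in simp)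
qed

subsection \<open>Playing finitely many rounds\<close>

text \<open>The rounds are played in the order of the sizes of the moves, so that no move mentions the
  answer to itself or to a later move: recording a new answer does not change the values of the
  moves that were played before. The last conjunct keeps the rest of each game for the induction.
  A round of one formula is a wasted round for the other formulas.\<close>

lemma play:
  fixes M :: "('f, 'p, 'm) model" and C :: "('f, 'p, 'v) fm \<Rightarrow> 'm list \<times> 'm list \<Rightarrow> bool"
    and R :: "('f, 'p, 'v) fm \<Rightarrow> 'm list \<times> 'm list \<Rightarrow> 'm list \<times> 'm list \<Rightarrow> bool"
  assumes e: "range e \<subseteq> univ M"
    and G: "\<And>\<gamma>. \<gamma> \<in> F \<Longrightarrow> game (univ M) (nx \<gamma>) (ny \<gamma>) (R \<gamma>) n (C \<gamma>)"
    and sym: "\<And>\<gamma> p q. R \<gamma> p q \<Longrightarrow> R \<gamma> q p" and rfl: "\<And>\<gamma> p. R \<gamma> p p"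
  shows "length K + m = n \<Longrightarrow> distinct K \<Longrightarrow> sorted (map keysize K) \<Longrightarrow>
    (\<forall>k \<in> set K. fst k \<in> F \<and> length (snd k) = nx (fst k)) \<Longrightarrow>
    \<exists>w. (\<forall>k \<in> set K. length (w k) = ny (fst k) \<and> set (w k) \<subseteq> univ M \<and>
          C (fst k) (map (ev M e w) (snd k), w k)) \<and>
      (\<forall>\<gamma> ts us. (\<gamma>, ts) \<in> set K \<and> (\<gamma>, us) \<in> set K \<longrightarrow>
          R \<gamma> (map (ev M e w) ts, w (\<gamma>, ts)) (map (ev M e w) us, w (\<gamma>, us))) \<and>
      (\<forall>\<gamma> \<in> F. game (univ M) (nx \<gamma>) (ny \<gamma>) (R \<gamma>) m
          (\<lambda>q. C \<gamma> q \<and> (\<forall>ts. (\<gamma>, ts) \<in> set K \<longrightarrow> R \<gamma> (map (ev M e w) ts, w (\<gamma>, ts)) q)))"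
proof (induction K arbitrary: m rule: rev_induct)
  case Nil
  then show ?case using G by simp
next
  case (snoc k K)
  obtain \<gamma> ts where k: "k = (\<gamma>, ts)" by (cases k)
  have "length K + Suc m = n" "distinct K" "sorted (map keysize K)"
    "\<forall>k \<in> set K. fst k \<in> F \<and> length (snd k) = nx (fst k)"
    using snoc.prems by (auto simp: sorted_append)
  from snoc.IH[OF this] obtain w where
    w1: "\<forall>k \<in> set K. length (w k) = ny (fst k) \<and> set (w k) \<subseteq> univ M \<and> C (fst k) (map (ev M e w) (snd k), w k)"
    and w2: "\<forall>\<gamma> ts us. (\<gamma>, ts) \<in> set K \<and> (\<gamma>, us) \<in> set K \<longrightarrow>
          R \<gamma> (map (ev M e w) ts, w (\<gamma>, ts)) (map (ev M e w) us, w (\<gamma>, us))"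
    and w3: "\<forall>\<gamma> \<in> F. game (univ M) (nx \<gamma>) (ny \<gamma>) (R \<gamma>) (Suc m)
          (\<lambda>q. C \<gamma> q \<and> (\<forall>ts. (\<gamma>, ts) \<in> set K \<longrightarrow> R \<gamma> (map (ev M e w) ts, w (\<gamma>, ts)) q))"
    by blast
  have kF: "\<gamma> \<in> F" "length ts = nx \<gamma>" using snoc.prems(4) k by auto
  let ?a = "map (ev M e w) ts"
  have "length ?a = nx \<gamma> \<and> set ?a \<subseteq> univ M" using kF ev_univ[OF e] by auto
  with w3 kF(1) obtain b where b: "length b = ny \<gamma>" "set b \<subseteq> univ M" "C \<gamma> (?a, b)"
    "\<forall>us. (\<gamma>, us) \<in> set K \<longrightarrow> R \<gamma> (map (ev M e w) us, w (\<gamma>, us)) (?a, b)"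
    "game (univ M) (nx \<gamma>) (ny \<gamma>) (R \<gamma>) m
      (\<lambda>q. (C \<gamma> q \<and> (\<forall>ts. (\<gamma>, ts) \<in> set K \<longrightarrow> R \<gamma> (map (ev M e w) ts, w (\<gamma>, ts)) q)) \<and> R \<gamma> (?a, b) q)"
    unfolding game.simps by blast
  define w' where "w' = w(k := b)"
  have kK: "k \<notin> set K" using snoc.prems(2) by simp
  have le: "keysize k' \<le> keysize k" if "k' \<in> set (K @ [k])" for k'
    using snoc.prems(3) that by (auto simp: sorted_append)
  have same: "map (ev M e w') us = map (ev M e w) us" if "(\<gamma>', us) \<in> set (K @ [k])" for \<gamma>' us
    unfolding w'_def by (rule ev_fresh_list) (use le[OF that] in simp)
  have wK: "w' k' = w k'" if "k' \<in> set K" for k' using kK that by (auto simp: w'_def)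
  have wk: "w' (\<gamma>, ts) = b" using k by (simp add: w'_def)
  have sk: "map (ev M e w') ts = ?a" by (rule same[of \<gamma>]) (simp add: k)
  have sK: "map (ev M e w') us = map (ev M e w) us" if "(\<gamma>', us) \<in> set K" for \<gamma>' us
    by (rule same[of \<gamma>']) (use that in simp)
  have 1: "\<forall>k \<in> set (K @ [k]). length (w' k) = ny (fst k) \<and> set (w' k) \<subseteq> univ M \<and>
      C (fst k) (map (ev M e w') (snd k), w' k)"
  proof
    fix k' assume "k' \<in> set (K @ [k])"
    then consider "k' \<in> set K" | "k' = (\<gamma>, ts)" using k by auto
    then show "length (w' k') = ny (fst k') \<and> set (w' k') \<subseteq> univ M \<and> C (fst k') (map (ev M e w') (snd k'), w' k')"
    proof cases
      case 1
      then show ?thesis using w1 wK[OF 1] sK[of "fst k'" "snd k'"] by (simp del: map_eq_conv)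
    next
      case 2
      then show ?thesis using b wk sk by (simp del: map_eq_conv)
    qed
  qed
  have 2: "\<forall>\<gamma>' ts us. (\<gamma>', ts) \<in> set (K @ [k]) \<and> (\<gamma>', us) \<in> set (K @ [k]) \<longrightarrow>
          R \<gamma>' (map (ev M e w') ts, w' (\<gamma>', ts)) (map (ev M e w') us, w' (\<gamma>', us))"
  proof (intro HOL.allI impI)
    fix \<gamma>' us vs assume "(\<gamma>', us) \<in> set (K @ [k]) \<and> (\<gamma>', vs) \<in> set (K @ [k])"
    then consider "(\<gamma>', us) \<in> set K" "(\<gamma>', vs) \<in> set K" | "(\<gamma>', us) \<in> set K" "(\<gamma>', vs) = (\<gamma>, ts)"
      | "(\<gamma>', us) = (\<gamma>, ts)" "(\<gamma>', vs) \<in> set K" | "(\<gamma>', us) = (\<gamma>, ts)" "(\<gamma>', vs) = (\<gamma>, ts)" using k by auto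
    then show "R \<gamma>' (map (ev M e w') us, w' (\<gamma>', us)) (map (ev M e w') vs, w' (\<gamma>', vs))"
    proof cases
      case 1
      then show ?thesis using w2 wK[OF 1(1)] wK[OF 1(2)] sK[OF 1(1)] sK[OF 1(2)] by (simp del: map_eq_conv)
    next
      case 2
      then show ?thesis using b(4) wK[OF 2(1)] sK[OF 2(1)] wk sk by (simp del: map_eq_conv)
    next
      case 3
      then show ?thesis using b(4) wK[OF 3(2)] sK[OF 3(2)] wk sk sym by (simp del: map_eq_conv)
    next
      case 4
      then show ?thesis using rfl by simp
    qed
  qed
  have 3: "\<forall>\<gamma>' \<in> F. game (univ M) (nx \<gamma>') (ny \<gamma>') (R \<gamma>') m
      (\<lambda>q. C \<gamma>' q \<and> (\<forall>ts. (\<gamma>', ts) \<in> set (K @ [k]) \<longrightarrow> R \<gamma>' (map (ev M e w') ts, w' (\<gamma>', ts)) q))"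
  proof
    fix \<gamma>' assume g: "\<gamma>' \<in> F"
    show "game (univ M) (nx \<gamma>') (ny \<gamma>') (R \<gamma>') m
      (\<lambda>q. C \<gamma>' q \<and> (\<forall>ts. (\<gamma>', ts) \<in> set (K @ [k]) \<longrightarrow> R \<gamma>' (map (ev M e w') ts, w' (\<gamma>', ts)) q))"
    proof (cases "\<gamma>' = \<gamma>")
      case True
      show ?thesis unfolding True
      proof (rule game_mono[OF _ _ b(5)])
        fix a' b' assume c: "(C \<gamma> (a', b') \<and> (\<forall>ts. (\<gamma>, ts) \<in> set K \<longrightarrow> R \<gamma> (map (ev M e w) ts, w (\<gamma>, ts)) (a', b'))) \<and> R \<gamma> (?a, b) (a', b')"
        have "R \<gamma> (map (ev M e w') us, w' (\<gamma>, us)) (a', b')" if "(\<gamma>, us) \<in> set (K @ [k])" for us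
        proof (cases "(\<gamma>, us) \<in> set K")
          case True
          then show ?thesis using c wK[OF True] sK[OF True] by (simp del: map_eq_conv)
        next
          case False
          then have "us = ts" using that k by simp
          then show ?thesis using c wk sk by (simp del: map_eq_conv)
        qed
        then show "C \<gamma> (a', b') \<and> (\<forall>ts. (\<gamma>, ts) \<in> set (K @ [k]) \<longrightarrow> R \<gamma> (map (ev M e w') ts, w' (\<gamma>, ts)) (a', b'))"
          using c by blast
      qed
    next
      case False
      \<comment> \<open>The wasted round: any move will do.\<close>
      obtain a0 where a0: "length a0 = nx \<gamma>' \<and> set a0 \<subseteq> univ M"
      proof
        show "length (replicate (nx \<gamma>') (e undefined)) = nx \<gamma>' \<and> set (replicate (nx \<gamma>') (e undefined)) \<subseteq> univ M"
          using e by auto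
      qed
      from w3 g have G': "game (univ M) (nx \<gamma>') (ny \<gamma>') (R \<gamma>') (Suc m)
          (\<lambda>q. C \<gamma>' q \<and> (\<forall>ts. (\<gamma>', ts) \<in> set K \<longrightarrow> R \<gamma>' (map (ev M e w) ts, w (\<gamma>', ts)) q))" by blast
      with a0 obtain b0 where g0: "game (univ M) (nx \<gamma>') (ny \<gamma>') (R \<gamma>') m
          (\<lambda>q. (C \<gamma>' q \<and> (\<forall>ts. (\<gamma>', ts) \<in> set K \<longrightarrow> R \<gamma>' (map (ev M e w) ts, w (\<gamma>', ts)) q)) \<and> R \<gamma>' (a0, b0) q)"
        unfolding game.simps by blast
      show ?thesis
      proof (rule game_mono[OF _ _ g0])
        fix a' b' assume c: "(C \<gamma>' (a', b') \<and> (\<forall>ts. (\<gamma>', ts) \<in> set K \<longrightarrow> R \<gamma>' (map (ev M e w) ts, w (\<gamma>', ts)) (a', b'))) \<and> R \<gamma>' (a0, b0) (a', b')"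
        have "R \<gamma>' (map (ev M e w') us, w' (\<gamma>', us)) (a', b')" if "(\<gamma>', us) \<in> set (K @ [k])" for us
        proof -
          have m: "(\<gamma>', us) \<in> set K" using that k False by simp
          then show ?thesis using c wK[OF m] sK[OF m] by (simp del: map_eq_conv)
        qed
        then show "C \<gamma>' (a', b') \<and> (\<forall>ts. (\<gamma>', ts) \<in> set (K @ [k]) \<longrightarrow> R \<gamma>' (map (ev M e w') ts, w' (\<gamma>', ts)) (a', b'))"
          using c by blast
      qed
    qed
  qed
  from 1 2 3 show ?case by blast
qed

subsection \<open>The model of the names\<close>

primrec nmv :: "('v \<Rightarrow> ('f, 'p, 'v) nm) \<Rightarrow> ('f, 'v) tm \<Rightarrow> ('f, 'p, 'v) nm" where
  "nmv \<eta> (Var x) = \<eta> x"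
| "nmv \<eta> (Fn f ts) = App f (map (nmv \<eta>) ts)"

lemma nmv_ev:
  assumes "is_model L M" "range e \<subseteq> univ M"
  shows "wf_tm L t \<Longrightarrow> tval M (\<lambda>v. ev M e w (\<eta> v)) t = ev M e w (nmv \<eta> t)"
proof (induction t)
  case (Fn f ts)
  have m: "map (tval M (\<lambda>v. ev M e w (\<eta> v))) ts = map (ev M e w) (map (nmv \<eta>) ts)"
    using Fn by simp
  have "set (map (ev M e w) (map (nmv \<eta>) ts)) \<subseteq> univ M" using ev_univ[OF assms(2)] by auto
  moreover have "fun_ar L f = Some (length (map (ev M e w) (map (nmv \<eta>) ts)))" using Fn.prems by simp
  ultimately have "fint M f (map (ev M e w) (map (nmv \<eta>) ts)) \<in> univ M"
    using assms(1) unfolding is_model_def by blast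
  then show ?case unfolding tval.simps m by (simp add: Let_def)
qed simp

text \<open>The witness name is interpreted by a choice that depends only on the values of its arguments,
  and these determine the truth of \<open>\<phi>\<close>.\<close>

lemma wit_ev:
  assumes e: "range e \<subseteq> univ M" and ex: "\<exists>a \<in> univ M. fsat M ((\<lambda>v. ev M e w (\<eta> v))(x := a)) \<phi>"
  shows "fsat M (\<lambda>v. ev M e w ((\<eta>(x := Wit x \<phi> (map \<eta> (fvl \<phi>)))) v)) \<phi>"
proof -
  let ?t = "Wit x \<phi> (map \<eta> (fvl \<phi>))"
  let ?P = "\<lambda>a. a \<in> univ M \<and> fsat M ((ovr e (fvl \<phi>) (map (ev M e w) (map \<eta> (fvl \<phi>))))(x := a)) \<phi>"
  have eq: "fsat M ((ovr e (fvl \<phi>) (map (ev M e w) (map \<eta> (fvl \<phi>))))(x := a)) \<phi> =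
      fsat M ((\<lambda>v. ev M e w (\<eta> v))(x := a)) \<phi>" for a
  proof (rule fsat_cong)
    fix v assume "v \<in> Fv \<phi>"
    then have "v \<in> set (fvl \<phi>)" by (simp add: fvl)
    from ovr_map_self[OF fvl(2) this, of e "\<lambda>v. ev M e w (\<eta> v)"]
    show "((ovr e (fvl \<phi>) (map (ev M e w) (map \<eta> (fvl \<phi>))))(x := a)) v = ((\<lambda>v. ev M e w (\<eta> v))(x := a)) v"
      by (simp add: o_def)
  qed
  have "\<exists>a. ?P a" using ex unfolding eq by blast
  from someI_ex[OF this] have "?P (ev M e w ?t)" using \<open>\<exists>a. ?P a\<close> by (simp only: ev.simps Let_def if_True)
  then have "fsat M ((\<lambda>v. ev M e w (\<eta> v))(x := ev M e w ?t)) \<phi>" unfolding eq by blast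
  moreover have "(\<lambda>v. ev M e w (\<eta> v))(x := ev M e w ?t) = (\<lambda>v. ev M e w ((\<eta>(x := ?t)) v))" by (rule ext) simp
  ultimately show ?thesis by simp
qed

context dep_logic_sem
begin

text \<open>The set \<open>Good k k'\<close> collects the triples in which the answer to the move \<open>k\<close> satisfies the matrix
  and is compatible with the answer to \<open>k'\<close>. These sets have the finite intersection property by
  \<open>play\<close>, with as many rounds as there are moves involved.

  In the model of the names, existential quantifiers are witnessed by the names \<open>Wit\<close>, as for an
  ultraproduct, and the team for the normal form of \<open>\<gamma>\<close> consists of the assignments \<open>et ts\<close>, for all
  lists \<open>ts\<close> of names. Two names of one move may get different answers; this is harmless since a
  quantifier in a team may have several values, and the dependences hold between any two rounds.\<close>

lemma strategy_model:
  fixes h :: "('f, 'p, 'v) fm \<Rightarrow> 'u" and xs ys vs :: "('f, 'p, 'v) fm \<Rightarrow> 'v list"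
    and ds :: "('f, 'p, 'v) fm \<Rightarrow> ('v list \<times> 'v) list" and al :: "('f, 'p, 'v) fm \<Rightarrow> ('f, 'p, 'v) fm"
  assumes h: "inj h" and \<alpha>: "first_order \<alpha>" "KV \<alpha>"
    and nf: "\<And>\<gamma>. \<gamma> \<in> \<Gamma> \<Longrightarrow> nform (xs \<gamma>) (ys \<gamma>) (vs \<gamma>) (ds \<gamma>) (al \<gamma>)"
    and fin: "\<And>F n. finite F \<Longrightarrow> F \<subseteq> \<Gamma> \<Longrightarrow> \<exists>(M :: ('f, 'p, nat) model) e. is_model L M \<and> range e \<subseteq> univ M \<and>
      \<not> fsat M e \<alpha> \<and> (\<forall>\<gamma> \<in> F. game (univ M) (length (xs \<gamma>)) (length (ys \<gamma>))
        (compat e (xs \<gamma>) (ys \<gamma>) (ds \<gamma>)) n (\<lambda>q. fsat M (asgn e (xs \<gamma>) (ys \<gamma>) q) (al \<gamma>)))"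
  shows "\<exists>(M :: ('f, 'p, 'u) model) e. is_model L M \<and> range e \<subseteq> univ M \<and> \<not> fsat M e \<alpha> \<and>
    (\<forall>\<gamma> \<in> \<Gamma>. sat M {\<lambda>v. Some (e v)} (Alls (xs \<gamma>) (Exs (ys \<gamma>) (And (dconj (ds \<gamma>)) (al \<gamma>)))))"
proof -
  define mo where "mo \<omega> = fst \<omega>" for \<omega> :: "('f, 'p, nat) model \<times> ('v \<Rightarrow> nat) \<times> (('f, 'p, 'v) fm \<times> ('f, 'p, 'v) nm list \<Rightarrow> nat list)"
  define as where "as \<omega> = fst (snd \<omega>)" for \<omega> :: "('f, 'p, nat) model \<times> ('v \<Rightarrow> nat) \<times> (('f, 'p, 'v) fm \<times> ('f, 'p, 'v) nm list \<Rightarrow> nat list)"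
  define st where "st \<omega> = snd (snd \<omega>)" for \<omega> :: "('f, 'p, nat) model \<times> ('v \<Rightarrow> nat) \<times> (('f, 'p, 'v) fm \<times> ('f, 'p, 'v) nm list \<Rightarrow> nat list)"
  define rho where "rho \<omega> = ev (mo \<omega>) (as \<omega>) (st \<omega>)" for \<omega>
  define S0 where "S0 = {\<omega>. is_model L (mo \<omega>) \<and> range (as \<omega>) \<subseteq> univ (mo \<omega>) \<and> \<not> fsat (mo \<omega>) (as \<omega>) \<alpha>}"
  define pos where "pos \<omega> k = (map (rho \<omega>) (snd k), st \<omega> k)" for \<omega> k
  define Good where "Good k k' = {\<omega> \<in> S0. length (st \<omega> k) = length (ys (fst k)) \<and> set (st \<omega> k) \<subseteq> univ (mo \<omega>) \<and>
    fsat (mo \<omega>) (asgn (as \<omega>) (xs (fst k)) (ys (fst k)) (pos \<omega> k)) (al (fst k)) \<and>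
    compat (as \<omega>) (xs (fst k)) (ys (fst k)) (ds (fst k)) (pos \<omega> k) (pos \<omega> k')}" for k k'
  define ok where "ok k \<longleftrightarrow> fst k \<in> \<Gamma> \<and> length (snd k) = length (xs (fst k))" for k :: "('f, 'p, 'v) fm \<times> ('f, 'p, 'v) nm list"
  define Pairs where "Pairs = {(k, k'). ok k \<and> ok k' \<and> fst k = fst k'}"
  define \<B> where "\<B> = insert S0 ((\<lambda>(k, k'). Good k k') ` Pairs)"
  have "fip \<B>" unfolding fip_def
  proof (intro HOL.allI impI)
    fix F assume F: "finite F \<and> F \<subseteq> \<B>"
    then have "finite (F - {S0})" "F - {S0} \<subseteq> (\<lambda>(k, k'). Good k k') ` Pairs" by (auto simp: \<B>_def)
    from finite_subset_image[OF this] obtain P where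
      "P \<subseteq> Pairs \<and> finite P \<and> F - {S0} = (\<lambda>(k, k'). Good k k') ` P" by (elim HOL.exE) (rule that)
    then have P: "P \<subseteq> Pairs" "finite P" "F - {S0} = (\<lambda>(k, k'). Good k k') ` P" by simp_all
    define Ks where "Ks = fst ` P \<union> snd ` P"
    have "finite Ks" using P(2) by (simp add: Ks_def)
    from finite_distinct_list[OF this] obtain l where l: "set l = Ks" "distinct l" by blast
    define K where "K = sort_key keysize l"
    have K: "set K = Ks" "distinct K" "sorted (map keysize K)" using l by (simp_all add: K_def)
    have okK: "ok k" if "k \<in> set K" for k using that P(1) unfolding K(1) Ks_def Pairs_def by auto
    have "finite (fst ` Ks)" "fst ` Ks \<subseteq> \<Gamma>" using \<open>finite Ks\<close> okK K(1) by (auto simp: ok_def)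
    from fin[OF this, of "length K"] obtain M :: "('f, 'p, nat) model" and e where
      M0: "is_model L M \<and> range e \<subseteq> univ M \<and> \<not> fsat M e \<alpha> \<and>
        (\<forall>\<gamma> \<in> fst ` Ks. game (univ M) (length (xs \<gamma>)) (length (ys \<gamma>)) (compat e (xs \<gamma>) (ys \<gamma>) (ds \<gamma>)) (length K)
        (\<lambda>q. fsat M (asgn e (xs \<gamma>) (ys \<gamma>) q) (al \<gamma>)))" by (elim HOL.exE) (rule that)
    then have M: "is_model L M" "range e \<subseteq> univ M" "\<not> fsat M e \<alpha>" by simp_all
    have G: "\<And>\<gamma>. \<gamma> \<in> fst ` Ks \<Longrightarrow> game (univ M) (length (xs \<gamma>)) (length (ys \<gamma>)) (compat e (xs \<gamma>) (ys \<gamma>) (ds \<gamma>)) (length K)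
        (\<lambda>q. fsat M (asgn e (xs \<gamma>) (ys \<gamma>) q) (al \<gamma>))" using M0 by blast
    have "\<forall>k \<in> set K. fst k \<in> fst ` Ks \<and> length (snd k) = length (xs (fst k))"
      using okK K(1) by (auto simp: ok_def)
    from play[where R = "\<lambda>\<gamma>. compat e (xs \<gamma>) (ys \<gamma>) (ds \<gamma>)", OF M(2) G compat_sym compat_refl _ K(2,3) this, of 0]
    obtain w where
      w1: "\<forall>k \<in> set K. length (w k) = length (ys (fst k)) \<and> set (w k) \<subseteq> univ M \<and>
          fsat M (asgn e (xs (fst k)) (ys (fst k)) (map (ev M e w) (snd k), w k)) (al (fst k))"
      and w2: "\<forall>\<gamma> ts us. (\<gamma>, ts) \<in> set K \<and> (\<gamma>, us) \<in> set K \<longrightarrow>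
          compat e (xs \<gamma>) (ys \<gamma>) (ds \<gamma>) (map (ev M e w) ts, w (\<gamma>, ts)) (map (ev M e w) us, w (\<gamma>, us))"
      by auto
    let ?\<omega> = "(M, e, w)"
    have c: "mo ?\<omega> = M" "as ?\<omega> = e" "st ?\<omega> = w" "rho ?\<omega> = ev M e w" by (simp_all add: mo_def as_def st_def rho_def)
    have "?\<omega> \<in> S0" using M by (simp add: S0_def c)
    moreover have "?\<omega> \<in> Good k k'" if "(k, k') \<in> P" for k k'
    proof -
      have kk: "k \<in> set K" "k' \<in> set K" using that unfolding K(1) Ks_def by force+
      have f: "fst k = fst k'" using that P(1) by (auto simp: Pairs_def)
      have "(fst k, snd k) \<in> set K" using kk by simp
      moreover have "(fst k, snd k') \<in> set K" unfolding f using kk by simp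
      ultimately have "compat e (xs (fst k)) (ys (fst k)) (ds (fst k)) (pos ?\<omega> k) (pos ?\<omega> k')"
        using w2 f unfolding pos_def c by (metis prod.collapse)
      then show ?thesis using w1 kk(1) \<open>?\<omega> \<in> S0\<close> by (simp add: Good_def c pos_def)
    qed
    then have "?\<omega> \<in> X" if "X \<in> F - {S0}" for X using that unfolding P(3) by auto
    ultimately have "?\<omega> \<in> \<Inter> F" by blast
    then show "\<Inter> F \<noteq> {}" by blast
  qed
  from ultrafilter_exists[OF this] obtain \<U> where U: "\<B> \<subseteq> \<U>" "fip \<U>" "\<forall>A. A \<in> \<U> \<or> - A \<in> \<U>" by blast
  interpret ultra \<U> using U by unfold_locales auto
  have S0: "S0 \<in> \<U>" using U(1) by (auto simp: \<B>_def)
  have Good: "Good (\<gamma>, ts) (\<gamma>, us) \<in> \<U>" if "\<gamma> \<in> \<Gamma>" "length ts = length (xs \<gamma>)" "length us = length (xs \<gamma>)" for \<gamma> ts us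
  proof -
    have "((\<gamma>, ts), (\<gamma>, us)) \<in> Pairs" using that by (simp add: Pairs_def ok_def)
    then have "Good (\<gamma>, ts) (\<gamma>, us) \<in> \<B>" unfolding \<B>_def by force
    then show ?thesis using U(1) by blast
  qed
  have S0D: "is_model L (mo \<omega>)" "range (as \<omega>) \<subseteq> univ (mo \<omega>)" "\<not> fsat (mo \<omega>) (as \<omega>) \<alpha>" if "\<omega> \<in> S0" for \<omega>
    using that by (auto simp: S0_def)
  have rho_univ: "rho \<omega> t \<in> univ (mo \<omega>)" if "\<omega> \<in> S0" for \<omega> t
    unfolding rho_def by (rule ev_univ[OF S0D(2)[OF that]])
  \<comment> \<open>Names are equal if their values coincide on a set of the ultrafilter.\<close>
  define eqn where "eqn s t \<longleftrightarrow> {\<omega>. rho \<omega> s = rho \<omega> t} \<in> \<U>" for s t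
  have eqn_refl: "eqn t t" for t unfolding eqn_def using up[OF S0, of UNIV] by simp
  have eqn_sym: "eqn s t \<Longrightarrow> eqn t s" for s t unfolding eqn_def by (simp add: eq_commute)
  have eqn_trans: "eqn r s \<Longrightarrow> eqn s t \<Longrightarrow> eqn r t" for r s t
    unfolding eqn_def
    by (rule up[OF meet[of "{\<omega>. rho \<omega> r = rho \<omega> s}" "{\<omega>. rho \<omega> s = rho \<omega> t}"]]) auto
  \<comment> \<open>A chosen representative of the class of a name, moved to the type \<open>'u\<close>.\<close>
  define u where "u t = h (enc (SOME t'. eqn t t'))" for t
  have some: "eqn t (SOME t'. eqn t t')" for t by (rule someI[of _ t]) (rule eqn_refl)
  have u_iff: "u s = u t \<longleftrightarrow> eqn s t" for s t
  proof
    assume "u s = u t"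
    then have "(SOME t'. eqn s t') = (SOME t'. eqn t t')" unfolding u_def using h enc_inj by (metis injD)
    then show "eqn s t" using some[of s] some[of t] eqn_sym eqn_trans by metis
  next
    assume "eqn s t"
    then have "eqn s = eqn t" using eqn_sym eqn_trans by blast
    then show "u s = u t" by (simp add: u_def)
  qed
  define R where "R p ts \<longleftrightarrow> {\<omega>. map (rho \<omega>) ts \<in> rint (mo \<omega>) p} \<in> \<U>" for p ts
  have maps: "{\<omega>. map (rho \<omega>) ts = map (rho \<omega>) us} \<in> \<U>" if "map u ts = map u us" for ts us
  proof -
    have l: "length ts = length us" using that by (metis length_map)
    have "{\<omega>. \<forall>z \<in> set (zip ts us). rho \<omega> (fst z) = rho \<omega> (snd z)} \<in> \<U>"
    proof (rule all_list[OF S0])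
      fix z assume "z \<in> set (zip ts us)"
      then obtain i where "i < length ts" "z = (ts ! i, us ! i)" using l by (auto simp: set_zip)
      moreover then have "u (ts ! i) = u (us ! i)" using that l by (metis nth_map)
      ultimately show "{\<omega>. rho \<omega> (fst z) = rho \<omega> (snd z)} \<in> \<U>" using u_iff by (simp add: eqn_def)
    qed
    then show ?thesis
      by (rule up) (use l in \<open>auto simp: set_zip list_eq_iff_nth_eq\<close>)
  qed
  obtain M :: "('f, 'p, 'u) model" where M: "univ M = range u"
    "\<And>f ts. fint M f (map u ts) = u (App f ts)" "\<And>p ts. map u ts \<in> rint M p \<longleftrightarrow> R p ts"
  proof (rule quotient_model[of u App R])
    fix f ts us assume "map u ts = map u us"
    from maps[OF this] have "{\<omega>. rho \<omega> (App f ts) = rho \<omega> (App f us)} \<in> \<U>"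
      by (rule up) (auto simp: rho_def simp del: map_eq_conv)
    then show "u (App f ts) = u (App f us)" using u_iff by (simp add: eqn_def)
  next
    fix p ts us assume e: "map u ts = map u us" "R p ts"
    show "R p us" unfolding R_def
      by (rule cong_on[OF maps[OF e(1)] _ e(2)[unfolded R_def]]) (simp del: map_eq_conv)
  qed blast
  have tv: "tval M (\<lambda>v. u (\<eta> v)) t = u (nmv \<eta> t)" for \<eta> t
  proof (induction t)
    case (Fn f ts)
    then have "map (tval M (\<lambda>v. u (\<eta> v))) ts = map u (map (nmv \<eta>) ts)" by simp
    then show ?case by (simp only: tval.simps M nmv.simps)
  qed simp
  have rt: "tval (mo \<omega>) (\<lambda>v. rho \<omega> (\<eta> v)) t = rho \<omega> (nmv \<eta> t)" if "\<omega> \<in> S0" "wf_tm L t" for \<omega> \<eta> t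
    unfolding rho_def by (rule nmv_ev[OF S0D(1,2)[OF that(1)] that(2)])
  have up_eta: "(\<lambda>v. u ((\<eta>(x := t)) v)) = (\<lambda>v. u (\<eta> v))(x := u t)"
    "(\<lambda>v. rho \<omega> ((\<eta>(x := t)) v)) = (\<lambda>v. rho \<omega> (\<eta> v))(x := rho \<omega> t)" for \<eta> \<omega> t and x :: 'v by auto
  define tr where "tr \<phi> \<eta> = {\<omega>. fsat (mo \<omega>) (\<lambda>v. rho \<omega> (\<eta> v)) \<phi>}" for \<phi> and \<eta> :: "'v \<Rightarrow> ('f, 'p, 'v) nm"
  have truth: "fsat M (\<lambda>v. u (\<eta> v)) \<phi> \<longleftrightarrow> tr \<phi> \<eta> \<in> \<U>" if "first_order \<phi>" "KV \<phi>" for \<phi> \<eta>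
    using that
  proof (induction \<phi> arbitrary: \<eta>)
    case (Eq t s)
    have wf: "wf_tm L t" "wf_tm L s" using Eq by simp_all
    have "fsat M (\<lambda>v. u (\<eta> v)) (Eq t s) \<longleftrightarrow> {\<omega>. rho \<omega> (nmv \<eta> t) = rho \<omega> (nmv \<eta> s)} \<in> \<U>"
      by (simp add: tv u_iff eqn_def)
    also have "\<dots> \<longleftrightarrow> tr (Eq t s) \<eta> \<in> \<U>"
      unfolding tr_def by (rule iffI; rule cong_on[OF S0]) (simp_all add: rt wf)
    finally show ?case .
  next
    case (Rel p ts)
    have wf: "\<forall>t \<in> set ts. wf_tm L t" using Rel by (simp add: KV_Rel)
    have "map (tval M (\<lambda>v. u (\<eta> v))) ts = map u (map (nmv \<eta>) ts)" by (simp add: tv)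
    then have "fsat M (\<lambda>v. u (\<eta> v)) (Rel p ts) \<longleftrightarrow> {\<omega>. map (rho \<omega>) (map (nmv \<eta>) ts) \<in> rint (mo \<omega>) p} \<in> \<U>"
      by (simp only: fsat.simps M R_def)
    also have "\<dots> \<longleftrightarrow> tr (Rel p ts) \<eta> \<in> \<U>"
    proof -
      have "map (tval (mo \<omega>) (\<lambda>v. rho \<omega> (\<eta> v))) ts = map (rho \<omega>) (map (nmv \<eta>) ts)" if "\<omega> \<in> S0" for \<omega>
        using wf rt[OF that] by simp
      then show ?thesis
        unfolding tr_def by (intro iffI; elim cong_on[OF S0, rotated]) (simp_all only: mem_Collect_eq fsat.simps)
    qed
    finally show ?case .
  next
    case (Neg \<phi>)
    have "tr (Neg \<phi>) \<eta> = - tr \<phi> \<eta>" by (auto simp: tr_def)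
    then show ?case using Neg compl by simp
  next
    case (And \<phi> \<psi>)
    have e: "tr (And \<phi> \<psi>) \<eta> = tr \<phi> \<eta> \<inter> tr \<psi> \<eta>" by (auto simp: tr_def)
    have "tr \<phi> \<eta> \<inter> tr \<psi> \<eta> \<in> \<U> \<longleftrightarrow> tr \<phi> \<eta> \<in> \<U> \<and> tr \<psi> \<eta> \<in> \<U>"
      using meet up[of "tr \<phi> \<eta> \<inter> tr \<psi> \<eta>"] by blast
    then show ?case using And e by simp
  next
    case (Or \<phi> \<psi>)
    have e: "tr (Or \<phi> \<psi>) \<eta> = tr \<phi> \<eta> \<union> tr \<psi> \<eta>" by (auto simp: tr_def)
    have "tr \<phi> \<eta> \<union> tr \<psi> \<eta> \<in> \<U> \<longleftrightarrow> tr \<phi> \<eta> \<in> \<U> \<or> tr \<psi> \<eta> \<in> \<U>"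
    proof
      assume a: "tr \<phi> \<eta> \<union> tr \<psi> \<eta> \<in> \<U>"
      show "tr \<phi> \<eta> \<in> \<U> \<or> tr \<psi> \<eta> \<in> \<U>"
      proof (rule disjCI)
        assume "tr \<psi> \<eta> \<notin> \<U>"
        then have "(tr \<phi> \<eta> \<union> tr \<psi> \<eta>) \<inter> - tr \<psi> \<eta> \<in> \<U>" using a meet compl by blast
        then show "tr \<phi> \<eta> \<in> \<U>" by (rule up) blast
      qed
    next
      assume "tr \<phi> \<eta> \<in> \<U> \<or> tr \<psi> \<eta> \<in> \<U>"
      then show "tr \<phi> \<eta> \<union> tr \<psi> \<eta> \<in> \<U>" using up[of "tr \<phi> \<eta>"] up[of "tr \<psi> \<eta>"] by blast
    qed
    then show ?case using Or e by simp
  next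
    case (Ex x \<phi>)
    have IH: "fsat M ((\<lambda>v. u (\<eta> v))(x := u t)) \<phi> \<longleftrightarrow> tr \<phi> (\<eta>(x := t)) \<in> \<U>" for t
      using Ex.IH[of "\<eta>(x := t)", unfolded up_eta] Ex.prems by (simp only: first_order.simps KV_simps)
    have "fsat M (\<lambda>v. u (\<eta> v)) (Ex x \<phi>) \<longleftrightarrow> (\<exists>t. tr \<phi> (\<eta>(x := t)) \<in> \<U>)"
      by (simp add: M(1) IH del: fun_upd_apply)
    also have "\<dots> \<longleftrightarrow> tr (Ex x \<phi>) \<eta> \<in> \<U>"
    proof
      assume "\<exists>t. tr \<phi> (\<eta>(x := t)) \<in> \<U>"
      then obtain t where t: "tr \<phi> (\<eta>(x := t)) \<in> \<U>" by blast
      show "tr (Ex x \<phi>) \<eta> \<in> \<U>"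
      proof (rule cong_on[OF S0 _ t])
        fix \<omega> assume w: "\<omega> \<in> S0" "\<omega> \<in> tr \<phi> (\<eta>(x := t))"
        then show "\<omega> \<in> tr (Ex x \<phi>) \<eta>"
          unfolding tr_def up_eta mem_Collect_eq fsat.simps by (intro bexI[OF _ rho_univ[OF w(1)]])
      qed
    next
      let ?t = "Wit x \<phi> (map \<eta> (fvl \<phi>))"
      assume t: "tr (Ex x \<phi>) \<eta> \<in> \<U>"
      have "tr \<phi> (\<eta>(x := ?t)) \<in> \<U>"
      proof (rule cong_on[OF S0 _ t])
        fix \<omega> assume w: "\<omega> \<in> S0" "\<omega> \<in> tr (Ex x \<phi>) \<eta>"
        then have "\<exists>a \<in> univ (mo \<omega>). fsat (mo \<omega>) ((\<lambda>v. ev (mo \<omega>) (as \<omega>) (st \<omega>) (\<eta> v))(x := a)) \<phi>"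
          unfolding tr_def rho_def mem_Collect_eq fsat.simps by blast
        from wit_ev[OF S0D(2)[OF w(1)] this] show "\<omega> \<in> tr \<phi> (\<eta>(x := ?t))"
          unfolding tr_def rho_def mem_Collect_eq .
      qed
      then show "\<exists>t. tr \<phi> (\<eta>(x := t)) \<in> \<U>" by blast
    qed
    finally show ?case .
  next
    case (All x \<phi>)
    have IH: "fsat M ((\<lambda>v. u (\<eta> v))(x := u t)) \<phi> \<longleftrightarrow> tr \<phi> (\<eta>(x := t)) \<in> \<U>" for t
      using All.IH[of "\<eta>(x := t)", unfolded up_eta] All.prems by (simp only: first_order.simps KV_simps)
    have "fsat M (\<lambda>v. u (\<eta> v)) (All x \<phi>) \<longleftrightarrow> (\<forall>t. tr \<phi> (\<eta>(x := t)) \<in> \<U>)"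
      by (simp add: M(1) IH del: fun_upd_apply)
    also have "\<dots> \<longleftrightarrow> tr (All x \<phi>) \<eta> \<in> \<U>"
    proof
      assume t: "tr (All x \<phi>) \<eta> \<in> \<U>"
      show "\<forall>t. tr \<phi> (\<eta>(x := t)) \<in> \<U>"
      proof
        fix t
        show "tr \<phi> (\<eta>(x := t)) \<in> \<U>"
        proof (rule cong_on[OF S0 _ t])
          fix \<omega> assume w: "\<omega> \<in> S0" "\<omega> \<in> tr (All x \<phi>) \<eta>"
          then show "\<omega> \<in> tr \<phi> (\<eta>(x := t))"
            unfolding tr_def up_eta mem_Collect_eq fsat.simps using rho_univ[OF w(1)] by blast
        qed
      qed
    next
      let ?t = "Wit x (Neg \<phi>) (map \<eta> (fvl (Neg \<phi>)))"
      assume a: "\<forall>t. tr \<phi> (\<eta>(x := t)) \<in> \<U>"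
      then have t: "tr \<phi> (\<eta>(x := ?t)) \<in> \<U>" by blast
      show "tr (All x \<phi>) \<eta> \<in> \<U>"
      proof (rule cong_on[OF S0 _ t])
        fix \<omega> assume w: "\<omega> \<in> S0" "\<omega> \<in> tr \<phi> (\<eta>(x := ?t))"
        show "\<omega> \<in> tr (All x \<phi>) \<eta>"
        proof (rule ccontr)
          assume "\<omega> \<notin> tr (All x \<phi>) \<eta>"
          then have "\<exists>a \<in> univ (mo \<omega>). fsat (mo \<omega>) ((\<lambda>v. ev (mo \<omega>) (as \<omega>) (st \<omega>) (\<eta> v))(x := a)) (Neg \<phi>)"
            unfolding tr_def rho_def mem_Collect_eq fsat.simps by blast
          from wit_ev[OF S0D(2)[OF w(1)] this] have "\<omega> \<notin> tr \<phi> (\<eta>(x := ?t))"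
            unfolding tr_def rho_def mem_Collect_eq fsat.simps .
          then show False using w(2) by blast
        qed
      qed
    qed
    finally show ?case .
  qed simp
  let ?e = "\<lambda>v. u (Par v)"
  have rPar: "(\<lambda>v. rho \<omega> (Par v)) = as \<omega>" for \<omega> by (simp add: rho_def)
  have n\<alpha>: "\<not> fsat M ?e \<alpha>"
  proof
    assume "fsat M ?e \<alpha>"
    then have t: "tr \<alpha> Par \<in> \<U>" using truth[OF \<alpha>] by simp
    have "{} \<in> \<U>"
      by (rule cong_on[OF S0 _ t]) (use S0D(3) in \<open>auto simp: tr_def rPar\<close>)
    then show False using not_empty by simp
  qed
  have model: "is_model L M"
  proof -
    obtain y z :: 'v where yz: "y \<noteq> z" using fresh[of "{undefined}"] by auto
    let ?two = "Ex y (Ex z (Neg (Eq (Var y) (Var z)))) :: ('f, 'p, 'v) fm"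
    have "tr ?two Par \<in> \<U>"
    proof (rule up[OF S0], rule subsetI)
      fix \<omega> assume "\<omega> \<in> S0"
      then obtain a b where ab: "a \<in> univ (mo \<omega>)" "b \<in> univ (mo \<omega>)" "a \<noteq> b" using S0D(1) unfolding is_model_def by blast
      have "fsat (mo \<omega>) (\<lambda>v. rho \<omega> (Par v)) ?two"
        unfolding fsat.simps using ab yz by (intro bexI[of _ a] bexI[of _ b]) simp_all
      then show "\<omega> \<in> tr ?two Par" by (simp only: tr_def mem_Collect_eq)
    qed
    then have "fsat M ?e ?two" using truth[of ?two Par] by simp
    then have "\<exists>a \<in> univ M. \<exists>b \<in> univ M. a \<noteq> b" using yz by auto
    then show ?thesis using quotient_closed[OF M(1,2)] by (simp add: is_model_closed)
  qed
  have "sat M {\<lambda>v. Some (?e v)} (Alls (xs \<gamma>) (Exs (ys \<gamma>) (And (dconj (ds \<gamma>)) (al \<gamma>))))" if g: "\<gamma> \<in> \<Gamma>" for \<gamma>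
  proof -
    let ?x = "xs \<gamma>" and ?y = "ys \<gamma>" and ?d = "ds \<gamma>" and ?a = "al \<gamma>"
    have N: "distinct (?x @ ?y)" "distinct ?x" "distinct ?y" "first_order ?a" "KV ?a"
      using nf[OF g] by (auto simp: nform_def qf_fo_def)
    \<comment> \<open>The name of the answer to the move \<open>ts\<close>, and the assignment of the move with its answer.\<close>
    define str where "str ts = map (\<lambda>i. Str \<gamma> i ts) [0..<length ?y]" for ts
    define et where "et ts = ovr Par (?x @ ?y) (ts @ str ts)" for ts
    have rho_et: "(\<lambda>v. rho \<omega> (et ts v)) = asgn (as \<omega>) ?x ?y (pos \<omega> (\<gamma>, ts))"
      if w: "\<omega> \<in> Good (\<gamma>, ts) k" for \<omega> ts k
    proof
      fix v
      have "map (rho \<omega>) (str ts) = st \<omega> (\<gamma>, ts)"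
      proof (rule nth_equalityI)
        show l: "length (map (rho \<omega>) (str ts)) = length (st \<omega> (\<gamma>, ts))" using w by (simp add: str_def Good_def)
        fix i assume "i < length (map (rho \<omega>) (str ts))"
        then have i: "i < length ?y" "i < length (st \<omega> (\<gamma>, ts))" using l by (simp_all add: str_def)
        have "st \<omega> (\<gamma>, ts) ! i \<in> univ (mo \<omega>)" using w i(2) nth_mem[OF i(2)] by (auto simp: Good_def)
        then show "map (rho \<omega>) (str ts) ! i = st \<omega> (\<gamma>, ts) ! i" using i by (simp add: str_def rho_def Let_def)
      qed
      then show "rho \<omega> (et ts v) = asgn (as \<omega>) ?x ?y (pos \<omega> (\<gamma>, ts)) v"
        unfolding et_def ovr_map[of "rho \<omega>"] asgn_def pos_def by (simp add: rPar)
    qed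
    have sat_a: "fsat M (\<lambda>v. u (et ts v)) ?a" if l: "length ts = length ?x" for ts
    proof -
      have "tr ?a (et ts) \<in> \<U>"
      proof (rule up[OF Good[OF g l l]], rule subsetI)
        fix \<omega> assume w: "\<omega> \<in> Good (\<gamma>, ts) (\<gamma>, ts)"
        then have "fsat (mo \<omega>) (asgn (as \<omega>) ?x ?y (pos \<omega> (\<gamma>, ts))) ?a" by (simp add: Good_def)
        then show "\<omega> \<in> tr ?a (et ts)" unfolding tr_def mem_Collect_eq rho_et[OF w] .
      qed
      then show ?thesis using truth[OF N(4,5)] by simp
    qed
    have det: "u (et ts y) = u (et us y)" if l: "length ts = length ?x" "length us = length ?x"
      and d: "(zs, y) \<in> set ?d" and eq: "\<And>z. z \<in> set zs \<Longrightarrow> u (et ts z) = u (et us z)" for ts us zs y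
    proof -
      have zs: "{\<omega>. \<forall>z \<in> set zs. rho \<omega> (et ts z) = rho \<omega> (et us z)} \<in> \<U>"
        by (rule all_list[OF S0]) (use eq u_iff in \<open>auto simp: eqn_def\<close>)
      have "{\<omega>. rho \<omega> (et ts y) = rho \<omega> (et us y)} \<in> \<U>"
      proof (rule cong_on[OF meet[OF Good[OF g l] Good[OF g l(2,1)]] _ zs])
        fix \<omega> assume w: "\<omega> \<in> Good (\<gamma>, ts) (\<gamma>, us) \<inter> Good (\<gamma>, us) (\<gamma>, ts)"
          and z: "\<omega> \<in> {\<omega>. \<forall>z \<in> set zs. rho \<omega> (et ts z) = rho \<omega> (et us z)}"
        have "compat (as \<omega>) ?x ?y ?d (pos \<omega> (\<gamma>, ts)) (pos \<omega> (\<gamma>, us))" using w by (simp add: Good_def)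
        moreover have "asgn (as \<omega>) ?x ?y (pos \<omega> (\<gamma>, ts)) = (\<lambda>v. rho \<omega> (et ts v))"
          "asgn (as \<omega>) ?x ?y (pos \<omega> (\<gamma>, us)) = (\<lambda>v. rho \<omega> (et us v))"
          using rho_et[of \<omega> ts "(\<gamma>, us)"] rho_et[of \<omega> us "(\<gamma>, ts)"] w by simp_all
        ultimately show "\<omega> \<in> {\<omega>. rho \<omega> (et ts y) = rho \<omega> (et us y)}"
          using d z unfolding compat_def by fastforce
      qed
      then show ?thesis using u_iff by (simp add: eqn_def)
    qed
    let ?T = "{ts :: ('f, 'p, 'v) nm list. length ts = length ?x}"
    let ?X = "{\<lambda>v. Some (u (ovr Par ?x ts v)) | ts. ts \<in> ?T}"
    let ?Y = "{\<lambda>v. Some (u (et ts v)) | ts. ts \<in> ?T}"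
    have "sat M ?Y (And (dconj ?d) ?a)"
    proof -
      have "sat M ?Y ?a" using sat_a by (auto simp: flat[OF N(4)])
      moreover have "sat M ?Y (dconj ?d)" unfolding Conj_simps
      proof
        fix \<phi> :: "('f, 'p, 'v) fm" assume "\<phi> \<in> set (map dep_atom ?d)"
        then obtain zs y where d: "(zs, y) \<in> set ?d" "\<phi> = dep_atom (zs, y)" by auto
        show "sat M ?Y \<phi>" unfolding d(2) sat_datom
        proof (intro ballI impI)
          fix s s' assume "s \<in> ?Y" "s' \<in> ?Y" and eq: "\<forall>z \<in> set zs. the (s z) = the (s' z)"
          then obtain ts us where s: "s = (\<lambda>v. Some (u (et ts v)))" "ts \<in> ?T" "s' = (\<lambda>v. Some (u (et us v)))" "us \<in> ?T" by blast
          show "the (s y) = the (s' y)" unfolding s using det[OF _ _ d(1), of ts us] eq s by simp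
        qed
      qed
      ultimately show ?thesis by simp
    qed
    moreover have "cov M ?y ?X ?Y" unfolding cov_def
    proof
      fix s assume "s \<in> ?X"
      then obtain ts where ts: "s = (\<lambda>v. Some (u (ovr Par ?x ts v)))" "ts \<in> ?T" by blast
      have e: "et ts = ovr (ovr Par ?x ts) ?y (str ts)"
        unfolding et_def by (rule ovr_append[symmetric]) (use N ts(2) in simp_all)
      have "\<forall>v. v \<notin> set ?y \<longrightarrow> Some (u (et ts v)) = s v" unfolding e ts(1) by (simp add: ovr_notin)
      moreover have "\<forall>y \<in> set ?y. \<exists>a \<in> univ M. Some (u (et ts y)) = Some a" using M(1) by simp
      moreover have "(\<lambda>v. Some (u (et ts v))) \<in> ?Y" using ts(2) by blast
      ultimately show "\<exists>t \<in> ?Y. (\<forall>v. v \<notin> set ?y \<longrightarrow> t v = s v) \<and> (\<forall>y \<in> set ?y. \<exists>a \<in> univ M. t y = Some a)"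
        by (intro bexI[of _ "\<lambda>v. Some (u (et ts v))"] conjI)
    qed
    ultimately have "sat M ?X (Exs ?y (And (dconj ?d) ?a))"
      by (intro sat_Exs_intro[OF KV_D[of L]]) (use N in simp_all)
    then show ?thesis
    proof (rule sat_Alls_intro[rotated 2])
      show "D_formula L (Exs ?y (And (dconj ?d) ?a))" by (rule KV_D) (use N in simp)
      fix s t assume s: "s \<in> {\<lambda>v. Some (?e v)}" and t: "\<forall>v. v \<notin> set ?x \<longrightarrow> t v = s v"
        and tx: "\<forall>x \<in> set ?x. \<exists>a \<in> univ M. t x = Some a"
      define nmx where "nmx x = (SOME r. t x = Some (u r))" for x
      have nmx: "t x = Some (u (nmx x))" if "x \<in> set ?x" for x
      proof -
        from tx that obtain a where "a \<in> univ M" "t x = Some a" by blast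
        then have "\<exists>r. t x = Some (u r)" unfolding M(1) by auto
        then show ?thesis unfolding nmx_def by (rule someI_ex)
      qed
      have "t = (\<lambda>v. Some (u (ovr Par ?x (map nmx ?x) v)))"
      proof
        fix v
        show "t v = Some (u (ovr Par ?x (map nmx ?x) v))"
        proof (cases "v \<in> set ?x")
          case True
          then show ?thesis using nmx by (simp add: ovr_map_self[OF N(2)])
        next
          case False
          then show ?thesis using t s by (simp add: ovr_notin)
        qed
      qed
      then show "t \<in> ?X" by auto
    qed
  qed
  moreover have "range ?e \<subseteq> univ M" using M(1) by auto
  ultimately show ?thesis using model n\<alpha> by blast
qed

end

section \<open>Completeness for first-order consequences\<close>

lemma expand_first_order: "first_order \<phi> \<Longrightarrow> expand \<phi> = \<phi>"
  by (induction \<phi>) auto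

context dep_logic
begin

lemma dep_shorthand_cases:
  assumes "length us \<noteq> 1"
  obtains xs ys where "length xs = length ts" "length ys = length us" "distinct (xs @ ys)"
    "set (xs @ ys) \<inter> (\<Union>t \<in> set ts \<union> set us. Fvt t) = {}"
    "(dep_shorthand ts us :: ('f, 'p, 'v) fm) = Exs (xs @ ys) (And (Conj (map (\<lambda>y. dep_atom (xs, y)) ys))
      (And (Eqs (map Var xs) ts) (Eqs (map Var ys) us)))"
proof -
  let ?P = "\<lambda>(xs, ys). length xs = length ts \<and> length ys = length us \<and> distinct (xs @ ys) \<and>
    set (xs @ ys) \<inter> (\<Union>t \<in> set ts \<union> set us. Fvt t) = {}"
  have "finite (\<Union>t \<in> set ts \<union> set us. Fvt t)" by simp
  from fresh_list[OF this, of "length ts + length us"] obtain zs where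
    zs: "length zs = length ts + length us" "distinct zs" "set zs \<inter> (\<Union>t \<in> set ts \<union> set us. Fvt t) = {}" by blast
  have "?P (take (length ts) zs, drop (length ts) zs)"
    unfolding prod.case append_take_drop_id using zs by simp
  then have P: "?P (SOME p. ?P p)" by (rule someI)
  obtain xs ys where p: "(SOME p. ?P p) = (xs, ys)" by (cases "SOME p. ?P p")
  note P' = P[unfolded p prod.case]
  show ?thesis
  proof (rule that[of xs ys])
    show "(dep_shorthand ts us :: ('f, 'p, 'v) fm) = Exs (xs @ ys) (And (Conj (map (\<lambda>y. dep_atom (xs, y)) ys))
      (And (Eqs (map Var xs) ts) (Eqs (map Var ys) us)))"
      by (simp only: dep_shorthand_def assms if_False p Let_def prod.case)
  qed (use P' in blast)+
qed

lemma Eqs_props: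
  "length ts = length us \<Longrightarrow> KV (Eqs ts us) \<longleftrightarrow> (\<forall>t \<in> set ts \<union> set us. wf_tm L t)"
  "length ts = length us \<Longrightarrow> sat M X (Eqs ts us) \<longleftrightarrow> (\<forall>s \<in> X. map (val M s) ts = map (val M s) us)"
  unfolding Eqs_def Conj_simps by (induction ts us rule: list_induct2; auto)+

lemma expand_KV: "D_formula L \<phi> \<Longrightarrow> KV (expand \<phi>)"
proof (induction \<phi>)
  case (Dep ts us)
  show ?case
  proof (cases "length us = 1")
    case True
    then show ?thesis using Dep by (auto simp: dep_shorthand_def KV_Dep)
  next
    case False
    then obtain xs ys where l: "length xs = length ts" "length ys = length us" and
      e: "(dep_shorthand ts us :: ('f, 'p, 'v) fm) = Exs (xs @ ys) (And (Conj (map (\<lambda>y. dep_atom (xs, y)) ys))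
      (And (Eqs (map Var xs) ts) (Eqs (map Var ys) us)))" by (rule dep_shorthand_cases)
    show ?thesis unfolding expand.simps e using Dep l by (simp add: Eqs_props Conj_simps ball_Un)
  qed
qed (auto simp: expand_first_order KV_Rel KV_first_order)

text \<open>The copies \<open>xs\<close> and \<open>ys\<close> of the terms have the same values as the terms, so the dependences of the
  \<open>ys\<close> on \<open>xs\<close> are those of \<open>us\<close> on \<open>ts\<close>. So a model of the expanded assumptions is one of the
  original assumptions.\<close>

lemma expand_sat:
  fixes \<phi> :: "('f, 'p, 'v) fm"
  shows "D_formula L \<phi> \<Longrightarrow> sat M X (expand \<phi>) \<Longrightarrow> sat M X \<phi>"
proof (induction \<phi> arbitrary: X)
  case (Dep ts us)
  show ?case
  proof (cases "length us = 1")
    case True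
    have "expand (Dep ts us) = (Dep ts us :: ('f, 'p, 'v) fm)"
      unfolding expand.simps dep_shorthand_def using True by (rule if_P)
    then show ?thesis using Dep.prems(2) by (simp only:)
  next
    case False
    then obtain xs ys where l: "length xs = length ts" "length ys = length us"
      and fr: "set (xs @ ys) \<inter> (\<Union>t \<in> set ts \<union> set us. Fvt t) = {}"
      and e: "(dep_shorthand ts us :: ('f, 'p, 'v) fm) = Exs (xs @ ys) (And (Conj (map (\<lambda>y. dep_atom (xs, y)) ys))
      (And (Eqs (map Var xs) ts) (Eqs (map Var ys) us)))" by (rule dep_shorthand_cases)
    have "sat M X (Exs (xs @ ys) (And (Conj (map (\<lambda>y. dep_atom (xs, y)) ys))
      (And (Eqs (map Var xs) ts) (Eqs (map Var ys) us)) :: ('f, 'p, 'v) fm))" using Dep.prems(2) by (simp only: expand.simps e)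
    from sat_Exs_elim[OF this] obtain Y where
      Y0: "cov M (xs @ ys) X Y" "sat M Y (And (Conj (map (\<lambda>y. dep_atom (xs, y)) ys))
      (And (Eqs (map Var xs) ts) (Eqs (map Var ys) us)) :: ('f, 'p, 'v) fm)" by (elim HOL.exE conjE) (rule that)
    then have Y: "cov M (xs @ ys) X Y"
      "sat M Y (Conj (map (\<lambda>y. dep_atom (xs, y)) ys) :: ('f, 'p, 'v) fm)"
      "sat M Y (Eqs (map Var xs) ts :: ('f, 'p, 'v) fm)" "sat M Y (Eqs (map Var ys) us :: ('f, 'p, 'v) fm)"
      by (simp_all only: sat.simps)
    have vals: "map (val M s) (map Var xs) = map (val M s) ts" "map (val M s) (map Var ys) = map (val M s) us"
      if "s \<in> Y" for s using Y(3,4) that l by (simp_all only: Eqs_props length_map)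
    have same: "map (val M t) rs = map (val M s) rs"
      if "\<forall>v. v \<notin> set (xs @ ys) \<longrightarrow> t v = s v" "set rs \<subseteq> set ts \<union> set us" for s t rs
    proof (rule map_cong[OF refl], rule val_cong)
      fix r v assume "r \<in> set rs" "v \<in> Fvt r"
      then have "v \<notin> set (xs @ ys)" using that(2) fr by blast
      then show "the (t v) = the (s v)" using that(1) by simp
    qed
    show ?thesis unfolding sat.simps
    proof (intro ballI impI)
      fix s s' assume s: "s \<in> X" "s' \<in> X" "map (val M s) ts = map (val M s') ts"
      from Y(1) s(1) obtain t where t: "t \<in> Y" "\<forall>v. v \<notin> set (xs @ ys) \<longrightarrow> t v = s v" unfolding cov_def by blast
      from Y(1) s(2) obtain t' where t': "t' \<in> Y" "\<forall>v. v \<notin> set (xs @ ys) \<longrightarrow> t' v = s' v" unfolding cov_def by blast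
      have "map (val M t) (map Var xs) = map (val M t') (map Var xs)"
        using vals(1)[OF t(1)] vals(1)[OF t'(1)] same[OF t(2), of ts] same[OF t'(2), of ts] s(3) by simp
      then have "map (val M t) [Var y] = map (val M t') [Var y]" if "y \<in> set ys" for y
      proof -
        have "sat M Y (dep_atom (xs, y) :: ('f, 'p, 'v) fm)" using Y(2) that unfolding Conj_simps by simp
        then show ?thesis
          using t(1) t'(1) \<open>map (val M t) (map Var xs) = map (val M t') (map Var xs)\<close>
          unfolding dep_atom_def sat.simps fst_conv snd_conv by blast
      qed
      then have "map (val M t) (map Var ys) = map (val M t') (map Var ys)" by simp
      then show "map (val M s) us = map (val M s') us"
        using vals(2)[OF t(1)] vals(2)[OF t'(1)] same[OF t(2), of us] same[OF t'(2), of us]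
        by (metis Un_upper2)
    qed
  qed
next
  case (Neg \<phi>)
  then show ?case by (simp add: expand_first_order)
next
  case (Or \<phi> \<psi>)
  then show ?case unfolding expand.simps sat.simps D_formula.simps by blast
next
  case (Ex x \<phi>)
  then show ?case unfolding expand.simps sat.simps D_formula.simps by blast
qed auto

end

theorem corollary5p13:
  fixes L :: "('f, 'p) vocab"
    and \<Gamma> :: "('f, 'p, 'v) fm set"
    and \<alpha> :: "('f, 'p, 'v) fm"
  assumes "infinite (UNIV :: 'v set)"
    and "\<exists>h :: ('f, 'p, 'v) fm \<Rightarrow> 'u. inj h"
    and "\<forall>\<gamma> \<in> \<Gamma>. D_formula L \<gamma>"
    and "countable (Fvs \<Gamma>)"
    and "D_formula L \<alpha>" and "first_order \<alpha>"
    and "entails TYPE('u) L \<Gamma> \<alpha>"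
  shows "D_derives L \<Gamma> \<alpha>"
proof (rule ccontr)
  interpret dep_logic_sem L "TYPE('v)" "TYPE('u)" using assms(1) by unfold_locales
  let ?\<Gamma> = "expand ` \<Gamma>"
  obtain h :: "('f, 'p, 'v) fm \<Rightarrow> 'u" where h: "inj h" using assms(2) by blast
  have KV\<alpha>: "KV \<alpha>" using assms(5,6) by (simp add: KV_first_order)
  have KVG: "KV \<gamma>" if "\<gamma> \<in> ?\<Gamma>" for \<gamma> using that assms(3) expand_KV by blast
  assume "\<not> D_derives L \<Gamma> \<alpha>"
  then have nd: "\<not> ?\<Gamma> \<turnstile> \<alpha>" using expand_first_order[OF assms(6)] by (simp add: D_derives_def)
  have "\<exists>d. \<gamma> \<in> ?\<Gamma> \<longrightarrow> (case d of (xs, ys, vs, ds, al) \<Rightarrow> nform xs ys vs ds al \<and>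
      red \<gamma> (Alls xs (Exs ys (And (dconj ds) al))))" for \<gamma>
    using normal_form[OF KVG[of \<gamma>]] by auto
  then have "\<exists>D. \<forall>\<gamma>. \<gamma> \<in> ?\<Gamma> \<longrightarrow> (case D \<gamma> of (xs, ys, vs, ds, al) \<Rightarrow> nform xs ys vs ds al \<and>
      red \<gamma> (Alls xs (Exs ys (And (dconj ds) al))))" by (intro choice HOL.allI)
  then obtain D where D: "\<forall>\<gamma>. \<gamma> \<in> ?\<Gamma> \<longrightarrow> (case D \<gamma> of (xs, ys, vs, ds, al) \<Rightarrow> nform xs ys vs ds al \<and>
      red \<gamma> (Alls xs (Exs ys (And (dconj ds) al))))" ..
  define xs where "xs \<gamma> = fst (D \<gamma>)" for \<gamma>
  define ys where "ys \<gamma> = fst (snd (D \<gamma>))" for \<gamma>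
  define vs where "vs \<gamma> = fst (snd (snd (D \<gamma>)))" for \<gamma>
  define ds where "ds \<gamma> = fst (snd (snd (snd (D \<gamma>))))" for \<gamma>
  define al where "al \<gamma> = snd (snd (snd (snd (D \<gamma>))))" for \<gamma>
  have nf: "nform (xs \<gamma>) (ys \<gamma>) (vs \<gamma>) (ds \<gamma>) (al \<gamma>)"
    and rd: "red \<gamma> (Alls (xs \<gamma>) (Exs (ys \<gamma>) (And (dconj (ds \<gamma>)) (al \<gamma>))))" if "\<gamma> \<in> ?\<Gamma>" for \<gamma>
    using D[rule_format, OF that] by (auto simp: xs_def ys_def vs_def ds_def al_def split: prod.splits)
  \<comment> \<open>Finitely many approximations cannot derive \<open>\<alpha>\<close>, so they have a countable model without \<open>\<alpha>\<close>.\<close>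
  have fin: "\<exists>(M :: ('f, 'p, nat) model) e. is_model L M \<and> range e \<subseteq> univ M \<and>
      \<not> fsat M e \<alpha> \<and> (\<forall>\<gamma> \<in> F. game (univ M) (length (xs \<gamma>)) (length (ys \<gamma>))
        (compat e (xs \<gamma>) (ys \<gamma>) (ds \<gamma>)) n (\<lambda>q. fsat M (asgn e (xs \<gamma>) (ys \<gamma>) q) (al \<gamma>)))"
    if F: "finite F" "F \<subseteq> ?\<Gamma>" for F n
  proof -
    have "\<exists>A. \<gamma> \<in> ?\<Gamma> \<longrightarrow> pv \<gamma> A \<and> first_order A \<and> (\<forall>(M :: ('f, 'p, nat) model) e. fsat M e A \<longrightarrow>
      game (univ M) (length (xs \<gamma>)) (length (ys \<gamma>)) (compat e (xs \<gamma>) (ys \<gamma>) (ds \<gamma>)) n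
        (\<lambda>q. fsat M (asgn e (xs \<gamma>) (ys \<gamma>) q) (al \<gamma>)))" for \<gamma>
    proof (cases "\<gamma> \<in> ?\<Gamma>")
      case True
      have N: "distinct (xs \<gamma> @ ys \<gamma> @ vs \<gamma>)" "Fv (al \<gamma>) \<subseteq> set (xs \<gamma> @ ys \<gamma> @ vs \<gamma>)" "qf_fo L (al \<gamma>)"
        "\<forall>(zs, y) \<in> set (ds \<gamma>). subseq zs (xs \<gamma> @ ys \<gamma> @ vs \<gamma>) \<and> y \<in> set (ys \<gamma>)"
        using nf[OF True] by (auto simp: nform_def)
      have b: "bvs \<psi> = {}" if "quantifier_free \<psi>" for \<psi> :: "('f, 'p, 'v) fm"
        using that by (induction \<psi>) auto
      have q: "first_order (al \<gamma>)" "KV (al \<gamma>)" "bvs (al \<gamma>) \<subseteq> {undefined}"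
        using N(3) b by (auto simp: qf_fo_def)
      from approximation[OF N(1,2) q N(4), of n, where 'm = nat] obtain A where
        A: "pv (Alls (xs \<gamma>) (Exs (ys \<gamma>) (And (dconj (ds \<gamma>)) (al \<gamma>)))) A" "first_order A"
        "\<forall>(M :: ('f, 'p, nat) model) e. fsat M e A \<longrightarrow>
          game (univ M) (length (xs \<gamma>)) (length (ys \<gamma>)) (compat e (xs \<gamma>) (ys \<gamma>) (ds \<gamma>)) n
          (\<lambda>q. fsat M (asgn e (xs \<gamma>) (ys \<gamma>) q) (al \<gamma>))" by blast
      have "pv \<gamma> A" by (rule pv_trans[OF _ A(1)]) (use rd[OF True] in \<open>simp add: red_def\<close>)
      then show ?thesis using A(2,3) by blast
    qed blast
    then obtain A where A: "\<And>\<gamma>. \<gamma> \<in> ?\<Gamma> \<Longrightarrow> pv \<gamma> (A \<gamma>)" "\<And>\<gamma>. \<gamma> \<in> ?\<Gamma> \<Longrightarrow> first_order (A \<gamma>)"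
      "\<And>\<gamma> (M :: ('f, 'p, nat) model) e. \<gamma> \<in> ?\<Gamma> \<Longrightarrow> fsat M e (A \<gamma>) \<Longrightarrow>
        game (univ M) (length (xs \<gamma>)) (length (ys \<gamma>)) (compat e (xs \<gamma>) (ys \<gamma>) (ds \<gamma>)) n
        (\<lambda>q. fsat M (asgn e (xs \<gamma>) (ys \<gamma>) q) (al \<gamma>))" by metis
    have KVA: "KV (A \<gamma>)" if "\<gamma> \<in> ?\<Gamma>" for \<gamma> using pv_KV(2)[OF A(1)[OF that]] .
    have "\<not> insert (Neg \<alpha>) (A ` F) \<turnstile> falsum"
    proof
      assume "insert (Neg \<alpha>) (A ` F) \<turnstile> falsum"
      then have a: "A ` F \<turnstile> \<alpha>" by (rule derives.raa) (rule assms(6))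
      have "F \<turnstile> \<alpha>"
      proof (rule cuts[OF _ _ a F(1)])
        fix \<delta> assume "\<delta> \<in> A ` F"
        then obtain \<gamma> where g: "\<gamma> \<in> F" "\<delta> = A \<gamma>" by blast
        show "F \<turnstile> \<delta>" unfolding g(2)
          by (rule pv_der[OF A(1) ax[OF g(1)] F(1)]) (use F(2) g(1) KVG in blast)+
      next
        show "KV \<delta>" if "\<delta> \<in> A ` F \<union> F" for \<delta> using that F(2) KVA KVG by blast
      qed (use F in simp)
      then have "?\<Gamma> \<turnstile> \<alpha>" by (rule derives.weaken[OF _ F(2)]) (use KVG in blast)
      then show False using nd by blast
    qed
    then have "\<exists>(M :: ('f, 'p, nat) model) e. is_model L M \<and> range e \<subseteq> univ M \<and>
        (\<forall>\<phi> \<in> insert (Neg \<alpha>) (A ` F). fsat M e \<phi>)"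
    proof (rule consistent_has_model[rotated 2])
      show "first_order \<phi> \<and> KV \<phi>" if "\<phi> \<in> insert (Neg \<alpha>) (A ` F)" for \<phi>
        using that F(2) A(2) KVA KV\<alpha> assms(6) by auto
    qed (use F in simp)
    then obtain M :: "('f, 'p, nat) model" and e where M: "is_model L M" "range e \<subseteq> univ M"
      "\<forall>\<phi> \<in> insert (Neg \<alpha>) (A ` F). fsat M e \<phi>" by blast
    have "\<not> fsat M e \<alpha>" using M(3) by simp
    moreover have "\<forall>\<gamma> \<in> F. game (univ M) (length (xs \<gamma>)) (length (ys \<gamma>))
        (compat e (xs \<gamma>) (ys \<gamma>) (ds \<gamma>)) n (\<lambda>q. fsat M (asgn e (xs \<gamma>) (ys \<gamma>) q) (al \<gamma>))"
    proof
      fix \<gamma> assume g: "\<gamma> \<in> F"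
      have "fsat M e (A \<gamma>)" using M(3) g by simp
      then show "game (univ M) (length (xs \<gamma>)) (length (ys \<gamma>))
        (compat e (xs \<gamma>) (ys \<gamma>) (ds \<gamma>)) n (\<lambda>q. fsat M (asgn e (xs \<gamma>) (ys \<gamma>) q) (al \<gamma>))"
        by (rule A(3)[rotated]) (use g F(2) in blast)
    qed
    ultimately show ?thesis using M(1,2) by blast
  qed
  have "\<exists>(M :: ('f, 'p, 'u) model) e. is_model L M \<and> range e \<subseteq> univ M \<and> \<not> fsat M e \<alpha> \<and>
    (\<forall>\<gamma> \<in> ?\<Gamma>. sat M {\<lambda>v. Some (e v)} (Alls (xs \<gamma>) (Exs (ys \<gamma>) (And (dconj (ds \<gamma>)) (al \<gamma>)))))"
    by (rule strategy_model[where vs = vs, OF h assms(6) KV\<alpha>]) (fact nf, fact fin)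
  then obtain M :: "('f, 'p, 'u) model" and e where M0: "is_model L M \<and> range e \<subseteq> univ M \<and> \<not> fsat M e \<alpha> \<and>
    (\<forall>\<gamma> \<in> ?\<Gamma>. sat M {\<lambda>v. Some (e v)} (Alls (xs \<gamma>) (Exs (ys \<gamma>) (And (dconj (ds \<gamma>)) (al \<gamma>)))))"
    by (elim HOL.exE) (rule that)
  then have M: "is_model L M" "range e \<subseteq> univ M" "\<not> fsat M e \<alpha>" by simp_all
  have s: "\<And>\<gamma>. \<gamma> \<in> ?\<Gamma> \<Longrightarrow> sat M {\<lambda>v. Some (e v)} (Alls (xs \<gamma>) (Exs (ys \<gamma>) (And (dconj (ds \<gamma>)) (al \<gamma>))))"
    using M0 by blast
  let ?X = "{\<lambda>v. Some (e v)}"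
  have ne: "univ M \<noteq> {}" using M(2) by blast
  have "sat M ?X \<gamma>" if g: "\<gamma> \<in> \<Gamma>" for \<gamma>
  proof -
    have "sat M ?X (expand \<gamma>)" using s[of "expand \<gamma>"] rd[of "expand \<gamma>"] g ne by (simp add: red_def refines_def)
    then show ?thesis using expand_sat assms(3) g by blast
  qed
  moreover have "is_team M UNIV ?X" using M(2) by (auto simp: is_team_def ran_def)
  ultimately have "sat M ?X \<alpha>" using assms(7) M(1) unfolding entails_def by blast
  then show False using M(3) by (simp add: flat[OF assms(6)])
qed

end
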